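(* There exist analytic maps $\varphi_t\colon\mathbb{D}\to\mathbb{D}$, $0\le t\le 1$, with the following properties. Let $X$ be any one of the spaces $\mathcal{M}$, $L^p=L^p(\mathbb{T},m)$ with $1\le p<\infty$, or $\mathcal{H}^p$ with $1\le p<\infty$. Then $C_{\varphi_0}$ is compact on $X$, $C_{\varphi_1}$ is not compact on $X$, and $t\mapsto C_{\varphi_t}$ is continuous from $[0,1]$ into the set of bounded operators on $X$ equipped with the operator norm. In particular, taking $X=\mathcal{H}^2$, the connected component of the set of all composition operators on $\mathcal{H}^2$ (with the operator-norm metric) that contains the compact composition operators also contains a non-compact composition operator.
   Context: $\mathbb{D}$ is the open unit disc, $\mathbb{T}=\partial\mathbb{D}$, and $m$ is normalized Lebesgue measure on $\mathbb{T}$. $\mathcal{M}$ is the Banach space of complex Borel measures on $\mathbb{T}$ with the total variation norm. For an analytic $\varphi\colon\mathbb{D}\to\mathbb{D}$, the composition operator $C_\varphi$ on $\mathcal{M}$ is defined as follows: for $\mu\in\mathcal{M}$, let $u(z)=\int_{\mathbb{T}}P_z\,d\mu$ with $P_z(\zeta)=(1-|z|^2)/|\zeta-z|^2$; then $u\circ\varphi$ is the Poisson integral of a unique $\nu\in\mathcal{M}$, and $C_\varphi\mu:=\nu$. This operator is bounded on $\mathcal{M}$, restricts to a bounded operator on each $L^p(\mathbb{T},m)$, and on the Hardy space $\mathcal{H}^p$ (identified with the subspace of $L^p$ of boundary values) it agrees with $f\mapsto f\circ\varphi$. *)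

theory Defs
  imports "HOL-Analysis.Analysis"
begin

definition DD :: "complex set" where "DD = ball 0 1"

definition analytic_selfmap :: "(complex \<Rightarrow> complex) \<Rightarrow> bool" where
  "analytic_selfmap \<phi> \<longleftrightarrow> \<phi> holomorphic_on DD \<and> \<phi> ` DD \<subseteq> DD"

definition borelT :: "complex measure" where
  "borelT = restrict_space borel (sphere 0 1)"

definition mT :: "complex measure" where
  "mT = distr (density (restrict_space lborel {0..<2*pi}) (\<lambda>_. ennreal (1 / (2*pi)))) borelT cis"

definition poisson_kernel :: "complex \<Rightarrow> complex \<Rightarrow> real" where
  "poisson_kernel z \<zeta> = (1 - (norm z)^2) / (norm (\<zeta> - z))^2"

section \<open>The spaces L^p and H^p (functions modulo the seminorm)\<close>

definition Lp :: "real \<Rightarrow> (complex \<Rightarrow> complex) set" where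
  "Lp p = {f. f \<in> borel_measurable mT \<and> integrable mT (\<lambda>\<zeta>. norm (f \<zeta>) powr p)}"

definition Lp_norm :: "real \<Rightarrow> (complex \<Rightarrow> complex) \<Rightarrow> real" where
  "Lp_norm p f = (\<integral>\<zeta>. norm (f \<zeta>) powr p \<partial>mT) powr (1 / p)"

text \<open>H^p: the elements of L^p whose Fourier coefficients of negative index vanish.\<close>
definition Hp :: "real \<Rightarrow> (complex \<Rightarrow> complex) set" where
  "Hp p = {f \<in> Lp p. \<forall>n::nat. n > 0 \<longrightarrow> (\<integral>\<zeta>. f \<zeta> * \<zeta> ^ n \<partial>mT) = 0}"

definition poisson_fun :: "(complex \<Rightarrow> complex) \<Rightarrow> complex \<Rightarrow> complex" where
  "poisson_fun f z = (\<integral>\<zeta>. of_real (poisson_kernel z \<zeta>) * f \<zeta> \<partial>mT)"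

text \<open>Composition operator on L^1 (hence on each L^p, H^p): C_phi f is the function whose
  Poisson integral is (Poisson integral of f) o phi.\<close>
definition compL :: "(complex \<Rightarrow> complex) \<Rightarrow> (complex \<Rightarrow> complex) \<Rightarrow> (complex \<Rightarrow> complex)" where
  "compL \<phi> f = (SOME g. g \<in> Lp 1 \<and> (\<forall>z\<in>DD. poisson_fun g z = poisson_fun f (\<phi> z)))"

definition cmeasure :: "(complex set \<Rightarrow> complex) \<Rightarrow> bool" where
  "cmeasure \<mu> \<longleftrightarrow> (\<forall>A. A \<notin> sets borelT \<longrightarrow> \<mu> A = 0) \<and>
     (\<forall>A :: nat \<Rightarrow> complex set. range A \<subseteq> sets borelT \<longrightarrow> disjoint_family A \<longrightarrow>
        (\<lambda>n. \<mu> (A n)) sums \<mu> (\<Union>n. A n))"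

definition Mspace :: "(complex set \<Rightarrow> complex) set" where
  "Mspace = {\<mu>. cmeasure \<mu>}"

definition tv_norm :: "(complex set \<Rightarrow> complex) \<Rightarrow> real" where
  "tv_norm \<mu> = Sup {(\<Sum>i\<in>I. norm (\<mu> (E i))) | I E. finite (I :: nat set) \<and>
      (\<forall>i\<in>I. E i \<in> sets borelT) \<and> disjoint_family_on E I}"

definition pos_var :: "(complex set \<Rightarrow> real) \<Rightarrow> complex measure" where
  "pos_var s = measure_of (space borelT) (sets borelT)
     (\<lambda>E. ennreal (Sup {s F | F. F \<in> sets borelT \<and> F \<subseteq> E}))"

definition neg_var :: "(complex set \<Rightarrow> real) \<Rightarrow> complex measure" where
  "neg_var s = pos_var (\<lambda>E. - s E)"

definition sintegral :: "(complex set \<Rightarrow> real) \<Rightarrow> (complex \<Rightarrow> complex) \<Rightarrow> complex" where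
  "sintegral s f = integral\<^sup>L (pos_var s) f - integral\<^sup>L (neg_var s) f"

definition cintegral :: "(complex set \<Rightarrow> complex) \<Rightarrow> (complex \<Rightarrow> complex) \<Rightarrow> complex" where
  "cintegral \<mu> f = sintegral (\<lambda>E. Re (\<mu> E)) f + \<i> * sintegral (\<lambda>E. Im (\<mu> E)) f"

definition poisson_meas :: "(complex set \<Rightarrow> complex) \<Rightarrow> complex \<Rightarrow> complex" where
  "poisson_meas \<mu> z = cintegral \<mu> (\<lambda>\<zeta>. of_real (poisson_kernel z \<zeta>))"

definition compM :: "(complex \<Rightarrow> complex) \<Rightarrow> (complex set \<Rightarrow> complex) \<Rightarrow> (complex set \<Rightarrow> complex)" where
  "compM \<phi> \<mu> = (THE \<nu>. cmeasure \<nu> \<and> (\<forall>z\<in>DD. poisson_meas \<nu> z = poisson_meas \<mu> (\<phi> z)))"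

definition compact_op :: "('a \<Rightarrow> complex) set \<Rightarrow> (('a \<Rightarrow> complex) \<Rightarrow> real)
    \<Rightarrow> (('a \<Rightarrow> complex) \<Rightarrow> ('a \<Rightarrow> complex)) \<Rightarrow> bool" where
  "compact_op X N T \<longleftrightarrow> (\<forall>x :: nat \<Rightarrow> 'a \<Rightarrow> complex. (\<forall>n. x n \<in> X \<and> N (x n) \<le> 1) \<longrightarrow>
      (\<exists>r y. strict_mono r \<and> y \<in> X \<and> (\<lambda>n. N (T (x (r n)) - y)) \<longlonglongrightarrow> 0))"

definition op_norm :: "('a \<Rightarrow> complex) set \<Rightarrow> (('a \<Rightarrow> complex) \<Rightarrow> real)
    \<Rightarrow> (('a \<Rightarrow> complex) \<Rightarrow> ('a \<Rightarrow> complex)) \<Rightarrow> real" where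
  "op_norm X N T = Sup {N (T x) | x. x \<in> X \<and> N x \<le> 1}"

definition norm_continuous_family :: "('a \<Rightarrow> complex) set \<Rightarrow> (('a \<Rightarrow> complex) \<Rightarrow> real)
    \<Rightarrow> (real \<Rightarrow> ('a \<Rightarrow> complex) \<Rightarrow> ('a \<Rightarrow> complex)) \<Rightarrow> bool" where
  "norm_continuous_family X N C \<longleftrightarrow> (\<forall>t\<in>{0..1}. \<forall>\<epsilon>>0. \<exists>\<delta>>0. \<forall>s\<in>{0..1}.
      \<bar>s - t\<bar> < \<delta> \<longrightarrow> op_norm X N (\<lambda>x. C s x - C t x) < \<epsilon>)"

definition compops_H2 :: "((complex \<Rightarrow> complex) \<Rightarrow> (complex \<Rightarrow> complex)) set" where
  "compops_H2 = {compL \<phi> | \<phi>. analytic_selfmap \<phi>}"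

definition dist_H2 :: "((complex \<Rightarrow> complex) \<Rightarrow> (complex \<Rightarrow> complex))
    \<Rightarrow> ((complex \<Rightarrow> complex) \<Rightarrow> (complex \<Rightarrow> complex)) \<Rightarrow> real" where
  "dist_H2 A B = op_norm (Hp 2) (Lp_norm 2) (\<lambda>f. A f - B f)"

definition compops_H2_top :: "((complex \<Rightarrow> complex) \<Rightarrow> (complex \<Rightarrow> complex)) topology" where
  "compops_H2_top = topology (\<lambda>U. U \<subseteq> compops_H2 \<and>
      (\<forall>A\<in>U. \<exists>\<epsilon>>0. \<forall>B\<in>compops_H2. dist_H2 A B < \<epsilon> \<longrightarrow> B \<in> U))"

end

theory Submission
  imports Defs "HOL-Complex_Analysis.Complex_Analysis"
begin

text \<open>Let \<open>\<sigma>\<^sub>t\<close>, \<open>0 \<le> t \<le> 1\<close>, be an increasing family of atomless singular measures on the circle,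
  the images of Lebesgue measure on \<open>[0,t]\<close> under a strictly increasing pure jump function, and
  define \<open>\<phi>\<^sub>t\<close> by \<open>(1 + \<phi>\<^sub>t) / (1 - \<phi>\<^sub>t) = 1 + H[\<sigma>\<^sub>t]\<close> with \<open>H\<close> the Herglotz transform. The
  Aleksandrov--Clark measure of \<open>\<phi>\<^sub>t\<close> at \<open>\<alpha>\<close> is then absolutely continuous for \<open>\<alpha> \<noteq> 1\<close>, and at
  \<open>\<alpha> = 1\<close> it is \<open>m + \<sigma>\<^sub>t\<close>; so \<open>C\<^bsub>\<phi>\<^esub> \<mu>\<close> is the sum of \<open>\<mu>{1} \<sigma>\<^sub>t\<close> and an absolutely continuous part whose
  density is an integral of Poisson kernels \<open>P\<^bsub>\<phi>(\<zeta>)\<^esub>(\<alpha>)\<close> against \<open>\<mu>\<close>. At \<open>t = 0\<close> the map is constant and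
  the operator has rank one. At \<open>t = 1\<close> the mass of \<open>\<sigma>\<^sub>1\<close> prevents compactness: kernels
  concentrating at \<open>1\<close> have images converging weakly to a measure with a singular part.
  Norm continuity reduces to the continuity of \<open>t \<mapsto> P\<^bsub>\<phi>(\<zeta>)\<^esub>(\<alpha>)\<close> in \<open>L\<^sup>1\<close>, uniformly in \<open>\<alpha>\<close>; near
  \<open>\<alpha> = 1\<close> this holds because \<open>\<sigma>\<^sub>t - \<sigma>\<^sub>s\<close> has small mass and, for \<open>t\<close> near \<open>s\<close>, lives
  near at most two points.
  Finally every compact \<open>C\<^bsub>\<phi>\<^esub>\<close> on \<open>H\<^sup>2\<close> is joined to \<open>C\<^sub>0\<close> by the path \<open>r \<mapsto> C\<^bsub>r\<phi>\<^esub>\<close>.\<close>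

text \<open>The obstacle is the point alpha = 1: as alpha tends to 1 the densities
  P_{phi(zeta)}(alpha) converge only weakly, and the limit carries the additional mass sigma_t.
  Three properties of the jump function are tuned to this. Strict monotonicity makes the measures
  atomless, so small arcs carry little limiting mass. One-sided limits confine sigma_t - sigma_s,
  for t near s, to two small arcs. The null closure of the range makes the measures singular and
  lets H extend analytically across the rest of the circle, where Re H = 0. Away from the two arcs a
  small change of H then changes the kernel by a factor close to 1, whatever alpha is; it is this
  relative form of the estimate that survives alpha -> 1. From L^1 to L^p the passage is a weak
  Jensen inequality with constant 3 and a Tonelli exchange. For the component statement phi is an
  arbitrary self-map, without explicit boundary values; there C_phi on H^2 is obtained through
  Taylor coefficients, Bessel's inequality and Riesz-Fischer.\<close>

section \<open>Normalised Lebesgue measure on the circle\<close>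

lemma space_borelT [simp]: "space borelT = sphere 0 1"
  by (simp add: borelT_def space_restrict_space)

lemma sets_borelT_iff: "A \<in> sets borelT \<longleftrightarrow> A \<in> sets borel \<and> A \<subseteq> sphere 0 1"
  unfolding borelT_def by (subst sets_restrict_space_iff) auto

lemma measurable_id_borelT: "(\<lambda>x. x) \<in> borel_measurable borelT"
  unfolding borelT_def by (rule measurable_restrict_space1) simp

lemma borel_measurable_borelT: "f \<in> borel_measurable borel \<Longrightarrow> f \<in> borel_measurable borelT"
  unfolding borelT_def by (rule measurable_restrict_space1)

lemma cis_measurable [measurable]: "cis \<in> borel_measurable borel"
  by (intro borel_measurable_continuous_onI continuous_intros)

lemma cis_measurable_borelT: "cis \<in> measurable borel borelT"
  unfolding borelT_def by (rule measurable_restrict_space2) (auto simp: norm_cis)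

lemma sets_mT [simp, measurable_cong]: "sets mT = sets borelT"
  by (simp add: mT_def)

lemma space_mT [simp]: "space mT = sphere 0 1"
  by (simp add: mT_def)

lemma nn_integral_mT:
  assumes f: "f \<in> borel_measurable borelT"
  shows "(\<integral>\<^sup>+\<zeta>. f \<zeta> \<partial>mT) = ennreal (1/(2*pi)) * (\<integral>\<^sup>+\<theta>. f (cis \<theta>) * indicator {0..<2*pi} \<theta> \<partial>lborel)"
proof -
  have 1: "cis \<in> measurable (density (restrict_space lborel {0..<2*pi}) (\<lambda>_. ennreal (1 / (2*pi)))) borelT"
    using measurable_restrict_space1[OF cis_measurable_borelT, of "{0..<2*pi}"]
    by (simp add: measurable_def space_restrict_space sets_restrict_space)
  have 2: "(\<lambda>x. f (cis x)) \<in> borel_measurable (restrict_space lborel {0..<2*pi})"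
    using measurable_compose[OF 1 f] by simp
  have "(\<integral>\<^sup>+\<zeta>. f \<zeta> \<partial>mT) = (\<integral>\<^sup>+\<theta>. ennreal (1 / (2*pi)) * f (cis \<theta>) \<partial>restrict_space lborel {0..<2*pi})"
    unfolding mT_def using 1 f 2 by (subst nn_integral_distr) (auto simp: nn_integral_density)
  also have "\<dots> = ennreal (1 / (2*pi)) * (\<integral>\<^sup>+\<theta>. f (cis \<theta>) \<partial>restrict_space lborel {0..<2*pi})"
    using 2 by (rule nn_integral_cmult)
  finally show ?thesis by (simp add: nn_integral_restrict_space)
qed

lemma integral_mT:
  fixes f :: "complex \<Rightarrow> 'b :: {banach, second_countable_topology}"
  assumes f: "f \<in> borel_measurable borelT"
  shows "(\<integral>\<zeta>. f \<zeta> \<partial>mT) = (1/(2*pi)) *\<^sub>R (\<integral>\<theta>. indicator {0..<2*pi} \<theta> *\<^sub>R f (cis \<theta>) \<partial>lborel)"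
proof -
  have 1: "cis \<in> measurable (density (restrict_space lborel {0..<2*pi}) (\<lambda>_. ennreal (1 / (2*pi)))) borelT"
    using measurable_restrict_space1[OF cis_measurable_borelT, of "{0..<2*pi}"]
    by (simp add: measurable_def space_restrict_space sets_restrict_space)
  have 2: "(\<lambda>x. f (cis x)) \<in> borel_measurable (restrict_space lborel {0..<2*pi})"
    using measurable_compose[OF 1 f] by simp
  have "(\<integral>\<zeta>. f \<zeta> \<partial>mT) = (\<integral>\<theta>. (1 / (2*pi)) *\<^sub>R f (cis \<theta>) \<partial>restrict_space lborel {0..<2*pi})"
    unfolding mT_def using 1 f 2 by (subst integral_distr) (auto simp: integral_density)
  then show ?thesis by (simp add: integral_restrict_space)
qed

lemma emeasure_mT_sphere: "emeasure mT (sphere 0 1) = 1"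
proof -
  have "emeasure mT (sphere 0 1) = (\<integral>\<^sup>+\<zeta>. 1 \<partial>mT)"
    using emeasure_space[of mT] by (simp add: space_mT)
  also have "\<dots> = ennreal (1/(2*pi)) * ennreal (2*pi)"
    by (subst nn_integral_mT) auto
  also have "\<dots> = 1" by (subst ennreal_mult[symmetric]) auto
  finally show ?thesis .
qed

global_interpretation mT: finite_measure mT
  by standard (simp add: emeasure_mT_sphere)

lemma measure_mT_sphere [simp]: "measure mT (sphere 0 1) = 1"
  by (simp add: measure_def emeasure_mT_sphere)

text \<open>\<open>cis\<close> is injective on the half-open interval, so the image has the measure
  of \<open>K\<close> up to the factor 1/(2 pi); compactness makes the image Borel. Applied to the
  carrier of the singular measures and to the point 1.\<close>

lemma null_mT_cis_image:
  assumes K: "K \<subseteq> {0..<2*pi}" "compact K" "K \<in> null_sets lborel"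
  shows "cis ` K \<in> null_sets mT"
proof -
  have "compact (cis ` K)" by (intro compact_continuous_image continuous_intros K)
  then have s: "cis ` K \<in> sets borelT"
    by (auto simp: sets_borelT_iff borel_compact norm_cis)
  have "emeasure mT (cis ` K) = (\<integral>\<^sup>+\<zeta>. indicator (cis ` K) \<zeta> \<partial>mT)" using s by simp
  also have "\<dots> = ennreal (1/(2*pi)) * (\<integral>\<^sup>+\<theta>. indicator (cis ` K) (cis \<theta>) * indicator {0..<2*pi} \<theta> \<partial>lborel)"
    using s by (intro nn_integral_mT) auto
  also have "(\<integral>\<^sup>+\<theta>. indicator (cis ` K) (cis \<theta>) * indicator {0..<2*pi} \<theta> \<partial>lborel) = (\<integral>\<^sup>+\<theta>. indicator K \<theta> \<partial>lborel)"
  proof (intro nn_integral_cong)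
    fix \<theta> :: real
    have "\<theta> \<in> K" if "0 \<le> \<theta>" "\<theta> < 2*pi" "x \<in> K" "cis \<theta> = cis x" for x
    proof -
      have "0 \<le> x" "x < 2*pi" using K that by auto
      then have "\<theta> = x" using that Arg2pi_unique[of 1 \<theta> "cis \<theta>"] Arg2pi_unique[of 1 x "cis \<theta>"]
        by (simp add: cis_conv_exp)
      then show ?thesis using that by simp
    qed
    then show "indicator (cis ` K) (cis \<theta>) * indicator {0..<2*pi} \<theta> = (indicator K \<theta> :: ennreal)"
      using K by (auto simp: indicator_def)
  qed
  also have "\<dots> = 0" using K(3) by (auto simp: null_sets_def)
  finally show ?thesis using s by (auto simp: null_sets_def)
qed

lemma null_mT_one: "{1} \<in> null_sets mT"
  using null_mT_cis_image[of "{0}"] by (simp add: null_sets_def)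

lemma integrable_mT_bounded:
  fixes f :: "complex \<Rightarrow> 'b :: {banach, second_countable_topology}"
  assumes "f \<in> borel_measurable borelT" "\<And>\<zeta>. norm \<zeta> = 1 \<Longrightarrow> norm (f \<zeta>) \<le> B"
  shows "integrable mT f"
  using assms by (intro mT.integrable_const_bound[of _ B]) auto

text \<open>With u = cis theta one has du / u = i dtheta, so integration against \<open>mT\<close>
  is a contour integral; this is how Cauchy's formula enters.\<close>

lemma has_contour_integral_mT:
  assumes f: "continuous_on (sphere 0 1) f"
  shows "((\<lambda>u. f u / u) has_contour_integral (2 * of_real pi * \<i> * (\<integral>\<zeta>. f \<zeta> \<partial>mT))) (circlepath 0 1)"
proof -
  have mf: "f \<in> borel_measurable borelT"
    unfolding borelT_def using f by (rule borel_measurable_continuous_on_restrict)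
  have c: "continuous_on {0..2*pi} (\<lambda>\<theta>. f (cis \<theta>))"
    by (rule continuous_on_compose2[OF f]) (auto intro!: continuous_intros simp: norm_cis)
  have si: "set_integrable lborel {0..2*pi} (\<lambda>\<theta>. f (cis \<theta>))"
    using c by (rule borel_integrable_atLeastAtMost')
  have "(\<integral>\<theta>. indicator {0..<2*pi} \<theta> *\<^sub>R f (cis \<theta>) \<partial>lborel) = (\<integral>\<theta>. indicator {0..2*pi} \<theta> *\<^sub>R f (cis \<theta>) \<partial>lborel)"
  proof (rule integral_cong_AE)
    have m: "(\<lambda>\<theta>. f (cis \<theta>)) \<in> borel_measurable lborel"
      using measurable_compose[OF cis_measurable_borelT mf] by simp
    show "(\<lambda>\<theta>. indicat_real {0..<2 * pi} \<theta> *\<^sub>R f (cis \<theta>)) \<in> borel_measurable lborel"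
      "(\<lambda>\<theta>. indicat_real {0..2 * pi} \<theta> *\<^sub>R f (cis \<theta>)) \<in> borel_measurable lborel"
      using m by simp_all
    show "AE x in lborel. indicat_real {0..<2 * pi} x *\<^sub>R f (cis x) = indicat_real {0..2 * pi} x *\<^sub>R f (cis x)"
      using AE_lborel_singleton[of "2*pi"] by eventually_elim (auto simp: indicator_def)
  qed
  also have "\<dots> = integral {0..2*pi} (\<lambda>\<theta>. f (cis \<theta>))"
    using set_borel_integral_eq_integral(2)[OF si] by (simp add: set_lebesgue_integral_def)
  finally have I: "(\<integral>\<zeta>. f \<zeta> \<partial>mT) = (1/(2*pi)) *\<^sub>R integral {0..2*pi} (\<lambda>\<theta>. f (cis \<theta>))"
    using integral_mT[OF mf] by simp
  have "((\<lambda>\<theta>. f (cis \<theta>)) has_integral (integral {0..2*pi} (\<lambda>\<theta>. f (cis \<theta>)))) {0..2*pi}"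
    using set_borel_integral_eq_integral(1)[OF si] by (simp add: has_integral_integral)
  then have "((\<lambda>x. f (cis ((2*pi) * x))) has_integral ((1 / \<bar>2*pi\<bar>) *\<^sub>R integral {0..2*pi} (\<lambda>\<theta>. f (cis \<theta>))))
     ((\<lambda>x. x / (2*pi)) ` {0..2*pi})"
    by (rule has_integral_stretch_real) simp
  moreover have "(\<lambda>x. x / (2*pi)) ` {0..2*pi} = {0..1}"
    by (subst image_divide_atLeastAtMost) auto
  ultimately have "((\<lambda>x. f (cis (2*pi*x))) has_integral (\<integral>\<zeta>. f \<zeta> \<partial>mT)) {0..1}"
    by (simp add: I)
  then have "((\<lambda>x. 2 * of_real pi * \<i> * f (cis (2*pi*x))) has_integral (2 * of_real pi * \<i> * (\<integral>\<zeta>. f \<zeta> \<partial>mT))) {0..1}"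
    by (rule has_integral_mult_right)
  then show ?thesis unfolding has_contour_integral_def
    by (rule has_integral_eq[rotated])
       (simp add: vector_derivative_circlepath01, simp add: circlepath cis_conv_exp mult_ac)
qed

section \<open>The Poisson kernel and the Poisson formula\<close>

lemma poisson_kernel_nonneg [simp]: "norm z \<le> 1 \<Longrightarrow> 0 \<le> poisson_kernel z \<zeta>"
  by (simp add: poisson_kernel_def power_le_one)

text \<open>A crude bound: numerator at most 2, |zeta - z| at least 1 - r. In the form 2 / (1 -
  |z|)^2 it recurs as the dominating constant for kernels with a fixed z in the disc.\<close>

lemma poisson_kernel_le:
  assumes "norm z \<le> r" "r < 1" "norm \<zeta> = 1"
  shows "poisson_kernel z \<zeta> \<le> 2 / (1 - r)\<^sup>2"
proof -
  have "1 - r \<le> norm (\<zeta> - z)" using assms norm_triangle_ineq2[of \<zeta> z] by simp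
  moreover have "1 - (norm z)\<^sup>2 \<le> 2" by (smt (verit) zero_le_power2)
  ultimately show ?thesis unfolding poisson_kernel_def using assms
    by (intro frac_le power_mono) auto
qed

text \<open>The real part of the Herglotz kernel. At z = zeta both sides are 0 by the convention for
  division by zero, so \<open>Re_herg\<close> can rewrite the integrand at every point of the
  circle.\<close>

lemma poisson_kernel_Re:
  assumes "norm \<zeta> = 1"
  shows "poisson_kernel z \<zeta> = Re ((\<zeta> + z) / (\<zeta> - z))"
proof -
  have "(Re \<zeta>)\<^sup>2 + (Im \<zeta>)\<^sup>2 = 1" using assms by (simp add: cmod_def)
  then have "Re (\<zeta> + z) * Re (\<zeta> - z) + Im (\<zeta> + z) * Im (\<zeta> - z) = 1 - (norm z)\<^sup>2"
    unfolding cmod_power2 by (simp add: power2_eq_square algebra_simps)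
  then show ?thesis
    by (simp add: poisson_kernel_def Re_divide cmod_power2 add_divide_distrib[symmetric])
qed

text \<open>On the circle |alpha - r zeta| = |zeta - r alpha|. The symmetry makes Poisson means
  self-adjoint: a dilation can be moved from a test function to a measure.\<close>

lemma poisson_kernel_swap:
  assumes "norm \<zeta> = 1" "norm \<alpha> = 1"
  shows "poisson_kernel (of_real r * \<zeta>) \<alpha> = poisson_kernel (of_real r * \<alpha>) \<zeta>"
proof -
  have "(norm (\<alpha> - of_real r * \<zeta>))\<^sup>2 = (norm (\<zeta> - of_real r * \<alpha>))\<^sup>2"
  proof -
    have "(Re \<zeta>)\<^sup>2 + (Im \<zeta>)\<^sup>2 = 1" "(Re \<alpha>)\<^sup>2 + (Im \<alpha>)\<^sup>2 = 1" using assms by (simp_all add: cmod_def)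
    then show ?thesis unfolding cmod_power2 by simp algebra
  qed
  then show ?thesis using assms by (simp add: poisson_kernel_def norm_mult)
qed

lemma poisson_kernel_zero [simp]: "norm \<zeta> = 1 \<Longrightarrow> poisson_kernel 0 \<zeta> = 1"
  by (simp add: poisson_kernel_def)

lemma measurable_poisson_kernel [measurable (raw)]:
  "f \<in> borel_measurable M \<Longrightarrow> g \<in> borel_measurable M \<Longrightarrow> (\<lambda>x. poisson_kernel (f x) (g x)) \<in> borel_measurable M"
proof -
  assume f [measurable]: "f \<in> borel_measurable M" and g [measurable]: "g \<in> borel_measurable M"
  have [measurable]: "(\<lambda>x. g x - f x) \<in> borel_measurable M" using f g by (rule borel_measurable_diff[rotated])
  show "(\<lambda>x. poisson_kernel (f x) (g x)) \<in> borel_measurable M" unfolding poisson_kernel_def by measurable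
qed

lemma measurable_poisson_kernel_borelT [simp]: "poisson_kernel z \<in> borel_measurable borelT"
  using measurable_poisson_kernel[OF borel_measurable_const measurable_id_borelT, of z] .

lemma continuous_poisson_kernel [continuous_intros]:
  assumes "continuous_on A f" "continuous_on A g" "\<And>x. x \<in> A \<Longrightarrow> f x \<noteq> g x"
  shows "continuous_on A (\<lambda>x. poisson_kernel (f x) (g x))"
  unfolding poisson_kernel_def using assms by (intro continuous_intros) (auto, metis)

lemma tendsto_poisson_kernel [tendsto_intros]:
  assumes "(f \<longlongrightarrow> a) F" "(g \<longlongrightarrow> b) F" "a \<noteq> b"
  shows "((\<lambda>x. poisson_kernel (f x) (g x)) \<longlongrightarrow> poisson_kernel a b) F"
  unfolding poisson_kernel_def using assms by (intro tendsto_intros) auto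

text \<open>On the circle u |u - z|^2 = (u - z) (1 - cnj z u). Hence P_z(u) F(u) / u is G(u) / (u -
  z) for the holomorphic function G(w) = F(w) (1 - |z|^2) / (1 - cnj z w), and Cauchy's formula for
  G gives G(z) = F(z).\<close>

theorem poisson_formula_cball:
  assumes c: "continuous_on (cball 0 1) F" and h: "F holomorphic_on ball 0 1" and z: "norm z < 1"
  shows "(\<integral>\<zeta>. of_real (poisson_kernel z \<zeta>) * F \<zeta> \<partial>mT) = F z"
proof -
  define G where "G w = F w * (of_real (1 - (norm z)\<^sup>2) / (1 - cnj z * w))" for w
  have nz: "1 - cnj z * w \<noteq> 0" if "norm w \<le> 1" for w
  proof
    assume "1 - cnj z * w = 0"
    then have "norm (cnj z * w) = 1" by simp
    then have "norm z * norm w = 1" by (simp add: norm_mult)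
    moreover have "norm z * norm w \<le> norm z * 1" using that by (intro mult_left_mono) auto
    ultimately show False using z by simp
  qed
  have "continuous_on (cball 0 1) G" unfolding G_def using nz by (intro continuous_intros c) auto
  moreover have "G holomorphic_on ball 0 1" unfolding G_def using nz by (intro holomorphic_intros h) auto
  ultimately have 1: "((\<lambda>u. G u / (u - z)) has_contour_integral (2 * of_real pi * \<i> * G z)) (circlepath 0 1)"
    using z by (intro Cauchy_integral_circlepath) auto
  have zz: "cnj z * z = of_real ((norm z)\<^sup>2)"
    using complex_norm_square[of z] by (simp add: mult.commute)
  have "1 - (norm z)\<^sup>2 \<noteq> 0"
    using z by (metis abs_norm_cancel eq_iff_diff_eq_0 less_irrefl one_power2 power2_eq_iff_nonneg zero_le_one norm_ge_zero)
  then have Gz: "G z = F z" unfolding G_def zz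
    by (metis (no_types, lifting) div_by_1 divide_self mult.right_neutral of_real_1 of_real_diff of_real_eq_0_iff)
  have eq: "G u / (u - z) = (of_real (poisson_kernel z u) * F u) / u" if "norm u = 1" for u
  proof -
    have u0: "u \<noteq> 0" "u - z \<noteq> 0" using that z by auto
    have n0: "1 - cnj z * u \<noteq> 0" using nz that by simp
    have uu: "u * cnj u = 1" using complex_norm_square[of u] that by simp
    have "of_real ((norm (u - z))\<^sup>2) = (u - z) * (cnj u - cnj z)"
      by (metis complex_norm_square complex_cnj_diff of_real_power)
    then have k: "of_real ((norm (u - z))\<^sup>2) * u = (u - z) * (1 - cnj z * u)"
      using uu by algebra
    have n1: "complex_of_real ((norm (u - z))\<^sup>2) \<noteq> 0" using u0 by simp
    have "(of_real (poisson_kernel z u) * F u) / u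
        = of_real (1 - (norm z)\<^sup>2) * F u / (of_real ((norm (u - z))\<^sup>2) * u)"
      by (simp add: poisson_kernel_def)
    also have "\<dots> = G u / (u - z)" unfolding k G_def by (simp add: mult.commute)
    finally show ?thesis by simp
  qed
  have "((\<lambda>u. (of_real (poisson_kernel z u) * F u) / u) has_contour_integral
     (2 * of_real pi * \<i> * (\<integral>\<zeta>. of_real (poisson_kernel z \<zeta>) * F \<zeta> \<partial>mT))) (circlepath 0 1)"
    using z by (intro has_contour_integral_mT continuous_intros continuous_on_subset[OF c]) auto
  then have "((\<lambda>u. G u / (u - z)) has_contour_integral
     (2 * of_real pi * \<i> * (\<integral>\<zeta>. of_real (poisson_kernel z \<zeta>) * F \<zeta> \<partial>mT))) (circlepath 0 1)"
    by (rule has_contour_integral_eq) (auto simp: eq path_image_circlepath)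
  from has_contour_integral_unique[OF this 1] show ?thesis by (simp add: Gz)
qed

text \<open>The dilate w -> F(r w) is continuous up to the boundary, so a function merely
  holomorphic in the disc is covered; limits r -> 1 are taken later, where a dominating function is
  at hand.\<close>

lemma poisson_formula:
  assumes h: "F holomorphic_on DD" and r: "0 \<le> r" "r < 1" and z: "z \<in> DD"
  shows "(\<integral>\<zeta>. of_real (poisson_kernel z \<zeta>) * F (of_real r * \<zeta>) \<partial>mT) = F (of_real r * z)"
proof -
  have s: "(*) (of_real r) ` cball 0 1 \<subseteq> DD"
  proof
    fix x assume "x \<in> (*) (complex_of_real r) ` cball 0 1"
    then obtain y where y: "x = of_real r * y" "y \<in> cball 0 1" by (elim imageE)
    have "r * norm y \<le> r * 1" using r y by (intro mult_left_mono) auto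
    then show "x \<in> DD" using r y by (simp add: DD_def norm_mult)
  qed
  have h': "(\<lambda>z. F (of_real r * z)) holomorphic_on ball 0 1"
    using holomorphic_on_compose_gen[of "(*) (of_real r)" "ball 0 1" F DD] h s
    by (force simp: o_def intro!: holomorphic_intros)
  have "continuous_on (cball 0 1) (\<lambda>z. F (of_real r * z))"
    by (rule continuous_on_compose2[OF holomorphic_on_imp_continuous_on[OF h]])
       (use s in \<open>auto intro!: continuous_intros\<close>)
  from poisson_formula_cball[OF this h'] z show ?thesis by (simp add: DD_def)
qed

lemma integral_poisson_kernel: "z \<in> DD \<Longrightarrow> (\<integral>\<zeta>. poisson_kernel z \<zeta> \<partial>mT) = 1"
  using poisson_formula[of "\<lambda>_. 1" 0 z] by simp

lemma integrable_poisson_kernel: "z \<in> DD \<Longrightarrow> integrable mT (poisson_kernel z)"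
  by (rule integrable_mT_bounded[where B="2/(1-norm z)\<^sup>2"]) (auto simp: DD_def intro!: poisson_kernel_le)

lemma of_real_mult_DD: "\<lbrakk>0 \<le> r; r < 1; norm \<zeta> \<le> 1\<rbrakk> \<Longrightarrow> of_real r * \<zeta> \<in> DD"
  using mult_left_mono[of "norm \<zeta>" 1 r] by (simp add: DD_def norm_mult)

text \<open>P_{phi(w)}(alpha) is the real part of (alpha + phi(w)) / (alpha - phi(w)), holomorphic
  in the disc, so the Poisson formula applies to its dilates. This is the harmonic function whose
  boundary measure is the Aleksandrov--Clark measure at alpha.\<close>

lemma poisson_kernel_selfmap:
  assumes \<phi>: "analytic_selfmap \<phi>" and a: "norm \<alpha> = 1" and r: "0 \<le> r" "r < 1" and z: "z \<in> DD"
  shows "(\<integral>\<zeta>. poisson_kernel z \<zeta> * poisson_kernel (\<phi> (of_real r * \<zeta>)) \<alpha> \<partial>mT) = poisson_kernel (\<phi> (of_real r * z)) \<alpha>"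
proof -
  define F where "F w = (\<alpha> + \<phi> w) / (\<alpha> - \<phi> w)" for w
  have lt: "norm (\<phi> w) < 1" if "w \<in> DD" for w using \<phi> that by (auto simp: analytic_selfmap_def DD_def image_subset_iff)
  have h: "F holomorphic_on DD" unfolding F_def
    using \<phi> lt a by (intro holomorphic_intros) (auto simp: analytic_selfmap_def, metis less_irrefl)
  have ReF: "Re (F w) = poisson_kernel (\<phi> w) \<alpha>" for w
    using poisson_kernel_Re[OF a] by (simp add: F_def)
  have cF: "continuous_on (sphere 0 1) (\<lambda>\<zeta>. F (of_real r * \<zeta>))"
    by (rule continuous_on_compose2[OF holomorphic_on_imp_continuous_on[OF h]])
       (use r in \<open>auto intro!: continuous_intros of_real_mult_DD\<close>)
  have "continuous_on (sphere 0 1) (\<lambda>\<zeta>. of_real (poisson_kernel z \<zeta>) * F (of_real r * \<zeta>))"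
    using z by (intro continuous_intros cF) (auto simp: DD_def)
  then have i: "integrable mT (\<lambda>\<zeta>. of_real (poisson_kernel z \<zeta>) * F (of_real r * \<zeta>))"
  proof -
    assume c: "continuous_on (sphere 0 1) (\<lambda>\<zeta>. of_real (poisson_kernel z \<zeta>) * F (of_real r * \<zeta>))"
    have "compact ((\<lambda>\<zeta>. of_real (poisson_kernel z \<zeta>) * F (of_real r * \<zeta>)) ` sphere 0 1)"
      using c by (intro compact_continuous_image) auto
    then obtain B where "\<forall>y\<in>(\<lambda>\<zeta>. of_real (poisson_kernel z \<zeta>) * F (of_real r * \<zeta>)) ` sphere 0 1. norm y \<le> B"
      using compact_imp_bounded bounded_iff by blast
    then show ?thesis
      using c unfolding borelT_def
      by (intro integrable_mT_bounded[where B=B]) (auto simp: borelT_def intro!: borel_measurable_continuous_on_restrict)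
  qed
  have "Re (\<integral>\<zeta>. of_real (poisson_kernel z \<zeta>) * F (of_real r * \<zeta>) \<partial>mT) = Re (F (of_real r * z))"
    using poisson_formula[OF h r z] by simp
  then show ?thesis using integral_Re[OF i] by (simp add: ReF)
qed

lemma measurable_of_real_poisson_kernel [simp]:
  "(\<lambda>\<zeta>. complex_of_real (poisson_kernel z \<zeta>)) \<in> borel_measurable borelT"
  using measurable_compose[OF measurable_poisson_kernel_borelT borel_measurable_of_real] .

section \<open>Complex measures on the circle\<close>

text \<open>A list of pairs (c, M) stands for the complex measure given by the sum of the c M.\<close>

definition wlist :: "(complex \<times> complex measure) list \<Rightarrow> bool" where
  "wlist L \<longleftrightarrow> (\<forall>(c, M) \<in> set L. finite_measure M \<and> sets M = sets borelT)"

text \<open>The value 0 off the Borel sets is the one prescribed by \<open>cmeasure\<close>; with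
  it, equality of complex measures is plain equality of functions.\<close>

definition wlist_meas :: "(complex \<times> complex measure) list \<Rightarrow> complex set \<Rightarrow> complex" where
  "wlist_meas L E = (if E \<in> sets borelT then (\<Sum>(c, M)\<leftarrow>L. c * of_real (measure M E)) else 0)"

definition wlist_int :: "(complex \<times> complex measure) list \<Rightarrow> (complex \<Rightarrow> complex) \<Rightarrow> complex" where
  "wlist_int L f = (\<Sum>(c, M)\<leftarrow>L. c * (\<integral>x. f x \<partial>M))"

text \<open>An upper bound for the total variation; it can be strictly larger when entries of the
  list cancel.\<close>

definition wlist_mass :: "(complex \<times> complex measure) list \<Rightarrow> real" where
  "wlist_mass L = (\<Sum>(c, M)\<leftarrow>L. norm c * measure M (sphere 0 1))"

lemma wlist_Cons [simp]: "wlist ((c, M) # L) \<longleftrightarrow> finite_measure M \<and> sets M = sets borelT \<and> wlist L"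
  and wlist_Nil [simp]: "wlist []"
  by (auto simp: wlist_def)

lemma wlist_append [simp]: "wlist (L @ L') \<longleftrightarrow> wlist L \<and> wlist L'"
  by (auto simp: wlist_def)

lemma wlist_int_simps [simp]:
  "wlist_int [] f = 0" "wlist_int ((c, M) # L) f = c * (\<integral>x. f x \<partial>M) + wlist_int L f"
  by (simp_all add: wlist_int_def)

lemma wlist_meas_Nil [simp]: "wlist_meas [] E = 0"
  by (simp add: wlist_meas_def)

lemma wlist_meas_Cons:
  "wlist_meas ((c, M) # L) E = (if E \<in> sets borelT then c * of_real (measure M E) else 0) + wlist_meas L E"
  by (simp add: wlist_meas_def)

lemma wlist_mass_simps [simp]:
  "wlist_mass [] = 0" "wlist_mass ((c, M) # L) = norm c * measure M (sphere 0 1) + wlist_mass L"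
  by (simp_all add: wlist_mass_def)

lemma space_eq_sphere: "sets M = sets borelT \<Longrightarrow> space M = sphere 0 1"
  using sets_eq_imp_space_eq[of M borelT] by simp

lemma cmeasure_zero: "cmeasure (\<lambda>_. 0)"
  by (simp add: cmeasure_def)

lemma cmeasure_add: "cmeasure \<mu> \<Longrightarrow> cmeasure \<nu> \<Longrightarrow> cmeasure (\<lambda>E. \<mu> E + \<nu> E)"
  unfolding cmeasure_def by (intro conjI allI impI sums_add) simp_all

lemma cmeasure_diff: "cmeasure \<mu> \<Longrightarrow> cmeasure \<nu> \<Longrightarrow> cmeasure (\<mu> - \<nu>)"
  unfolding cmeasure_def minus_apply by (intro conjI allI impI sums_diff) simp_all

lemma cmeasure_wlist_meas:
  assumes "wlist L"
  shows "cmeasure (wlist_meas L)"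
  using assms
proof (induction L)
  case Nil
  then show ?case by (simp add: cmeasure_zero wlist_meas_def cong: if_cong)
next
  case (Cons p L)
  obtain c M where p: "p = (c, M)" by force
  interpret M: finite_measure M using Cons.prems p by simp
  have s: "sets M = sets borelT" using Cons.prems p by simp
  have "cmeasure (\<lambda>E. if E \<in> sets borelT then c * of_real (measure M E) else 0)"
    unfolding cmeasure_def
  proof (intro conjI allI impI)
    fix A :: "nat \<Rightarrow> complex set" assume A: "range A \<subseteq> sets borelT" "disjoint_family A"
    then have "(\<lambda>i. measure M (A i)) sums (measure M (\<Union>i. A i))"
      by (intro M.finite_measure_UNION) (auto simp: s)
    then have "(\<lambda>i. c * of_real (measure M (A i))) sums (c * of_real (measure M (\<Union>i. A i)))"
      by (intro sums_mult) (simp add: sums_of_real)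
    moreover have "\<And>n. A n \<in> sets borelT" "(\<Union>i. A i) \<in> sets borelT" using A by auto
    ultimately show "(\<lambda>n. if A n \<in> sets borelT then c * of_real (measure M (A n)) else 0) sums
       (if (\<Union>n. A n) \<in> sets borelT then c * of_real (measure M (\<Union>n. A n)) else 0)" by simp
  qed auto
  moreover have "wlist_meas (p # L) = (\<lambda>E. (if E \<in> sets borelT then c * of_real (measure M E) else 0) + wlist_meas L E)"
    by (rule ext) (simp add: p wlist_meas_Cons)
  ultimately show ?case using cmeasure_add[OF _ Cons.IH] Cons.prems p by simp
qed

lemma integral_simple_function:
  fixes f :: "'a \<Rightarrow> complex"
  assumes "finite_measure M" "simple_function M f"
  shows "integrable M f" "(\<integral>x. f x \<partial>M) = (\<Sum>y\<in>f ` space M. of_real (measure M {x\<in>space M. f x = y}) * y)"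
proof -
  interpret finite_measure M by fact
  have "Bochner_Integration.simple_bochner_integrable M f"
    using assms(2) by (simp add: simple_bochner_integrable.simps)
  then show "integrable M f" "(\<integral>x. f x \<partial>M) = (\<Sum>y\<in>f ` space M. of_real (measure M {x\<in>space M. f x = y}) * y)"
    using simple_bochner_integrable_eq_integral[of M f] has_bochner_integral_simple_bochner_integrable[of M f]
    by (auto simp: Bochner_Integration.simple_bochner_integral_def scaleR_conv_of_real has_bochner_integral_iff)
qed

lemma wlist_int_simple:
  assumes L: "wlist L" and f: "simple_function borelT f"
  shows "wlist_int L f = (\<Sum>y\<in>f ` sphere 0 1. wlist_meas L {x\<in>sphere 0 1. f x = y} * y)"
  using L
proof (induction L)
  case (Cons p L)
  obtain c M where p: "p = (c, M)" by force
  have s: "sets M = sets borelT" "finite_measure M" using Cons.prems p by auto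
  have f': "simple_function M f" using f simple_function_cong_algebra[of borelT M f] s space_eq_sphere[OF s(1)] by auto
  have m: "{x\<in>sphere 0 1. f x = y} \<in> sets borelT" for y
    using simple_functionD(2)[OF f, of "{y}"]
    by (simp add: vimage_def Int_def conj_commute)
  have "c * (\<integral>x. f x \<partial>M) = (\<Sum>y\<in>f ` sphere 0 1. c * of_real (measure M {x\<in>sphere 0 1. f x = y}) * y)"
    by (subst integral_simple_function(2)[OF s(2) f']) (simp add: sum_distrib_left mult.assoc space_eq_sphere[OF s(1)])
  then show ?case using Cons p m
    by (simp add: wlist_meas_Cons sum.distrib[symmetric] distrib_right del: mem_sphere_0)
qed simp

lemma integrable_bounded_borelT:
  fixes f :: "complex \<Rightarrow> 'b :: {banach, second_countable_topology}"
  assumes "finite_measure M" "sets M = sets borelT" "f \<in> borel_measurable borelT" "\<And>x. norm x = 1 \<Longrightarrow> norm (f x) \<le> B"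
  shows "integrable M f"
  using assms measurable_cong_sets[of M borelT "borel::'b measure" borel]
  by (intro finite_measure.integrable_const_bound[of M f B]) (auto simp: space_eq_sphere)

lemma tendsto_wlist_int:
  assumes L: "wlist L"
    and m: "\<And>n. f n \<in> borel_measurable borelT" "g \<in> borel_measurable borelT"
    and b: "\<And>n x. norm x = 1 \<Longrightarrow> norm (f n x) \<le> B"
    and lim: "\<And>x. norm x = 1 \<Longrightarrow> (\<lambda>n. f n x) \<longlonglongrightarrow> g x"
  shows "(\<lambda>n. wlist_int L (f n)) \<longlonglongrightarrow> wlist_int L g"
  using L
proof (induction L)
  case (Cons p L)
  obtain c M where p: "p = (c, M)" by force
  have s: "sets M = sets borelT" "finite_measure M" using Cons.prems p by auto
  have mm: "\<And>n. f n \<in> borel_measurable M" "g \<in> borel_measurable M"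
    using m measurable_cong_sets[OF s(1) refl, of borel] by auto
  have "(\<lambda>n. \<integral>x. f n x \<partial>M) \<longlonglongrightarrow> (\<integral>x. g x \<partial>M)"
    by (rule integral_dominated_convergence[where w="\<lambda>_. B"])
       (use mm b lim s in \<open>auto simp: space_eq_sphere finite_measure.integrable_const\<close>)
  then show ?case using Cons p by (auto intro!: tendsto_intros)
qed simp

text \<open>The integral depends on the represented set function alone, not on the list. For simple
  functions it is a combination of values on level sets; a bounded f is a limit of simple functions
  dominated by 2 |f|, and dominated convergence finishes.\<close>

lemma wlist_int_eq:
  assumes L: "wlist L" "wlist L'" and eq: "\<And>E. E \<in> sets borelT \<Longrightarrow> wlist_meas L E = wlist_meas L' E"
    and f: "f \<in> borel_measurable borelT" and B: "\<And>x. norm x = 1 \<Longrightarrow> norm (f x) \<le> B"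
  shows "wlist_int L f = wlist_int L' f"
proof -
  obtain F where "(\<forall>i. simple_function borelT (F i)) \<and> (\<forall>x\<in>sphere 0 1. (\<lambda>i. F i x) \<longlonglongrightarrow> f x) \<and>
     (\<forall>i. \<forall>x\<in>sphere 0 1. norm (F i x) \<le> 2 * norm (f x))"
    using borel_measurable_implies_sequence_metric[OF f, of 0] by (auto simp del: mem_sphere_0)
  then have F: "\<And>i. simple_function borelT (F i)" "\<And>x. norm x = 1 \<Longrightarrow> (\<lambda>i. F i x) \<longlonglongrightarrow> f x"
     "\<And>i x. norm x = 1 \<Longrightarrow> norm (F i x) \<le> 2 * norm (f x)" by auto
  have m: "{x\<in>sphere 0 1. F i x = y} \<in> sets borelT" for y i
    using simple_functionD(2)[OF F(1)[of i], of "{y}"]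
    by (simp add: vimage_def Int_def conj_commute)
  have "wlist_int L (F i) = wlist_int L' (F i)" for i
    using eq[OF m] by (simp add: wlist_int_simple[OF L(1) F(1)] wlist_int_simple[OF L(2) F(1)] del: mem_sphere_0)
  moreover have "norm (F i x) \<le> 2 * B" if "norm x = 1" for i x
    using F(3)[OF that, of i] B[OF that] by simp
  then have "(\<lambda>i. wlist_int L0 (F i)) \<longlonglongrightarrow> wlist_int L0 f" if "wlist L0" for L0
    using that f F by (intro tendsto_wlist_int[where B="2*B"]) (auto intro: borel_measurable_simple_function)
  from this[OF L(1)] this[OF L(2)] calculation show ?thesis using LIMSEQ_unique by simp
qed

text \<open>The constant sequence of empty sets is a disjoint family, and a convergent series with
  constant terms has terms 0.\<close>

lemma cmeasure_empty: "cmeasure \<mu> \<Longrightarrow> \<mu> {} = 0"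
proof -
  assume "cmeasure \<mu>"
  then have "(\<lambda>n::nat. \<mu> ((\<lambda>_. {}) n)) sums \<mu> (\<Union>n::nat. (\<lambda>_. {}) n)"
    unfolding cmeasure_def by (elim conjE allE[of _ "\<lambda>_. {}"]) (auto simp: disjoint_family_on_def)
  then have "summable (\<lambda>n::nat. \<mu> {})" by (auto simp: sums_iff)
  from summable_LIMSEQ_zero[OF this] show ?thesis by (simp add: LIMSEQ_const_iff)
qed

lemma cmeasure_sums:
  "\<lbrakk>cmeasure \<mu>; \<And>n. A n \<in> sets borelT; disjoint_family A\<rbrakk> \<Longrightarrow> (\<lambda>n::nat. \<mu> (A n)) sums \<mu> (\<Union>n. A n)"
  unfolding cmeasure_def by blast

lemma cmeasure_Un:
  assumes m: "cmeasure \<mu>" and A: "A \<in> sets borelT" "B \<in> sets borelT" "A \<inter> B = {}"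
  shows "\<mu> (A \<union> B) = \<mu> A + \<mu> B"
proof -
  have "(\<lambda>n. \<mu> (binaryset A B n)) sums \<mu> (\<Union>n. binaryset A B n)"
    using A by (intro cmeasure_sums[OF m]) (auto simp: binaryset_def disjoint_family_on_def)
  then show ?thesis
    using binaryset_sums[of \<mu> A B] cmeasure_empty[OF m] sums_unique2 by (auto simp: UN_binaryset_eq)
qed

lemma cmeasure_Diff:
  assumes m: "cmeasure \<mu>" and A: "A \<in> sets borelT" "B \<in> sets borelT" "A \<subseteq> B"
  shows "\<mu> (B - A) = \<mu> B - \<mu> A"
  using cmeasure_Un[OF m, of A "B - A"] A by (simp add: Un_absorb1)

text \<open>An unbounded complex measure could be halved repeatedly into an unbounded part and a part of
  measure at least 1 in modulus; the discarded parts then contradict countable additivity.\<close>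

lemma cmeasure_bounded:
  assumes m: "cmeasure \<mu>"
  shows "\<exists>B. \<forall>E\<in>sets borelT. norm (\<mu> E) \<le> B"
proof (rule ccontr)
  define bad where "bad E \<longleftrightarrow> E \<in> sets borelT \<and> (\<forall>B. \<exists>F\<in>sets borelT. F \<subseteq> E \<and> norm (\<mu> F) > B)" for E
  assume "\<nexists>B. \<forall>E\<in>sets borelT. norm (\<mu> E) \<le> B"
  then have 0: "bad (sphere 0 1)"
    unfolding bad_def using sets.top[of borelT] sets.sets_into_space[of _ borelT] by (force simp: not_le)
  have nb: "\<exists>B. \<forall>G\<in>sets borelT. G \<subseteq> F \<longrightarrow> norm (\<mu> G) \<le> B" if "\<not> bad F" "F \<in> sets borelT" for F
  proof -
    from that obtain B where "\<not> (\<exists>G\<in>sets borelT. G \<subseteq> F \<and> norm (\<mu> G) > B)" unfolding bad_def by auto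
    then show ?thesis by (intro exI[of _ B]) (simp add: not_less)
  qed
  \<comment> \<open>Unboundedness passes to one of two complementary pieces, because |mu G| is at
    most |mu (G Int F)| + |mu (G - F)|.\<close>
  have bad_Un: "bad F \<or> bad (E - F)" if "bad E" "F \<in> sets borelT" "F \<subseteq> E" for E F
  proof (rule ccontr)
    assume n: "\<not> (bad F \<or> bad (E - F))"
    have EF: "E - F \<in> sets borelT" using that by (auto simp: bad_def)
    obtain B1 where B1: "\<forall>G\<in>sets borelT. G \<subseteq> F \<longrightarrow> norm (\<mu> G) \<le> B1"
      using nb[of F] \<open>F \<in> sets borelT\<close> n by meson
    obtain B2 where B2: "\<forall>G\<in>sets borelT. G \<subseteq> E - F \<longrightarrow> norm (\<mu> G) \<le> B2"
      using nb[OF _ EF] n by meson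
    obtain G where G: "G \<in> sets borelT" "G \<subseteq> E" "norm (\<mu> G) > B1 + B2"
      using \<open>bad E\<close> unfolding bad_def by blast
    have "\<mu> G = \<mu> (G \<inter> F) + \<mu> (G - F)"
      using cmeasure_Un[OF m, of "G \<inter> F" "G - F"] G that(2) by (simp add: Int_Diff_Un Int_Diff_disjoint)
    moreover have "norm (\<mu> (G \<inter> F)) \<le> B1" by (rule B1[rule_format]) (use G \<open>F \<in> sets borelT\<close> in simp_all)
    moreover have "norm (\<mu> (G - F)) \<le> B2" by (rule B2[rule_format]) (use G \<open>F \<in> sets borelT\<close> in \<open>simp_all add: Diff_mono\<close>)
    ultimately show False using G norm_triangle_ineq[of "\<mu> (G \<inter> F)" "\<mu> (G - F)"] by simp
  qed
  have step: "\<exists>F. bad F \<and> F \<subseteq> E \<and> norm (\<mu> (E - F)) \<ge> 1" if E: "bad E" for E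
  proof -
    \<comment> \<open>The margin |mu E| + 1 makes both |mu F| and |mu (E - F)| at least 1. Whichever
      of the two pieces is \<open>bad\<close> is kept, and the other one may be discarded.\<close>
    obtain F where F: "F \<in> sets borelT" "F \<subseteq> E" "norm (\<mu> F) > norm (\<mu> E) + 1"
      using E unfolding bad_def by blast
    have "\<mu> (E - F) = \<mu> E - \<mu> F" using F E by (intro cmeasure_Diff[OF m]) (auto simp: bad_def)
    then have "norm (\<mu> (E - F)) \<ge> 1" using F norm_triangle_ineq2[of "\<mu> F" "\<mu> E"] by (simp add: norm_minus_commute)
    moreover have "norm (\<mu> F) \<ge> 1" using F norm_ge_zero[of "\<mu> E"] by linarith
    moreover have "E - (E - F) = F" using F by auto
    ultimately show ?thesis using bad_Un[OF E F(1,2)] F by (metis Diff_subset)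
  qed
  define Q where "Q = rec_nat (sphere 0 1) (\<lambda>_ E. SOME F. bad F \<and> F \<subseteq> E \<and> norm (\<mu> (E - F)) \<ge> 1)"
  have QS: "Q (Suc n) = (SOME F. bad F \<and> F \<subseteq> Q n \<and> norm (\<mu> (Q n - F)) \<ge> 1)" for n by (simp add: Q_def)
  have Qbad: "bad (Q n)" for n
  proof (induction n)
    case (Suc n) then show ?case using someI_ex[OF step[OF Suc]] QS by simp
  qed (simp add: 0 Q_def)
  have Q: "Q (Suc n) \<subseteq> Q n" "norm (\<mu> (Q n - Q (Suc n))) \<ge> 1" for n
    using someI_ex[OF step[OF Qbad[of n]]] QS by simp_all
  have anti: "m \<le> n \<Longrightarrow> Q n \<subseteq> Q m" for m n using Q(1) by (rule lift_Suc_antimono_le)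
  have "disjoint_family (\<lambda>n. Q n - Q (Suc n))"
  unfolding disjoint_family_on_def
  proof (intro ballI impI)
    fix m n :: nat assume "m \<noteq> n"
    then consider "Suc m \<le> n" | "Suc n \<le> m" by linarith
    then show "(Q m - Q (Suc m)) \<inter> (Q n - Q (Suc n)) = {}"
      using anti by cases blast+
  qed
  then have "(\<lambda>n. \<mu> (Q n - Q (Suc n))) sums \<mu> (\<Union>n. Q n - Q (Suc n))"
    using Qbad by (intro cmeasure_sums[OF m]) (auto simp: bad_def)
  then have "(\<lambda>n. \<mu> (Q n - Q (Suc n))) \<longlonglongrightarrow> 0" by (intro summable_LIMSEQ_zero) (auto simp: sums_iff)
  from LIMSEQ_D[OF this zero_less_one] obtain n where "norm (\<mu> (Q n - Q (Suc n))) < 1" by auto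
  then show False using Q(2)[of n] by simp
qed

section \<open>The Jordan decomposition\<close>

text \<open>Phrased through \<open>cmeasure\<close> so that additivity and boundedness are inherited
  from the complex case.\<close>

definition smeas :: "(complex set \<Rightarrow> real) \<Rightarrow> bool" where
  "smeas s \<longleftrightarrow> cmeasure (\<lambda>E. of_real (s E))"

text \<open>The positive variation: the real set function from which \<open>pos_var\<close> builds
  its measure.\<close>

definition upvar :: "(complex set \<Rightarrow> real) \<Rightarrow> complex set \<Rightarrow> real" where
  "upvar s E = Sup {s F | F. F \<in> sets borelT \<and> F \<subseteq> E}"

context
  fixes s assumes s: "smeas s"
begin

lemma smeas_sums: "\<lbrakk>\<And>n. A n \<in> sets borelT; disjoint_family A\<rbrakk> \<Longrightarrow> (\<lambda>n::nat. s (A n)) sums s (\<Union>n. A n)"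
  using cmeasure_sums[OF s[unfolded smeas_def], of A] by (simp add: sums_of_real_iff)

lemma smeas_empty: "s {} = 0"
  using cmeasure_empty[OF s[unfolded smeas_def]] by simp

lemma smeas_Un: "\<lbrakk>A \<in> sets borelT; B \<in> sets borelT; A \<inter> B = {}\<rbrakk> \<Longrightarrow> s (A \<union> B) = s A + s B"
  using cmeasure_Un[OF s[unfolded smeas_def], of A B] by (simp flip: of_real_add)

lemma upvar_bdd: "bdd_above {s F | F. F \<in> sets borelT \<and> F \<subseteq> E}"
proof -
  obtain B where "\<And>F. F \<in> sets borelT \<Longrightarrow> \<bar>s F\<bar> \<le> B"
    using cmeasure_bounded[OF s[unfolded smeas_def]] by auto
  then show ?thesis by (intro bdd_aboveI[of _ B]) (force simp: abs_le_iff)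
qed

lemma upvar_ge: "F \<in> sets borelT \<Longrightarrow> F \<subseteq> E \<Longrightarrow> s F \<le> upvar s E"
  unfolding upvar_def by (intro cSup_upper upvar_bdd) auto

lemma upvar_le: "(\<And>F. F \<in> sets borelT \<Longrightarrow> F \<subseteq> E \<Longrightarrow> s F \<le> b) \<Longrightarrow> upvar s E \<le> b"
  unfolding upvar_def by (rule cSup_least) (auto intro!: exI[of _ "{}"])

lemma upvar_nonneg: "0 \<le> upvar s E"
  using upvar_ge[of "{}" E] by (simp add: smeas_empty)

lemma upvar_super:
  assumes A: "A \<inter> B = {}"
  shows "upvar s A + upvar s B \<le> upvar s (A \<union> B)"
proof -
  have "upvar s A \<le> upvar s (A \<union> B) - upvar s B"
  proof (rule upvar_le)
    fix F assume F: "F \<in> sets borelT" "F \<subseteq> A"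
    have "upvar s B \<le> upvar s (A \<union> B) - s F"
    proof (rule upvar_le)
      fix G assume G: "G \<in> sets borelT" "G \<subseteq> B"
      have "s (F \<union> G) = s F + s G" using F G A by (intro smeas_Un) auto
      moreover have "s (F \<union> G) \<le> upvar s (A \<union> B)" using F G by (intro upvar_ge) auto
      ultimately show "s G \<le> upvar s (A \<union> B) - s F" by simp
    qed
    then show "s F \<le> upvar s (A \<union> B) - upvar s B" by simp
  qed
  then show ?thesis by simp
qed

text \<open>Superadditivity bounds the partial sums from above. Conversely any competitor F splits
  into the pieces F Int A n, and countable additivity of s bounds s F by the sum of the
  variations.\<close>

lemma upvar_sums:
  assumes A: "\<And>n. A n \<in> sets borelT" "disjoint_family A"
  shows "(\<lambda>n::nat. upvar s (A n)) sums upvar s (\<Union>n. A n)"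
proof -
  have fin: "(\<Sum>i<n. upvar s (A i)) \<le> upvar s (\<Union>i<n. A i)" for n
  proof (induction n)
    case (Suc n)
    have "A i \<inter> A n = {}" if "i < n" for i using disjoint_family_onD[OF A(2), of i n] that by simp
    then have "(\<Union>i<n. A i) \<inter> A n = {}" by blast
    from upvar_super[OF this] Suc show ?case by (simp add: lessThan_Suc Un_commute)
  qed (simp add: upvar_nonneg)
  have "upvar s (\<Union>i<n. A i) \<le> upvar s (\<Union>n. A n)" for n
    by (rule upvar_le) (auto intro!: upvar_ge)
  then have fin': "(\<Sum>i<n. upvar s (A i)) \<le> upvar s (\<Union>n. A n)" for n using fin order_trans by blast
  then have sm: "summable (\<lambda>n. upvar s (A n))" by (intro summableI_nonneg_bounded upvar_nonneg)
  have "suminf (\<lambda>n. upvar s (A n)) \<le> upvar s (\<Union>n. A n)" by (rule suminf_le_const[OF sm fin'])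
  moreover have "upvar s (\<Union>n. A n) \<le> suminf (\<lambda>n. upvar s (A n))"
  proof (rule upvar_le)
    fix F assume F: "F \<in> sets borelT" "F \<subseteq> (\<Union>n. A n)"
    have "(\<lambda>n. s (F \<inter> A n)) sums s (\<Union>n. F \<inter> A n)"
      using A F by (intro smeas_sums) (auto simp: disjoint_family_on_def)
    moreover have "(\<Union>n. F \<inter> A n) = F" using F by auto
    ultimately have "(\<lambda>n. s (F \<inter> A n)) sums s F" by simp
    then show "s F \<le> suminf (\<lambda>n. upvar s (A n))"
      by (rule sums_le[OF _ _ summable_sums[OF sm], rotated]) (use A F in \<open>auto intro!: upvar_ge\<close>)
  qed
  ultimately show ?thesis using sm by (simp add: sums_iff)
qed

lemma sets_pos_var: "sets (pos_var s) = sets borelT"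
  unfolding pos_var_def by (rule sets.sets_measure_of_eq)

lemma emeasure_pos_var: "E \<in> sets borelT \<Longrightarrow> emeasure (pos_var s) E = ennreal (upvar s E)"
proof -
  assume E: "E \<in> sets borelT"
  have "pos_var s = measure_of (space borelT) (sets borelT) (\<lambda>E. ennreal (upvar s E))"
    by (simp add: pos_var_def upvar_def)
  moreover have "emeasure (measure_of (space borelT) (sets borelT) (\<lambda>E. ennreal (upvar s E))) E = ennreal (upvar s E)"
  proof (rule emeasure_measure_of_sigma[OF sets.sigma_algebra_axioms _ _ E])
    have "upvar s {} \<le> 0" by (rule upvar_le) (simp add: smeas_empty)
    then have "upvar s {} = 0" using upvar_nonneg[of "{}"] by simp
    then show "positive (sets borelT) (\<lambda>E. ennreal (upvar s E))" by (simp add: positive_def)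
    show "countably_additive (sets borelT) (\<lambda>E. ennreal (upvar s E))"
    proof (rule countably_additiveI)
      fix A :: "nat \<Rightarrow> complex set"
      assume A: "range A \<subseteq> sets borelT" "disjoint_family A"
      have "(\<lambda>n. ennreal (upvar s (A n))) sums ennreal (upvar s (\<Union>n. A n))"
        using upvar_sums[of A] A upvar_nonneg by (subst sums_ennreal) auto
      then show "(\<Sum>i. ennreal (upvar s (A i))) = ennreal (upvar s (\<Union>i. A i))" by (simp add: sums_iff)
    qed
  qed
  ultimately show ?thesis by simp
qed

lemma measure_pos_var: "E \<in> sets borelT \<Longrightarrow> measure (pos_var s) E = upvar s E"
  using emeasure_pos_var upvar_nonneg by (simp add: measure_def)

lemma finite_measure_pos_var: "finite_measure (pos_var s)"
  using emeasure_pos_var[of "sphere 0 1"] sets.top[of borelT]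
  by (intro finite_measureI) (simp add: space_eq_sphere[OF sets_pos_var])

end

lemma smeas_uminus: "smeas s \<Longrightarrow> smeas (\<lambda>E. - s E)"
  unfolding smeas_def using cmeasure_diff[OF cmeasure_zero, of "\<lambda>E. of_real (s E)"]
  by (simp add: fun_diff_def)

text \<open>Complementation inside E gives s F = s E + (- s (E - F)); taking suprema over F in both
  directions yields that the positive variation of E equals s E plus the negative one.\<close>

lemma jordan_decomposition:
  assumes s: "smeas s" and E: "E \<in> sets borelT"
  shows "s E = measure (pos_var s) E - measure (neg_var s) E"
proof -
  note s' = smeas_uminus[OF s]
  have C: "s E = s F + s (E - F)" if "F \<in> sets borelT" "F \<subseteq> E" for F
    using smeas_Un[OF s, of F "E - F"] that E by (simp add: Un_absorb1)
  have "upvar s E \<le> s E + upvar (\<lambda>E. - s E) E"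
  proof (rule upvar_le[OF s])
    fix F assume F: "F \<in> sets borelT" "F \<subseteq> E"
    then show "s F \<le> s E + upvar (\<lambda>E. - s E) E"
      using C[OF F] upvar_ge[OF s', of "E - F" E] E by auto
  qed
  moreover have "upvar (\<lambda>E. - s E) E \<le> upvar s E - s E"
  proof (rule upvar_le[OF s'])
    fix F assume F: "F \<in> sets borelT" "F \<subseteq> E"
    then show "- s F \<le> upvar s E - s E"
      using C[OF F] upvar_ge[OF s, of "E - F" E] E by auto
  qed
  ultimately show ?thesis
    unfolding neg_var_def using measure_pos_var[OF s E] measure_pos_var[OF s' E] by simp
qed

lemma smeas_Re: "cmeasure \<mu> \<Longrightarrow> smeas (\<lambda>E. Re (\<mu> E))"
  and smeas_Im: "cmeasure \<mu> \<Longrightarrow> smeas (\<lambda>E. Im (\<mu> E))"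
  unfolding smeas_def cmeasure_def sums_of_real_iff
  by ((intro conjI allI impI sums_Re sums_Im, simp_all)[])+

text \<open>The weights 1, -1, i, -i reproduce the way \<open>cintegral\<close> combines the
  variations, which turns \<open>cintegral\<close> into a \<open>wlist_int\<close>.\<close>

definition jordan :: "(complex set \<Rightarrow> complex) \<Rightarrow> (complex \<times> complex measure) list" where
  "jordan \<mu> = [(1, pos_var (\<lambda>E. Re (\<mu> E))), (-1, neg_var (\<lambda>E. Re (\<mu> E))),
     (\<i>, pos_var (\<lambda>E. Im (\<mu> E))), (-\<i>, neg_var (\<lambda>E. Im (\<mu> E)))]"

lemma wlist_jordan: "cmeasure \<mu> \<Longrightarrow> wlist (jordan \<mu>)"
  unfolding jordan_def neg_var_def
  using smeas_Re[of \<mu>] smeas_Im[of \<mu>] smeas_uminus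
  by (simp add: sets_pos_var finite_measure_pos_var)

lemma wlist_meas_jordan: "cmeasure \<mu> \<Longrightarrow> wlist_meas (jordan \<mu>) = \<mu>"
proof
  fix E assume m: "cmeasure \<mu>"
  show "wlist_meas (jordan \<mu>) E = \<mu> E"
  proof (cases "E \<in> sets borelT")
    case True
    show ?thesis using jordan_decomposition[OF smeas_Re[OF m] True] jordan_decomposition[OF smeas_Im[OF m] True] True
      unfolding jordan_def wlist_meas_def by (simp add: complex_eq_iff)
  next
    case False
    then show ?thesis using m by (simp add: wlist_meas_def cmeasure_def)
  qed
qed

lemma cintegral_jordan: "cintegral \<mu> f = wlist_int (jordan \<mu>) f"
  by (simp add: cintegral_def sintegral_def jordan_def algebra_simps)

text \<open>\<open>L\<close> and the Jordan list of its measure represent the same set function, so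
  \<open>wlist_int_eq\<close> applies. Integrals against densities and against \<open>smu t\<close>
  can thus be computed entry by entry.\<close>

lemma cintegral_wlist_meas:
  assumes L: "wlist L" and f: "f \<in> borel_measurable borelT" "\<And>x. norm x = 1 \<Longrightarrow> norm (f x) \<le> B"
  shows "cintegral (wlist_meas L) f = wlist_int L f"
  unfolding cintegral_jordan
  using cmeasure_wlist_meas[OF L] f L
  by (intro wlist_int_eq[where B=B] wlist_jordan) (auto simp: wlist_meas_jordan)

lemma poisson_meas_wlist_meas:
  assumes L: "wlist L" and z: "z \<in> DD"
  shows "poisson_meas (wlist_meas L) z = wlist_int L (\<lambda>\<zeta>. of_real (poisson_kernel z \<zeta>))"
  unfolding poisson_meas_def
  using z by (intro cintegral_wlist_meas[OF L, where B="2/(1-norm z)\<^sup>2"]) (auto simp: DD_def intro!: poisson_kernel_le)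

section \<open>The total variation norm\<close>

lemma sum_norm_wlist_meas_le:
  assumes L: "wlist L" and I: "finite (I :: nat set)" "\<And>i. i \<in> I \<Longrightarrow> E i \<in> sets borelT" "disjoint_family_on E I"
  shows "(\<Sum>i\<in>I. norm (wlist_meas L (E i))) \<le> wlist_mass L"
  using L
proof (induction L)
  case (Cons p L)
  obtain c M where p: "p = (c, M)" by force
  interpret M: finite_measure M using Cons.prems p by simp
  have s: "sets M = sets borelT" using Cons.prems p by simp
  have "(\<Sum>i\<in>I. measure M (E i)) = measure M (\<Union>i\<in>I. E i)"
    using I s by (subst M.finite_measure_finite_Union) auto
  also have "\<dots> \<le> measure M (sphere 0 1)"
    using M.bounded_measure space_eq_sphere[OF s] by simp
  finally have "norm c * (\<Sum>i\<in>I. measure M (E i)) \<le> norm c * measure M (sphere 0 1)"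
    by (intro mult_left_mono) auto
  moreover have "(\<Sum>i\<in>I. norm (wlist_meas (p # L) (E i))) \<le> (\<Sum>i\<in>I. norm c * measure M (E i) + norm (wlist_meas L (E i)))"
    by (intro sum_mono) (auto simp: p wlist_meas_Cons I norm_mult intro!: norm_triangle_mono)
  ultimately show ?case using Cons p by (simp add: sum.distrib sum_distrib_left)
qed simp

lemma tv_norm_bdd:
  assumes "cmeasure \<mu>"
  shows "bdd_above {(\<Sum>i\<in>I. norm (\<mu> (E i))) | I E. finite (I :: nat set) \<and>
      (\<forall>i\<in>I. E i \<in> sets borelT) \<and> disjoint_family_on E I}"
  using sum_norm_wlist_meas_le[OF wlist_jordan[OF assms]]
  by (intro bdd_aboveI[of _ "wlist_mass (jordan \<mu>)"]) (auto simp: wlist_meas_jordan[OF assms])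

lemma tv_norm_le:
  assumes "\<And>(I :: nat set) E. \<lbrakk>finite I; \<And>i. i \<in> I \<Longrightarrow> E i \<in> sets borelT; disjoint_family_on E I\<rbrakk>
    \<Longrightarrow> (\<Sum>i\<in>I. norm (\<mu> (E i))) \<le> B"
  shows "tv_norm \<mu> \<le> B"
  unfolding tv_norm_def
proof (rule cSup_least)
  show "{(\<Sum>i\<in>I. norm (\<mu> (E i))) | I E. finite (I :: nat set) \<and>
      (\<forall>i\<in>I. E i \<in> sets borelT) \<and> disjoint_family_on E I} \<noteq> {}"
    using exI[of "\<lambda>I. \<exists>E. (0::real) = (\<Sum>i\<in>I. norm (\<mu> (E i))) \<and> finite (I :: nat set) \<and>
      (\<forall>i\<in>I. E i \<in> sets borelT) \<and> disjoint_family_on E I" "{}"] by (auto simp: disjoint_family_on_def)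
qed (use assms in auto)

lemma norm_le_tv_norm:
  assumes "cmeasure \<mu>" "E \<in> sets borelT"
  shows "norm (\<mu> E) \<le> tv_norm \<mu>"
  unfolding tv_norm_def using assms
  by (intro cSup_upper tv_norm_bdd) (auto intro!: exI[of _ "{0::nat}"] exI[of _ "\<lambda>_. E"] simp: disjoint_family_on_def)

lemma tv_norm_wlist_meas_le: "wlist L \<Longrightarrow> tv_norm (wlist_meas L) \<le> wlist_mass L"
  by (rule tv_norm_le) (rule sum_norm_wlist_meas_le)

text \<open>The four variations of the real and imaginary parts are suprema of numbers bounded by
  |mu F|, and each |mu F| is at most the total variation.\<close>

lemma wlist_mass_jordan_le:
  assumes "cmeasure \<mu>"
  shows "wlist_mass (jordan \<mu>) \<le> 4 * tv_norm \<mu>"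
proof -
  have T: "sphere 0 1 \<in> sets borelT" using sets.top[of borelT] by simp
  have "measure (pos_var s) (sphere 0 1) \<le> tv_norm \<mu>" if s: "smeas s" "\<And>F. \<bar>s F\<bar> \<le> norm (\<mu> F)" for s
    unfolding measure_pos_var[OF s(1) T]
  proof (rule upvar_le[OF s(1)])
    fix F assume "F \<in> sets borelT"
    then show "s F \<le> tv_norm \<mu>" using s(2)[of F] norm_le_tv_norm[OF assms, of F] by simp
  qed
  from this[of "\<lambda>E. Re (\<mu> E)"] this[of "\<lambda>E. Im (\<mu> E)"] this[of "\<lambda>E. - Re (\<mu> E)"] this[of "\<lambda>E. - Im (\<mu> E)"]
  show ?thesis using smeas_Re[OF assms] smeas_Im[OF assms] smeas_uminus
    by (simp add: jordan_def neg_var_def abs_Re_le_cmod abs_Im_le_cmod)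
qed

lemma norm_wlist_int_le:
  assumes L: "wlist L" and f: "f \<in> borel_measurable borelT" "\<And>x. norm x = 1 \<Longrightarrow> norm (f x) \<le> B"
  shows "norm (wlist_int L f) \<le> B * wlist_mass L"
  using L
proof (induction L)
  case (Cons p L)
  obtain c M where p: "p = (c, M)" by force
  interpret M: finite_measure M using Cons.prems p by simp
  have s: "sets M = sets borelT" using Cons.prems p by simp
  have i: "integrable M f" using f s by (intro integrable_bounded_borelT) (auto intro: M.finite_measure_axioms)
  have "norm (\<integral>x. f x \<partial>M) \<le> (\<integral>x. norm (f x) \<partial>M)" by (rule integral_norm_bound)
  also have "\<dots> \<le> (\<integral>x. B \<partial>M)" using i f s by (intro integral_mono) (auto simp: space_eq_sphere)
  also have "\<dots> = B * measure M (sphere 0 1)" using space_eq_sphere[OF s] by simp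
  finally have "norm c * norm (\<integral>x. f x \<partial>M) \<le> norm c * (B * measure M (sphere 0 1))" by (intro mult_left_mono) auto
  then show ?case using Cons p norm_triangle_ineq[of "c * (\<integral>x. f x \<partial>M)" "wlist_int L f"]
    by (simp add: norm_mult algebra_simps)
qed simp

text \<open>The 8 is the kernel constant 2 times the 4 of \<open>wlist_mass_jordan_le\<close>.
  Consequence: convergence in total variation implies pointwise convergence of Poisson
  integrals.\<close>

lemma norm_poisson_meas_le:
  assumes m: "cmeasure \<mu>" and z: "z \<in> DD"
  shows "norm (poisson_meas \<mu> z) \<le> 8 / (1 - norm z)\<^sup>2 * tv_norm \<mu>"
proof -
  have "norm (poisson_meas \<mu> z) \<le> 2/(1-norm z)\<^sup>2 * wlist_mass (jordan \<mu>)"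
    unfolding poisson_meas_def cintegral_jordan
    using z by (intro norm_wlist_int_le wlist_jordan m) (auto simp: DD_def intro!: poisson_kernel_le)
  also have "\<dots> \<le> 2/(1-norm z)\<^sup>2 * (4 * tv_norm \<mu>)"
    by (intro mult_left_mono wlist_mass_jordan_le m) auto
  finally show ?thesis by simp
qed

text \<open>The Jordan decomposition is not additive in the measure. The concatenation of the Jordan
  list of mu with the negated one of nu represents mu - nu, and on lists the integral is visibly
  additive.\<close>

lemma poisson_meas_diff:
  assumes m: "cmeasure \<mu>" "cmeasure \<nu>" and z: "z \<in> DD"
  shows "poisson_meas (\<mu> - \<nu>) z = poisson_meas \<mu> z - poisson_meas \<nu> z"
proof -
  let ?L = "jordan \<mu> @ map (\<lambda>(c, M). (-c, M)) (jordan \<nu>)"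
  have w: "wlist ?L" using wlist_jordan[OF m(1)] wlist_jordan[OF m(2)] by (auto simp: wlist_def)
  have "wlist_meas ?L E = \<mu> E - \<nu> E" for E
  proof -
    have "wlist_meas ?L E = wlist_meas (jordan \<mu>) E - wlist_meas (jordan \<nu>) E"
      by (simp add: wlist_meas_def jordan_def)
    then show ?thesis by (simp add: wlist_meas_jordan m)
  qed
  then have "wlist_meas ?L = \<mu> - \<nu>" by auto
  then have "poisson_meas (\<mu> - \<nu>) z = wlist_int ?L (\<lambda>\<zeta>. of_real (poisson_kernel z \<zeta>))"
    using poisson_meas_wlist_meas[OF w z] by simp
  also have "\<dots> = poisson_meas \<mu> z - poisson_meas \<nu> z"
    unfolding poisson_meas_def cintegral_jordan by (simp add: wlist_int_def jordan_def)
  finally show ?thesis .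
qed

section \<open>A strictly increasing function with null range\<close>

definition jump_pt :: "nat \<Rightarrow> real" where "jump_pt = from_nat_into \<rat>"

definition jump_wt :: "nat \<Rightarrow> real" where "jump_wt n = (1/2) ^ Suc n"

text \<open>A pure jump function, with jump of size \<open>jump_wt n\<close> just to the right of the n-th rational.
  The closure of its range is null because the jumps exhaust the total increase.\<close>

definition jumps :: "real \<Rightarrow> real" where
  "jumps x = (\<Sum>n. jump_wt n * of_bool (jump_pt n < x))"

text \<open>The right-hand limit of \<open>jumps\<close> at x, with a possible jump at x counted;
  \<open>jumps\<close> itself is left continuous.\<close>

definition jumps_right :: "real \<Rightarrow> real" where
  "jumps_right x = (\<Sum>n. jump_wt n * of_bool (jump_pt n \<le> x))"

lemma bij_jump_pt: "bij_betw jump_pt UNIV \<rat>"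
  unfolding jump_pt_def by (intro bij_betw_from_nat_into countable_rat Rats_infinite)

lemma jump_wt_sums: "jump_wt sums 1"
  unfolding jump_wt_def by (rule power_half_series)

lemma jump_wt_pos: "0 < jump_wt n"
  by (simp add: jump_wt_def)

lemma summable_jump_wt: "summable jump_wt"
  using jump_wt_sums by (rule sums_summable)

lemma summable_jumps: "summable (\<lambda>n. jump_wt n * of_bool (P n))"
  by (rule summable_comparison_test[OF _ summable_jump_wt]) (auto simp: jump_wt_pos less_imp_le intro!: exI[of _ 0])

lemma jumps_nonneg: "0 \<le> jumps x"
  unfolding jumps_def by (intro suminf_nonneg summable_jumps) (simp add: jump_wt_pos less_imp_le)

lemma jumps_le_1: "jumps x \<le> 1"
  unfolding jumps_def sums_unique[OF jump_wt_sums]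
  by (intro suminf_le summable_jumps summable_jump_wt) (simp add: jump_wt_pos less_imp_le)

text \<open>The n-th term alone contributes its full weight when jump_pt n is passed, and the other
  terms cannot decrease. This gives strict monotonicity and the gaps in the range.\<close>

lemma jumps_gap:
  assumes "x \<le> jump_pt n" "jump_pt n < y"
  shows "jumps x + jump_wt n \<le> jumps y"
proof -
  let ?d = "\<lambda>k. jump_wt k * of_bool (jump_pt k < y) - jump_wt k * of_bool (jump_pt k < x)"
  have "jumps y - jumps x = suminf ?d"
    unfolding jumps_def by (intro suminf_diff summable_jumps)
  moreover have "sum ?d {n} \<le> suminf ?d"
    using assms by (intro sum_le_suminf summable_diff summable_jumps) (auto simp: jump_wt_pos less_imp_le of_bool_def)
  ultimately show ?thesis using assms by simp
qed

lemma jumps_strict_mono: "x < y \<Longrightarrow> jumps x < jumps y"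
proof -
  assume "x < y"
  then obtain q where q: "q \<in> \<rat>" "x < q" "q < y" using Rats_dense_in_real by blast
  then obtain n where "jump_pt n = q" using bij_jump_pt unfolding bij_betw_def by (metis imageE)
  then show ?thesis using jumps_gap[of x n y] jump_wt_pos[of n] q by simp
qed

lemma jumps_mono: "x \<le> y \<Longrightarrow> jumps x \<le> jumps y"
  using jumps_strict_mono[of x y] by (cases "x = y") auto

lemma jumps_eq_iff: "jumps x = jumps y \<longleftrightarrow> x = y"
  using jumps_strict_mono[of x y] jumps_strict_mono[of y x] by (cases x y rule: linorder_cases) auto

lemma jumps_measurable [measurable]: "jumps \<in> borel_measurable borel"
  by (rule borel_measurable_mono) (simp add: mono_def jumps_mono)

definition jump_closure :: "real set" where "jump_closure = closure (range jumps)"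

lemma jump_closure_subset: "jump_closure \<subseteq> {0..1}"
  unfolding jump_closure_def by (rule closure_minimal) (auto simp: jumps_nonneg jumps_le_1)

lemma compact_jump_closure: "compact jump_closure"
proof -
  have "bounded jump_closure" using jump_closure_subset bounded_closed_interval bounded_subset by blast
  then show ?thesis by (simp add: jump_closure_def compact_eq_bounded_closed)
qed

lemma null_jump_closure: "jump_closure \<in> null_sets lborel"
proof -
  \<comment> \<open>The interval skipped by the n-th jump. Being open and disjoint from the range,
    it is disjoint from the closure too; the lengths 1/2, 1/4, ... of these disjoint gaps add up to
    the length of [0,1].\<close>
  define G where "G n = {jumps (jump_pt n)<..<jumps (jump_pt n) + jump_wt n}" for n
  have disj: "G n \<inter> range jumps = {}" for n
  proof -
    have "jumps x \<notin> G n" for x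
    proof (cases "x \<le> jump_pt n")
      case True then show ?thesis using jumps_mono[OF True] by (auto simp: G_def)
    next
      case False
      then show ?thesis using jumps_gap[of "jump_pt n" n x] by (auto simp: G_def)
    qed
    then show ?thesis by auto
  qed
  have "G n \<inter> jump_closure = {}" for n
    using disj[of n] open_Int_closure_eq_empty[of "G n" "range jumps"] by (auto simp: G_def jump_closure_def)
  moreover have G01: "G n \<subseteq> {0..1}" for n
  proof
    fix y assume "y \<in> G n"
    then show "y \<in> {0..1}" using jumps_nonneg[of "jump_pt n"] jumps_gap[of "jump_pt n" n "jump_pt n + 1"]
        jumps_le_1[of "jump_pt n + 1"] by (auto simp: G_def)
  qed
  ultimately have sub: "jump_closure \<subseteq> {0..1} - (\<Union>n. G n)" using jump_closure_subset by auto
  have dG: "disjoint_family G"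
  unfolding disjoint_family_on_def
  proof (intro ballI impI)
    fix m n :: nat assume "m \<noteq> n"
    then have "jump_pt m \<noteq> jump_pt n" using bij_jump_pt by (auto simp: bij_betw_def inj_on_def)
    then consider "jump_pt m < jump_pt n" | "jump_pt n < jump_pt m" by linarith
    then show "G m \<inter> G n = {}"
      using jumps_gap[of "jump_pt m" m "jump_pt n"] jumps_gap[of "jump_pt n" n "jump_pt m"]
      by cases (auto simp: G_def)
  qed
  have "emeasure lborel (\<Union>n. G n) = (\<Sum>n. emeasure lborel (G n))"
    by (rule suminf_emeasure[symmetric]) (auto simp: G_def dG[unfolded G_def])
  also have "\<dots> = (\<Sum>n. ennreal (jump_wt n))" by (simp add: G_def jump_wt_pos less_imp_le)
  also have "\<dots> = ennreal 1" using jump_wt_sums jump_wt_pos less_imp_le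
    by (intro sums_unique[symmetric]) (subst sums_ennreal, auto)
  finally have e: "emeasure lborel (\<Union>n. G n) = 1" by simp
  have "emeasure lborel ({0..1} - (\<Union>n. G n)) = emeasure lborel {0..1::real} - emeasure lborel (\<Union>n. G n)"
    using G01 by (intro emeasure_Diff) (auto simp: e, auto simp: G_def)
  also have "\<dots> = 0" by (simp add: e)
  finally have "{0..1} - (\<Union>n. G n) \<in> null_sets lborel" by (auto simp: null_sets_def, auto simp: G_def)
  moreover have "jump_closure \<in> sets lborel" by (simp add: jump_closure_def)
  ultimately show ?thesis using sub null_sets_subset by blast
qed

text \<open>The weights from index N on add up to exactly (1/2)^N.\<close>

lemma abs_suminf_tail_le:
  assumes "\<And>n. n < N \<Longrightarrow> d n = 0" "\<And>n. \<bar>d n\<bar> \<le> jump_wt n"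
  shows "\<bar>suminf d\<bar> \<le> (1/2) ^ N"
proof -
  have sd: "summable d" by (rule summable_comparison_test[OF _ summable_jump_wt]) (use assms(2) in auto)
  have "suminf d = (\<Sum>n. d (n + N))" using suminf_split_initial_segment[OF sd, of N] assms(1) by simp
  moreover have "(\<lambda>n. jump_wt (n + N)) sums ((1/2) ^ N)"
    using sums_mult[OF jump_wt_sums, of "(1/2) ^ N"] by (simp add: jump_wt_def power_add mult_ac)
  ultimately show ?thesis
    using norm_suminf_le[of "\<lambda>n. d (n + N)" "\<lambda>n. jump_wt (n + N)"] assms(2) by (simp add: sums_iff)
qed

text \<open>The first N jump points other than s keep a positive distance from s. Closer than that,
  the first N terms of \<open>jumps x\<close> agree with those of \<open>jumps s\<close> on the left
  and of \<open>jumps_right s\<close> on the right, and the tail is below eta.\<close>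

lemma jumps_near:
  assumes "0 < \<eta>"
  obtains \<delta> where "0 < \<delta>" "\<And>x. \<bar>x - s\<bar> < \<delta> \<Longrightarrow> \<bar>jumps x - jumps s\<bar> < \<eta> \<or> \<bar>jumps x - jumps_right s\<bar> < \<eta>"
proof -
  obtain N where N: "(1/2) ^ N < \<eta>" using real_arch_pow_inv[OF assms, of "1/2"] by auto
  \<comment> \<open>The element 1 keeps the set nonempty when s is the only jump point among the
    first N, or there is none.\<close>
  define \<delta> where "\<delta> = Min (insert 1 ((\<lambda>n. \<bar>jump_pt n - s\<bar>) ` {n. n < N \<and> jump_pt n \<noteq> s}))"
  have d0: "0 < \<delta>" unfolding \<delta>_def by (subst Min_gr_iff) auto
  have d: "\<delta> \<le> \<bar>jump_pt n - s\<bar>" if "n < N" "jump_pt n \<noteq> s" for n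
    unfolding \<delta>_def using that by (intro Min_le) auto
  have "\<bar>jumps x - jumps s\<bar> < \<eta> \<or> \<bar>jumps x - jumps_right s\<bar> < \<eta>" if x: "\<bar>x - s\<bar> < \<delta>" for x
  proof (cases "x \<le> s")
    case True
    have "\<bar>\<Sum>n. jump_wt n * of_bool (jump_pt n < x) - jump_wt n * of_bool (jump_pt n < s)\<bar> \<le> (1/2) ^ N"
    proof (rule abs_suminf_tail_le)
      fix n assume "n < N"
      then show "jump_wt n * of_bool (jump_pt n < x) - jump_wt n * of_bool (jump_pt n < s) = 0"
        using d[of n] x True by (cases "jump_pt n = s") (auto simp: of_bool_def)
    qed (auto simp: of_bool_def jump_wt_pos less_imp_le)
    then show ?thesis using N unfolding jumps_def by (subst suminf_diff) (auto intro: summable_jumps)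
  next
    case False
    have "\<bar>\<Sum>n. jump_wt n * of_bool (jump_pt n < x) - jump_wt n * of_bool (jump_pt n \<le> s)\<bar> \<le> (1/2) ^ N"
    proof (rule abs_suminf_tail_le)
      fix n assume "n < N"
      then show "jump_wt n * of_bool (jump_pt n < x) - jump_wt n * of_bool (jump_pt n \<le> s) = 0"
        using d[of n] x False by (cases "jump_pt n = s") (auto simp: of_bool_def)
    qed (auto simp: of_bool_def jump_wt_pos less_imp_le)
    then have "\<bar>jumps x - jumps_right s\<bar> \<le> (1/2) ^ N"
      unfolding jumps_def jumps_right_def by (subst suminf_diff) (auto intro: summable_jumps)
    then show ?thesis using N by auto
  qed
  with d0 show ?thesis by (rule that)
qed

section \<open>The singular measures\<close>

definition sgen :: "real \<Rightarrow> complex" where "sgen x = cis (jumps x)"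

text \<open>One closed null set that carries all the measures \<open>smu t\<close>, taken larger
  than their supports so that it is independent of t. Herglotz transforms are analytic on its
  complement, arcs of the circle included.\<close>

definition ssupp :: "complex set" where "ssupp = cis ` jump_closure"

definition smu :: "real \<Rightarrow> complex measure" where
  "smu t = distr (restrict_space lborel {0..t}) borelT sgen"

lemma norm_sgen [simp]: "norm (sgen x) = 1"
  by (simp add: sgen_def)

lemma sgen_ssupp: "sgen x \<in> ssupp"
  unfolding sgen_def ssupp_def jump_closure_def
  by (rule imageI, rule subsetD[OF closure_subset]) simp

lemma compact_ssupp: "compact ssupp"
  unfolding ssupp_def by (intro compact_continuous_image continuous_intros compact_jump_closure)

lemma closed_ssupp: "closed ssupp"
  by (simp add: compact_imp_closed compact_ssupp)

lemma ssupp_subset: "ssupp \<subseteq> sphere 0 1"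
  by (auto simp: ssupp_def)

lemma sets_ssupp: "ssupp \<in> sets borelT"
  using closed_ssupp ssupp_subset by (auto simp: sets_borelT_iff)

lemma null_ssupp: "ssupp \<in> null_sets mT"
  unfolding ssupp_def
proof (intro null_mT_cis_image compact_jump_closure null_jump_closure)
  have "{0..1} \<subseteq> {0..<2*pi}" using pi_gt3 by auto
  then show "jump_closure \<subseteq> {0..<2*pi}" using jump_closure_subset by (rule order_trans[rotated])
qed

lemma AE_not_ssupp: "AE \<zeta> in mT. \<zeta> \<notin> ssupp"
  using null_ssupp by (rule AE_not_in)

text \<open>Values of \<open>jumps\<close> lie in [0,1], within one period of
  \<open>cis\<close>.\<close>

lemma inj_sgen: "sgen x = sgen y \<Longrightarrow> x = y"
proof -
  assume eq: "sgen x = sgen y"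
  have "jumps x < 2*pi" "jumps y < 2*pi" using jumps_le_1[of x] jumps_le_1[of y] pi_gt3 by auto
  then have "jumps x = jumps y"
    using eq Arg2pi_unique[of 1 "jumps x" "sgen x"] Arg2pi_unique[of 1 "jumps y" "sgen x"] jumps_nonneg
    by (simp add: sgen_def cis_conv_exp)
  then show ?thesis by (simp add: jumps_eq_iff)
qed

lemma sgen_measurable: "sgen \<in> measurable borel borelT"
  unfolding sgen_def using measurable_compose[OF jumps_measurable cis_measurable_borelT] .

lemma sgen_measurable': "sgen \<in> measurable (restrict_space lborel {0..t}) borelT"
  by (rule measurable_restrict_space1) (use sgen_measurable in simp)

lemma sets_smu [simp, measurable_cong]: "sets (smu t) = sets borelT"
  by (simp add: smu_def)

lemma space_smu [simp]: "space (smu t) = sphere 0 1"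
  by (simp add: smu_def)

lemma emeasure_smu:
  "A \<in> sets borelT \<Longrightarrow> emeasure (smu t) A = emeasure lborel {x\<in>{0..t}. sgen x \<in> A}"
proof -
  assume A: "A \<in> sets borelT"
  have eq: "sgen -` A \<inter> {0..t} = {x\<in>{0..t}. sgen x \<in> A}" by auto
  have "emeasure (smu t) A = emeasure (restrict_space lborel {0..t}) (sgen -` A \<inter> {0..t})"
    unfolding smu_def by (subst emeasure_distr[OF sgen_measurable' A]) (simp add: space_restrict_space)
  also have "\<dots> = emeasure lborel (sgen -` A \<inter> {0..t})" by (rule emeasure_restrict_space) auto
  finally show ?thesis by (simp only: eq)
qed

lemma emeasure_smu_sphere: "emeasure (smu t) (sphere 0 1) = ennreal t"
proof -
  have "{x\<in>{0..t}. sgen x \<in> sphere 0 1} = {0..t}" by auto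
  then show ?thesis using emeasure_smu[of "sphere 0 1" t] sets.top[of borelT] by (cases "0 \<le> t") (auto simp: ennreal_neg)
qed

global_interpretation smu: finite_measure "smu t"
  by standard (simp add: emeasure_smu_sphere)

lemma measure_smu_sphere: "0 \<le> t \<Longrightarrow> measure (smu t) (sphere 0 1) = t"
  by (simp add: measure_def emeasure_smu_sphere)

lemma measure_smu_ssupp: "0 \<le> t \<Longrightarrow> measure (smu t) ssupp = t"
proof -
  have "{x\<in>{0..t}. sgen x \<in> ssupp} = {0..t}" using sgen_ssupp by auto
  then show "0 \<le> t \<Longrightarrow> measure (smu t) ssupp = t" using emeasure_smu[OF sets_ssupp, of t] by (simp add: measure_def)
qed

lemma AE_smu_ssupp: "AE \<zeta> in smu t. \<zeta> \<in> ssupp"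
proof -
  have "{x \<in> space borelT. x \<in> ssupp} = ssupp" using ssupp_subset by auto
  then show ?thesis unfolding smu_def using sgen_ssupp sets_ssupp
    by (subst AE_distr_iff[OF sgen_measurable']) simp_all
qed

text \<open>Injectivity of \<open>sgen\<close> leaves at most one parameter over each point. The
  absence of atoms is what makes \<open>small_poisson_bump\<close> work.\<close>

lemma measure_smu_singleton: "measure (smu t) {\<omega>} = 0"
proof (cases "norm \<omega> = 1")
  case True
  have "\<exists>y. {x\<in>{0..t}. sgen x \<in> {\<omega>}} \<subseteq> {y}"
    using inj_sgen by (cases "\<exists>y. sgen y = \<omega>") auto
  then have "countable {x\<in>{0..t}. sgen x \<in> {\<omega>}}" by (metis countable_empty countable_insert countable_subset)
  then have "emeasure lborel {x\<in>{0..t}. sgen x \<in> {\<omega>}} = 0" by (rule emeasure_lborel_countable)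
  then show ?thesis using emeasure_smu[of "{\<omega>}" t] True by (simp add: measure_def sets_borelT_iff)
next
  case False
  then have "{\<omega>} \<notin> sets (smu t)" by (auto simp: sets_borelT_iff)
  then show ?thesis by (simp add: measure_notin_sets)
qed

lemma integral_smu:
  fixes f :: "complex \<Rightarrow> 'b :: {banach, second_countable_topology}"
  assumes "f \<in> borel_measurable borelT"
  shows "(\<integral>\<zeta>. f \<zeta> \<partial>smu t) = (\<integral>x. indicator {0..t} x *\<^sub>R f (sgen x) \<partial>lborel)"
  unfolding smu_def using assms sgen_measurable'
  by (subst integral_distr) (auto simp: integral_restrict_space)

text \<open>The difference of the two measures is the image of Lebesgue measure on (s,t], so a bound
  for f is demanded only at the points \<open>sgen x\<close> with x in that interval. This
  localisation is exploited in \<open>herg_diff_le\<close>.\<close>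

lemma integral_smu_diff_le:
  fixes f :: "complex \<Rightarrow> complex"
  assumes f: "f \<in> borel_measurable borelT" and st: "0 \<le> s" "s \<le> t"
    and B: "\<And>x. s < x \<Longrightarrow> x \<le> t \<Longrightarrow> norm (f (sgen x)) \<le> B" "0 \<le> B"
    and int: "integrable (smu s) f"
  shows "norm ((\<integral>\<zeta>. f \<zeta> \<partial>smu t) - (\<integral>\<zeta>. f \<zeta> \<partial>smu s)) \<le> B * (t - s)"
proof -
  have m: "(\<lambda>x. f (sgen x)) \<in> borel_measurable borel" using measurable_compose[OF sgen_measurable f] .
  have "integrable (restrict_space lborel {0..s}) (\<lambda>x. f (sgen x))"
    using int unfolding smu_def by (subst (asm) integrable_distr_eq) (use f sgen_measurable' in auto)
  then have ii: "integrable lborel (\<lambda>x. indicator {0..s} x *\<^sub>R f (sgen x))"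
    by (simp add: integrable_restrict_space)
  have iB: "integrable lborel (\<lambda>x. indicator {s<..t} x * B)"
    using st by (intro integrable_mult_left integrable_real_indicator) auto
  have id: "integrable lborel (\<lambda>x. indicator {s<..t} x *\<^sub>R f (sgen x))"
  proof (rule Bochner_Integration.integrable_bound[OF iB])
  qed (use m B in \<open>auto simp: indicator_def\<close>)
  have "(\<integral>x. indicator {0..t} x *\<^sub>R f (sgen x) \<partial>lborel)
      = (\<integral>x. indicator {0..s} x *\<^sub>R f (sgen x) + indicator {s<..t} x *\<^sub>R f (sgen x) \<partial>lborel)"
    using st by (intro Bochner_Integration.integral_cong refl) (auto simp: indicator_def)
  then have "(\<integral>\<zeta>. f \<zeta> \<partial>smu t) - (\<integral>\<zeta>. f \<zeta> \<partial>smu s) = (\<integral>x. indicator {s<..t} x *\<^sub>R f (sgen x) \<partial>lborel)"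
    using ii id by (simp add: integral_smu[OF f])
  also have "norm \<dots> \<le> (\<integral>x. norm (indicator {s<..t} x *\<^sub>R f (sgen x)) \<partial>lborel)"
    by (rule integral_norm_bound)
  also have "\<dots> \<le> (\<integral>x. indicator {s<..t} x * B \<partial>lborel)"
    by (rule integral_mono[OF integrable_norm[OF id] iB]) (use B in \<open>auto simp: indicator_def\<close>)
  also have "\<dots> = B * (t - s)" using st by simp
  finally show ?thesis .
qed

lemma borel_measurable_smu [simp]: "borel_measurable (smu t) = borel_measurable borelT"
  by (rule measurable_cong_sets) simp_all

lemma borel_measurable_mT [simp]: "borel_measurable mT = borel_measurable borelT"
  by (rule measurable_cong_sets) simp_all

text \<open>The shift by 2 keeps all radii in [1/2, 1).\<close>

definition rad :: "nat \<Rightarrow> real" where "rad n = 1 - 1 / real (n+2)"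

lemma tendsto_rad: "rad \<longlonglongrightarrow> 1"
  unfolding rad_def[abs_def]
  using tendsto_diff[OF tendsto_const LIMSEQ_ignore_initial_segment[OF lim_1_over_n, of 2], of 1] by simp

lemma rad: "0 \<le> rad n" "rad n < 1"
  by (auto simp: rad_def field_simps)

section \<open>The maps\<close>

definition herg :: "real \<Rightarrow> complex \<Rightarrow> complex" where
  "herg t z = (\<integral>\<zeta>. (\<zeta> + z) / (\<zeta> - z) \<partial>smu t)"

text \<open>The solution of (1 + phi) / (1 - phi) = 1 + H for phi; the summand 1 is the Herglotz
  transform of m.\<close>

definition phi :: "real \<Rightarrow> complex \<Rightarrow> complex" where
  "phi t z = herg t z / (2 + herg t z)"

lemma dist_ssupp:
  assumes "z \<notin> ssupp"
  obtains d where "0 < d" "\<And>\<zeta>. \<zeta> \<in> ssupp \<Longrightarrow> d \<le> norm (\<zeta> - z)"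
proof -
  obtain d where "0 < d" "\<forall>y\<in>ssupp. d \<le> dist z y"
    using separate_point_closed[OF closed_ssupp assms] by blast
  then show ?thesis by (intro that[of d]) (auto simp: dist_norm norm_minus_commute)
qed

lemma integrable_smu:
  fixes f :: "complex \<Rightarrow> 'b :: {banach, second_countable_topology}"
  assumes "f \<in> borel_measurable borelT" "\<And>\<zeta>. \<zeta> \<in> ssupp \<Longrightarrow> norm (f \<zeta>) \<le> B"
  shows "integrable (smu t) f"
  using assms AE_smu_ssupp[of t] by (intro smu.integrable_const_bound[where B=B]) (auto elim: eventually_mono)

lemma norm_integral_smu_le:
  fixes f :: "complex \<Rightarrow> 'b :: {banach, second_countable_topology}"
  assumes f: "f \<in> borel_measurable borelT" "\<And>\<zeta>. \<zeta> \<in> ssupp \<Longrightarrow> norm (f \<zeta>) \<le> B" and t: "0 \<le> t"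
  shows "norm (\<integral>\<zeta>. f \<zeta> \<partial>smu t) \<le> B * t"
proof -
  have "norm (\<integral>\<zeta>. f \<zeta> \<partial>smu t) \<le> (\<integral>\<zeta>. norm (f \<zeta>) \<partial>smu t)" by (rule integral_norm_bound)
  also have "\<dots> \<le> (\<integral>\<zeta>. B \<partial>smu t)"
    using integrable_smu[OF f] f AE_smu_ssupp[of t]
    by (intro integral_mono_AE integrable_norm smu.integrable_const) (auto elim: eventually_mono)
  also have "\<dots> = B * t" by (simp add: measure_smu_sphere[OF t])
  finally show ?thesis .
qed

lemma cauchy_kernel_measurable [simp]:
  "(\<lambda>\<zeta>::complex. (\<zeta> + z) / (\<zeta> - z)) \<in> borel_measurable borelT"
  by (rule borel_measurable_borelT) measurable

text \<open>Differentiation under the integral sign, carried out on the whole complement of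
  \<open>ssupp\<close> and not only in the disc: at circle points off \<open>ssupp\<close>, radial
  limits then follow from continuity.\<close>

lemma herg_holomorphic: 
  assumes t: "0 \<le> t"
  shows "herg t holomorphic_on - ssupp"
proof -
  have "herg t field_differentiable (at z)" if z: "z \<notin> ssupp" for z
  proof -
    obtain d where d: "0 < d" "\<And>\<zeta>. \<zeta> \<in> ssupp \<Longrightarrow> d \<le> norm (\<zeta> - z)" using dist_ssupp[OF z] by blast
    have [simp]: "(\<lambda>\<zeta>::complex. 2 * \<zeta> / (\<zeta> - z)\<^sup>2) \<in> borel_measurable borelT"
      by (rule borel_measurable_borelT) measurable
    have nz: "\<zeta> - z \<noteq> 0" "norm \<zeta> = 1" if "\<zeta> \<in> ssupp" for \<zeta>
      using d(1) d(2)[OF that] that ssupp_subset by auto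
    have i2: "integrable (smu t) (\<lambda>\<zeta>. 2 * \<zeta> / (\<zeta> - z)\<^sup>2)"
    proof (rule integrable_smu[where B="2 / d\<^sup>2"])
      fix \<zeta> assume z: "\<zeta> \<in> ssupp"
      show "norm (2 * \<zeta> / (\<zeta> - z)\<^sup>2) \<le> 2 / d\<^sup>2"
        using d(1) d(2)[OF z] nz[OF z] by (auto simp: norm_divide norm_mult norm_power intro!: divide_left_mono power_mono)
    qed simp
    have i1: "integrable (smu t) (\<lambda>\<zeta>. (\<zeta> + w) / (\<zeta> - w))" if w: "norm (w - z) < d / 2" for w
    proof (rule integrable_smu[where B="(1 + norm w) / (d / 2)"])
      fix \<zeta> assume z: "\<zeta> \<in> ssupp"
      have "d / 2 \<le> norm (\<zeta> - w)" using d(2)[OF z] w norm_triangle_ineq[of "\<zeta> - w" "w - z"] by simp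
      then show "norm ((\<zeta> + w) / (\<zeta> - w)) \<le> (1 + norm w) / (d / 2)"
        unfolding norm_divide using d(1) nz[OF z] norm_triangle_ineq[of \<zeta> w] by (intro frac_le) auto
    qed simp
    define D where "D = (\<integral>\<zeta>. 2 * \<zeta> / (\<zeta> - z)\<^sup>2 \<partial>smu t)"
    \<comment> \<open>The error of the difference quotient has integrand 2 zeta (w - z) / ((zeta -
      w) (zeta - z)^2). Here |zeta - w| >= d/2 and |zeta - z| >= d, while the total mass is
      t.\<close>
    have est: "norm ((herg t w - herg t z) / (w - z) - D) \<le> (4 / d ^ 3 * t) * norm (w - z)"
      if w: "norm (w - z) < d / 2" "w \<noteq> z" for w
    proof -
      have "(herg t w - herg t z) / (w - z) - D =
         (\<integral>\<zeta>. ((\<zeta> + w) / (\<zeta> - w) - (\<zeta> + z) / (\<zeta> - z)) / (w - z) - 2 * \<zeta> / (\<zeta> - z)\<^sup>2 \<partial>smu t)"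
      proof -
        have "(\<integral>\<zeta>. ((\<zeta> + w) / (\<zeta> - w) - (\<zeta> + z) / (\<zeta> - z)) / (w - z) - 2 * \<zeta> / (\<zeta> - z)\<^sup>2 \<partial>smu t)
          = (\<integral>\<zeta>. ((\<zeta> + w) / (\<zeta> - w) - (\<zeta> + z) / (\<zeta> - z)) / (w - z) \<partial>smu t) - D"
          unfolding D_def using i1[OF w(1)] i1[of z] i2 d(1)
          by (intro Bochner_Integration.integral_diff integrable_divide_zero Bochner_Integration.integrable_diff) auto
        also have "(\<integral>\<zeta>. ((\<zeta> + w) / (\<zeta> - w) - (\<zeta> + z) / (\<zeta> - z)) / (w - z) \<partial>smu t)
          = (\<integral>\<zeta>. (\<zeta> + w) / (\<zeta> - w) - (\<zeta> + z) / (\<zeta> - z) \<partial>smu t) / (w - z)"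
          by (rule integral_divide_zero)
        also have "(\<integral>\<zeta>. (\<zeta> + w) / (\<zeta> - w) - (\<zeta> + z) / (\<zeta> - z) \<partial>smu t) = herg t w - herg t z"
          unfolding herg_def using i1[OF w(1)] i1[of z] d(1) by (intro Bochner_Integration.integral_diff) auto
        finally show ?thesis by simp
      qed
      also have "norm \<dots> \<le> (4 / d ^ 3 * norm (w - z)) * t"
      proof (rule norm_integral_smu_le[OF _ _ t])
        show "(\<lambda>\<zeta>. ((\<zeta> + w) / (\<zeta> - w) - (\<zeta> + z) / (\<zeta> - z)) / (w - z) - 2 * \<zeta> / (\<zeta> - z)\<^sup>2) \<in> borel_measurable borelT"
          by (rule borel_measurable_borelT) measurable
        fix \<zeta> assume z: "\<zeta> \<in> ssupp"
        have dw: "d / 2 \<le> norm (\<zeta> - w)" using d(2)[OF z] w norm_triangle_ineq[of "\<zeta> - w" "w - z"] by simp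
        then have nw: "\<zeta> - w \<noteq> 0" using d(1) by auto
        have "((\<zeta> + w) / (\<zeta> - w) - (\<zeta> + z) / (\<zeta> - z)) / (w - z) = 2 * \<zeta> / ((\<zeta> - w) * (\<zeta> - z))"
          using nw nz[OF z] w(2) by (simp add: divide_simps, simp add: algebra_simps)
        also have "\<dots> - 2 * \<zeta> / (\<zeta> - z)\<^sup>2 = 2 * \<zeta> * (w - z) / ((\<zeta> - w) * (\<zeta> - z)\<^sup>2)"
          using nw nz[OF z] by (simp add: divide_simps power2_eq_square, simp add: algebra_simps)
        finally have "norm (((\<zeta> + w) / (\<zeta> - w) - (\<zeta> + z) / (\<zeta> - z)) / (w - z) - 2 * \<zeta> / (\<zeta> - z)\<^sup>2)
           = 2 * norm (w - z) / (norm (\<zeta> - w) * (norm (\<zeta> - z))\<^sup>2)"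
          using nz[OF z] by (simp add: norm_divide norm_mult norm_power)
        also have "\<dots> \<le> 2 * norm (w - z) / (d / 2 * d\<^sup>2)"
          using d(1) d(2)[OF z] dw by (intro divide_left_mono mult_mono power_mono mult_pos_pos) auto
        also have "\<dots> = 4 / d ^ 3 * norm (w - z)" by (simp add: power2_eq_square power3_eq_cube)
        finally show "norm (((\<zeta> + w) / (\<zeta> - w) - (\<zeta> + z) / (\<zeta> - z)) / (w - z) - 2 * \<zeta> / (\<zeta> - z)\<^sup>2)
          \<le> 4 / d ^ 3 * norm (w - z)" .
      qed
      finally show ?thesis by (simp add: mult_ac)
    qed
    have "((\<lambda>w. (herg t w - herg t z) / (w - z) - D) \<longlongrightarrow> 0) (at z)"
    proof (rule Lim_null_comparison)
      show "\<forall>\<^sub>F w in at z. norm ((herg t w - herg t z) / (w - z) - D) \<le> (4 / d ^ 3 * t) * norm (w - z)"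
        unfolding eventually_at using d(1) est by (intro exI[of _ "d/2"]) (auto simp: dist_norm)
      have "((\<lambda>w. (4 / d ^ 3 * t) * norm (w - z)) \<longlongrightarrow> (4 / d ^ 3 * t) * norm (z - z)) (at z)"
        by (intro tendsto_intros)
      then show "((\<lambda>w. (4 / d ^ 3 * t) * norm (w - z)) \<longlongrightarrow> 0) (at z)" by simp
    qed
    then have "((\<lambda>w. (herg t w - herg t z) / (w - z)) \<longlongrightarrow> D) (at z)" by (rule LIM_zero_cancel)
    then have "(herg t has_field_derivative D) (at z)" by (simp add: has_field_derivative_iff)
    then show ?thesis by (auto simp: field_differentiable_def)
  qed
  then show ?thesis unfolding holomorphic_on_def
    by (auto intro: field_differentiable_at_within)
qed

text \<open>Measurability on the whole plane includes \<open>ssupp\<close>, where the integral may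
  fail to exist and takes its default value; later product-measurability arguments can therefore use
  \<open>phi t\<close> without removing a null set.\<close>

lemma herg_measurable [measurable]: "herg t \<in> borel_measurable borel"
proof -
  have "(\<lambda>p::complex \<times> complex. (snd p + fst p) / (snd p - fst p)) \<in> borel_measurable (borel \<Otimes>\<^sub>M borel)"
    by measurable
  moreover have "(\<lambda>p. (fst p, snd p)) \<in> measurable (borel \<Otimes>\<^sub>M smu t) (borel \<Otimes>\<^sub>M (borel :: complex measure))"
  proof (rule measurable_Pair)
    show "snd \<in> measurable (borel \<Otimes>\<^sub>M smu t) (borel :: complex measure)"
      using measurable_compose[OF measurable_snd[of borel "smu t"], of "\<lambda>x. x" borel] measurable_id_borelT
        measurable_cong_sets[OF sets_smu refl, of t "borel :: complex measure"] by simp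
  qed simp
  from measurable_compose[OF this calculation]
  have "(\<lambda>p. (snd p + fst p) / (snd p - fst p)) \<in> borel_measurable (borel \<Otimes>\<^sub>M smu t)" by simp
  then have "(\<lambda>z. \<integral>\<zeta>. (\<zeta> + z) / (\<zeta> - z) \<partial>smu t) \<in> borel_measurable borel"
    by (intro smu.borel_measurable_lebesgue_integral) (simp add: case_prod_unfold)
  then show ?thesis by (simp add: herg_def[abs_def])
qed

lemma phi_measurable [measurable]: "phi t \<in> borel_measurable borel"
  unfolding phi_def[abs_def] by measurable

lemma DD_not_ssupp: "z \<in> DD \<Longrightarrow> z \<notin> ssupp"
  using ssupp_subset by (auto simp: DD_def)

lemma Re_herg:
  assumes z: "z \<notin> ssupp"
  shows "Re (herg t z) = (\<integral>\<zeta>. poisson_kernel z \<zeta> \<partial>smu t)"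
proof -
  obtain d where d: "0 < d" "\<And>\<zeta>. \<zeta> \<in> ssupp \<Longrightarrow> d \<le> norm (\<zeta> - z)" using dist_ssupp[OF z] by blast
  have "integrable (smu t) (\<lambda>\<zeta>. (\<zeta> + z) / (\<zeta> - z))"
  proof (rule integrable_smu[where B="(1 + norm z) / d"])
    fix \<zeta> assume s: "\<zeta> \<in> ssupp"
    then have "norm \<zeta> = 1" using ssupp_subset by auto
    then show "norm ((\<zeta> + z) / (\<zeta> - z)) \<le> (1 + norm z) / d"
      using d(1) d(2)[OF s] norm_triangle_ineq[of \<zeta> z] by (auto simp: norm_divide intro!: frac_le)
  qed simp
  then have "Re (herg t z) = (\<integral>\<zeta>. Re ((\<zeta> + z) / (\<zeta> - z)) \<partial>smu t)"
    unfolding herg_def by (rule integral_Re[symmetric])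
  also have "\<dots> = (\<integral>\<zeta>. poisson_kernel z \<zeta> \<partial>smu t)"
    by (intro Bochner_Integration.integral_cong refl) (simp add: poisson_kernel_Re)
  finally show ?thesis .
qed

lemma Re_herg_nonneg: "z \<notin> ssupp \<Longrightarrow> norm z \<le> 1 \<Longrightarrow> 0 \<le> Re (herg t z)"
  by (subst Re_herg) simp_all

text \<open>The Poisson kernel of a point of the circle vanishes. Hence \<open>phi t\<close> sends
  almost every point of the circle to the horocycle P_w(1) = 1.\<close>

lemma Re_herg_sphere: "z \<notin> ssupp \<Longrightarrow> norm z = 1 \<Longrightarrow> Re (herg t z) = 0"
proof -
  assume z: "z \<notin> ssupp" "norm z = 1"
  have "poisson_kernel z = (\<lambda>_. 0)" using z by (intro ext) (simp add: poisson_kernel_def)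
  then show ?thesis using Re_herg[OF z(1)] by simp
qed

lemma herg_plus_2: "z \<notin> ssupp \<Longrightarrow> norm z \<le> 1 \<Longrightarrow> 2 + herg t z \<noteq> 0"
  using Re_herg_nonneg[of z t] by (auto simp: complex_eq_iff)

text \<open>|2 + H|^2 - |H|^2 = 4 (1 + Re H) is positive. Strictness also on the circle off
  \<open>ssupp\<close> is essential: Poisson integrals can be evaluated at \<open>phi t\<close> of
  almost every boundary point.\<close>

lemma norm_phi: "z \<notin> ssupp \<Longrightarrow> norm z \<le> 1 \<Longrightarrow> norm (phi t z) < 1"
proof -
  assume z: "z \<notin> ssupp" "norm z \<le> 1"
  have "(norm (herg t z))\<^sup>2 < (norm (2 + herg t z))\<^sup>2"
    using Re_herg_nonneg[OF z, of t] unfolding cmod_power2 by (simp add: power2_eq_square algebra_simps)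
  then have "norm (herg t z) < norm (2 + herg t z)" by (rule power_less_imp_less_base) simp
  then show ?thesis using herg_plus_2[OF z, of t] by (simp add: phi_def norm_divide)
qed

lemma phi_holomorphic: "0 \<le> t \<Longrightarrow> phi t holomorphic_on DD"
  unfolding phi_def[abs_def] using herg_plus_2 DD_not_ssupp
  by (intro holomorphic_intros holomorphic_on_subset[OF herg_holomorphic]) (auto simp: DD_def)

lemma phi_selfmap: "0 \<le> t \<Longrightarrow> analytic_selfmap (phi t)"
  using phi_holomorphic norm_phi DD_not_ssupp by (auto simp: analytic_selfmap_def DD_def)

lemma phi_DD: "z \<notin> ssupp \<Longrightarrow> norm z \<le> 1 \<Longrightarrow> phi t z \<in> DD"
  using norm_phi by (simp add: DD_def)

lemma herg_0: "0 \<le> t \<Longrightarrow> herg t 0 = of_real t"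
proof -
  assume t: "0 \<le> t"
  have "herg t 0 = (\<integral>\<zeta>. 1 \<partial>smu t)"
    unfolding herg_def by (intro Bochner_Integration.integral_cong refl) auto
  then show ?thesis by (simp add: measure_smu_sphere[OF t] scaleR_conv_of_real)
qed

lemma smu_0_herg: "herg 0 z = 0"
proof -
  have "AE x in smu 0. (x + z) / (x - z) = 0"
    using emeasure_smu_sphere[of 0] by (auto simp: eventually_ae_filter null_sets_def intro!: exI[of _ "sphere 0 1"] sets.top[of borelT, simplified])
  then have "(\<integral>\<zeta>. (\<zeta> + z) / (\<zeta> - z) \<partial>smu 0) = (\<integral>\<zeta>. 0 \<partial>smu 0)"
    by (intro integral_cong_AE) auto
  then show ?thesis by (simp add: herg_def)
qed

lemma phi_0: "phi 0 z = 0"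
  by (simp add: phi_def smu_0_herg)

text \<open>Numerator and denominator of the kernel both carry |2 + H|^2, which cancels. All
  estimates in alpha start from this formula.\<close>

lemma poisson_kernel_phi:
  assumes z: "z \<notin> ssupp" "norm z \<le> 1"
  shows "poisson_kernel (phi t z) \<alpha> = 4 * (1 + Re (herg t z)) / (norm (2 * \<alpha> + herg t z * (\<alpha> - 1)))\<^sup>2"
proof -
  let ?H = "herg t z"
  have n: "2 + ?H \<noteq> 0" using herg_plus_2[OF z] .
  have "1 - (norm (phi t z))\<^sup>2 = ((norm (2 + ?H))\<^sup>2 - (norm ?H)\<^sup>2) / (norm (2 + ?H))\<^sup>2"
    using n by (simp add: phi_def norm_divide power_divide diff_divide_distrib)
  also have "(norm (2 + ?H))\<^sup>2 - (norm ?H)\<^sup>2 = 4 * (1 + Re ?H)"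
    unfolding cmod_power2 by (simp add: power2_eq_square algebra_simps)
  finally have 1: "1 - (norm (phi t z))\<^sup>2 = 4 * (1 + Re ?H) / (norm (2 + ?H))\<^sup>2" .
  have "\<alpha> - phi t z = (2 * \<alpha> + ?H * (\<alpha> - 1)) / (2 + ?H)"
    using n by (simp add: phi_def field_simps)
  then have 2: "(norm (\<alpha> - phi t z))\<^sup>2 = (norm (2 * \<alpha> + ?H * (\<alpha> - 1)))\<^sup>2 / (norm (2 + ?H))\<^sup>2"
    by (simp add: norm_divide power_divide)
  show ?thesis unfolding poisson_kernel_def 1 2 using n by simp
qed

lemma poisson_kernel_phi_1:
  assumes z: "z \<notin> ssupp" "norm z \<le> 1"
  shows "poisson_kernel (phi t z) 1 = 1 + Re (herg t z)"
  using poisson_kernel_phi[OF z, of t 1] by simp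

text \<open>On the circle 2 alpha / (alpha - 1) has real part 1, so its sum with h has real part,
  hence modulus at least, 1 + Re h.\<close>

lemma norm_phi_denominator_ge:
  assumes a: "norm \<alpha> = 1" and h: "0 \<le> Re h"
  shows "norm (\<alpha> - 1) * (1 + Re h) \<le> norm (2 * \<alpha> + h * (\<alpha> - 1))"
proof (cases "\<alpha> = 1")
  case False
  have ab: "(Re \<alpha>)\<^sup>2 + (Im \<alpha>)\<^sup>2 = 1" using a by (simp add: cmod_def)
  have "Re (2 * \<alpha>) * Re (\<alpha> - 1) + Im (2 * \<alpha>) * Im (\<alpha> - 1) = (Re (\<alpha> - 1))\<^sup>2 + (Im (\<alpha> - 1))\<^sup>2"
    using ab by (simp add: power2_eq_square algebra_simps)
  moreover have "(Re (\<alpha> - 1))\<^sup>2 + (Im (\<alpha> - 1))\<^sup>2 \<noteq> 0"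
    using False by (metis cmod_power2 power_not_zero norm_eq_zero eq_iff_diff_eq_0)
  ultimately have "Re (2 * \<alpha> / (\<alpha> - 1)) = 1"
    by (simp add: Re_divide add_divide_distrib[symmetric])
  then have "1 + Re h = Re (2 * \<alpha> / (\<alpha> - 1) + h)" by simp
  also have "\<dots> \<le> norm (2 * \<alpha> / (\<alpha> - 1) + h)" by (rule complex_Re_le_cmod)
  finally have "norm (\<alpha> - 1) * (1 + Re h) \<le> norm (\<alpha> - 1) * norm (2 * \<alpha> / (\<alpha> - 1) + h)"
    by (intro mult_left_mono) auto
  also have "\<dots> = norm (2 * \<alpha> + h * (\<alpha> - 1))"
  proof -
    have "(\<alpha> - 1) * (2 * \<alpha> / (\<alpha> - 1) + h) = 2 * \<alpha> + h * (\<alpha> - 1)"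
      using False by (simp add: distrib_left)
    then show ?thesis by (metis norm_mult)
  qed
  finally show ?thesis .
qed simp

text \<open>Uniform in t and z: one factor 1 + Re H >= 1 of the squared denominator cancels the
  numerator, and the other is dropped. This is the dominating function away from alpha = 1.\<close>

lemma poisson_kernel_phi_le:
  assumes z: "z \<notin> ssupp" "norm z \<le> 1" and a: "norm \<alpha> = 1" "\<alpha> \<noteq> 1"
  shows "poisson_kernel (phi t z) \<alpha> \<le> 4 / (norm (\<alpha> - 1))\<^sup>2"
proof -
  let ?R = "1 + Re (herg t z)"
  have R: "1 \<le> ?R" using Re_herg_nonneg[OF z] by simp
  have "poisson_kernel (phi t z) \<alpha> \<le> 4 * ?R / (norm (\<alpha> - 1) * ?R)\<^sup>2"
    unfolding poisson_kernel_phi[OF z]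
    using norm_phi_denominator_ge[OF a(1), of "herg t z"] R a(2) 
    by (intro divide_left_mono power_mono mult_pos_pos zero_less_power) 
       (auto intro!: mult_nonneg_nonneg, smt (verit) zero_less_norm_iff norm_zero right_minus_eq mult_pos_pos)
  also have "\<dots> = 4 / (norm (\<alpha> - 1))\<^sup>2 / ?R"
  proof -
    have "4 * R / (a * R)\<^sup>2 = 4 / a\<^sup>2 / R" if "R \<noteq> 0" for a R :: real
      using that by (simp add: power2_eq_square field_simps)
    from this[of ?R "norm (\<alpha> - 1)"] show ?thesis using R by linarith
  qed
  also have "\<dots> \<le> 4 / (norm (\<alpha> - 1))\<^sup>2 / 1" using R by (intro divide_left_mono) auto
  finally show ?thesis by simp
qed

lemma phi_at_0: "0 \<le> t \<Longrightarrow> phi t 0 = of_real (t / (2 + t))"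
  by (simp add: phi_def herg_0)

text \<open>phi t 0 = t / (2 + t) is at most 1/3, and 2 / (1 - 1/3)^2 = 9/2.\<close>

lemma poisson_kernel_phi_0_le:
  assumes t: "0 \<le> t" "t \<le> 1" and a: "norm \<alpha> = 1"
  shows "poisson_kernel (phi t 0) \<alpha> \<le> 5"
proof -
  have "norm (phi t 0) \<le> 1/3"
    unfolding phi_at_0[OF t(1)] norm_of_real using t by (simp add: field_simps)
  then have "poisson_kernel (phi t 0) \<alpha> \<le> 2 / (1 - 1/3)\<^sup>2" using a by (intro poisson_kernel_le) auto
  then show ?thesis by (simp add: power2_eq_square)
qed

lemma phi_radial_limit:
  assumes t: "0 \<le> t" and z: "z \<notin> ssupp" "norm z \<le> 1"
  shows "(\<lambda>n. phi t (of_real (rad n) * z)) \<longlonglongrightarrow> phi t z"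
proof -
  have "(\<lambda>n. complex_of_real (rad n) * z) \<longlonglongrightarrow> of_real 1 * z"
    by (intro tendsto_intros tendsto_rad)
  moreover have "isCont (herg t) z"
    using holomorphic_on_imp_continuous_on[OF herg_holomorphic[OF t]] closed_ssupp z(1)
    by (simp add: continuous_on_eq_continuous_at open_Compl)
  ultimately have "(\<lambda>n. herg t (of_real (rad n) * z)) \<longlonglongrightarrow> herg t z"
    using isCont_tendsto_compose by fastforce
  then show ?thesis unfolding phi_def using herg_plus_2[OF z] by (intro tendsto_intros) auto
qed

text \<open>The kernel \<open>poisson_kernel (phi t \<zeta>) \<alpha>\<close> is the density of the Aleksandrov--Clark measure of \<open>phi t\<close>
  at \<open>\<alpha>\<close>; for \<open>\<alpha> = 1\<close> that measure has the additional singular part \<open>smu t\<close>.\<close>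

lemma poisson_phi_kernel:
  assumes t: "0 \<le> t" and z: "z \<in> DD" and a: "norm \<alpha> = 1" "\<alpha> \<noteq> 1"
  shows "(\<integral>\<zeta>. poisson_kernel z \<zeta> * poisson_kernel (phi t \<zeta>) \<alpha> \<partial>mT) = poisson_kernel (phi t z) \<alpha>"
proof -
  have rD: "of_real (rad n) * \<zeta> \<notin> ssupp" "norm (of_real (rad n) * \<zeta>) \<le> 1" if "norm \<zeta> \<le> 1" for n \<zeta>
    using of_real_mult_DD[OF rad that, of n] DD_not_ssupp by (auto simp: DD_def intro: less_imp_le)
  have ph: "(\<lambda>\<zeta>. phi t (of_real (rad n) * \<zeta>)) \<in> borel_measurable borel" for n by measurable
  have "(\<lambda>n. \<integral>\<zeta>. poisson_kernel z \<zeta> * poisson_kernel (phi t (of_real (rad n) * \<zeta>)) \<alpha> \<partial>mT) \<longlonglongrightarrow>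
     (\<integral>\<zeta>. poisson_kernel z \<zeta> * poisson_kernel (phi t \<zeta>) \<alpha> \<partial>mT)"
  \<comment> \<open>On each circle of radius \<open>rad n\<close> the identity is exact by
    \<open>poisson_kernel_selfmap\<close>. For alpha different from 1 the bound 4 / |alpha - 1|^2
    lets the radius tend to 1 without loss of mass.\<close>
  proof (rule integral_dominated_convergence[where w="\<lambda>\<zeta>. poisson_kernel z \<zeta> * (4 / (norm (\<alpha> - 1))\<^sup>2)"])
    show "(\<lambda>\<zeta>. poisson_kernel z \<zeta> * poisson_kernel (phi t \<zeta>) \<alpha>) \<in> borel_measurable mT"
      "(\<lambda>\<zeta>. poisson_kernel z \<zeta> * poisson_kernel (phi t (of_real (rad n) * \<zeta>)) \<alpha>) \<in> borel_measurable mT" for n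
      using ph by (simp_all add: measurable_cong_sets[OF sets_mT refl] borel_measurable_borelT)
    show "integrable mT (\<lambda>\<zeta>. poisson_kernel z \<zeta> * (4 / (norm (\<alpha> - 1))\<^sup>2))"
      using integrable_poisson_kernel[OF z] by simp
    show "AE \<zeta> in mT. (\<lambda>n. poisson_kernel z \<zeta> * poisson_kernel (phi t (of_real (rad n) * \<zeta>)) \<alpha>)
         \<longlonglongrightarrow> poisson_kernel z \<zeta> * poisson_kernel (phi t \<zeta>) \<alpha>"
      using AE_not_ssupp AE_space[of mT]
    proof eventually_elim
      case (elim \<zeta>)
      then have "norm (phi t \<zeta>) < 1" by (intro norm_phi) auto
      then have "phi t \<zeta> \<noteq> \<alpha>" using a by auto
      then show ?case using phi_radial_limit[OF t, of \<zeta>] elim by (intro tendsto_intros) (auto)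
    qed
    fix n
    show "AE \<zeta> in mT. norm (poisson_kernel z \<zeta> * poisson_kernel (phi t (of_real (rad n) * \<zeta>)) \<alpha>)
       \<le> poisson_kernel z \<zeta> * (4 / (norm (\<alpha> - 1))\<^sup>2)"
      using AE_space[of mT]
    proof eventually_elim
      case (elim \<zeta>)
      then have n: "norm \<zeta> \<le> 1" by simp
      have "0 \<le> poisson_kernel (phi t (of_real (rad n) * \<zeta>)) \<alpha>"
        using norm_phi[OF rD[OF n]] by (intro poisson_kernel_nonneg) (simp add: less_imp_le)
      moreover have "0 \<le> poisson_kernel z \<zeta>" using z by (simp add: DD_def)
      moreover have "poisson_kernel z \<zeta> * poisson_kernel (phi t (of_real (rad n) * \<zeta>)) \<alpha>
          \<le> poisson_kernel z \<zeta> * (4 / (norm (\<alpha> - 1))\<^sup>2)"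
        using \<open>0 \<le> poisson_kernel z \<zeta>\<close> by (intro mult_left_mono poisson_kernel_phi_le rD n a)
      ultimately show ?case by (simp add: abs_mult)
    qed
  qed
  moreover have "(\<integral>\<zeta>. poisson_kernel z \<zeta> * poisson_kernel (phi t (of_real (rad n) * \<zeta>)) \<alpha> \<partial>mT)
      = poisson_kernel (phi t (of_real (rad n) * z)) \<alpha>" for n
    by (rule poisson_kernel_selfmap[OF phi_selfmap[OF t] a(1) rad z])
  moreover have "(\<lambda>n. poisson_kernel (phi t (of_real (rad n) * z)) \<alpha>) \<longlonglongrightarrow> poisson_kernel (phi t z) \<alpha>"
  proof -
    have "norm (phi t z) < 1" using z by (intro norm_phi DD_not_ssupp) (auto simp: DD_def)
    then have "phi t z \<noteq> \<alpha>" using a by auto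
    then show ?thesis using phi_radial_limit[OF t, of z] z DD_not_ssupp[OF z]
      by (intro tendsto_intros) (auto simp: DD_def)
  qed
  ultimately show ?thesis using LIMSEQ_unique by simp
qed

text \<open>At alpha = 1 the boundary kernel is 1 almost everywhere, so its Poisson integral is 1
  and misses exactly the Poisson integral of \<open>smu t\<close>: the singular part.\<close>

lemma poisson_phi_kernel_1:
  assumes z: "z \<in> DD"
  shows "(\<integral>\<zeta>. poisson_kernel z \<zeta> * poisson_kernel (phi t \<zeta>) 1 \<partial>mT) = 1"
    and "poisson_kernel (phi t z) 1 = 1 + (\<integral>\<zeta>. poisson_kernel z \<zeta> \<partial>smu t)"
proof -
  have "(\<integral>\<zeta>. poisson_kernel z \<zeta> * poisson_kernel (phi t \<zeta>) 1 \<partial>mT) = (\<integral>\<zeta>. poisson_kernel z \<zeta> \<partial>mT)"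
  proof (rule integral_cong_AE)
    show "AE \<zeta> in mT. poisson_kernel z \<zeta> * poisson_kernel (phi t \<zeta>) 1 = poisson_kernel z \<zeta>"
      using AE_not_ssupp AE_space[of mT]
      by eventually_elim (simp add: poisson_kernel_phi_1 Re_herg_sphere)
  qed (simp_all add: measurable_cong_sets[OF sets_mT refl] borel_measurable_borelT)
  then show "(\<integral>\<zeta>. poisson_kernel z \<zeta> * poisson_kernel (phi t \<zeta>) 1 \<partial>mT) = 1"
    by (simp add: integral_poisson_kernel[OF z])
  show "poisson_kernel (phi t z) 1 = 1 + (\<integral>\<zeta>. poisson_kernel z \<zeta> \<partial>smu t)"
    using z DD_not_ssupp[OF z] by (simp add: poisson_kernel_phi_1 Re_herg DD_def)
qed

lemma norm_integral_le_integral: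
  fixes f :: "'a \<Rightarrow> 'b :: {banach, second_countable_topology}"
  assumes "integrable M f" "integrable M g" "\<And>x. x \<in> space M \<Longrightarrow> norm (f x) \<le> g x"
  shows "norm (\<integral>x. f x \<partial>M) \<le> (\<integral>x. g x \<partial>M)"
  by (rule order_trans[OF integral_norm_bound integral_mono]) (use assms in auto)

section \<open>Uniqueness of Poisson integrals\<close>

lemma continuous_imp_measurable_borelT:
  fixes f :: "complex \<Rightarrow> 'b :: topological_space"
  shows "continuous_on (sphere 0 1) f \<Longrightarrow> f \<in> borel_measurable borelT"
  unfolding borelT_def by (rule borel_measurable_continuous_on_restrict)

lemma continuous_bounded_sphere:
  fixes f :: "complex \<Rightarrow> 'b :: real_normed_vector"
  assumes "continuous_on (sphere 0 1) f"
  obtains B where "0 < B" "\<And>\<zeta>. norm \<zeta> = 1 \<Longrightarrow> norm (f \<zeta>) \<le> B"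
proof -
  have "bounded (f ` sphere 0 1)"
    using assms by (intro compact_imp_bounded compact_continuous_image) auto
  then obtain B where "0 < B" "\<And>y. y \<in> f ` sphere 0 1 \<Longrightarrow> norm y \<le> B"
    using bounded_pos[of "f ` sphere 0 1"] by blast
  then show ?thesis by (intro that[of B]) auto
qed

text \<open>Since |r zeta - zeta| = 1 - r <= |eta - r zeta|, one has |eta - zeta| <= 2 |eta - r
  zeta|. The right side tends to 0 as r -> 1, a quantitative approximate identity.\<close>

lemma poisson_kernel_mult_dist_le:
  assumes r: "0 \<le> r" "r < 1" and z: "norm \<zeta> = 1" "norm \<eta> = 1"
  shows "poisson_kernel (of_real r * \<zeta>) \<eta> * (norm (\<eta> - \<zeta>))\<^sup>2 \<le> 4 * (1 - r\<^sup>2)"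
proof -
  let ?w = "of_real r * \<zeta>"
  have nw: "norm ?w = r" using r z by (simp add: norm_mult)
  have 1: "1 - r \<le> norm (\<eta> - ?w)" using norm_triangle_ineq2[of \<eta> ?w] nw z by simp
  then have p: "0 < norm (\<eta> - ?w)" using r by linarith
  have e: "?w - \<zeta> = of_real (r - 1) * \<zeta>" by (simp add: algebra_simps)
  have "norm (?w - \<zeta>) = 1 - r" unfolding e norm_mult norm_of_real using z r by simp
  then have "norm (\<eta> - \<zeta>) \<le> 2 * norm (\<eta> - ?w)" using norm_triangle_ineq[of "\<eta> - ?w" "?w - \<zeta>"] 1 by simp
  then have "(norm (\<eta> - \<zeta>))\<^sup>2 \<le> (2 * norm (\<eta> - ?w))\<^sup>2" by (intro power_mono) auto
  then have "(1 - r\<^sup>2) * (norm (\<eta> - \<zeta>))\<^sup>2 \<le> (1 - r\<^sup>2) * (4 * (norm (\<eta> - ?w))\<^sup>2)"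
    using r by (intro mult_left_mono) (auto simp: power_mult_distrib power_le_one)
  moreover have "a / y * x \<le> 4 * a" if "a * x \<le> a * (4 * y)" "0 < y" for a x y :: real
    using that by (simp add: field_simps)
  ultimately show ?thesis using p unfolding poisson_kernel_def nw by (meson zero_less_power)
qed

lemma poisson_approx:
  fixes \<psi> :: "complex \<Rightarrow> real"
  assumes c: "continuous_on (sphere 0 1) \<psi>" and z: "norm \<zeta> = 1"
  shows "(\<lambda>n. \<integral>\<eta>. poisson_kernel (of_real (rad n) * \<zeta>) \<eta> * \<psi> \<eta> \<partial>mT) \<longlonglongrightarrow> \<psi> \<zeta>"
proof (rule LIMSEQ_I)
  fix e :: real assume e: "0 < e"
  obtain B where B: "0 < B" "\<And>\<eta>. norm \<eta> = 1 \<Longrightarrow> norm (\<psi> \<eta>) \<le> B" using continuous_bounded_sphere[OF c] by blast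
  obtain d where d: "0 < d" "\<And>\<eta>. norm \<eta> = 1 \<Longrightarrow> norm (\<eta> - \<zeta>) < d \<Longrightarrow> \<bar>\<psi> \<eta> - \<psi> \<zeta>\<bar> < e / 2"
    using c[unfolded continuous_on_iff, rule_format, of \<zeta> "e/2"] z e by (auto simp: dist_norm dist_real_def)
  \<comment> \<open>The oscillation is majorised globally by a constant plus a quadratic term, which
    \<open>poisson_kernel_mult_dist_le\<close> can absorb; no splitting of the integral into arcs
    follows.\<close>
  have pt: "\<bar>\<psi> \<eta> - \<psi> \<zeta>\<bar> \<le> e / 2 + 2 * B / d\<^sup>2 * (norm (\<eta> - \<zeta>))\<^sup>2" if n: "norm \<eta> = 1" for \<eta>
  proof (cases "norm (\<eta> - \<zeta>) < d")
    case True
    have "0 \<le> 2 * B / d\<^sup>2 * (norm (\<eta> - \<zeta>))\<^sup>2" using B by simp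
    then show ?thesis using d(2)[OF n True] by linarith
  next
    case False
    then have "d\<^sup>2 \<le> (norm (\<eta> - \<zeta>))\<^sup>2" using d(1) by (intro power_mono) auto
    then have "2 * B * d\<^sup>2 \<le> 2 * B * (norm (\<eta> - \<zeta>))\<^sup>2" using B by (intro mult_left_mono) auto
    then have "2 * B \<le> 2 * B / d\<^sup>2 * (norm (\<eta> - \<zeta>))\<^sup>2" using d(1) by (simp add: field_simps)
    then show ?thesis using B(2)[OF n] B(2)[OF z] e by (simp add: abs_le_iff)
  qed
  have m: "\<psi> \<in> borel_measurable borelT" by (rule continuous_imp_measurable_borelT[OF c])
  have est: "\<bar>(\<integral>\<eta>. poisson_kernel (of_real r * \<zeta>) \<eta> * \<psi> \<eta> \<partial>mT) - \<psi> \<zeta>\<bar> \<le> e / 2 + 8 * B / d\<^sup>2 * (1 - r\<^sup>2)"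
    if r: "0 \<le> r" "r < 1" for r
  proof -
    have rz: "of_real r * \<zeta> \<in> DD" using of_real_mult_DD[OF r] z by simp
    note i = integrable_poisson_kernel[OF rz]
    have pk: "0 \<le> poisson_kernel (of_real r * \<zeta>) \<eta>" for \<eta> using rz by (simp add: DD_def)
    have ip: "integrable mT (\<lambda>\<eta>. poisson_kernel (of_real r * \<zeta>) \<eta> * \<psi> \<eta>)"
    proof (rule Bochner_Integration.integrable_bound[of mT "\<lambda>\<eta>. poisson_kernel (of_real r * \<zeta>) \<eta> * B"])
      show "AE \<eta> in mT. norm (poisson_kernel (of_real r * \<zeta>) \<eta> * \<psi> \<eta>) \<le> norm (poisson_kernel (of_real r * \<zeta>) \<eta> * B)"
        using B by (intro AE_I2) (auto simp: abs_mult pk intro!: mult_left_mono)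
    qed (use i m in auto)
    have "(\<integral>\<eta>. poisson_kernel (of_real r * \<zeta>) \<eta> * \<psi> \<eta> \<partial>mT) - \<psi> \<zeta>
       = (\<integral>\<eta>. poisson_kernel (of_real r * \<zeta>) \<eta> * (\<psi> \<eta> - \<psi> \<zeta>) \<partial>mT)"
      using ip i integral_poisson_kernel[OF rz] by (simp add: right_diff_distrib)
    also have "\<bar>\<dots>\<bar> \<le> (\<integral>\<eta>. \<bar>poisson_kernel (of_real r * \<zeta>) \<eta> * (\<psi> \<eta> - \<psi> \<zeta>)\<bar> \<partial>mT)"
      by (rule integral_abs_bound)
    also have "\<dots> \<le> (\<integral>\<eta>. poisson_kernel (of_real r * \<zeta>) \<eta> * (e/2) + 8 * B / d\<^sup>2 * (1 - r\<^sup>2) \<partial>mT)"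
    proof (rule integral_mono)
      have "integrable mT (\<lambda>\<eta>. poisson_kernel (of_real r * \<zeta>) \<eta> * \<psi> \<eta> - poisson_kernel (of_real r * \<zeta>) \<eta> * \<psi> \<zeta>)"
        using ip i by simp
      then show "integrable mT (\<lambda>\<eta>. \<bar>poisson_kernel (of_real r * \<zeta>) \<eta> * (\<psi> \<eta> - \<psi> \<zeta>)\<bar>)"
        by (intro integrable_abs) (simp add: right_diff_distrib)
      show "integrable mT (\<lambda>\<eta>. poisson_kernel (of_real r * \<zeta>) \<eta> * (e/2) + 8 * B / d\<^sup>2 * (1 - r\<^sup>2))"
        using i by simp
      fix \<eta> assume "\<eta> \<in> space mT"
      then have n: "norm \<eta> = 1" by simp
      have "\<bar>poisson_kernel (of_real r * \<zeta>) \<eta> * (\<psi> \<eta> - \<psi> \<zeta>)\<bar>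
          \<le> poisson_kernel (of_real r * \<zeta>) \<eta> * (e / 2 + 2 * B / d\<^sup>2 * (norm (\<eta> - \<zeta>))\<^sup>2)"
        using pt[OF n] pk by (simp add: abs_mult mult_left_mono)
      also have "\<dots> = poisson_kernel (of_real r * \<zeta>) \<eta> * (e / 2) + 2 * B / d\<^sup>2 * (poisson_kernel (of_real r * \<zeta>) \<eta> * (norm (\<eta> - \<zeta>))\<^sup>2)"
        by (simp add: algebra_simps)
      also have "\<dots> \<le> poisson_kernel (of_real r * \<zeta>) \<eta> * (e / 2) + 2 * B / d\<^sup>2 * (4 * (1 - r\<^sup>2))"
        using B(1) poisson_kernel_mult_dist_le[OF r z n] by (intro add_left_mono mult_left_mono) auto
      also have "2 * B / d\<^sup>2 * (4 * (1 - r\<^sup>2)) = 8 * B / d\<^sup>2 * (1 - r\<^sup>2)" by (simp add: field_simps)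
      finally show "\<bar>poisson_kernel (of_real r * \<zeta>) \<eta> * (\<psi> \<eta> - \<psi> \<zeta>)\<bar>
          \<le> poisson_kernel (of_real r * \<zeta>) \<eta> * (e/2) + 8 * B / d\<^sup>2 * (1 - r\<^sup>2)" by simp
    qed
    also have "\<dots> = e / 2 + 8 * B / d\<^sup>2 * (1 - r\<^sup>2)"
      using i integral_poisson_kernel[OF rz] by simp
    finally show ?thesis .
  qed
  have "(\<lambda>n. e / 2 + 8 * B / d\<^sup>2 * (1 - (rad n)\<^sup>2)) \<longlonglongrightarrow> e / 2 + 8 * B / d\<^sup>2 * (1 - 1\<^sup>2)"
    by (intro tendsto_intros tendsto_rad)
  then have "(\<lambda>n. e / 2 + 8 * B / d\<^sup>2 * (1 - (rad n)\<^sup>2)) \<longlonglongrightarrow> e / 2" by simp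
  from order_tendstoD(2)[OF this, of e] e
  obtain N where "\<forall>n\<ge>N. e / 2 + 8 * B / d\<^sup>2 * (1 - (rad n)\<^sup>2) < e"
    by (auto simp: eventually_sequentially)
  then show "\<exists>no. \<forall>n\<ge>no. norm ((\<integral>\<eta>. poisson_kernel (of_real (rad n) * \<zeta>) \<eta> * \<psi> \<eta> \<partial>mT) - \<psi> \<zeta>) < e"
    using est[OF rad] by (intro exI[of _ N]) (fastforce intro: le_less_trans)
qed

lemma fst_borelT: "fst \<in> borel_measurable (borelT \<Otimes>\<^sub>M borelT)"
  using measurable_compose[OF measurable_fst measurable_id_borelT] .

lemma snd_borelT: "snd \<in> borel_measurable (borelT \<Otimes>\<^sub>M borelT)"
  using measurable_compose[OF measurable_snd measurable_id_borelT] .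

lemma Fubini_bounded:
  fixes f :: "complex \<Rightarrow> complex \<Rightarrow> 'b :: {banach, second_countable_topology}"
  assumes M: "finite_measure M" "sets M = sets borelT" and N: "finite_measure N" "sets N = sets borelT"
    and f: "(\<lambda>p. f (fst p) (snd p)) \<in> borel_measurable (borelT \<Otimes>\<^sub>M borelT)"
    and B: "\<And>x y. norm x = 1 \<Longrightarrow> norm y = 1 \<Longrightarrow> norm (f x y) \<le> B"
  shows "(\<integral>x. (\<integral>y. f x y \<partial>N) \<partial>M) = (\<integral>y. (\<integral>x. f x y \<partial>M) \<partial>N)"
    and "integrable M (\<lambda>x. \<integral>y. f x y \<partial>N)" and "integrable N (\<lambda>y. \<integral>x. f x y \<partial>M)"
proof -
  interpret M: finite_measure M by fact
  interpret N: finite_measure N by fact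
  interpret P: pair_sigma_finite M N ..
  have s: "sets (M \<Otimes>\<^sub>M N) = sets (borelT \<Otimes>\<^sub>M borelT)" using M(2) N(2) by (rule sets_pair_measure_cong)
  have "integrable (M \<Otimes>\<^sub>M N) (\<lambda>p. f (fst p) (snd p))"
  proof (rule finite_measure.integrable_const_bound[where B=B])
    show "finite_measure (M \<Otimes>\<^sub>M N)" using M(1) N(1) by (intro finite_measure_pair_measure)
    show "(\<lambda>p. f (fst p) (snd p)) \<in> borel_measurable (M \<Otimes>\<^sub>M N)"
      using f by (simp add: measurable_cong_sets[OF s refl])
    show "AE p in M \<Otimes>\<^sub>M N. norm (f (fst p) (snd p)) \<le> B"
      using B by (intro AE_I2) (auto simp: space_pair_measure space_eq_sphere M N)
  qed
  then have i: "integrable (M \<Otimes>\<^sub>M N) (case_prod f)" by (simp add: case_prod_unfold)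
  show "(\<integral>x. (\<integral>y. f x y \<partial>N) \<partial>M) = (\<integral>y. (\<integral>x. f x y \<partial>M) \<partial>N)" using P.Fubini_integral[OF i] by simp
  show "integrable M (\<lambda>x. \<integral>y. f x y \<partial>N)" using P.integrable_fst[OF i] .
  show "integrable N (\<lambda>y. \<integral>x. f x y \<partial>M)" using P.integrable_snd[OF i] .
qed

lemma poisson_kernel_circle_measurable:
  "(\<lambda>p. poisson_kernel (of_real r * fst p) (snd p)) \<in> borel_measurable (borelT \<Otimes>\<^sub>M borelT)"
  "(\<lambda>p. poisson_kernel (of_real r * snd p) (fst p)) \<in> borel_measurable (borelT \<Otimes>\<^sub>M borelT)"
  using fst_borelT snd_borelT
  by (intro measurable_poisson_kernel borel_measurable_times borel_measurable_const, simp_all)+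

text \<open>Fubini together with \<open>poisson_kernel_swap\<close>: integrating a Poisson mean of
  psi against the measure is integrating psi against the dilated Poisson integral of the
  measure.\<close>

lemma wlist_int_poisson_approx:
  fixes \<psi> :: "complex \<Rightarrow> real"
  assumes L: "wlist L" and c: "continuous_on (sphere 0 1) \<psi>" and r: "0 \<le> r" "r < 1"
  shows "wlist_int L (\<lambda>\<zeta>. of_real (\<integral>\<eta>. poisson_kernel (of_real r * \<zeta>) \<eta> * \<psi> \<eta> \<partial>mT))
     = (\<integral>\<eta>. of_real (\<psi> \<eta>) * wlist_int L (\<lambda>\<zeta>. of_real (poisson_kernel (of_real r * \<eta>) \<zeta>)) \<partial>mT)"
    and "integrable mT (\<lambda>\<eta>. of_real (\<psi> \<eta>) * wlist_int L (\<lambda>\<zeta>. of_real (poisson_kernel (of_real r * \<eta>) \<zeta>)))"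
  using L
proof (induction L)
  case (Cons p L)
  case 1
  obtain k M where p: "p = (k, M)" by force
  have s: "sets M = sets borelT" "finite_measure M" using 1 p by auto
  have m: "\<psi> \<in> borel_measurable borelT" by (rule continuous_imp_measurable_borelT[OF c])
  obtain B where B: "0 < B" "\<And>\<eta>. norm \<eta> = 1 \<Longrightarrow> norm (\<psi> \<eta>) \<le> B" using continuous_bounded_sphere[OF c] by blast
  define f where "f \<zeta> \<eta> = complex_of_real (poisson_kernel (of_real r * \<zeta>) \<eta> * \<psi> \<eta>)" for \<zeta> \<eta>
  have "(\<lambda>p. poisson_kernel (of_real r * fst p) (snd p) * \<psi> (snd p)) \<in> borel_measurable (borelT \<Otimes>\<^sub>M borelT)"
    using measurable_compose[OF measurable_snd m] by (intro borel_measurable_times poisson_kernel_circle_measurable)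
  then have fm: "(\<lambda>p. f (fst p) (snd p)) \<in> borel_measurable (borelT \<Otimes>\<^sub>M borelT)"
    unfolding f_def using measurable_compose borel_measurable_of_real by fast
  have fB: "norm (f x y) \<le> 2 / (1 - r)\<^sup>2 * B" if n: "norm x = 1" "norm y = 1" for x y
  proof -
    have "0 \<le> poisson_kernel (of_real r * x) y" "poisson_kernel (of_real r * x) y \<le> 2 / (1 - r)\<^sup>2"
      using n r by (auto intro!: poisson_kernel_le poisson_kernel_nonneg simp: norm_mult)
    then show ?thesis using B(2)[OF n(2)] unfolding f_def norm_of_real abs_mult by (intro mult_mono) auto
  qed
  note F = Fubini_bounded[OF s(2,1) mT.finite_measure_axioms sets_mT fm fB]
  have eq: "(\<integral>\<zeta>. f \<zeta> \<eta> \<partial>M) = of_real (\<psi> \<eta>) * (\<integral>\<zeta>. of_real (poisson_kernel (of_real r * \<eta>) \<zeta>) \<partial>M)" if "norm \<eta> = 1" for \<eta>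
  proof -
    have "(\<integral>\<zeta>. f \<zeta> \<eta> \<partial>M) = (\<integral>\<zeta>. of_real (\<psi> \<eta>) * of_real (poisson_kernel (of_real r * \<eta>) \<zeta>) \<partial>M)"
      by (intro Bochner_Integration.integral_cong refl)
         (simp add: f_def poisson_kernel_swap[OF _ that] space_eq_sphere[OF s(1)])
    then show ?thesis by simp
  qed
  have "integrable mT (\<lambda>\<eta>. \<integral>\<zeta>. f \<zeta> \<eta> \<partial>M)" using F(3) .
  then have i1: "integrable mT (\<lambda>\<eta>. complex_of_real (\<psi> \<eta>) * (\<integral>\<zeta>. of_real (poisson_kernel (of_real r * \<eta>) \<zeta>) \<partial>M))"
    by (rule Bochner_Integration.integrable_cong[THEN iffD1, rotated -1]) (auto simp: eq)
  have e1: "(\<integral>\<zeta>. complex_of_real (\<integral>\<eta>. poisson_kernel (of_real r * \<zeta>) \<eta> * \<psi> \<eta> \<partial>mT) \<partial>M)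
     = (\<integral>\<eta>. of_real (\<psi> \<eta>) * (\<integral>\<zeta>. of_real (poisson_kernel (of_real r * \<eta>) \<zeta>) \<partial>M) \<partial>mT)"
  proof -
    have "(\<integral>\<zeta>. of_real (\<integral>\<eta>. poisson_kernel (of_real r * \<zeta>) \<eta> * \<psi> \<eta> \<partial>mT) \<partial>M) = (\<integral>\<zeta>. (\<integral>\<eta>. f \<zeta> \<eta> \<partial>mT) \<partial>M)"
      unfolding f_def integral_complex_of_real ..
    also have "\<dots> = (\<integral>\<eta>. (\<integral>\<zeta>. f \<zeta> \<eta> \<partial>M) \<partial>mT)" by (rule F(1))
    also have "\<dots> = (\<integral>\<eta>. of_real (\<psi> \<eta>) * (\<integral>\<zeta>. of_real (poisson_kernel (of_real r * \<eta>) \<zeta>) \<partial>M) \<partial>mT)"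
      by (intro Bochner_Integration.integral_cong refl eq) simp
    finally show ?thesis .
  qed
  have IH: "wlist L" using 1 p by simp
  show ?case using e1 Cons.IH(1)[OF IH] i1 Cons.IH(2)[OF IH]
    by (simp add: p distrib_left mult.left_commute[of _ k])
  case 2
  show ?case using i1 Cons.IH(2)[OF IH]
    by (simp add: p distrib_left mult.left_commute[of _ k])
qed simp_all

lemma wlist_meas_eq_int:
  assumes L: "wlist L" and E: "E \<in> sets borelT"
  shows "wlist_meas L E = wlist_int L (indicator E)"
  using L
proof (induction L)
  case (Cons p L)
  obtain c M where p: "p = (c, M)" by force
  have s: "sets M = sets borelT" "finite_measure M" using Cons.prems p by auto
  have "(\<integral>x. indicator E x \<partial>M) = complex_of_real (measure M E)"
  proof -
    have "(\<integral>x. indicator E x \<partial>M) = (\<integral>x. complex_of_real (indicator E x) \<partial>M)"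
      by (intro Bochner_Integration.integral_cong) (auto simp: indicator_def)
    also have "\<dots> = of_real (measure M (E \<inter> space M))" by (simp del: of_real_indicator)
    also have "E \<inter> space M = E" using E s sets.sets_into_space by blast
    finally show ?thesis .
  qed
  then show ?case using Cons p E by (simp add: wlist_meas_Cons)
qed simp

text \<open>Continuous functions are limits of their Poisson means, whose integrals against mu
  vanish by \<open>wlist_int_poisson_approx\<close>. Indicators of closed sets are bounded limits of
  continuous functions, and closed sets generate the Borel sets.\<close>

theorem poisson_meas_unique:
  assumes m: "cmeasure \<mu>" and z: "\<And>z. z \<in> DD \<Longrightarrow> poisson_meas \<mu> z = 0"
  shows "\<mu> = (\<lambda>_. 0)"
proof -
  let ?L = "jordan \<mu>"
  have L: "wlist ?L" using wlist_jordan[OF m] .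
  have cont: "wlist_int ?L (\<lambda>\<zeta>. of_real (\<psi> \<zeta>)) = 0" if c: "continuous_on (sphere 0 1) \<psi>" for \<psi> :: "complex \<Rightarrow> real"
  proof -
    obtain B where B: "0 < B" "\<And>\<eta>. norm \<eta> = 1 \<Longrightarrow> norm (\<psi> \<eta>) \<le> B" using continuous_bounded_sphere[OF c] by blast
    have mps: "\<psi> \<in> borel_measurable borelT" by (rule continuous_imp_measurable_borelT[OF c])
    define f where "f n \<zeta> = (\<integral>\<eta>. poisson_kernel (of_real (rad n) * \<zeta>) \<eta> * \<psi> \<eta> \<partial>mT)" for n \<zeta>
    have zero: "wlist_int ?L (\<lambda>\<zeta>. of_real (f n \<zeta>)) = 0" for n
    proof -
      have "wlist_int ?L (\<lambda>\<zeta>. of_real (f n \<zeta>)) =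
        (\<integral>\<eta>. of_real (\<psi> \<eta>) * wlist_int ?L (\<lambda>\<zeta>. of_real (poisson_kernel (of_real (rad n) * \<eta>) \<zeta>)) \<partial>mT)"
        unfolding f_def by (rule wlist_int_poisson_approx(1)[OF L c rad])
      also have "\<dots> = (\<integral>\<eta>. 0 \<partial>mT)"
      proof (intro Bochner_Integration.integral_cong refl)
        fix \<eta> assume "\<eta> \<in> space mT"
        then have "of_real (rad n) * \<eta> \<in> DD" by (intro of_real_mult_DD rad) simp
        from z[OF this] show "of_real (\<psi> \<eta>) * wlist_int ?L (\<lambda>\<zeta>. of_real (poisson_kernel (of_real (rad n) * \<eta>) \<zeta>)) = 0"
          by (simp add: poisson_meas_def cintegral_jordan)
      qed
      finally show ?thesis by simp
    qed
    have fm: "f n \<in> borel_measurable borelT" for n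
    proof -
      have "(\<lambda>p. poisson_kernel (of_real (rad n) * fst p) (snd p) * \<psi> (snd p)) \<in> borel_measurable (borelT \<Otimes>\<^sub>M borelT)"
        using measurable_compose[OF measurable_snd mps] by (intro borel_measurable_times poisson_kernel_circle_measurable)
      then have "(\<lambda>p. poisson_kernel (of_real (rad n) * fst p) (snd p) * \<psi> (snd p)) \<in> borel_measurable (borelT \<Otimes>\<^sub>M mT)"
        by (simp add: measurable_cong_sets[OF sets_pair_measure_cong[OF refl sets_mT] refl])
      then show ?thesis unfolding f_def[abs_def]
        by (intro mT.borel_measurable_lebesgue_integral) (simp add: case_prod_unfold)
    qed
    have fB: "norm (f n \<zeta>) \<le> B" if n: "norm \<zeta> = 1" for n \<zeta>
    proof -
      have D: "of_real (rad n) * \<zeta> \<in> DD" using n by (intro of_real_mult_DD rad) simp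
      have "norm (f n \<zeta>) \<le> (\<integral>\<eta>. poisson_kernel (of_real (rad n) * \<zeta>) \<eta> * B \<partial>mT)"
        unfolding f_def
      proof (rule norm_integral_le_integral)
        show "integrable mT (\<lambda>\<eta>. poisson_kernel (of_real (rad n) * \<zeta>) \<eta> * B)"
          using integrable_poisson_kernel[OF D] by simp
        show *: "norm (poisson_kernel (of_real (rad n) * \<zeta>) \<eta> * \<psi> \<eta>)
          \<le> poisson_kernel (of_real (rad n) * \<zeta>) \<eta> * B" if "\<eta> \<in> space mT" for \<eta>
          using B(2)[of \<eta>] that D unfolding norm_mult
          by (intro mult_mono) (auto simp: DD_def)
        show "integrable mT (\<lambda>\<eta>. poisson_kernel (of_real (rad n) * \<zeta>) \<eta> * \<psi> \<eta>)"
          by (rule Bochner_Integration.integrable_bound[OF \<open>integrable mT (\<lambda>\<eta>. poisson_kernel (of_real (rad n) * \<zeta>) \<eta> * B)\<close>])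
             (use borel_measurable_times[OF measurable_poisson_kernel_borelT mps] * in
               \<open>auto intro!: AE_I2 intro: order_trans[OF _ abs_ge_self]\<close>)
      qed
      then show ?thesis using integral_poisson_kernel[OF D] by simp
    qed
    have "(\<lambda>n. wlist_int ?L (\<lambda>\<zeta>. of_real (f n \<zeta>))) \<longlonglongrightarrow> wlist_int ?L (\<lambda>\<zeta>. of_real (\<psi> \<zeta>))"
    proof (rule tendsto_wlist_int[OF L, where B=B])
      show "(\<lambda>\<zeta>. complex_of_real (f n \<zeta>)) \<in> borel_measurable borelT" for n
        using measurable_compose[OF fm borel_measurable_of_real] .
      show "(\<lambda>\<zeta>. complex_of_real (\<psi> \<zeta>)) \<in> borel_measurable borelT"
        using measurable_compose[OF mps borel_measurable_of_real] .
      show "norm (complex_of_real (f n \<zeta>)) \<le> B" if "norm \<zeta> = 1" for n \<zeta> using fB[OF that] by simp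
      show "(\<lambda>n. complex_of_real (f n \<zeta>)) \<longlonglongrightarrow> of_real (\<psi> \<zeta>)" if "norm \<zeta> = 1" for \<zeta>
        unfolding f_def by (intro tendsto_of_real poisson_approx c that)
    qed
    then show ?thesis by (simp add: zero LIMSEQ_const_iff)
  qed
  have closed0: "\<mu> K = 0" if K: "closed K" "K \<subseteq> sphere 0 1" for K
  proof (cases "K = {}")
    case True then show ?thesis by (simp add: cmeasure_empty[OF m])
  next
    case False
    have KT: "K \<in> sets borelT" using K by (auto simp: sets_borelT_iff)
    \<comment> \<open>Continuous cut-offs, equal to 1 on K and to 0 at distance at least 1/n from
      it; they decrease to the indicator of K.\<close>
    define \<psi> where "\<psi> n \<zeta> = max 0 (1 - real n * infdist \<zeta> K)" for n \<zeta>
    have c: "continuous_on (sphere 0 1) (\<psi> n)" for n unfolding \<psi>_def by (intro continuous_intros)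
    have lim: "(\<lambda>n. complex_of_real (\<psi> n \<zeta>)) \<longlonglongrightarrow> indicator K \<zeta>" for \<zeta>
    proof (cases "\<zeta> \<in> K")
      case True
      then show ?thesis by (simp add: \<psi>_def)
    next
      case F: False
      then have p: "0 < infdist \<zeta> K" using K(1) False by (metis in_closed_iff_infdist_zero infdist_nonneg order_le_less)
      obtain N where N: "1 < real N * infdist \<zeta> K" using reals_Archimedean3[OF p] by blast
      have "\<psi> n \<zeta> = 0" if "N \<le> n" for n
      proof -
        have "real N * infdist \<zeta> K \<le> real n * infdist \<zeta> K" using that p by (intro mult_right_mono) auto
        then show ?thesis using N by (simp add: \<psi>_def)
      qed
      then have "\<forall>\<^sub>F n in sequentially. complex_of_real (\<psi> n \<zeta>) = 0" by (auto simp: eventually_sequentially)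
      then show ?thesis using F by (simp add: tendsto_eventually)
    qed
    have "(\<lambda>n. wlist_int ?L (\<lambda>\<zeta>. of_real (\<psi> n \<zeta>))) \<longlonglongrightarrow> wlist_int ?L (indicator K)"
    proof (rule tendsto_wlist_int[OF L, where B=1])
      show "(\<lambda>\<zeta>. complex_of_real (\<psi> n \<zeta>)) \<in> borel_measurable borelT" for n
        using measurable_compose[OF continuous_imp_measurable_borelT[OF c] borel_measurable_of_real] .
      show "norm (complex_of_real (\<psi> n \<zeta>)) \<le> 1" for n \<zeta> by (simp add: \<psi>_def infdist_nonneg)
    qed (use lim KT in auto)
    then have "wlist_int ?L (indicator K) = 0" by (simp add: cont[OF c] LIMSEQ_const_iff)
    then show ?thesis using wlist_meas_eq_int[OF L KT] wlist_meas_jordan[OF m] by simp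
  qed
  have T: "sphere 0 1 \<in> sets borelT" using sets.top[of borelT] by simp
  \<comment> \<open>The induction runs over Borel sets of the plane, generated by the
    intersection-stable family of closed sets, and evaluates mu on their traces on the
    circle.\<close>
  have "\<mu> (A \<inter> sphere 0 1) = 0" if A: "A \<in> sets borel" for A
  proof -
    have sb: "sigma_sets UNIV (Collect closed) = sets (borel :: complex measure)"
      by (simp add: borel_eq_closed)
    have iT: "A \<inter> sphere 0 1 \<in> sets borelT" if "A \<in> sigma_sets UNIV (Collect closed)" for A
      using that unfolding sb by (simp add: sets_borelT_iff)
    have st: "Int_stable (Collect closed :: complex set set)" by (auto simp: Int_stable_def)
    have As: "A \<in> sigma_sets UNIV (Collect closed)" using A unfolding sb .
    have sub: "Collect closed \<subseteq> Pow (UNIV :: complex set)" by simp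
    show ?thesis using st sub As
    proof (induction A rule: sigma_sets_induct_disjoint)
      case (basic A)
      then show ?case by (intro closed0) auto
    next
      case empty
      then show ?case by (simp add: cmeasure_empty[OF m])
    next
      case (compl A)
      have "(UNIV - A) \<inter> sphere 0 1 = sphere 0 1 - (A \<inter> sphere 0 1)" by auto
      then show ?case using cmeasure_Diff[OF m iT[OF compl(1)] T] compl(2) closed0[of "sphere 0 1"] by simp
    next
      case (union A)
      have "(\<lambda>n. \<mu> (A n \<inter> sphere 0 1)) sums \<mu> (\<Union>n. A n \<inter> sphere 0 1)"
      proof (rule cmeasure_sums[OF m])
        show "A n \<inter> sphere 0 1 \<in> sets borelT" for n by (rule iT) (use union(2) in blast)
        show "disjoint_family (\<lambda>n. A n \<inter> sphere 0 1)" using union(1) by (auto simp: disjoint_family_on_def)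
      qed
      moreover have "(\<Union>n. A n \<inter> sphere 0 1) = (\<Union>n. A n) \<inter> sphere 0 1" by blast
      ultimately show ?case using union(3) by (simp add: sums_iff)
    qed
  qed
  then show ?thesis
    using m by (intro ext) (metis cmeasure_def inf.absorb1 sets_borelT_iff)
qed

section \<open>Absolutely continuous measures\<close>

lemma density_max:
  fixes g :: "complex \<Rightarrow> real"
  assumes g: "integrable mT g"
  defines "M \<equiv> density mT (\<lambda>x. ennreal (max 0 (g x)))"
  shows "finite_measure M" "sets M = sets borelT"
    and "\<And>k :: complex \<Rightarrow> complex. k \<in> borel_measurable borelT \<Longrightarrow> (\<integral>x. k x \<partial>M) = (\<integral>x. of_real (max 0 (g x)) * k x \<partial>mT)"
proof -
  have m: "(\<lambda>x. max 0 (g x)) \<in> borel_measurable borelT" using g borel_measurable_integrable[OF g] by simp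
  show s: "sets M = sets borelT" by (simp add: M_def)
  have i: "integrable mT (\<lambda>x. max 0 (g x))" using g by simp
  have "emeasure M (space M) = (\<integral>\<^sup>+x. ennreal (max 0 (g x)) * indicator (space mT) x \<partial>mT)"
    unfolding M_def using m sets.top[of mT] by (subst emeasure_density) auto
  also have "\<dots> = (\<integral>\<^sup>+x. ennreal (max 0 (g x)) \<partial>mT)" by (intro nn_integral_cong) auto
  also have "\<dots> = ennreal (\<integral>x. max 0 (g x) \<partial>mT)" using i by (intro nn_integral_eq_integral) auto
  finally show "finite_measure M" by (intro finite_measureI) simp
  fix k :: "complex \<Rightarrow> complex" assume k: "k \<in> borel_measurable borelT"
  show "(\<integral>x. k x \<partial>M) = (\<integral>x. of_real (max 0 (g x)) * k x \<partial>mT)"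
    unfolding M_def using k m by (subst integral_density) (auto simp: scaleR_conv_of_real)
qed

text \<open>The complex measure f dm, split into four parts because \<open>density\<close> takes a
  nonnegative weight.\<close>

definition dlist :: "(complex \<Rightarrow> complex) \<Rightarrow> (complex \<times> complex measure) list" where
  "dlist f = [(1, density mT (\<lambda>x. ennreal (max 0 (Re (f x))))), (-1, density mT (\<lambda>x. ennreal (max 0 (- Re (f x))))),
     (\<i>, density mT (\<lambda>x. ennreal (max 0 (Im (f x))))), (-\<i>, density mT (\<lambda>x. ennreal (max 0 (- Im (f x)))))]"

lemma wlist_dlist: "integrable mT f \<Longrightarrow> wlist (dlist f)"
  unfolding dlist_def by (auto simp: density_max)

lemma integrable_bounded_mult:
  fixes f k :: "'a \<Rightarrow> complex"
  assumes "integrable M f" "k \<in> borel_measurable M" "\<And>x. x \<in> space M \<Longrightarrow> norm (k x) \<le> B"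
  shows "integrable M (\<lambda>x. k x * f x)"
proof (rule Bochner_Integration.integrable_bound)
  show "integrable M (\<lambda>x. of_real B * f x)" using assms(1) by simp
  show "(\<lambda>x. k x * f x) \<in> borel_measurable M" using assms by (intro borel_measurable_times) auto
  show "AE x in M. norm (k x * f x) \<le> norm (of_real B * f x)"
  proof (intro AE_I2)
    fix x assume "x \<in> space M"
    then have "norm (k x) \<le> \<bar>B\<bar>" using assms(3)[of x] by simp
    then show "norm (k x * f x) \<le> norm (of_real B * f x)" by (simp add: norm_mult mult_right_mono)
  qed
qed

lemma wlist_int_dlist:
  assumes f: "integrable mT f" and k: "k \<in> borel_measurable borelT" "\<And>x. norm x = 1 \<Longrightarrow> norm (k x) \<le> B"
  shows "wlist_int (dlist f) k = (\<integral>x. k x * f x \<partial>mT)"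
proof -
  have i: "integrable mT (\<lambda>x. k x * of_real (max 0 (g x)))" if "integrable mT g" for g :: "complex \<Rightarrow> real"
    using that k by (intro integrable_bounded_mult[where B=B]) (auto intro!: integrable_of_real)
  let ?a = "\<lambda>x. k x * complex_of_real (max 0 (Re (f x)))" and ?b = "\<lambda>x. k x * complex_of_real (max 0 (- Re (f x)))"
  let ?c = "\<lambda>x. k x * complex_of_real (max 0 (Im (f x)))" and ?d = "\<lambda>x. k x * complex_of_real (max 0 (- Im (f x)))"
  have I: "integrable mT ?a" "integrable mT ?b" "integrable mT ?c" "integrable mT ?d"
    using f by (intro i; simp)+
  have "wlist_int (dlist f) k = integral\<^sup>L mT ?a - integral\<^sup>L mT ?b + \<i> * (integral\<^sup>L mT ?c - integral\<^sup>L mT ?d)"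
    unfolding dlist_def using f k by (simp add: density_max algebra_simps)
  also have "\<dots> = (\<integral>x. ?a x - ?b x + \<i> * (?c x - ?d x) \<partial>mT)" using I by simp
  also have "\<dots> = (\<integral>x. k x * f x \<partial>mT)"
  proof (intro Bochner_Integration.integral_cong refl)
    fix x
    have r: "complex_of_real (max 0 a) - of_real (max 0 (-a)) = of_real a" for a :: real by (simp add: max_def)
    have "?a x - ?b x + \<i> * (?c x - ?d x) = k x * ((of_real (max 0 (Re (f x))) - of_real (max 0 (- Re (f x))))
       + \<i> * (of_real (max 0 (Im (f x))) - of_real (max 0 (- Im (f x)))))" by (simp add: algebra_simps)
    also have "\<dots> = k x * f x" unfolding r by (simp add: complex_eq_iff)
    finally show "?a x - ?b x + \<i> * (?c x - ?d x) = k x * f x" .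
  qed
  finally show ?thesis .
qed

lemma wlist_meas_dlist:
  assumes f: "integrable mT f" and E: "E \<in> sets borelT"
  shows "wlist_meas (dlist f) E = (\<integral>x. indicator E x * f x \<partial>mT)"
  unfolding wlist_meas_eq_int[OF wlist_dlist[OF f] E] using E
  by (intro wlist_int_dlist[OF f, where B=1]) (auto simp: indicator_def)

lemma poisson_meas_dlist:
  assumes f: "integrable mT f" and z: "z \<in> DD"
  shows "poisson_meas (wlist_meas (dlist f)) z = poisson_fun f z"
  unfolding poisson_meas_wlist_meas[OF wlist_dlist[OF f] z] poisson_fun_def
  using z by (intro wlist_int_dlist[OF f, where B="2/(1-norm z)\<^sup>2"]) (auto simp: DD_def intro!: poisson_kernel_le)

lemma integrable_poisson_mult:
  fixes f :: "complex \<Rightarrow> complex"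
  assumes f: "integrable mT f" and z: "z \<in> DD"
  shows "integrable mT (\<lambda>\<zeta>. of_real (poisson_kernel z \<zeta>) * f \<zeta>)"
  using z by (intro integrable_bounded_mult[OF f, where B="2/(1-norm z)\<^sup>2"]) (auto simp: DD_def intro!: poisson_kernel_le)

lemma poisson_fun_diff:
  assumes "integrable mT f" "integrable mT g" "z \<in> DD"
  shows "poisson_fun (\<lambda>\<zeta>. f \<zeta> - g \<zeta>) z = poisson_fun f z - poisson_fun g z"
  unfolding poisson_fun_def using assms by (simp add: right_diff_distrib integrable_poisson_mult)

lemma norm_poisson_fun_le:
  assumes f: "integrable mT f" and z: "z \<in> DD"
  shows "norm (poisson_fun f z) \<le> 2 / (1 - norm z)\<^sup>2 * (\<integral>x. norm (f x) \<partial>mT)"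
proof -
  have "norm (poisson_fun f z) \<le> (\<integral>x. 2 / (1 - norm z)\<^sup>2 * norm (f x) \<partial>mT)"
    unfolding poisson_fun_def
  proof (rule norm_integral_le_integral)
    fix x assume "x \<in> space mT"
    then have "0 \<le> poisson_kernel z x" "poisson_kernel z x \<le> 2 / (1 - norm z)\<^sup>2"
      using z by (auto simp: DD_def intro!: poisson_kernel_le)
    then show "norm (of_real (poisson_kernel z x) * f x) \<le> 2 / (1 - norm z)\<^sup>2 * norm (f x)"
      unfolding norm_mult norm_of_real by (intro mult_right_mono) auto
  qed (use f z in \<open>auto intro: integrable_poisson_mult\<close>)
  then show ?thesis by simp
qed

text \<open>Test with E = {g > 0}: a nonnegative function with integral 0 vanishes almost
  everywhere.\<close>

lemma AE_nonpos_if_integrals_zero: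
  fixes g :: "complex \<Rightarrow> real"
  assumes g: "integrable mT g" and z: "\<And>E. E \<in> sets borelT \<Longrightarrow> (\<integral>x. indicator E x * g x \<partial>mT) = 0"
  shows "AE x in mT. g x \<le> 0"
proof -
  define E where "E = {x \<in> sphere 0 1. 0 < g x}"
  have m: "g \<in> borel_measurable mT" using g by auto
  have "{x \<in> space mT. 0 < g x} \<in> sets mT" using m by (intro borel_measurable_less) simp_all
  then have E: "E \<in> sets borelT" by (simp add: E_def)
  have "integrable mT (\<lambda>x. indicator E x * g x)"
    using integrable_mult_indicator[of E mT g] E g by simp
  then have "AE x in mT. indicator E x * g x = 0"
    using z[OF E] by (subst (asm) integral_nonneg_eq_0_iff_AE) (auto simp: E_def indicator_def)
  then show ?thesis using AE_space[of mT] by eventually_elim (auto simp: E_def indicator_def split: if_splits)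
qed

text \<open>Uniqueness for measures applied to (f - g) dm, then read back through real and imaginary
  parts and both signs.\<close>

theorem poisson_fun_unique:
  assumes f: "integrable mT f" "integrable mT g" and z: "\<And>z. z \<in> DD \<Longrightarrow> poisson_fun f z = poisson_fun g z"
  shows "AE x in mT. f x = g x"
proof -
  let ?h = "\<lambda>x. f x - g x"
  have h: "integrable mT ?h" using f by simp
  have "wlist_meas (dlist ?h) = (\<lambda>_. 0)"
    using f z by (intro poisson_meas_unique cmeasure_wlist_meas wlist_dlist h)
      (simp add: poisson_meas_dlist poisson_fun_diff)
  then have E0: "(\<integral>x. indicator E x * ?h x \<partial>mT) = 0" if "E \<in> sets borelT" for E
    using wlist_meas_dlist[OF h that] by simp
  have ih: "integrable mT (\<lambda>x. indicator E x * ?h x)" if "E \<in> sets borelT" for E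
    using that by (intro integrable_bounded_mult[OF h, where B=1]) (auto simp: indicator_def)
  have R: "(\<integral>x. indicator E x * Re (?h x) \<partial>mT) = 0" "(\<integral>x. indicator E x * Im (?h x) \<partial>mT) = 0" if "E \<in> sets borelT" for E
  proof -
    have "Re (indicator E x * ?h x) = indicator E x * Re (?h x)" "Im (indicator E x * ?h x) = indicator E x * Im (?h x)" for x
      by (auto simp: indicator_def)
    then show "(\<integral>x. indicator E x * Re (?h x) \<partial>mT) = 0" "(\<integral>x. indicator E x * Im (?h x) \<partial>mT) = 0"
      using integral_Re[OF ih[OF that]] integral_Im[OF ih[OF that]] E0[OF that] by simp_all
  qed
  have "AE x in mT. Re (?h x) \<le> 0" "AE x in mT. Im (?h x) \<le> 0" "AE x in mT. - Re (?h x) \<le> 0" "AE x in mT. - Im (?h x) \<le> 0"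
    using R h by (intro AE_nonpos_if_integrals_zero; simp del: minus_complex.sel)+
  then show ?thesis by eventually_elim (simp add: complex_eq_iff)
qed

lemma Lp_1_iff: "f \<in> Lp 1 \<longleftrightarrow> integrable mT f"
  unfolding Lp_def by (auto simp: integrable_norm_iff)

text \<open>\<open>compL\<close> chooses among functions differing on null sets. One candidate g
  with the right Poisson integral shows that the choice succeeds, and uniqueness identifies it with
  g almost everywhere.\<close>

lemma compL_AE:
  assumes g: "integrable mT g" and z: "\<And>z. z \<in> DD \<Longrightarrow> poisson_fun g z = poisson_fun f (\<phi> z)"
  shows "integrable mT (compL \<phi> f)" "AE x in mT. compL \<phi> f x = g x"
    and "\<And>z. z \<in> DD \<Longrightarrow> poisson_fun (compL \<phi> f) z = poisson_fun f (\<phi> z)"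
proof -
  have "compL \<phi> f \<in> Lp 1 \<and> (\<forall>z\<in>DD. poisson_fun (compL \<phi> f) z = poisson_fun f (\<phi> z))"
    unfolding compL_def by (rule someI[of _ g]) (use g z in \<open>simp add: Lp_1_iff\<close>)
  then show "integrable mT (compL \<phi> f)" "\<And>z. z \<in> DD \<Longrightarrow> poisson_fun (compL \<phi> f) z = poisson_fun f (\<phi> z)"
    by (auto simp: Lp_1_iff)
  then show "AE x in mT. compL \<phi> f x = g x" using g z by (intro poisson_fun_unique) auto
qed

lemma compM_eq:
  assumes n: "cmeasure \<nu>" and z: "\<And>z. z \<in> DD \<Longrightarrow> poisson_meas \<nu> z = poisson_meas \<mu> (\<phi> z)"
  shows "compM \<phi> \<mu> = \<nu>"
  unfolding compM_def
proof (rule the_equality)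
  fix \<nu>' assume a: "cmeasure \<nu>' \<and> (\<forall>z\<in>DD. poisson_meas \<nu>' z = poisson_meas \<mu> (\<phi> z))"
  have "\<nu>' - \<nu> = (\<lambda>_. 0)"
    using a n z by (intro poisson_meas_unique cmeasure_diff) (auto simp: poisson_meas_diff)
  then show "\<nu>' = \<nu>" by (intro ext) (metis eq_iff_diff_eq_0 minus_apply)
qed (use assms in auto)

section \<open>Explicit form of the composition operators\<close>

lemma hk_AE_nonneg: "AE \<zeta> in mT. 0 \<le> poisson_kernel (phi t \<zeta>) \<alpha>"
  using AE_not_ssupp AE_space[of mT]
proof eventually_elim
  case (elim \<zeta>)
  then show ?case using norm_phi[of \<zeta> t] by (intro poisson_kernel_nonneg) simp
qed

lemma hk_measurable [simp]: "(\<lambda>\<zeta>. poisson_kernel (phi t \<zeta>) \<alpha>) \<in> borel_measurable borelT"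
  by (rule borel_measurable_borelT) measurable

lemma hk_integrable:
  assumes a: "norm \<alpha> = 1"
  shows "integrable mT (\<lambda>\<zeta>. poisson_kernel (phi t \<zeta>) \<alpha>)"
proof (cases "\<alpha> = 1")
  case True
  show ?thesis
  proof (rule mT.integrable_const_bound[where B=1])
    show "AE \<zeta> in mT. norm (poisson_kernel (phi t \<zeta>) \<alpha>) \<le> 1"
      using AE_not_ssupp AE_space[of mT]
      by eventually_elim (simp add: True poisson_kernel_phi_1 Re_herg_sphere)
  qed simp
next
  case False
  show ?thesis
  proof (rule mT.integrable_const_bound[where B="4 / (norm (\<alpha> - 1))\<^sup>2"])
    show "AE \<zeta> in mT. norm (poisson_kernel (phi t \<zeta>) \<alpha>) \<le> 4 / (norm (\<alpha> - 1))\<^sup>2"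
      using AE_not_ssupp AE_space[of mT] hk_AE_nonneg[of t \<alpha>]
    proof eventually_elim
      case (elim \<zeta>)
      then show ?case using poisson_kernel_phi_le[of \<zeta> \<alpha> t] a False by simp
    qed
  qed simp
qed

lemma hk_poisson_integrable:
  assumes "norm \<alpha> = 1" "z \<in> DD"
  shows "integrable mT (\<lambda>\<zeta>. poisson_kernel z \<zeta> * poisson_kernel (phi t \<zeta>) \<alpha>)"
proof (rule Bochner_Integration.integrable_bound)
  show "integrable mT (\<lambda>\<zeta>. 2/(1-norm z)\<^sup>2 * poisson_kernel (phi t \<zeta>) \<alpha>)" using hk_integrable[OF assms(1)] by simp
  show "AE \<zeta> in mT. norm (poisson_kernel z \<zeta> * poisson_kernel (phi t \<zeta>) \<alpha>) \<le> norm (2/(1-norm z)\<^sup>2 * poisson_kernel (phi t \<zeta>) \<alpha>)"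
  proof (intro AE_I2)
    fix \<zeta> assume "\<zeta> \<in> space mT"
    then have "0 \<le> poisson_kernel z \<zeta>" "poisson_kernel z \<zeta> \<le> 2 / (1 - norm z)\<^sup>2"
      using assms by (auto simp: DD_def intro!: poisson_kernel_le)
    then show "norm (poisson_kernel z \<zeta> * poisson_kernel (phi t \<zeta>) \<alpha>) \<le> norm (2/(1-norm z)\<^sup>2 * poisson_kernel (phi t \<zeta>) \<alpha>)"
      unfolding norm_mult by (intro mult_right_mono) auto
  qed
qed (auto intro!: borel_measurable_times)

lemma hk_poisson_integral:
  assumes "norm \<alpha> = 1" "z \<in> DD" "0 \<le> t"
  shows "(\<integral>\<zeta>. poisson_kernel z \<zeta> * poisson_kernel (phi t \<zeta>) \<alpha> \<partial>mT)
     = poisson_kernel (phi t z) \<alpha> - indicator {1} \<alpha> * (\<integral>\<zeta>. poisson_kernel z \<zeta> \<partial>smu t)"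
  using poisson_phi_kernel[OF assms(3,2,1)] poisson_phi_kernel_1[OF assms(2), of t] by (cases "\<alpha> = 1") auto

text \<open>Evaluation of the Poisson integral at z = 0; at alpha = 1 the singular mass that is
  subtracted can only lower the value.\<close>

lemma hk_integral_le:
  assumes "norm \<alpha> = 1" "0 \<le> t" "t \<le> 1"
  shows "(\<integral>\<zeta>. poisson_kernel (phi t \<zeta>) \<alpha> \<partial>mT) \<le> 5"
proof -
  have "0 \<in> DD" by (simp add: DD_def)
  have "(\<integral>\<zeta>. poisson_kernel (phi t \<zeta>) \<alpha> \<partial>mT) = (\<integral>\<zeta>. poisson_kernel 0 \<zeta> * poisson_kernel (phi t \<zeta>) \<alpha> \<partial>mT)"
    by (intro Bochner_Integration.integral_cong) auto
  also have "\<dots> \<le> poisson_kernel (phi t 0) \<alpha>"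
    unfolding hk_poisson_integral[OF assms(1) \<open>0 \<in> DD\<close> assms(2)]
    by (simp add: indicator_def)
  finally show ?thesis using poisson_kernel_phi_0_le[OF assms(2,3,1)] by simp
qed

text \<open>Stated for a measure A with a density f so as to serve both \<open>mT\<close> with f in
  L^1 and a variation measure with f = 1. An atom of A at 1 leaves behind a multiple of the Poisson
  integral of \<open>smu t\<close>.\<close>

lemma hk_Fubini:
  fixes f :: "complex \<Rightarrow> complex"
  assumes A: "finite_measure A" "sets A = sets borelT" and f: "integrable A f" and t: "0 \<le> t" and z: "z \<in> DD"
  shows "integrable mT (\<lambda>\<zeta>. of_real (poisson_kernel z \<zeta>) * (\<integral>\<alpha>. of_real (poisson_kernel (phi t \<zeta>) \<alpha>) * f \<alpha> \<partial>A))" (is ?I)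
    and "(\<integral>\<zeta>. of_real (poisson_kernel z \<zeta>) * (\<integral>\<alpha>. of_real (poisson_kernel (phi t \<zeta>) \<alpha>) * f \<alpha> \<partial>A) \<partial>mT)
      = (\<integral>\<alpha>. of_real (poisson_kernel (phi t z) \<alpha>) * f \<alpha> \<partial>A)
        - of_real (\<integral>\<zeta>. poisson_kernel z \<zeta> \<partial>smu t) * (\<integral>\<alpha>. indicator {1} \<alpha> * f \<alpha> \<partial>A)" (is ?E)
proof -
  interpret A: finite_measure A by fact
  interpret P: pair_sigma_finite A mT ..
  have fm: "f \<in> borel_measurable borelT" using borel_measurable_integrable[OF f] measurable_cong_sets[OF A(2) refl] by blast
  have sp: "space A = sphere 0 1" using space_eq_sphere[OF A(2)] .
  define F where "F \<alpha> \<zeta> = complex_of_real (poisson_kernel z \<zeta> * poisson_kernel (phi t \<zeta>) \<alpha>) * f \<alpha>" for \<alpha> \<zeta>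
  have cz: "norm (phi t z) < 1" using z DD_not_ssupp by (intro norm_phi) (auto simp: DD_def)
  have "(\<lambda>p. poisson_kernel z (snd p) * poisson_kernel (phi t (snd p)) (fst p)) \<in> borel_measurable (borelT \<Otimes>\<^sub>M borelT)"
    by (intro borel_measurable_times measurable_poisson_kernel borel_measurable_const snd_borelT fst_borelT
        measurable_compose[OF snd_borelT phi_measurable])
  from measurable_compose[OF this borel_measurable_of_real]
  have "(\<lambda>p. F (fst p) (snd p)) \<in> borel_measurable (borelT \<Otimes>\<^sub>M borelT)"
    unfolding F_def by (rule borel_measurable_times[OF _ measurable_compose[OF measurable_fst fm]])
  then have Fm: "case_prod F \<in> borel_measurable (A \<Otimes>\<^sub>M mT)"
    by (simp add: case_prod_unfold measurable_cong_sets[OF sets_pair_measure_cong[OF A(2) sets_mT] refl])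
  \<comment> \<open>The kernel is unbounded near alpha = 1, so integrability on the product comes
    from the order of integration: the integral in zeta is known exactly, and is bounded in alpha
    for fixed z.\<close>
  have norm_int: "(\<integral>\<zeta>. norm (F \<alpha> \<zeta>) \<partial>mT) = norm (f \<alpha>) *
      (poisson_kernel (phi t z) \<alpha> - indicator {1} \<alpha> * (\<integral>\<zeta>. poisson_kernel z \<zeta> \<partial>smu t))" if a: "norm \<alpha> = 1" for \<alpha>
  proof -
    have "(\<integral>\<zeta>. norm (F \<alpha> \<zeta>) \<partial>mT) = (\<integral>\<zeta>. norm (f \<alpha>) * (poisson_kernel z \<zeta> * poisson_kernel (phi t \<zeta>) \<alpha>) \<partial>mT)"
    proof (rule integral_cong_AE)
      show "AE \<zeta> in mT. norm (F \<alpha> \<zeta>) = norm (f \<alpha>) * (poisson_kernel z \<zeta> * poisson_kernel (phi t \<zeta>) \<alpha>)"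
        using hk_AE_nonneg[of t \<alpha>] by eventually_elim (use z in \<open>simp add: F_def norm_mult DD_def\<close>)
    qed (auto simp: F_def intro!: borel_measurable_times measurable_compose[OF _ borel_measurable_of_real]
           measurable_compose[OF _ borel_measurable_norm])
    then show ?thesis by (simp add: hk_poisson_integral[OF a z t])
  qed
  have bd: "\<bar>\<integral>\<zeta>. norm (F \<alpha> \<zeta>) \<partial>mT\<bar> \<le> norm (f \<alpha>) * (2/(1-norm (phi t z))\<^sup>2)" if a: "norm \<alpha> = 1" for \<alpha>
  proof -
    have "0 \<le> (\<integral>\<zeta>. norm (F \<alpha> \<zeta>) \<partial>mT)" by (rule Bochner_Integration.integral_nonneg) simp
    moreover have "0 \<le> (\<integral>\<zeta>. poisson_kernel z \<zeta> \<partial>smu t)" using z by (intro Bochner_Integration.integral_nonneg) (simp add: DD_def)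
    moreover have "poisson_kernel (phi t z) \<alpha> \<le> 2/(1-norm (phi t z))\<^sup>2" by (rule poisson_kernel_le) (use a cz in auto)
    ultimately have le: "poisson_kernel (phi t z) \<alpha> - indicator {1} \<alpha> * (\<integral>\<zeta>. poisson_kernel z \<zeta> \<partial>smu t) \<le> 2/(1-norm (phi t z))\<^sup>2"
      by (auto simp: indicator_def)
    show ?thesis unfolding abs_of_nonneg[OF \<open>0 \<le> (\<integral>\<zeta>. norm (F \<alpha> \<zeta>) \<partial>mT)\<close>] unfolding norm_int[OF a]
      by (rule mult_left_mono[OF le]) simp
  qed
  have int: "integrable (A \<Otimes>\<^sub>M mT) (case_prod F)"
  proof (rule P.Fubini_integrable[OF Fm])
    show "AE x in A. integrable mT (\<lambda>y. case (x, y) of (x, y) \<Rightarrow> F x y)"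
      by (intro AE_I2) (auto simp: F_def sp intro!: integrable_mult_left integrable_of_real hk_poisson_integrable z simp del: of_real_mult)
    show "integrable A (\<lambda>x. \<integral>y. norm (case (x, y) of (x, y) \<Rightarrow> F x y) \<partial>mT)"
    proof (rule Bochner_Integration.integrable_bound)
      show "integrable A (\<lambda>\<alpha>. norm (f \<alpha>) * (2/(1-norm (phi t z))\<^sup>2))" using f by simp
      have "(\<lambda>p. norm (case_prod F p)) \<in> borel_measurable (A \<Otimes>\<^sub>M mT)" using Fm by simp
      then show "(\<lambda>x. \<integral>y. norm (case (x, y) of (x, y) \<Rightarrow> F x y) \<partial>mT) \<in> borel_measurable A"
        by (intro mT.borel_measurable_lebesgue_integral) (simp add: case_prod_unfold)
      show "AE \<alpha> in A. norm (\<integral>y. norm (case (\<alpha>, y) of (x, y) \<Rightarrow> F x y) \<partial>mT) \<le> norm (norm (f \<alpha>) * (2/(1-norm (phi t z))\<^sup>2))"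
        using bd by (intro AE_I2) (simp add: sp abs_mult)
    qed
  qed
  have e: "(\<integral>\<alpha>. F \<alpha> \<zeta> \<partial>A) = of_real (poisson_kernel z \<zeta>) * (\<integral>\<alpha>. of_real (poisson_kernel (phi t \<zeta>) \<alpha>) * f \<alpha> \<partial>A)" for \<zeta>
    by (simp add: F_def mult.assoc)
  show ?I using P.integrable_snd[OF int] by (simp add: e)
  have e2: "(\<integral>\<zeta>. F \<alpha> \<zeta> \<partial>mT) = of_real (poisson_kernel (phi t z) \<alpha>) * f \<alpha>
     - of_real (\<integral>\<zeta>. poisson_kernel z \<zeta> \<partial>smu t) * (indicator {1} \<alpha> * f \<alpha>)" if a: "norm \<alpha> = 1" for \<alpha>
  proof -
    have "(\<integral>\<zeta>. F \<alpha> \<zeta> \<partial>mT) = of_real (\<integral>\<zeta>. poisson_kernel z \<zeta> * poisson_kernel (phi t \<zeta>) \<alpha> \<partial>mT) * f \<alpha>"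
      unfolding F_def by (simp del: of_real_mult)
    then show ?thesis unfolding hk_poisson_integral[OF a z t]
      by (cases "\<alpha> = 1") (simp_all add: algebra_simps)
  qed
  have "(\<integral>\<zeta>. of_real (poisson_kernel z \<zeta>) * (\<integral>\<alpha>. of_real (poisson_kernel (phi t \<zeta>) \<alpha>) * f \<alpha> \<partial>A) \<partial>mT)
      = (\<integral>\<alpha>. (\<integral>\<zeta>. F \<alpha> \<zeta> \<partial>mT) \<partial>A)"
    using P.Fubini_integral[OF int] by (simp add: e)
  also have "\<dots> = (\<integral>\<alpha>. of_real (poisson_kernel (phi t z) \<alpha>) * f \<alpha>
     - of_real (\<integral>\<zeta>. poisson_kernel z \<zeta> \<partial>smu t) * (indicator {1} \<alpha> * f \<alpha>) \<partial>A)"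
    by (intro Bochner_Integration.integral_cong refl e2) (simp add: sp)
  also have "\<dots> = (\<integral>\<alpha>. of_real (poisson_kernel (phi t z) \<alpha>) * f \<alpha> \<partial>A)
        - of_real (\<integral>\<zeta>. poisson_kernel z \<zeta> \<partial>smu t) * (\<integral>\<alpha>. indicator {1} \<alpha> * f \<alpha> \<partial>A)"
  proof -
    have "integrable A (\<lambda>\<alpha>. of_real (poisson_kernel (phi t z) \<alpha>) * f \<alpha>)"
      using cz measurable_of_real_poisson_kernel measurable_cong_sets[OF A(2) refl, of "borel :: complex measure"]
      by (intro integrable_bounded_mult[OF f, where B="2/(1-norm (phi t z))\<^sup>2"]) (auto simp: sp intro!: poisson_kernel_le)
    moreover have "{1} \<in> sets A" by (simp add: A(2) sets_borelT_iff)
    then have "integrable A (\<lambda>\<alpha>. indicator {1} \<alpha> * f \<alpha>)"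
      by (intro integrable_bounded_mult[OF f, where B=1]) (auto simp: indicator_def)
    ultimately show ?thesis by simp
  qed
  finally show ?E .
qed

text \<open>The point 1 is null for m, so the correction term of \<open>hk_Fubini\<close> disappears
  and the boundary function f~(phi t zeta), with f~ the Poisson integral of f, is a valid candidate
  in \<open>compL_AE\<close>.\<close>

lemma compL_phi:
  assumes f: "integrable mT f" and t: "0 \<le> t"
  shows "integrable mT (\<lambda>\<zeta>. poisson_fun f (phi t \<zeta>))"
    and "AE \<zeta> in mT. compL (phi t) f \<zeta> = poisson_fun f (phi t \<zeta>)"
    and "integrable mT (compL (phi t) f)"
    and "\<And>z. z \<in> DD \<Longrightarrow> poisson_fun (compL (phi t) f) z = poisson_fun f (phi t z)"
proof -
  have D0: "0 \<in> DD" by (simp add: DD_def)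
  note F = hk_Fubini[OF mT.finite_measure_axioms sets_mT f t, folded poisson_fun_def]
  have g: "integrable mT (\<lambda>\<zeta>. poisson_fun f (phi t \<zeta>))"
    using F(1)[OF D0] by (subst Bochner_Integration.integrable_cong[OF refl]) auto
  then show "integrable mT (\<lambda>\<zeta>. poisson_fun f (phi t \<zeta>))" .
  have "(\<integral>\<alpha>. indicator {1} \<alpha> * f \<alpha> \<partial>mT) = (\<integral>\<alpha>. 0 \<partial>mT)"
  proof (rule integral_cong_AE)
    show "AE \<alpha> in mT. indicator {1} \<alpha> * f \<alpha> = 0"
      using AE_not_in[OF null_mT_one] by eventually_elim simp
    show "(\<lambda>\<alpha>. indicator {1} \<alpha> * f \<alpha>) \<in> borel_measurable mT"
      using f null_mT_one by (intro borel_measurable_times borel_measurable_indicator) (auto simp: null_sets_def)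
  qed simp
  then have "poisson_fun (\<lambda>\<zeta>. poisson_fun f (phi t \<zeta>)) z = poisson_fun f (phi t z)" if "z \<in> DD" for z
    using F(2)[OF that] by (simp add: poisson_fun_def)
  from compL_AE[OF g this] show "AE \<zeta> in mT. compL (phi t) f \<zeta> = poisson_fun f (phi t \<zeta>)"
    "integrable mT (compL (phi t) f)" "\<And>z. z \<in> DD \<Longrightarrow> poisson_fun (compL (phi t) f) z = poisson_fun f (phi t z)" by auto
qed

lemma wlist_hk_Fubini:
  assumes L: "wlist L" and t: "0 \<le> t" and z: "z \<in> DD"
  shows "integrable mT (\<lambda>\<zeta>. of_real (poisson_kernel z \<zeta>) * wlist_int L (\<lambda>\<alpha>. of_real (poisson_kernel (phi t \<zeta>) \<alpha>)))"
    and "(\<integral>\<zeta>. of_real (poisson_kernel z \<zeta>) * wlist_int L (\<lambda>\<alpha>. of_real (poisson_kernel (phi t \<zeta>) \<alpha>)) \<partial>mT)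
      = wlist_int L (\<lambda>\<alpha>. of_real (poisson_kernel (phi t z) \<alpha>))
        - of_real (\<integral>\<zeta>. poisson_kernel z \<zeta> \<partial>smu t) * wlist_int L (indicator {1})"
  using L
proof (induction L)
  case (Cons p L)
  case 1
  obtain c M where p: "p = (c, M)" by force
  have s: "finite_measure M" "sets M = sets borelT" and IH: "wlist L" using 1 p by auto
  have "integrable M (\<lambda>_. 1::complex)" using s(1) by (simp add: finite_measure.integrable_const)
  note H = hk_Fubini[OF s this t z, simplified mult_1_right]
  have e: "of_real (poisson_kernel z \<zeta>) * wlist_int (p # L) (\<lambda>\<alpha>. of_real (poisson_kernel (phi t \<zeta>) \<alpha>)) =
     c * (of_real (poisson_kernel z \<zeta>) * (\<integral>\<alpha>. of_real (poisson_kernel (phi t \<zeta>) \<alpha>) \<partial>M))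
     + of_real (poisson_kernel z \<zeta>) * wlist_int L (\<lambda>\<alpha>. of_real (poisson_kernel (phi t \<zeta>) \<alpha>))" for \<zeta>
    by (simp add: p algebra_simps)
  define X where "X \<zeta> = complex_of_real (poisson_kernel z \<zeta>) * (\<integral>\<alpha>. of_real (poisson_kernel (phi t \<zeta>) \<alpha>) \<partial>M)" for \<zeta>
  define Y where "Y \<zeta> = of_real (poisson_kernel z \<zeta>) * wlist_int L (\<lambda>\<alpha>. of_real (poisson_kernel (phi t \<zeta>) \<alpha>))" for \<zeta>
  have e': "of_real (poisson_kernel z \<zeta>) * wlist_int (p # L) (\<lambda>\<alpha>. of_real (poisson_kernel (phi t \<zeta>) \<alpha>)) = c * X \<zeta> + Y \<zeta>" for \<zeta>
    unfolding X_def Y_def by (rule e)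
  have X: "integrable mT X" "integral\<^sup>L mT X = (\<integral>\<alpha>. of_real (poisson_kernel (phi t z) \<alpha>) \<partial>M)
      - of_real (\<integral>\<zeta>. poisson_kernel z \<zeta> \<partial>smu t) * (\<integral>\<alpha>. indicator {1} \<alpha> \<partial>M)"
    unfolding X_def using H by auto
  have Y: "integrable mT Y" "integral\<^sup>L mT Y = wlist_int L (\<lambda>\<alpha>. of_real (poisson_kernel (phi t z) \<alpha>))
        - of_real (\<integral>\<zeta>. poisson_kernel z \<zeta> \<partial>smu t) * wlist_int L (indicator {1})"
    unfolding Y_def using Cons.IH[OF IH] by auto
  show ?case unfolding e' using X(1) Y(1) by simp
  case 2
  have "(\<integral>\<zeta>. c * X \<zeta> + Y \<zeta> \<partial>mT) = c * integral\<^sup>L mT X + integral\<^sup>L mT Y" using X(1) Y(1) by simp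
  then show ?case unfolding e' X(2) Y(2) unfolding p wlist_int_simps
    by (simp only: algebra_simps)
qed simp_all

definition comp_list :: "real \<Rightarrow> (complex set \<Rightarrow> complex) \<Rightarrow> (complex \<times> complex measure) list" where
  "comp_list t \<mu> = (\<mu> {1}, smu t) # dlist (\<lambda>\<zeta>. poisson_meas \<mu> (phi t \<zeta>))"

lemma poisson_meas_phi_integrable:
  assumes m: "cmeasure \<mu>" and t: "0 \<le> t"
  shows "integrable mT (\<lambda>\<zeta>. poisson_meas \<mu> (phi t \<zeta>))"
proof -
  have D0: "0 \<in> DD" by (simp add: DD_def)
  show ?thesis using wlist_hk_Fubini(1)[OF wlist_jordan[OF m] t D0]
    unfolding poisson_meas_def cintegral_jordan
    by (subst Bochner_Integration.integrable_cong[OF refl]) auto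
qed

lemma wlist_comp_list: "cmeasure \<mu> \<Longrightarrow> 0 \<le> t \<Longrightarrow> wlist (comp_list t \<mu>)"
  unfolding comp_list_def by (simp add: wlist_dlist poisson_meas_phi_integrable smu.finite_measure_axioms)

text \<open>The entry \<open>(\<mu> {1}, smu t)\<close> restores precisely what Fubini subtracts for
  the atom at 1.\<close>

lemma poisson_meas_compM_phi:
  assumes m: "cmeasure \<mu>" and t: "0 \<le> t" and z: "z \<in> DD"
  shows "poisson_meas (wlist_meas (comp_list t \<mu>)) z = poisson_meas \<mu> (phi t z)"
proof -
  have one: "{1} \<in> sets borelT" by (simp add: sets_borelT_iff)
  have "poisson_meas (wlist_meas (comp_list t \<mu>)) z = \<mu> {1} * of_real (\<integral>\<zeta>. poisson_kernel z \<zeta> \<partial>smu t)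
      + wlist_int (dlist (\<lambda>\<zeta>. poisson_meas \<mu> (phi t \<zeta>))) (\<lambda>\<zeta>. of_real (poisson_kernel z \<zeta>))"
    unfolding poisson_meas_wlist_meas[OF wlist_comp_list[OF m t] z] by (simp add: comp_list_def)
  also have "wlist_int (dlist (\<lambda>\<zeta>. poisson_meas \<mu> (phi t \<zeta>))) (\<lambda>\<zeta>. of_real (poisson_kernel z \<zeta>))
    = (\<integral>\<zeta>. of_real (poisson_kernel z \<zeta>) * poisson_meas \<mu> (phi t \<zeta>) \<partial>mT)"
    using z by (intro wlist_int_dlist[OF poisson_meas_phi_integrable[OF m t], where B="2/(1-norm z)\<^sup>2"])
      (auto simp: DD_def intro!: poisson_kernel_le)
  also have "\<dots> = poisson_meas \<mu> (phi t z) - of_real (\<integral>\<zeta>. poisson_kernel z \<zeta> \<partial>smu t) * \<mu> {1}"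
    using wlist_hk_Fubini(2)[OF wlist_jordan[OF m] t z] wlist_meas_eq_int[OF wlist_jordan[OF m] one]
    by (simp add: poisson_meas_def cintegral_jordan wlist_meas_jordan[OF m])
  finally show ?thesis by simp
qed

theorem compM_phi:
  assumes m: "cmeasure \<mu>" and t: "0 \<le> t"
  shows "compM (phi t) \<mu> = wlist_meas (comp_list t \<mu>)"
  using poisson_meas_compM_phi[OF m t] m t by (intro compM_eq cmeasure_wlist_meas wlist_comp_list)

section \<open>Norm continuity of the kernels\<close>

text \<open>Only points \<open>sgen x\<close> with x between s and t enter the bound: the difference
  of the transforms is controlled at every z that is far from those points, however close z is to
  the rest of the carrier.\<close>

lemma herg_diff_le:
  assumes z: "z \<notin> ssupp" and st: "0 \<le> s" "0 \<le> t" and B: "0 \<le> B"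
    "\<And>x. min s t < x \<Longrightarrow> x \<le> max s t \<Longrightarrow> norm ((sgen x + z) / (sgen x - z)) \<le> B"
  shows "norm (herg t z - herg s z) \<le> B * \<bar>t - s\<bar>"
proof -
  obtain d where d: "0 < d" "\<And>\<zeta>. \<zeta> \<in> ssupp \<Longrightarrow> d \<le> norm (\<zeta> - z)" using dist_ssupp[OF z] by blast
  have i: "integrable (smu u) (\<lambda>\<zeta>. (\<zeta> + z) / (\<zeta> - z))" for u
  proof (rule integrable_smu[where B="(1 + norm z) / d"])
    fix \<zeta> assume s: "\<zeta> \<in> ssupp"
    then have "norm \<zeta> = 1" using ssupp_subset by auto
    then show "norm ((\<zeta> + z) / (\<zeta> - z)) \<le> (1 + norm z) / d"
      unfolding norm_divide using d(1) d(2)[OF s] norm_triangle_ineq[of \<zeta> z] by (intro frac_le) auto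
  qed simp
  have main: "norm (herg b z - herg a z) \<le> B * (b - a)"
    if ab: "0 \<le> a" "a \<le> b" "a = min s t" "b = max s t" for a b
    unfolding herg_def by (rule integral_smu_diff_le[OF cauchy_kernel_measurable ab(1,2) _ B(1) i]) (use B(2) ab in auto)
  show ?thesis
  proof (cases "s \<le> t")
    case True then show ?thesis using main[of s t] st by (simp add: min_def max_def)
  next
    case False then show ?thesis using main[of t s] st by (simp add: min_def max_def norm_minus_commute)
  qed
qed

lemma herg_tendsto:
  assumes z: "z \<notin> ssupp" and t: "\<And>n. 0 \<le> t n" "t \<longlonglongrightarrow> s" "0 \<le> s"
  shows "(\<lambda>n. herg (t n) z) \<longlonglongrightarrow> herg s z"
proof -
  obtain d where d: "0 < d" "\<And>\<zeta>. \<zeta> \<in> ssupp \<Longrightarrow> d \<le> norm (\<zeta> - z)" using dist_ssupp[OF z] by blast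
  have B: "norm ((sgen x + z) / (sgen x - z)) \<le> (1 + norm z) / d" for x
    unfolding norm_divide using d(1) d(2)[OF sgen_ssupp] norm_triangle_ineq[of "sgen x" z] by (intro frac_le) auto
  have "norm (herg (t n) z - herg s z) \<le> (1 + norm z) / d * \<bar>t n - s\<bar>" for n
    using herg_diff_le[OF z t(3) t(1), of "(1 + norm z) / d" n] B d(1) by simp
  moreover have "(\<lambda>n. (1 + norm z) / d * \<bar>t n - s\<bar>) \<longlonglongrightarrow> (1 + norm z) / d * \<bar>s - s\<bar>"
    by (intro tendsto_intros t)
  ultimately have l: "(\<lambda>n. (1 + norm z) / d * \<bar>t n - s\<bar>) \<longlonglongrightarrow> 0"
    and b: "\<And>n. norm (herg (t n) z - herg s z) \<le> (1 + norm z) / d * \<bar>t n - s\<bar>" by simp_all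
  have "(\<lambda>n. herg (t n) z - herg s z) \<longlonglongrightarrow> 0"
    by (rule Lim_null_comparison[OF always_eventually l]) (rule allI, rule b)
  then show ?thesis by (rule LIM_zero_cancel)
qed

lemma phi_tendsto:
  assumes z: "z \<notin> ssupp" "norm z \<le> 1" and t: "\<And>n. 0 \<le> t n" "t \<longlonglongrightarrow> s" "0 \<le> s"
  shows "(\<lambda>n. phi (t n) z) \<longlonglongrightarrow> phi s z"
  unfolding phi_def using herg_plus_2[OF z] by (intro tendsto_intros herg_tendsto[OF z(1) t]) auto

lemma hk_tendsto:
  assumes z: "z \<notin> ssupp" "norm z \<le> 1" and t: "\<And>n. 0 \<le> t n" "t \<longlonglongrightarrow> s" "0 \<le> s"
    and a: "a \<longlonglongrightarrow> \<alpha>" "norm \<alpha> = 1"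
  shows "(\<lambda>n. poisson_kernel (phi (t n) z) (a n)) \<longlonglongrightarrow> poisson_kernel (phi s z) \<alpha>"
proof -
  have "phi s z \<noteq> \<alpha>" using norm_phi[OF z, of s] a(2) by auto
  then show ?thesis by (intro tendsto_poisson_kernel phi_tendsto[OF z t] a(1))
qed

text \<open>A perturbation that is small relative to c, and hence to A and B, is multiplicative. The
  3 comes from A + B <= 3 A, which uses k <= 1.\<close>

lemma inverse_square_diff_le:
  fixes A B k c :: real
  assumes "0 < A" "0 < B" "0 \<le> k" "k \<le> 1" "\<bar>A - B\<bar> \<le> k * c" "c \<le> A" "c \<le> B"
  shows "\<bar>4 / A\<^sup>2 - 4 / B\<^sup>2\<bar> \<le> 3 * k * (4 / B\<^sup>2)"
proof -
  have "k * c \<le> k * A" using assms by (intro mult_left_mono) auto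
  then have 1: "\<bar>B - A\<bar> \<le> k * A" using assms(5) by linarith
  have "k * A \<le> 1 * A" using assms by (intro mult_right_mono) auto
  then have 2: "A + B \<le> 3 * A" using 1 by linarith
  have "B\<^sup>2 - A\<^sup>2 = (B - A) * (A + B)" by (simp add: power2_eq_square algebra_simps)
  then have "\<bar>B\<^sup>2 - A\<^sup>2\<bar> = \<bar>B - A\<bar> * (A + B)" using assms by (simp add: abs_mult)
  also have "\<dots> \<le> (k * A) * (3 * A)" using 1 2 assms by (intro mult_mono) auto
  finally have 3: "\<bar>B\<^sup>2 - A\<^sup>2\<bar> \<le> 3 * k * A\<^sup>2" by (simp add: power2_eq_square)
  have "4 / A\<^sup>2 - 4 / B\<^sup>2 = 4 * (B\<^sup>2 - A\<^sup>2) / (A\<^sup>2 * B\<^sup>2)" using assms by (simp add: divide_simps)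
  then have "\<bar>4 / A\<^sup>2 - 4 / B\<^sup>2\<bar> = 4 * \<bar>B\<^sup>2 - A\<^sup>2\<bar> / (A\<^sup>2 * B\<^sup>2)"
    by (simp only: abs_divide abs_mult abs_numeral abs_power2)
  also have "\<dots> \<le> 4 * (3 * k * A\<^sup>2) / (A\<^sup>2 * B\<^sup>2)" using 3 by (intro divide_right_mono mult_left_mono) auto
  also have "\<dots> = 3 * k * (4 / B\<^sup>2)" using assms by simp
  finally show ?thesis .
qed

text \<open>On the circle Re H = 0, so the kernel is 4 / |2 alpha + H (alpha - 1)|^2. Changing H by
  k moves the term inside by k |alpha - 1|, while its modulus is at least |alpha - 1|; the factor
  |alpha - 1| cancels and the estimate is uniform as alpha -> 1.\<close>

lemma hk_diff_le:
  assumes z: "z \<notin> ssupp" "norm z = 1" and a: "norm \<alpha> = 1" "\<alpha> \<noteq> 1"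
    and k: "norm (herg t z - herg s z) \<le> k" "k \<le> 1"
  shows "\<bar>poisson_kernel (phi t z) \<alpha> - poisson_kernel (phi s z) \<alpha>\<bar> \<le> 3 * k * poisson_kernel (phi s z) \<alpha>"
proof -
  have z1: "norm z \<le> 1" using z by simp
  define A B where "A = 2 * \<alpha> + herg t z * (\<alpha> - 1)" and "B = 2 * \<alpha> + herg s z * (\<alpha> - 1)"
  have ge: "norm (\<alpha> - 1) \<le> norm A" "norm (\<alpha> - 1) \<le> norm B"
    using norm_phi_denominator_ge[OF a(1), of "herg t z"] norm_phi_denominator_ge[OF a(1), of "herg s z"]
    by (simp_all add: A_def B_def Re_herg_sphere[OF z])
  have "A - B = (herg t z - herg s z) * (\<alpha> - 1)" by (simp add: A_def B_def algebra_simps)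
  then have "norm (A - B) \<le> k * norm (\<alpha> - 1)" using k by (simp add: norm_mult mult_right_mono)
  then have d: "\<bar>norm A - norm B\<bar> \<le> k * norm (\<alpha> - 1)" using norm_triangle_ineq3[of A B] by linarith
  have p: "0 < norm (\<alpha> - 1)" using a by simp
  have k0: "0 \<le> k" using k(1) norm_ge_zero order_trans by blast
  have "0 < norm A" "0 < norm B" using ge p by linarith+
  from inverse_square_diff_le[OF this k0 k(2) d ge] show ?thesis
    by (simp add: poisson_kernel_phi[OF z(1) z1] Re_herg_sphere[OF z] A_def[symmetric] B_def[symmetric])
qed

text \<open>(1 - r) / (1 + r) normalises the kernel at r omega to peak value 1 at omega. The bump
  tends to 0 off omega, and omega is not an atom, so its integral against m + sigma_s becomes
  arbitrarily small.\<close>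

lemma small_poisson_bump:
  assumes w: "norm \<omega> = 1" and e: "0 < e"
  obtains r where "0 \<le> r" "r < 1" "(1 - r) / (1 + r) * (1 + (\<integral>\<zeta>. poisson_kernel (of_real r * \<omega>) \<zeta> \<partial>smu s)) < e"
proof -
  have norm_w: "norm (complex_of_real (rad n) * \<omega>) = rad n" for n using w rad[of n] by (simp add: norm_mult)
  have "(\<lambda>n. (1 - rad n) / (1 + rad n)) \<longlonglongrightarrow> (1 - 1) / (1 + 1)" by (intro tendsto_intros tendsto_rad) auto
  then have 1: "(\<lambda>n. (1 - rad n) / (1 + rad n)) \<longlonglongrightarrow> 0" by simp
  \<comment> \<open>The bump is ((1 - r) / |zeta - r omega|)^2, visibly at most 1 on the
    circle.\<close>
  have pw: "(1 - rad n) / (1 + rad n) * poisson_kernel (of_real (rad n) * \<omega>) \<zeta> = (1 - rad n)\<^sup>2 / (norm (\<zeta> - of_real (rad n) * \<omega>))\<^sup>2" for n \<zeta>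
  proof -
    have "(1 - x) / (1 + x) * ((1 - x\<^sup>2) / y) = (1 - x)\<^sup>2 / y" if "0 \<le> x" for x y :: real
    proof -
      have "1 + x \<noteq> 0" "1 - x\<^sup>2 = (1 + x) * (1 - x)" using that by (auto simp: power2_eq_square algebra_simps)
      then show ?thesis by (simp add: power2_eq_square)
    qed
    then show ?thesis using rad(1)[of n] unfolding poisson_kernel_def norm_w by blast
  qed
  have "(\<lambda>n. \<integral>\<zeta>. (1 - rad n) / (1 + rad n) * poisson_kernel (of_real (rad n) * \<omega>) \<zeta> \<partial>smu s) \<longlonglongrightarrow> (\<integral>\<zeta>. 0 \<partial>smu s)"
  proof (rule integral_dominated_convergence[where w="\<lambda>_. 1"])
    have "{\<omega>} \<in> null_sets (smu s)"
      using measure_smu_singleton[of s \<omega>] w by (auto simp: null_sets_def smu.emeasure_eq_measure sets_borelT_iff)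
    from AE_not_in[OF this]
    show "AE \<zeta> in smu s. (\<lambda>n. (1 - rad n) / (1 + rad n) * poisson_kernel (of_real (rad n) * \<omega>) \<zeta>) \<longlonglongrightarrow> 0"
    proof eventually_elim
      case (elim \<zeta>)
      then have "(\<lambda>n. (1 - rad n)\<^sup>2 / (norm (\<zeta> - of_real (rad n) * \<omega>))\<^sup>2) \<longlonglongrightarrow> (1 - 1)\<^sup>2 / (norm (\<zeta> - of_real 1 * \<omega>))\<^sup>2"
        by (intro tendsto_intros tendsto_rad) auto
      then show "(\<lambda>n. (1 - rad n) / (1 + rad n) * poisson_kernel (of_real (rad n) * \<omega>) \<zeta>) \<longlonglongrightarrow> 0"
        unfolding pw by simp
    qed
    fix n
    show "AE \<zeta> in smu s. norm ((1 - rad n) / (1 + rad n) * poisson_kernel (of_real (rad n) * \<omega>) \<zeta>) \<le> 1"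
    proof (intro AE_I2)
      fix \<zeta> assume "\<zeta> \<in> space (smu s)"
      then have "1 - rad n \<le> norm (\<zeta> - of_real (rad n) * \<omega>)"
        using norm_triangle_ineq2[of \<zeta> "of_real (rad n) * \<omega>"] norm_w[of n] by simp
      then have "(1 - rad n)\<^sup>2 \<le> (norm (\<zeta> - of_real (rad n) * \<omega>))\<^sup>2" using rad[of n] by (intro power_mono) auto
      then show "norm ((1 - rad n) / (1 + rad n) * poisson_kernel (of_real (rad n) * \<omega>) \<zeta>) \<le> 1"
        unfolding pw by (simp add: divide_le_eq_1)
    qed
    show "(\<lambda>\<zeta>. (1 - rad n) / (1 + rad n) * poisson_kernel (of_real (rad n) * \<omega>) \<zeta>) \<in> borel_measurable (smu s)"
      unfolding borel_measurable_smu
      by (intro borel_measurable_times borel_measurable_const measurable_poisson_kernel_borelT)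
  qed simp_all
  then have 2: "(\<lambda>n. (1 - rad n) / (1 + rad n) * (\<integral>\<zeta>. poisson_kernel (of_real (rad n) * \<omega>) \<zeta> \<partial>smu s)) \<longlonglongrightarrow> 0" by simp
  have "(\<lambda>n. (1 - rad n) / (1 + rad n) * (1 + (\<integral>\<zeta>. poisson_kernel (of_real (rad n) * \<omega>) \<zeta> \<partial>smu s))) \<longlonglongrightarrow> 0"
    using tendsto_add[OF 1 2] by (simp add: distrib_left)
  from order_tendstoD(2)[OF this e] obtain n where
    "(1 - rad n) / (1 + rad n) * (1 + (\<integral>\<zeta>. poisson_kernel (of_real (rad n) * \<omega>) \<zeta> \<partial>smu s)) < e"
    by (auto simp: eventually_sequentially)
  then show ?thesis using that rad by blast
qed

text \<open>Within (1 - r)/4 of omega the distance to r omega is at most (5/4)(1 - r), and 25/16 <=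
  2. Poisson kernels serve as cut-off functions because their integrals against the
  Aleksandrov--Clark kernels are known exactly.\<close>

lemma poisson_bump_ge:
  assumes r: "0 \<le> r" "r < 1" and w: "norm \<omega> = 1" "norm \<zeta> = 1" and d: "norm (\<zeta> - \<omega>) < (1 - r) / 4"
  shows "1 / 2 \<le> (1 - r) / (1 + r) * poisson_kernel (of_real r * \<omega>) \<zeta>"
proof -
  have nw: "norm (of_real r * \<omega>) = r" using w r by (simp add: norm_mult)
  have e: "\<omega> - of_real r * \<omega> = of_real (1 - r) * \<omega>" by (simp add: algebra_simps)
  have "norm (\<omega> - of_real r * \<omega>) = 1 - r" unfolding e norm_mult norm_of_real using w r by simp
  then have "norm (\<zeta> - of_real r * \<omega>) \<le> 5/4 * (1 - r)"
    using norm_triangle_ineq[of "\<zeta> - \<omega>" "\<omega> - of_real r * \<omega>"] d by simp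
  then have "(norm (\<zeta> - of_real r * \<omega>))\<^sup>2 \<le> (5/4 * (1 - r))\<^sup>2" by (intro power_mono) auto
  also have "\<dots> = 25/16 * (1 - r)\<^sup>2" unfolding power_mult_distrib by (simp add: power_divide)
  also have "\<dots> \<le> 2 * (1 - r)\<^sup>2" by (intro mult_right_mono) auto
  finally have le: "(norm (\<zeta> - of_real r * \<omega>))\<^sup>2 \<le> 2 * (1 - r)\<^sup>2" .
  have "1 - r \<le> norm (\<zeta> - of_real r * \<omega>)"
    using norm_triangle_ineq2[of \<zeta> "of_real r * \<omega>"] nw w by simp
  then have "0 < norm (\<zeta> - of_real r * \<omega>)" using r by linarith
  then have p: "0 < (norm (\<zeta> - of_real r * \<omega>))\<^sup>2" by simp
  have "(1 - r) / (1 + r) * ((1 - r\<^sup>2) / y) = (1 - r)\<^sup>2 / y" for y :: real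
  proof -
    have "1 + r \<noteq> 0" "1 - r\<^sup>2 = (1 + r) * (1 - r)" using r by (auto simp: power2_eq_square algebra_simps)
    then show ?thesis by (simp add: power2_eq_square)
  qed
  then have "(1 - r) / (1 + r) * poisson_kernel (of_real r * \<omega>) \<zeta> = (1 - r)\<^sup>2 / (norm (\<zeta> - of_real r * \<omega>))\<^sup>2"
    unfolding poisson_kernel_def nw by blast
  moreover have "1/2 * (norm (\<zeta> - of_real r * \<omega>))\<^sup>2 \<le> (1 - r)\<^sup>2" using le by simp
  ultimately show ?thesis using p by (simp add: pos_le_divide_eq)
qed

lemma norm_cis_diff_le: "norm (cis a - cis b) \<le> \<bar>a - b\<bar>"
proof -
  have "norm (cis a - cis b) = norm (cis b * (cis (a - b) - 1))" by (simp add: algebra_simps cis_mult)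
  also have "\<dots> = norm (exp (\<i> * of_real (a - b)) - 1)" by (simp add: norm_mult cis_conv_exp)
  also have "\<dots> \<le> \<bar>a - b\<bar>" using dist_exp_i_1[of "a - b"] abs_sin_x_le_abs_x[of "(a - b)/2"] by (simp add: dist_norm)
  finally show ?thesis .
qed

lemma hk_dist_AE_nonneg: "integrable mT (\<lambda>\<zeta>. \<bar>poisson_kernel (phi t \<zeta>) \<alpha> - poisson_kernel (phi s \<zeta>) \<alpha>\<bar>)" if "norm \<alpha> = 1"
  using hk_integrable[OF that] by (intro integrable_abs Bochner_Integration.integrable_diff)

lemma hk_dist_at_1: "(\<integral>\<zeta>. \<bar>poisson_kernel (phi t \<zeta>) 1 - poisson_kernel (phi s \<zeta>) 1\<bar> \<partial>mT) = 0"
proof -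
  have "(\<integral>\<zeta>. \<bar>poisson_kernel (phi t \<zeta>) 1 - poisson_kernel (phi s \<zeta>) 1\<bar> \<partial>mT) = (\<integral>\<zeta>. 0 \<partial>mT)"
  proof (rule integral_cong_AE)
    show "AE \<zeta> in mT. \<bar>poisson_kernel (phi t \<zeta>) 1 - poisson_kernel (phi s \<zeta>) 1\<bar> = 0"
      using AE_not_ssupp AE_space[of mT]
      by eventually_elim (simp add: poisson_kernel_phi_1 Re_herg_sphere)
  qed (auto intro!: borel_measurable_abs borel_measurable_diff)
  then show ?thesis by simp
qed

text \<open>Away from \<open>\<alpha> = 1\<close> the kernels are bounded and dominated convergence applies.\<close>

lemma hk_dist_tendsto_generic:
  assumes t: "\<And>n. 0 \<le> t n" "t \<longlonglongrightarrow> s" "0 \<le> s" and a: "\<And>n. norm (a n) = 1" "a \<longlonglongrightarrow> \<alpha>" "\<alpha> \<noteq> 1"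
  shows "(\<lambda>n. \<integral>\<zeta>. \<bar>poisson_kernel (phi (t n) \<zeta>) (a n) - poisson_kernel (phi s \<zeta>) (a n)\<bar> \<partial>mT) \<longlonglongrightarrow> 0"
proof -
  have al: "norm \<alpha> = 1" using LIMSEQ_unique[OF tendsto_norm[OF a(2)]] a(1) by simp
  \<comment> \<open>Half the limiting distance to 1, eventually a lower bound for |a n - 1|; each of
    the two kernels is then at most 4 / d^2.\<close>
  define d where "d = norm (\<alpha> - 1) / 2"
  have d: "0 < d" "d < norm (\<alpha> - 1)" using a(3) by (auto simp: d_def)
  have "(\<lambda>n. norm (a n - 1)) \<longlonglongrightarrow> norm (\<alpha> - 1)" by (intro tendsto_intros a)
  from order_tendstoD(1)[OF this d(2)] obtain N where N: "\<And>n. n \<ge> N \<Longrightarrow> d < norm (a n - 1)"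
    by (auto simp: eventually_sequentially)
  have "(\<lambda>n. \<integral>\<zeta>. \<bar>poisson_kernel (phi (t (n + N)) \<zeta>) (a (n + N)) - poisson_kernel (phi s \<zeta>) (a (n + N))\<bar> \<partial>mT)
     \<longlonglongrightarrow> (\<integral>\<zeta>. 0 \<partial>mT)"
  proof (rule integral_dominated_convergence[where w="\<lambda>_. 8 / d\<^sup>2"])
    show "AE \<zeta> in mT. (\<lambda>n. \<bar>poisson_kernel (phi (t (n + N)) \<zeta>) (a (n + N)) - poisson_kernel (phi s \<zeta>) (a (n + N))\<bar>) \<longlonglongrightarrow> 0"
      using AE_not_ssupp AE_space[of mT]
    proof eventually_elim
      case (elim \<zeta>)
      then have z: "\<zeta> \<notin> ssupp" "norm \<zeta> \<le> 1" by auto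
      have "(\<lambda>n. \<bar>poisson_kernel (phi (t n) \<zeta>) (a n) - poisson_kernel (phi s \<zeta>) (a n)\<bar>) \<longlonglongrightarrow>
         \<bar>poisson_kernel (phi s \<zeta>) \<alpha> - poisson_kernel (phi s \<zeta>) \<alpha>\<bar>"
        using t by (intro tendsto_intros hk_tendsto[OF z] a al) auto
      then show ?case by (intro LIMSEQ_ignore_initial_segment) simp
    qed
    fix n
    have an: "a (n + N) \<noteq> 1" "d \<le> norm (a (n + N) - 1)" using N[of "n + N"] d(1) by auto
    have "0 < norm (a (n + N) - 1)" using an(2) d(1) by linarith
    then have "4 / (norm (a (n + N) - 1))\<^sup>2 \<le> 4 / d\<^sup>2"
      using an(2) d(1) by (intro divide_left_mono power_mono mult_pos_pos zero_less_power) auto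
    note le = order_trans[OF poisson_kernel_phi_le[OF _ _ a(1) an(1)] this]
    show "AE \<zeta> in mT. norm \<bar>poisson_kernel (phi (t (n + N)) \<zeta>) (a (n + N)) - poisson_kernel (phi s \<zeta>) (a (n + N))\<bar> \<le> 8 / d\<^sup>2"
      using AE_not_ssupp AE_space[of mT] hk_AE_nonneg[of "t (n + N)" "a (n + N)"] hk_AE_nonneg[of s "a (n + N)"]
    proof eventually_elim
      case (elim \<zeta>)
      then show ?case using le[of \<zeta> "t (n + N)"] le[of \<zeta> s] by (simp add: abs_le_iff)
    qed
  qed (auto intro!: borel_measurable_abs borel_measurable_diff)
  then show ?thesis by (simp add: LIMSEQ_offset)
qed

text \<open>Near \<open>\<alpha> = 1\<close>: outside small neighbourhoods of the (at most two) points where \<open>sgen\<close> accumulates at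
  the parameter \<open>s\<close> the kernels have ratio close to 1, and over these neighbourhoods the Aleksandrov--Clark measures
  have small mass, as they do in the limit.\<close>

lemma hk_dist_bound_singular:
  assumes t: "\<And>n. 0 \<le> t n" "\<And>n. t n \<le> 1" "t \<longlonglongrightarrow> s" "0 \<le> s" "s \<le> 1"
    and a: "\<And>n. norm (a n) = 1" "\<And>n. a n \<noteq> 1" "a \<longlonglongrightarrow> 1" and e: "0 < e"
  shows "\<exists>n. (\<integral>\<zeta>. \<bar>poisson_kernel (phi (t n) \<zeta>) (a n) - poisson_kernel (phi s \<zeta>) (a n)\<bar> \<partial>mT) < e"
proof -
  define \<omega>1 \<omega>2 where "\<omega>1 = cis (jumps s)" and "\<omega>2 = cis (jumps_right s)"
  have w: "norm \<omega>1 = 1" "norm \<omega>2 = 1" by (auto simp: \<omega>1_def \<omega>2_def)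
  \<comment> \<open>The limit of the bump terms in \<open>U\<close> is four times the sum of two
    such masses, hence below e/2.\<close>
  obtain r1 where r1: "0 \<le> r1" "r1 < 1" "(1 - r1) / (1 + r1) * (1 + (\<integral>\<zeta>. poisson_kernel (of_real r1 * \<omega>1) \<zeta> \<partial>smu s)) < e/16"
    using small_poisson_bump[OF w(1), of "e/16" s] e by auto
  obtain r2 where r2: "0 \<le> r2" "r2 < 1" "(1 - r2) / (1 + r2) * (1 + (\<integral>\<zeta>. poisson_kernel (of_real r2 * \<omega>2) \<zeta> \<partial>smu s)) < e/16"
    using small_poisson_bump[OF w(2), of "e/16" s] e by auto
  define c1 c2 where "c1 = (1 - r1) / (1 + r1)" and "c2 = (1 - r2) / (1 + r2)"
  define z1 z2 where "z1 = of_real r1 * \<omega>1" and "z2 = of_real r2 * \<omega>2"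
  have c: "0 \<le> c1" "0 \<le> c2" using r1 r2 by (auto simp: c1_def c2_def)
  have zD: "z1 \<in> DD" "z2 \<in> DD" using r1 r2 w by (auto simp: z1_def z2_def intro!: of_real_mult_DD)
  \<comment> \<open>A radius for which both bumps are at least 1/2 on the neighbourhoods of their
    centres.\<close>
  define \<rho> where "\<rho> = min ((1 - r1) / 4) ((1 - r2) / 4)"
  have \<rho>: "0 < \<rho>" using r1 r2 by (auto simp: \<rho>_def)
  obtain \<delta> where \<delta>: "0 < \<delta>" "\<And>x. \<bar>x - s\<bar> < \<delta> \<Longrightarrow> \<bar>jumps x - jumps s\<bar> < \<rho>/2 \<or> \<bar>jumps x - jumps_right s\<bar> < \<rho>/2"
    using jumps_near[of "\<rho>/2" s] \<rho> by auto
  \<comment> \<open>For x near s the point \<open>sgen x\<close> is within rho/2 of one of the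
    centres, so a zeta at distance rho from both stays rho/2 away from it; the Herglotz kernel there
    is at most 2 / (rho/2).\<close>
  have far: "norm (herg (t n) \<zeta> - herg s \<zeta>) \<le> 4 / \<rho> * \<bar>t n - s\<bar>"
    if tn: "\<bar>t n - s\<bar> < \<delta>" and z: "\<zeta> \<notin> ssupp" "norm \<zeta> = 1" and d: "\<rho> \<le> norm (\<zeta> - \<omega>1)" "\<rho> \<le> norm (\<zeta> - \<omega>2)" for n \<zeta>
  proof (rule herg_diff_le[OF z(1) t(4) t(1)])
    fix x assume "min s (t n) < x" "x \<le> max s (t n)"
    then have "\<bar>x - s\<bar> < \<delta>" using tn by (auto simp: min_def max_def split: if_splits)
    from \<delta>(2)[OF this] have "norm (sgen x - \<omega>1) < \<rho>/2 \<or> norm (sgen x - \<omega>2) < \<rho>/2"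
      using norm_cis_diff_le[of "jumps x" "jumps s"] norm_cis_diff_le[of "jumps x" "jumps_right s"]
      by (auto simp: sgen_def \<omega>1_def \<omega>2_def)
    then have "\<rho>/2 \<le> norm (sgen x - \<zeta>)"
      using d norm_triangle_ineq[of "\<zeta> - sgen x" "sgen x - \<omega>1"] norm_triangle_ineq[of "\<zeta> - sgen x" "sgen x - \<omega>2"]
      by (auto simp: norm_minus_commute)
    moreover have "norm (sgen x + \<zeta>) \<le> 2" using norm_triangle_ineq[of "sgen x" \<zeta>] z by simp
    ultimately have "norm ((sgen x + \<zeta>) / (sgen x - \<zeta>)) \<le> 2 / (\<rho>/2)"
      unfolding norm_divide using \<rho> by (intro frac_le) auto
    then show "norm ((sgen x + \<zeta>) / (sgen x - \<zeta>)) \<le> 4 / \<rho>" by simp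
  qed (use \<rho> in auto)
  \<comment> \<open>The first term is the multiplicative estimate, integrated with the bound 5 of
    \<open>hk_integral_le\<close>. The others are bump integrals, which
    \<open>poisson_phi_kernel\<close> evaluates as kernel values at z1 and z2; these converge as a n
    -> 1.\<close>
  define U where "U n = 3 * (4 / \<rho> * \<bar>t n - s\<bar>) * 5
     + 2 * (c1 * (poisson_kernel (phi (t n) z1) (a n) + poisson_kernel (phi s z1) (a n))
          + c2 * (poisson_kernel (phi (t n) z2) (a n) + poisson_kernel (phi s z2) (a n)))" for n
  have bound: "(\<integral>\<zeta>. \<bar>poisson_kernel (phi (t n) \<zeta>) (a n) - poisson_kernel (phi s \<zeta>) (a n)\<bar> \<partial>mT) \<le> U n"
    if tn: "\<bar>t n - s\<bar> < \<delta>" "4 / \<rho> * \<bar>t n - s\<bar> \<le> 1" for n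
  proof -
    let ?ht = "\<lambda>\<zeta>. poisson_kernel (phi (t n) \<zeta>) (a n)" and ?hs = "\<lambda>\<zeta>. poisson_kernel (phi s \<zeta>) (a n)"
    let ?k = "3 * (4 / \<rho> * \<bar>t n - s\<bar>)"
    let ?P1 = "poisson_kernel z1" and ?P2 = "poisson_kernel z2"
    let ?W = "\<lambda>\<zeta>. ?k * ?hs \<zeta> + 2 * (c1 * (?P1 \<zeta> * ?ht \<zeta> + ?P1 \<zeta> * ?hs \<zeta>) + c2 * (?P2 \<zeta> * ?ht \<zeta> + ?P2 \<zeta> * ?hs \<zeta>))"
    note ints = hk_integrable[OF a(1), of _ n] hk_poisson_integrable[OF a(1) zD(1), of _ n] hk_poisson_integrable[OF a(1) zD(2), of _ n]
    have "(\<integral>\<zeta>. \<bar>?ht \<zeta> - ?hs \<zeta>\<bar> \<partial>mT) \<le> (\<integral>\<zeta>. ?W \<zeta> \<partial>mT)"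
    proof (rule integral_mono_AE)
      show "AE \<zeta> in mT. \<bar>?ht \<zeta> - ?hs \<zeta>\<bar> \<le> ?W \<zeta>"
        using AE_not_ssupp AE_space[of mT] hk_AE_nonneg[of "t n" "a n"] hk_AE_nonneg[of s "a n"]
      proof eventually_elim
        case (elim \<zeta>)
        then have z: "\<zeta> \<notin> ssupp" "norm \<zeta> = 1" by auto
        have P: "0 \<le> ?P1 \<zeta>" "0 \<le> ?P2 \<zeta>" using zD by (auto simp: DD_def)
        have W: "?W \<zeta> = ?k * ?hs \<zeta> + 2 * ((c1 * ?P1 \<zeta>) * (?ht \<zeta> + ?hs \<zeta>) + (c2 * ?P2 \<zeta>) * (?ht \<zeta> + ?hs \<zeta>))"
          by (simp add: algebra_simps)
        have n1: "0 \<le> ?k * ?hs \<zeta>" using \<rho> elim by simp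
        have n2: "0 \<le> (c1 * ?P1 \<zeta>) * (?ht \<zeta> + ?hs \<zeta>)" "0 \<le> (c2 * ?P2 \<zeta>) * (?ht \<zeta> + ?hs \<zeta>)" using c P elim by simp_all
        \<comment> \<open>Near a centre the difference is bounded by the sum of the two kernels, at
          the price of twice the bump.\<close>
        have near: "?ht \<zeta> + ?hs \<zeta> \<le> 2 * (x * (?ht \<zeta> + ?hs \<zeta>))" if "1/2 \<le> x" for x
          using mult_right_mono[OF that, of "?ht \<zeta> + ?hs \<zeta>"] elim by simp
        have abs: "\<bar>?ht \<zeta> - ?hs \<zeta>\<bar> \<le> ?ht \<zeta> + ?hs \<zeta>" using elim by (simp add: abs_le_iff)
        have comb: "D \<le> K + 2 * (X + Y)" if "S \<le> 2 * X \<or> S \<le> 2 * Y" "D \<le> S" "0 \<le> K" "0 \<le> X" "0 \<le> Y"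
          for D S K X Y :: real using that by argo
        have comb': "D \<le> K + 2 * (X + Y)" if "D \<le> K" "0 \<le> X" "0 \<le> Y"
          for D K X Y :: real using that by argo
        consider "norm (\<zeta> - \<omega>1) < \<rho>" | "norm (\<zeta> - \<omega>2) < \<rho>" | "\<rho> \<le> norm (\<zeta> - \<omega>1)" "\<rho> \<le> norm (\<zeta> - \<omega>2)"
          by linarith
        then show ?case
        proof cases
          case 1
          then have "1/2 \<le> c1 * ?P1 \<zeta>" unfolding c1_def z1_def
            by (intro poisson_bump_ge r1 w z) (simp add: \<rho>_def)
          from near[OF this] show ?thesis unfolding W by (intro comb[OF disjI1 abs n1 n2])
        next
          case 2
          then have "1/2 \<le> c2 * ?P2 \<zeta>" unfolding c2_def z2_def
            by (intro poisson_bump_ge r2 w z) (simp add: \<rho>_def)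
          from near[OF this] show ?thesis unfolding W by (intro comb[OF disjI2 abs n1 n2])
        next
          case 3
          have "\<bar>?ht \<zeta> - ?hs \<zeta>\<bar> \<le> ?k * ?hs \<zeta>"
            by (rule hk_diff_le[OF z a(1,2) far[OF tn(1) z 3] tn(2)])
          then show ?thesis unfolding W by (rule comb'[OF _ n2])
        qed
      qed
      show "integrable mT (\<lambda>\<zeta>. \<bar>?ht \<zeta> - ?hs \<zeta>\<bar>)" by (rule hk_dist_AE_nonneg[OF a(1)])
      show "integrable mT ?W" using ints by simp
    qed
    also have "\<dots> = ?k * (\<integral>\<zeta>. ?hs \<zeta> \<partial>mT)
       + 2 * (c1 * ((\<integral>\<zeta>. ?P1 \<zeta> * ?ht \<zeta> \<partial>mT) + (\<integral>\<zeta>. ?P1 \<zeta> * ?hs \<zeta> \<partial>mT)) + c2 * ((\<integral>\<zeta>. ?P2 \<zeta> * ?ht \<zeta> \<partial>mT) + (\<integral>\<zeta>. ?P2 \<zeta> * ?hs \<zeta> \<partial>mT)))"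
      using ints by simp
    also have "\<dots> \<le> U n"
      unfolding U_def poisson_phi_kernel[OF t(1) zD(1) a(1,2)] poisson_phi_kernel[OF t(4) zD(1) a(1,2)]
        poisson_phi_kernel[OF t(1) zD(2) a(1,2)] poisson_phi_kernel[OF t(4) zD(2) a(1,2)]
      using hk_integral_le[OF a(1) t(4,5), of n] \<rho> by (intro add_right_mono mult_left_mono) auto
    finally show ?thesis .
  qed
  have z': "z1 \<notin> ssupp" "norm z1 \<le> 1" "z2 \<notin> ssupp" "norm z2 \<le> 1"
    using zD DD_not_ssupp by (auto simp: DD_def)
  have "U \<longlonglongrightarrow> 3 * (4 / \<rho> * \<bar>s - s\<bar>) * 5
     + 2 * (c1 * (poisson_kernel (phi s z1) 1 + poisson_kernel (phi s z1) 1)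
          + c2 * (poisson_kernel (phi s z2) 1 + poisson_kernel (phi s z2) 1))" (is "U \<longlonglongrightarrow> ?L")
    unfolding U_def[abs_def] using t z' a by (intro tendsto_intros hk_tendsto) auto
  moreover have "?L < e"
  proof -
    have "c1 * poisson_kernel (phi s z1) 1 < e/16" "c2 * poisson_kernel (phi s z2) 1 < e/16"
      unfolding poisson_phi_kernel_1(2)[OF zD(1)] poisson_phi_kernel_1(2)[OF zD(2)]
      using r1(3) r2(3) unfolding c1_def c2_def z1_def z2_def by simp_all
    then show ?thesis using e by (simp add: distrib_left)
  qed
  ultimately have 1: "\<forall>\<^sub>F n in sequentially. U n < e" by (rule order_tendstoD)
  have td: "(\<lambda>n. \<bar>t n - s\<bar>) \<longlonglongrightarrow> 0" using tendsto_rabs[OF tendsto_diff[OF t(3) tendsto_const, of s]] by simp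
  have 2: "\<forall>\<^sub>F n in sequentially. \<bar>t n - s\<bar> < \<delta>" using td \<delta>(1) by (rule order_tendstoD)
  have "(\<lambda>n. 4 / \<rho> * \<bar>t n - s\<bar>) \<longlonglongrightarrow> 4 / \<rho> * 0" by (intro tendsto_intros td)
  then have 3: "\<forall>\<^sub>F n in sequentially. 4 / \<rho> * \<bar>t n - s\<bar> < 1" by (intro order_tendstoD) auto
  from 1 2 3 have "\<forall>\<^sub>F n in sequentially. (\<integral>\<zeta>. \<bar>poisson_kernel (phi (t n) \<zeta>) (a n) - poisson_kernel (phi s \<zeta>) (a n)\<bar> \<partial>mT) < e"
  proof eventually_elim
    case (elim n)
    then show ?case using bound[of n] by linarith
  qed
  then show ?thesis by (auto simp: eventually_sequentially)
qed

text \<open>Uniformity in alpha by compactness of the circle: a failure yields sequences t n -> s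
  and alpha n -> alpha, and the limit alpha falls under one of the two preceding cases.\<close>

theorem hk_norm_continuous:
  assumes s: "0 \<le> s" "s \<le> 1" and e: "0 < e"
  shows "\<exists>\<delta>>0. \<forall>t\<in>{0..1}. \<bar>t - s\<bar> < \<delta> \<longrightarrow>
    (\<forall>\<alpha>. norm \<alpha> = 1 \<longrightarrow> (\<integral>\<zeta>. \<bar>poisson_kernel (phi t \<zeta>) \<alpha> - poisson_kernel (phi s \<zeta>) \<alpha>\<bar> \<partial>mT) < e)"
proof (rule ccontr)
  let ?D = "\<lambda>t \<alpha>. \<integral>\<zeta>. \<bar>poisson_kernel (phi t \<zeta>) \<alpha> - poisson_kernel (phi s \<zeta>) \<alpha>\<bar> \<partial>mT"
  assume c: "\<not> ?thesis"
  have "\<exists>t \<alpha>. t \<in> {0..1} \<and> \<bar>t - s\<bar> < 1 / real (Suc n) \<and> norm \<alpha> = 1 \<and> e \<le> ?D t \<alpha>" for n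
  proof (rule ccontr)
    assume "\<not> ?thesis"
    then have "\<forall>t\<in>{0..1}. \<bar>t - s\<bar> < 1 / real (Suc n) \<longrightarrow> (\<forall>\<alpha>. norm \<alpha> = 1 \<longrightarrow> ?D t \<alpha> < e)" by (meson not_le)
    moreover have "0 < 1 / real (Suc n)" by simp
    ultimately show False using c by blast
  qed
  then have "\<forall>n. \<exists>t \<alpha>. t \<in> {0..1} \<and> \<bar>t - s\<bar> < 1 / real (Suc n) \<and> norm \<alpha> = 1 \<and> e \<le> ?D t \<alpha>" by (rule allI)
  from choice[OF this] obtain t
    where "\<forall>n. \<exists>\<alpha>. t n \<in> {0..1} \<and> \<bar>t n - s\<bar> < 1 / real (Suc n) \<and> norm \<alpha> = 1 \<and> e \<le> ?D (t n) \<alpha>" by (elim exE)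
  from choice[OF this] obtain a
    where a: "\<forall>n. t n \<in> {0..1} \<and> \<bar>t n - s\<bar> < 1 / real (Suc n) \<and> norm (a n) = 1 \<and> e \<le> ?D (t n) (a n)" by (elim exE)
  have ta: "t n \<in> {0..1}" "\<bar>t n - s\<bar> < 1 / real (Suc n)" "norm (a n) = 1" "e \<le> ?D (t n) (a n)" for n
    using a[rule_format, of n] by blast+
  \<comment> \<open>At alpha = 1 both boundary kernels are 1 almost everywhere, so a term of a bad
    sequence cannot sit there.\<close>
  have an1: "a n \<noteq> 1" for n using ta(4)[of n] e hk_dist_at_1[of "t n" s] by auto
  have tl: "t \<longlonglongrightarrow> s"
  proof (rule LIM_zero_cancel, rule Lim_null_comparison)
    show "\<forall>\<^sub>F n in sequentially. norm (t n - s) \<le> 1 / real (Suc n)"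
      unfolding real_norm_def using ta(2) by (intro always_eventually allI less_imp_le)
    show "(\<lambda>n. 1 / real (Suc n)) \<longlonglongrightarrow> 0" by (rule LIMSEQ_Suc[OF lim_1_over_n])
  qed
  obtain \<alpha> r where r: "strict_mono r" "(a \<circ> r) \<longlonglongrightarrow> \<alpha>"
    using compact_sphere[of "0::complex" 1] ta(3) unfolding compact_def by (metis mem_sphere_0)
  have tr: "(\<lambda>n. t (r n)) \<longlonglongrightarrow> s" using LIMSEQ_subseq_LIMSEQ[OF tl r(1)] by (simp add: o_def)
  have ar: "(\<lambda>n. a (r n)) \<longlonglongrightarrow> \<alpha>" using r(2) by (simp add: o_def)
  have t01: "0 \<le> t n" "t n \<le> 1" for n using ta(1)[of n] by auto
  have "\<exists>n. ?D (t (r n)) (a (r n)) < e"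
  proof (cases "\<alpha> = 1")
    case True
    show ?thesis by (rule hk_dist_bound_singular) (use t01 tr s ta(3) an1 ar True e in auto)
  next
    case False
    have "(\<lambda>n. ?D (t (r n)) (a (r n))) \<longlonglongrightarrow> 0"
      by (rule hk_dist_tendsto_generic) (use t01 tr s ta(3) ar False in auto)
    from order_tendstoD(2)[OF this e] show ?thesis by (auto simp: eventually_sequentially)
  qed
  then show False using ta(4) by (meson not_le)
qed

section \<open>Norm continuity of the composition operators\<close>

lemma op_norm_le:
  assumes "x0 \<in> X" "N x0 \<le> 1" "\<And>x. x \<in> X \<Longrightarrow> N x \<le> 1 \<Longrightarrow> N (T x) \<le> c"
  shows "op_norm X N T \<le> c"
  unfolding op_norm_def by (rule cSup_least) (use assms in auto)

lemma norm_continuous_familyI: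
  assumes "x0 \<in> X" "N x0 \<le> 1"
    and "\<And>t e. \<lbrakk>0 \<le> t; t \<le> 1; 0 < e\<rbrakk> \<Longrightarrow> \<exists>\<delta>>0. \<forall>s\<in>{0..1}. \<bar>s - t\<bar> < \<delta> \<longrightarrow> (\<forall>x\<in>X. N x \<le> 1 \<longrightarrow> N (C s x - C t x) \<le> e)"
  shows "norm_continuous_family X N C"
  unfolding norm_continuous_family_def
proof (intro ballI allI impI)
  fix t e :: real assume t: "t \<in> {0..1}" and e: "0 < e"
  obtain \<delta> where d: "\<delta> > 0" "\<And>s x. s \<in> {0..1} \<Longrightarrow> \<bar>s - t\<bar> < \<delta> \<Longrightarrow> x \<in> X \<Longrightarrow> N x \<le> 1 \<Longrightarrow> N (C s x - C t x) \<le> e/2"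
    using assms(3)[of t "e/2"] t e by auto
  show "\<exists>\<delta>>0. \<forall>s\<in>{0..1}. \<bar>s - t\<bar> < \<delta> \<longrightarrow> op_norm X N (\<lambda>x. C s x - C t x) < e"
  proof (intro exI[of _ \<delta>] conjI ballI impI d(1))
    fix s assume "s \<in> {0..1::real}" "\<bar>s - t\<bar> < \<delta>"
    then have "op_norm X N (\<lambda>x. C s x - C t x) \<le> e/2"
      using d(2) by (intro op_norm_le[where N=N, OF assms(1,2)])
    then show "op_norm X N (\<lambda>x. C s x - C t x) < e" using e by simp
  qed
qed

definition hk_dist :: "real \<Rightarrow> real \<Rightarrow> complex \<Rightarrow> complex \<Rightarrow> real" where
  "hk_dist s t \<alpha> \<zeta> = \<bar>poisson_kernel (phi s \<zeta>) \<alpha> - poisson_kernel (phi t \<zeta>) \<alpha>\<bar>"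

lemma hk_dist_measurable:
  assumes "sets A = sets borelT"
  shows "(\<lambda>p. ennreal (hk_dist s t (fst p) (snd p))) \<in> borel_measurable (A \<Otimes>\<^sub>M mT)"
proof -
  have "(\<lambda>p. poisson_kernel (phi u (snd p)) (fst p)) \<in> borel_measurable (borelT \<Otimes>\<^sub>M borelT)" for u
    by (intro measurable_poisson_kernel fst_borelT measurable_compose[OF snd_borelT phi_measurable])
  then have "(\<lambda>p. hk_dist s t (fst p) (snd p)) \<in> borel_measurable (borelT \<Otimes>\<^sub>M borelT)"
    unfolding hk_dist_def by (intro borel_measurable_abs borel_measurable_diff)
  then have "(\<lambda>p. ennreal (hk_dist s t (fst p) (snd p))) \<in> borel_measurable (borelT \<Otimes>\<^sub>M borelT)" by simp
  then show ?thesis using measurable_cong_sets[OF sets_pair_measure_cong[OF assms sets_mT] refl] by blast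
qed

text \<open>Half of Schur's test: an L^1 bound in zeta that is uniform in alpha bounds the integral
  operator with kernel \<open>hk_dist\<close> from L^1(A) to L^1(m).\<close>

lemma hk_dist_Tonelli:
  assumes A: "finite_measure A" "sets A = sets borelT" and w: "w \<in> borel_measurable borelT"
    and D: "\<And>\<alpha>. norm \<alpha> = 1 \<Longrightarrow> (\<integral>\<zeta>. hk_dist s t \<alpha> \<zeta> \<partial>mT) \<le> D"
  shows "(\<integral>\<^sup>+\<zeta>. (\<integral>\<^sup>+\<alpha>. ennreal (hk_dist s t \<alpha> \<zeta>) * w \<alpha> \<partial>A) \<partial>mT) \<le> ennreal D * (\<integral>\<^sup>+\<alpha>. w \<alpha> \<partial>A)"
proof -
  interpret A: finite_measure A by fact
  interpret P: pair_sigma_finite A mT ..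
  have wA: "w \<in> borel_measurable A" using w measurable_cong_sets[OF A(2) refl] by blast
  have m: "(\<lambda>p. ennreal (hk_dist s t (fst p) (snd p)) * w (fst p)) \<in> borel_measurable (A \<Otimes>\<^sub>M mT)"
    using hk_dist_measurable[OF A(2)] measurable_compose[OF measurable_fst wA] by (rule borel_measurable_times_ennreal)
  have "(\<integral>\<^sup>+\<zeta>. (\<integral>\<^sup>+\<alpha>. ennreal (hk_dist s t \<alpha> \<zeta>) * w \<alpha> \<partial>A) \<partial>mT)
      = (\<integral>\<^sup>+\<alpha>. (\<integral>\<^sup>+\<zeta>. ennreal (hk_dist s t \<alpha> \<zeta>) * w \<alpha> \<partial>mT) \<partial>A)"
    using P.Fubini[of "\<lambda>p. ennreal (hk_dist s t (fst p) (snd p)) * w (fst p)"] m by simp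
  also have "\<dots> \<le> (\<integral>\<^sup>+\<alpha>. ennreal D * w \<alpha> \<partial>A)"
  proof (rule nn_integral_mono)
    fix \<alpha> assume "\<alpha> \<in> space A"
    then have a: "norm \<alpha> = 1" by (simp add: space_eq_sphere[OF A(2)])
    have mm: "(\<lambda>\<zeta>. ennreal (hk_dist s t \<alpha> \<zeta>)) \<in> borel_measurable mT"
      unfolding hk_dist_def by (auto intro!: borel_measurable_abs borel_measurable_diff)
    have "(\<integral>\<^sup>+\<zeta>. ennreal (hk_dist s t \<alpha> \<zeta>) \<partial>mT) = ennreal (\<integral>\<zeta>. hk_dist s t \<alpha> \<zeta> \<partial>mT)"
      using hk_dist_AE_nonneg[OF a, of s t] by (intro nn_integral_eq_integral) (auto simp: hk_dist_def)
    also have "\<dots> \<le> ennreal D" using D[OF a] by (rule ennreal_leI)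
    finally show "(\<integral>\<^sup>+\<zeta>. ennreal (hk_dist s t \<alpha> \<zeta>) * w \<alpha> \<partial>mT) \<le> ennreal D * w \<alpha>"
      using mm by (simp add: nn_integral_multc mult_right_mono)
  qed
  also have "\<dots> = ennreal D * (\<integral>\<^sup>+\<alpha>. w \<alpha> \<partial>A)" using wA by (rule nn_integral_cmult)
  finally show ?thesis .
qed

lemma poisson_kernel_integrable_wlist:
  assumes "finite_measure M" "sets M = sets borelT" "z \<in> DD"
  shows "integrable M (\<lambda>\<alpha>. complex_of_real (poisson_kernel z \<alpha>))" "integrable M (poisson_kernel z)"
  using assms by (auto intro!: integrable_bounded_borelT[where B="2/(1-norm z)\<^sup>2"] poisson_kernel_le simp: DD_def)

lemma wlist_hk_dist:
  assumes L: "wlist L" and st: "0 \<le> s" "0 \<le> t"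
    and D: "0 \<le> D" "\<And>\<alpha>. norm \<alpha> = 1 \<Longrightarrow> (\<integral>\<zeta>. hk_dist s t \<alpha> \<zeta> \<partial>mT) \<le> D"
  shows "(\<integral>\<^sup>+\<zeta>. ennreal (norm (wlist_int L (\<lambda>\<alpha>. of_real (poisson_kernel (phi s \<zeta>) \<alpha>))
     - wlist_int L (\<lambda>\<alpha>. of_real (poisson_kernel (phi t \<zeta>) \<alpha>)))) \<partial>mT) \<le> ennreal (D * wlist_mass L)"
  using L
proof (induction L)
  case (Cons p L)
  obtain c M where p: "p = (c, M)" by force
  have s: "finite_measure M" "sets M = sets borelT" and IH: "wlist L" using Cons.prems p by auto
  interpret M: finite_measure M by fact
  let ?W = "\<lambda>u \<zeta>. wlist_int L (\<lambda>\<alpha>. of_real (poisson_kernel (phi u \<zeta>) \<alpha>))"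
  have D0: "0 \<in> DD" by (simp add: DD_def)
  have Wm: "?W u \<in> borel_measurable borelT" if "0 \<le> u" for u
  proof -
    have "(\<lambda>\<zeta>. of_real (poisson_kernel 0 \<zeta>) * ?W u \<zeta>) \<in> borel_measurable mT"
      using wlist_hk_Fubini(1)[OF IH that D0] by (rule borel_measurable_integrable)
    then show ?thesis unfolding borel_measurable_mT[symmetric] by (subst measurable_cong[where g="\<lambda>\<zeta>. of_real (poisson_kernel 0 \<zeta>) * ?W u \<zeta>"]) auto
  qed
  have m1: "(\<lambda>\<zeta>. ennreal (norm (?W s \<zeta> - ?W t \<zeta>))) \<in> borel_measurable mT"
    using Wm st by (auto intro!: measurable_compose[OF borel_measurable_diff borel_measurable_norm] measurable_compose[OF _ measurable_ennreal])
  have m2: "(\<lambda>\<zeta>. \<integral>\<^sup>+\<alpha>. ennreal (hk_dist s t \<alpha> \<zeta>) \<partial>M) \<in> borel_measurable mT"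
  proof -
    have "(\<lambda>p. ennreal (hk_dist s t (snd p) (fst p))) \<in> borel_measurable (mT \<Otimes>\<^sub>M M)"
      using measurable_compose[OF measurable_pair_swap' hk_dist_measurable[OF s(2), of s t], unfolded case_prod_unfold] by simp
    then show ?thesis by (intro M.borel_measurable_nn_integral) (simp add: case_prod_unfold)
  qed
  have "(\<integral>\<^sup>+\<zeta>. ennreal (norm (wlist_int (p # L) (\<lambda>\<alpha>. of_real (poisson_kernel (phi s \<zeta>) \<alpha>))
     - wlist_int (p # L) (\<lambda>\<alpha>. of_real (poisson_kernel (phi t \<zeta>) \<alpha>)))) \<partial>mT)
     \<le> (\<integral>\<^sup>+\<zeta>. ennreal (norm c) * (\<integral>\<^sup>+\<alpha>. ennreal (hk_dist s t \<alpha> \<zeta>) \<partial>M) + ennreal (norm (?W s \<zeta> - ?W t \<zeta>)) \<partial>mT)"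
  proof (rule nn_integral_mono_AE)
    show "AE \<zeta> in mT. ennreal (norm (wlist_int (p # L) (\<lambda>\<alpha>. of_real (poisson_kernel (phi s \<zeta>) \<alpha>))
       - wlist_int (p # L) (\<lambda>\<alpha>. of_real (poisson_kernel (phi t \<zeta>) \<alpha>))))
       \<le> ennreal (norm c) * (\<integral>\<^sup>+\<alpha>. ennreal (hk_dist s t \<alpha> \<zeta>) \<partial>M) + ennreal (norm (?W s \<zeta> - ?W t \<zeta>))"
      using AE_not_ssupp AE_space[of mT]
    proof eventually_elim
      case (elim \<zeta>)
      then have "phi s \<zeta> \<in> DD" "phi t \<zeta> \<in> DD" by (auto intro!: phi_DD)
      then have i: "integrable M (poisson_kernel (phi s \<zeta>))" "integrable M (poisson_kernel (phi t \<zeta>))"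
        using poisson_kernel_integrable_wlist(2)[OF s] by auto
      have ih: "integrable M (\<lambda>\<alpha>. hk_dist s t \<alpha> \<zeta>)"
        unfolding hk_dist_def using i by (intro integrable_abs Bochner_Integration.integrable_diff)
      have "\<bar>integral\<^sup>L M (poisson_kernel (phi s \<zeta>)) - integral\<^sup>L M (poisson_kernel (phi t \<zeta>))\<bar> \<le> (\<integral>\<alpha>. hk_dist s t \<alpha> \<zeta> \<partial>M)"
        unfolding hk_dist_def Bochner_Integration.integral_diff[OF i, symmetric] by (rule integral_abs_bound)
      then have "norm c * norm (complex_of_real (integral\<^sup>L M (poisson_kernel (phi s \<zeta>)) - integral\<^sup>L M (poisson_kernel (phi t \<zeta>))))
         \<le> norm c * (\<integral>\<alpha>. hk_dist s t \<alpha> \<zeta> \<partial>M)" unfolding norm_of_real by (rule mult_left_mono) simp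
      moreover have "norm (wlist_int (p # L) (\<lambda>\<alpha>. of_real (poisson_kernel (phi s \<zeta>) \<alpha>))
       - wlist_int (p # L) (\<lambda>\<alpha>. of_real (poisson_kernel (phi t \<zeta>) \<alpha>)))
        \<le> norm c * norm (complex_of_real (integral\<^sup>L M (poisson_kernel (phi s \<zeta>)) - integral\<^sup>L M (poisson_kernel (phi t \<zeta>)))) + norm (?W s \<zeta> - ?W t \<zeta>)"
        unfolding norm_mult[symmetric]
        by (rule order_trans[OF eq_refl norm_triangle_ineq]) (simp add: p algebra_simps)
      ultimately have "norm (wlist_int (p # L) (\<lambda>\<alpha>. of_real (poisson_kernel (phi s \<zeta>) \<alpha>))
       - wlist_int (p # L) (\<lambda>\<alpha>. of_real (poisson_kernel (phi t \<zeta>) \<alpha>)))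
        \<le> norm c * (\<integral>\<alpha>. hk_dist s t \<alpha> \<zeta> \<partial>M) + norm (?W s \<zeta> - ?W t \<zeta>)" by linarith
      moreover have "(\<integral>\<^sup>+\<alpha>. ennreal (hk_dist s t \<alpha> \<zeta>) \<partial>M) = ennreal (\<integral>\<alpha>. hk_dist s t \<alpha> \<zeta> \<partial>M)"
        using ih by (intro nn_integral_eq_integral) (auto simp: hk_dist_def)
      moreover have "0 \<le> (\<integral>\<alpha>. hk_dist s t \<alpha> \<zeta> \<partial>M)" by (intro Bochner_Integration.integral_nonneg) (simp add: hk_dist_def)
      ultimately show ?case by (simp add: ennreal_leI flip: ennreal_mult ennreal_plus)
    qed
  qed
  also have "\<dots> = ennreal (norm c) * (\<integral>\<^sup>+\<zeta>. (\<integral>\<^sup>+\<alpha>. ennreal (hk_dist s t \<alpha> \<zeta>) \<partial>M) \<partial>mT) + (\<integral>\<^sup>+\<zeta>. ennreal (norm (?W s \<zeta> - ?W t \<zeta>)) \<partial>mT)"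
    using m1 m2 by (subst nn_integral_add) (auto simp: nn_integral_cmult)
  also have "\<dots> \<le> ennreal (norm c) * (ennreal D * ennreal (measure M (sphere 0 1))) + ennreal (D * wlist_mass L)"
  proof (intro add_mono mult_left_mono Cons.IH IH)
    show "(\<integral>\<^sup>+\<zeta>. (\<integral>\<^sup>+\<alpha>. ennreal (hk_dist s t \<alpha> \<zeta>) \<partial>M) \<partial>mT) \<le> ennreal D * ennreal (measure M (sphere 0 1))"
      using hk_dist_Tonelli[OF s, of "\<lambda>_. 1" s t D] D(2) M.emeasure_eq_measure[of "sphere 0 1"]
      by (simp add: space_eq_sphere[OF s(2)])
  qed auto
  also have "\<dots> = ennreal (D * wlist_mass (p # L))"
  proof -
    have "0 \<le> wlist_mass L" unfolding wlist_mass_def by (auto intro!: sum_list_nonneg)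
    then show ?thesis using D(1) by (simp add: p algebra_simps flip: ennreal_mult ennreal_plus)
  qed
  finally show ?case .
qed simp

lemma sum_norm_dlist_le:
  fixes f :: "complex \<Rightarrow> complex"
  assumes f: "integrable mT f" and I: "finite (I :: nat set)" "\<And>i. i \<in> I \<Longrightarrow> E i \<in> sets borelT" "disjoint_family_on E I"
  shows "(\<Sum>i\<in>I. norm (\<integral>x. indicator (E i) x * f x \<partial>mT)) \<le> (\<integral>x. norm (f x) \<partial>mT)"
proof -
  have i: "integrable mT (\<lambda>x. indicator (E i) x * f x)" if "i \<in> I" for i
    using I(2)[OF that] by (intro integrable_bounded_mult[OF f, where B=1]) (auto simp: indicator_def)
  have "(\<Sum>i\<in>I. norm (\<integral>x. indicator (E i) x * f x \<partial>mT)) \<le> (\<Sum>i\<in>I. \<integral>x. norm (indicator (E i) x * f x) \<partial>mT)"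
    by (intro sum_mono integral_norm_bound)
  also have "\<dots> = (\<integral>x. (\<Sum>i\<in>I. norm (indicator (E i) x * f x)) \<partial>mT)"
    using i by (subst Bochner_Integration.integral_sum) auto
  also have "\<dots> \<le> (\<integral>x. norm (f x) \<partial>mT)"
  proof (rule integral_mono)
    fix x
    have "(\<Sum>i\<in>I. norm (indicator (E i) x * f x)) = (\<Sum>i\<in>I. indicator (E i) x) * norm (f x)"
      unfolding sum_distrib_right by (intro sum.cong refl) (auto simp: indicator_def)
    also have "(\<Sum>i\<in>I. indicator (E i) x) = (indicator (\<Union>i\<in>I. E i) x :: real)"
      by (rule indicator_UN_disjoint[symmetric, OF I(1,3)])
    finally show "(\<Sum>i\<in>I. norm (indicator (E i) x * f x)) \<le> norm (f x)" by (auto simp: indicator_def)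
  qed (use i f in auto)
  finally show ?thesis .
qed

lemma measure_smu_diff:
  assumes st: "0 \<le> s" "s \<le> t" and E: "E \<in> sets borelT"
  shows "0 \<le> measure (smu t) E - measure (smu s) E" "measure (smu t) E - measure (smu s) E \<le> t - s"
proof -
  have mono: "measure (smu s) F \<le> measure (smu t) F" if F: "F \<in> sets borelT" for F
  proof -
    have "{x \<in> space borel. sgen x \<in> F} \<in> sets borel" using measurable_sets[OF sgen_measurable F] by (simp add: vimage_def)
    then have "{x\<in>{0..t}. sgen x \<in> F} \<in> sets lborel"
      by (simp add: Collect_conj_eq[where P="\<lambda>x. x \<in> {0..t}", simplified] Collect_mem_eq sets.Int)
    then have "emeasure (smu s) F \<le> emeasure (smu t) F"
      unfolding emeasure_smu[OF F] using st by (intro emeasure_mono) auto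
    then show ?thesis by (simp add: smu.emeasure_eq_measure)
  qed
  show "0 \<le> measure (smu t) E - measure (smu s) E" using mono[OF E] by simp
  have T: "sphere 0 1 \<in> sets borelT" using sets.top[of borelT] by simp
  have "measure (smu s) (sphere 0 1 - E) \<le> measure (smu t) (sphere 0 1 - E)" using T E by (intro mono) auto
  then show "measure (smu t) E - measure (smu s) E \<le> t - s"
    using smu.finite_measure_compl[of E s] smu.finite_measure_compl[of E t] E st by (simp add: measure_smu_sphere)
qed

lemma sum_measure_smu_diff:
  assumes st: "0 \<le> s" "0 \<le> t" and I: "finite (I :: nat set)" "\<And>i. i \<in> I \<Longrightarrow> E i \<in> sets borelT" "disjoint_family_on E I"
  shows "(\<Sum>i\<in>I. \<bar>measure (smu s) (E i) - measure (smu t) (E i)\<bar>) \<le> \<bar>s - t\<bar>"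
proof -
  have main: "(\<Sum>i\<in>I. \<bar>measure (smu b) (E i) - measure (smu a) (E i)\<bar>) \<le> b - a" if ab: "0 \<le> a" "a \<le> b" for a b
  proof -
    have "(\<Sum>i\<in>I. \<bar>measure (smu b) (E i) - measure (smu a) (E i)\<bar>) = (\<Sum>i\<in>I. measure (smu b) (E i)) - (\<Sum>i\<in>I. measure (smu a) (E i))"
      unfolding sum_subtractf[symmetric] using measure_smu_diff(1)[OF ab I(2)] by (intro sum.cong refl) simp
    also have "\<dots> = measure (smu b) (\<Union>i\<in>I. E i) - measure (smu a) (\<Union>i\<in>I. E i)"
      using I by (subst (1 2) smu.finite_measure_finite_Union) auto
    also have "\<dots> \<le> b - a" using I by (intro measure_smu_diff(2)[OF ab]) auto
    finally show ?thesis .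
  qed
  show ?thesis
  proof (cases "s \<le> t")
    case True then show ?thesis using main[of s t] st by (simp add: abs_minus_commute)
  next
    case False then show ?thesis using main[of t s] st by simp
  qed
qed

text \<open>The singular parts differ by mu{1} (sigma_s - sigma_t), which gives |s - t|. The
  absolutely continuous parts are handled by the kernel distance, the 4 being the mass of the Jordan
  list.\<close>

lemma tv_norm_compM_diff:
  assumes m: "cmeasure \<mu>" "tv_norm \<mu> \<le> 1" and st: "0 \<le> s" "0 \<le> t"
    and D: "0 \<le> D" "\<And>\<alpha>. norm \<alpha> = 1 \<Longrightarrow> (\<integral>\<zeta>. hk_dist s t \<alpha> \<zeta> \<partial>mT) \<le> D"
  shows "tv_norm (compM (phi s) \<mu> - compM (phi t) \<mu>) \<le> \<bar>s - t\<bar> + 4 * D"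
proof (rule tv_norm_le)
  fix I :: "nat set" and E assume I: "finite I" "\<And>i. i \<in> I \<Longrightarrow> E i \<in> sets borelT" "disjoint_family_on E I"
  let ?g = "\<lambda>u \<zeta>. poisson_meas \<mu> (phi u \<zeta>)"
  have ig: "integrable mT (?g s)" "integrable mT (?g t)" using m st by (auto intro: poisson_meas_phi_integrable)
  have one: "{1} \<in> sets borelT" by (simp add: sets_borelT_iff)
  have eq: "(compM (phi s) \<mu> - compM (phi t) \<mu>) F =
     \<mu> {1} * of_real (measure (smu s) F - measure (smu t) F) + (\<integral>x. indicator F x * (?g s x - ?g t x) \<partial>mT)"
    if F: "F \<in> sets borelT" for F
  proof -
    have "integrable mT (\<lambda>x. indicator F x * ?g u x)" if "integrable mT (?g u)" for u
      using F by (intro integrable_bounded_mult[OF that, where B=1]) (auto simp: indicator_def)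
    then have "(\<integral>x. indicator F x * (?g s x - ?g t x) \<partial>mT) = (\<integral>x. indicator F x * ?g s x \<partial>mT) - (\<integral>x. indicator F x * ?g t x \<partial>mT)"
      using ig by (simp add: right_diff_distrib)
    then show ?thesis unfolding minus_apply compM_phi[OF m(1) st(1)] compM_phi[OF m(1) st(2)] comp_list_def
      using F by (simp add: wlist_meas_Cons wlist_meas_dlist[OF ig(1)] wlist_meas_dlist[OF ig(2)] algebra_simps)
  qed
  have "(\<Sum>i\<in>I. norm ((compM (phi s) \<mu> - compM (phi t) \<mu>) (E i)))
    \<le> (\<Sum>i\<in>I. norm (\<mu> {1}) * \<bar>measure (smu s) (E i) - measure (smu t) (E i)\<bar> + norm (\<integral>x. indicator (E i) x * (?g s x - ?g t x) \<partial>mT))"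
  proof (rule sum_mono)
    fix i assume "i \<in> I"
    show "norm ((compM (phi s) \<mu> - compM (phi t) \<mu>) (E i)) \<le> norm (\<mu> {1}) * \<bar>measure (smu s) (E i) - measure (smu t) (E i)\<bar>
      + norm (\<integral>x. indicator (E i) x * (?g s x - ?g t x) \<partial>mT)"
      unfolding eq[OF I(2)[OF \<open>i \<in> I\<close>]] by (rule order_trans[OF norm_triangle_ineq]) (simp add: norm_mult del: of_real_diff)
  qed
  also have "\<dots> = norm (\<mu> {1}) * (\<Sum>i\<in>I. \<bar>measure (smu s) (E i) - measure (smu t) (E i)\<bar>)
     + (\<Sum>i\<in>I. norm (\<integral>x. indicator (E i) x * (?g s x - ?g t x) \<partial>mT))"
    by (simp add: sum.distrib sum_distrib_left)
  also have "\<dots> \<le> 1 * \<bar>s - t\<bar> + 4 * D"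
  proof (intro add_mono mult_mono sum_measure_smu_diff st I)
    show "norm (\<mu> {1}) \<le> 1" using norm_le_tv_norm[OF m(1) one] m(2) by simp
    have "(\<Sum>i\<in>I. norm (\<integral>x. indicator (E i) x * (?g s x - ?g t x) \<partial>mT)) \<le> (\<integral>x. norm (?g s x - ?g t x) \<partial>mT)"
      using ig I by (intro sum_norm_dlist_le) auto
    also have "\<dots> \<le> D * wlist_mass (jordan \<mu>)"
    proof (rule integral_real_bounded)
      have "0 \<le> wlist_mass (jordan \<mu>)" unfolding wlist_mass_def by (auto intro!: sum_list_nonneg)
      then show "0 \<le> D * wlist_mass (jordan \<mu>)" using D(1) by simp
      show "(\<integral>\<^sup>+x. ennreal (norm (?g s x - ?g t x)) \<partial>mT) \<le> ennreal (D * wlist_mass (jordan \<mu>))"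
        unfolding poisson_meas_def cintegral_jordan by (rule wlist_hk_dist[OF wlist_jordan[OF m(1)] st D])
    qed
    also have "\<dots> \<le> D * (4 * 1)"
      using wlist_mass_jordan_le[OF m(1)] m(2) D(1) by (intro mult_left_mono) auto
    finally show "(\<Sum>i\<in>I. norm (\<integral>x. indicator (E i) x * (?g s x - ?g t x) \<partial>mT)) \<le> 4 * D" by simp
  qed (auto intro: sum_nonneg)
  finally show "(\<Sum>i\<in>I. norm ((compM (phi s) \<mu> - compM (phi t) \<mu>) (E i))) \<le> \<bar>s - t\<bar> + 4 * D" by simp
qed

theorem norm_continuous_M: "norm_continuous_family Mspace tv_norm (\<lambda>t. compM (phi t))"
proof (rule norm_continuous_familyI)
  show "(\<lambda>_. 0) \<in> Mspace" by (simp add: Mspace_def cmeasure_zero)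
  show "tv_norm (\<lambda>_. 0) \<le> 1" by (rule tv_norm_le) simp
  fix t e :: real assume t: "0 \<le> t" "t \<le> 1" and e: "0 < e"
  obtain \<delta> where d: "0 < \<delta>" "\<And>s \<alpha>. s \<in> {0..1} \<Longrightarrow> \<bar>s - t\<bar> < \<delta> \<Longrightarrow> norm \<alpha> = 1 \<Longrightarrow> (\<integral>\<zeta>. hk_dist s t \<alpha> \<zeta> \<partial>mT) < e / 8"
    using hk_norm_continuous[OF t, of "e/8"] e unfolding hk_dist_def by auto
  show "\<exists>\<delta>>0. \<forall>s\<in>{0..1}. \<bar>s - t\<bar> < \<delta> \<longrightarrow> (\<forall>x\<in>Mspace. tv_norm x \<le> 1 \<longrightarrow> tv_norm (compM (phi s) x - compM (phi t) x) \<le> e)"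
  \<comment> \<open>Half of e for |s - t|, the other half for 4 * (e/8).\<close>
  proof (intro exI[of _ "min \<delta> (e/2)"] conjI ballI impI)
    fix s x assume s: "s \<in> {0..1}" "\<bar>s - t\<bar> < min \<delta> (e/2)" and x: "x \<in> Mspace" "tv_norm x \<le> 1"
    have "tv_norm (compM (phi s) x - compM (phi t) x) \<le> \<bar>s - t\<bar> + 4 * (e / 8)"
      using s x t e d(2)[OF s(1)] by (intro tv_norm_compM_diff) (auto simp: Mspace_def less_imp_le)
    then show "tv_norm (compM (phi s) x - compM (phi t) x) \<le> e" using s by simp
  qed (use d e in auto)
qed

section \<open>A weak Jensen inequality and the L^p estimates\<close>

text \<open>Either x <= c or (x/c)^(p-1) >= 1. The scale c is free and gets optimised in
  \<open>jensen_weak\<close>.\<close>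

lemma powr_interpolation:
  fixes x c p :: real
  assumes "0 \<le> x" "0 < c" "1 \<le> p"
  shows "x \<le> x powr p * c powr (1 - p) + c"
proof (cases "x \<le> c")
  case True
  have "0 \<le> x powr p * c powr (1 - p)" by simp
  then show ?thesis using True by linarith
next
  case False
  then have x: "0 < x" "c < x" using assms by auto
  have "1 \<le> (x / c) powr (p - 1)" using x assms by (intro ge_one_powr_ge_zero) auto
  also have "\<dots> = x powr (p - 1) * c powr (1 - p)"
    using x assms by (simp add: powr_divide powr_diff divide_simps)
  finally have "x * 1 \<le> x * (x powr (p - 1) * c powr (1 - p))" using x by (intro mult_left_mono) auto
  moreover have "x * x powr (p - 1) = x powr p" using x powr_mult_base[of x "p - 1"] by simp
  ultimately have "x \<le> x powr p * c powr (1 - p)" by (simp add: mult.assoc[symmetric])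
  then show ?thesis using assms by linarith
qed

text \<open>Integrating \<open>powr_interpolation\<close> gives c^(1-p) I + 2 c, and c = I^(1/p)
  makes this 3 c. Mass 2 is allowed because the weight of main interest is the modulus of a
  difference of two Poisson kernels.\<close>

lemma jensen_weak:
  fixes k F :: "'a \<Rightarrow> real"
  assumes k: "\<And>x. x \<in> space M \<Longrightarrow> 0 \<le> k x" "integrable M k" "(\<integral>x. k x \<partial>M) \<le> 2"
    and F: "\<And>x. 0 \<le> F x" "integrable M (\<lambda>x. k x * F x)" "integrable M (\<lambda>x. k x * F x powr p)" and p: "1 \<le> p"
  shows "(\<integral>x. k x * F x \<partial>M) \<le> 3 * (\<integral>x. k x * F x powr p \<partial>M) powr (1/p)"
proof -
  let ?I = "\<integral>x. k x * F x powr p \<partial>M"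
  have I0: "0 \<le> ?I" using k by (intro Bochner_Integration.integral_nonneg) auto
  have main: "(\<integral>x. k x * F x \<partial>M) \<le> c powr (1 - p) * ?I + 2 * c" if c: "0 < c" for c
  proof -
    have "(\<integral>x. k x * F x \<partial>M) \<le> (\<integral>x. c powr (1 - p) * (k x * F x powr p) + c * k x \<partial>M)"
    proof (rule integral_mono)
      fix x assume "x \<in> space M"
      then have "k x * F x \<le> k x * (F x powr p * c powr (1 - p) + c)"
        using k F c p by (intro mult_left_mono powr_interpolation) auto
      then show "k x * F x \<le> c powr (1 - p) * (k x * F x powr p) + c * k x" by (simp add: algebra_simps)
    qed (use k F in auto)
    also have "\<dots> = c powr (1 - p) * ?I + c * (\<integral>x. k x \<partial>M)" using k F by simp
    also have "\<dots> \<le> c powr (1 - p) * ?I + c * 2" using k c by (intro add_left_mono mult_left_mono) auto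
    finally show ?thesis by simp
  qed
  show ?thesis
  proof (cases "?I = 0")
    \<comment> \<open>There is no optimal scale when I = 0; letting c tend to 0 forces the left side
      to be nonpositive.\<close>
    case True
    have "(\<integral>x. k x * F x \<partial>M) \<le> e" if "0 < e" for e using main[of "e/2"] that True by simp
    then show ?thesis using True field_le_epsilon[of "\<integral>x. k x * F x \<partial>M" 0] by simp
  next
    case False
    define c where "c = ?I powr (1/p)"
    have c: "0 < c" using False I0 by (simp add: c_def)
    have "?I = c powr p" using I0 p by (simp add: c_def powr_powr)
    then have "c powr (1 - p) * ?I = c" using c by (simp add: powr_add[symmetric])
    then show ?thesis using main[OF c] by (simp add: c_def)
  qed
qed

lemma le_one_plus_powr: "0 \<le> x \<Longrightarrow> 1 \<le> p \<Longrightarrow> x \<le> x powr p + (1::real)"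
  using powr_interpolation[of x 1 p] by simp

lemma Lp_integrable:
  assumes "f \<in> Lp p" "1 \<le> p"
  shows "integrable mT f" "integrable mT (\<lambda>x. norm (f x) powr p)" "f \<in> borel_measurable borelT"
proof -
  show i: "integrable mT (\<lambda>x. norm (f x) powr p)" and m: "f \<in> borel_measurable borelT" using assms by (auto simp: Lp_def)
  show "integrable mT f"
  proof (rule Bochner_Integration.integrable_bound)
    show "integrable mT (\<lambda>x. norm (f x) powr p + 1)" using i by simp
    show "AE x in mT. norm (f x) \<le> norm (norm (f x) powr p + 1)"
      using assms(2) le_one_plus_powr[of "norm (f _)" p] by (intro AE_I2) (simp add: abs_of_nonneg add_nonneg_nonneg)
  qed (use m in simp)
qed

lemma Lp_norm_le_iff:
  assumes "1 \<le> p" "0 \<le> c"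
  shows "(\<integral>x. norm (f x) powr p \<partial>mT) \<le> c powr p \<Longrightarrow> Lp_norm p f \<le> c"
proof -
  assume "(\<integral>x. norm (f x) powr p \<partial>mT) \<le> c powr p"
  then have "(\<integral>x. norm (f x) powr p \<partial>mT) powr (1/p) \<le> (c powr p) powr (1/p)"
    using assms by (intro powr_mono2) (auto intro: Bochner_Integration.integral_nonneg)
  then show ?thesis using assms by (simp add: Lp_norm_def powr_powr)
qed

lemma Lp_norm_powr: "1 \<le> p \<Longrightarrow> Lp_norm p f powr p = (\<integral>x. norm (f x) powr p \<partial>mT)"
  unfolding Lp_norm_def by (subst powr_powr) (auto intro: Bochner_Integration.integral_nonneg)

lemma Lp_norm_nonneg: "0 \<le> Lp_norm p f"
  by (simp add: Lp_norm_def)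

lemma Lp_norm_le_1: "1 \<le> p \<Longrightarrow> Lp_norm p f \<le> 1 \<Longrightarrow> (\<integral>x. norm (f x) powr p \<partial>mT) \<le> 1"
  using powr_mono2[of p "Lp_norm p f" 1] Lp_norm_powr[of p f] Lp_norm_nonneg[of p f] by simp

text \<open>Here the weak Jensen inequality is applied in alpha for fixed zeta. The p-th power of
  the norm is thereby linear in |f|^p, ready for \<open>hk_dist_Tonelli\<close>.\<close>

lemma poisson_fun_phi_diff_powr_le:
  assumes f: "f \<in> Lp p" and p: "1 \<le> p" and z: "\<zeta> \<notin> ssupp" "norm \<zeta> = 1"
  shows "ennreal (norm (poisson_fun f (phi s \<zeta>) - poisson_fun f (phi t \<zeta>)) powr p)
    \<le> ennreal (3 powr p) * (\<integral>\<^sup>+\<alpha>. ennreal (hk_dist s t \<alpha> \<zeta>) * ennreal (norm (f \<alpha>) powr p) \<partial>mT)"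
proof -
  note fi = Lp_integrable[OF f p]
  have D: "phi s \<zeta> \<in> DD" "phi t \<zeta> \<in> DD" using z by (auto intro!: phi_DD)
  define k where "k \<alpha> = hk_dist s t \<alpha> \<zeta>" for \<alpha>
  have km: "k \<in> borel_measurable borelT" unfolding k_def[abs_def] hk_dist_def
    by (intro borel_measurable_abs borel_measurable_diff measurable_poisson_kernel_borelT)
  define B where "B = 2/(1-norm (phi s \<zeta>))\<^sup>2 + 2/(1-norm (phi t \<zeta>))\<^sup>2"
  have pk: "0 \<le> poisson_kernel (phi u \<zeta>) \<alpha>" for u \<alpha> using norm_phi[OF z(1), of u] z by (intro poisson_kernel_nonneg) simp
  have kB: "norm (k \<alpha>) \<le> B" if "norm \<alpha> = 1" for \<alpha>
  proof -
    have le: "poisson_kernel (phi s \<zeta>) \<alpha> \<le> 2/(1-norm (phi s \<zeta>))\<^sup>2" "poisson_kernel (phi t \<zeta>) \<alpha> \<le> 2/(1-norm (phi t \<zeta>))\<^sup>2"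
      using D that by (auto simp: DD_def intro!: poisson_kernel_le)
    have "\<bar>a - b\<bar> \<le> A + B" if "a \<le> A" "b \<le> B" "0 \<le> a" "0 \<le> b" for a b A B :: real using that by linarith
    from this[OF le pk pk] show ?thesis by (simp add: k_def hk_dist_def B_def)
  qed
  have ki: "integrable mT k" using km kB by (rule integrable_mT_bounded)
  have k0: "0 \<le> k \<alpha>" for \<alpha> by (simp add: k_def hk_dist_def)
  have kint: "integrable mT (\<lambda>\<alpha>. k \<alpha> * F \<alpha>)" if "integrable mT F" for F :: "complex \<Rightarrow> real"
  proof (rule Bochner_Integration.integrable_bound)
    show "integrable mT (\<lambda>\<alpha>. B * F \<alpha>)" using that by simp
    show "AE \<alpha> in mT. norm (k \<alpha> * F \<alpha>) \<le> norm (B * F \<alpha>)"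
      using kB by (intro AE_I2) (auto simp: abs_mult intro!: mult_right_mono intro: order_trans[OF _ abs_ge_self])
  qed (use km that in \<open>auto intro!: borel_measurable_times\<close>)
  have k2: "(\<integral>\<alpha>. k \<alpha> \<partial>mT) \<le> 2"
  proof -
    have "(\<integral>\<alpha>. k \<alpha> \<partial>mT) \<le> (\<integral>\<alpha>. poisson_kernel (phi s \<zeta>) \<alpha> + poisson_kernel (phi t \<zeta>) \<alpha> \<partial>mT)"
      using ki integrable_poisson_kernel[OF D(1)] integrable_poisson_kernel[OF D(2)] pk
      by (intro integral_mono) (auto simp: k_def hk_dist_def abs_le_iff)
    also have "\<dots> = 2" using integrable_poisson_kernel[OF D(1)] integrable_poisson_kernel[OF D(2)]
        integral_poisson_kernel[OF D(1)] integral_poisson_kernel[OF D(2)] by simp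
    finally show ?thesis .
  qed
  have "norm (poisson_fun f (phi s \<zeta>) - poisson_fun f (phi t \<zeta>)) \<le> (\<integral>\<alpha>. k \<alpha> * norm (f \<alpha>) \<partial>mT)"
  proof -
    have "poisson_fun f (phi s \<zeta>) - poisson_fun f (phi t \<zeta>)
       = (\<integral>\<alpha>. of_real (poisson_kernel (phi s \<zeta>) \<alpha>) * f \<alpha> - of_real (poisson_kernel (phi t \<zeta>) \<alpha>) * f \<alpha> \<partial>mT)"
      unfolding poisson_fun_def using integrable_poisson_mult[OF fi(1)] D by simp
    also have "norm \<dots> \<le> (\<integral>\<alpha>. k \<alpha> * norm (f \<alpha>) \<partial>mT)"
    proof (rule norm_integral_le_integral)
      fix \<alpha>
      have "of_real (poisson_kernel (phi s \<zeta>) \<alpha>) * f \<alpha> - of_real (poisson_kernel (phi t \<zeta>) \<alpha>) * f \<alpha>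
        = of_real (poisson_kernel (phi s \<zeta>) \<alpha> - poisson_kernel (phi t \<zeta>) \<alpha>) * f \<alpha>" by (simp add: algebra_simps)
      then show "norm (of_real (poisson_kernel (phi s \<zeta>) \<alpha>) * f \<alpha> - of_real (poisson_kernel (phi t \<zeta>) \<alpha>) * f \<alpha>) \<le> k \<alpha> * norm (f \<alpha>)"
        by (simp add: norm_mult k_def hk_dist_def del: of_real_diff)
    qed (use integrable_poisson_mult[OF fi(1)] D kint fi(1) in auto)
    finally show ?thesis .
  qed
  also have "\<dots> \<le> 3 * (\<integral>\<alpha>. k \<alpha> * norm (f \<alpha>) powr p \<partial>mT) powr (1/p)"
    using k0 ki k2 kint fi p by (intro jensen_weak) auto
  finally have "norm (poisson_fun f (phi s \<zeta>) - poisson_fun f (phi t \<zeta>)) powr p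
     \<le> (3 * (\<integral>\<alpha>. k \<alpha> * norm (f \<alpha>) powr p \<partial>mT) powr (1/p)) powr p" using p by (intro powr_mono2) auto
  also have "\<dots> = 3 powr p * (\<integral>\<alpha>. k \<alpha> * norm (f \<alpha>) powr p \<partial>mT)"
    using p k0 by (simp add: powr_mult powr_powr Bochner_Integration.integral_nonneg)
  finally have "ennreal (norm (poisson_fun f (phi s \<zeta>) - poisson_fun f (phi t \<zeta>)) powr p)
    \<le> ennreal (3 powr p * (\<integral>\<alpha>. k \<alpha> * norm (f \<alpha>) powr p \<partial>mT))" by (rule ennreal_leI)
  also have "\<dots> = ennreal (3 powr p) * ennreal (\<integral>\<alpha>. k \<alpha> * norm (f \<alpha>) powr p \<partial>mT)"
    using k0 by (intro ennreal_mult) (auto intro: Bochner_Integration.integral_nonneg)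
  also have "ennreal (\<integral>\<alpha>. k \<alpha> * norm (f \<alpha>) powr p \<partial>mT) = (\<integral>\<^sup>+\<alpha>. ennreal (k \<alpha> * norm (f \<alpha>) powr p) \<partial>mT)"
    using kint[OF fi(2)] k0 by (intro nn_integral_eq_integral[symmetric]) auto
  also have "\<dots> = (\<integral>\<^sup>+\<alpha>. ennreal (hk_dist s t \<alpha> \<zeta>) * ennreal (norm (f \<alpha>) powr p) \<partial>mT)"
    using k0 by (intro nn_integral_cong) (simp add: k_def ennreal_mult)
  finally show ?thesis .
qed

lemma Lp_norm_compL_diff:
  assumes f: "f \<in> Lp p" "Lp_norm p f \<le> 1" and p: "1 \<le> p" and st: "0 \<le> s" "0 \<le> t"
    and D: "0 \<le> D" "\<And>\<alpha>. norm \<alpha> = 1 \<Longrightarrow> (\<integral>\<zeta>. hk_dist s t \<alpha> \<zeta> \<partial>mT) \<le> D powr p"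
  shows "Lp_norm p (compL (phi s) f - compL (phi t) f) \<le> 3 * D"
proof (rule Lp_norm_le_iff[OF p])
  note fi = Lp_integrable[OF f(1) p]
  have "(\<integral>\<^sup>+\<zeta>. ennreal (norm ((compL (phi s) f - compL (phi t) f) \<zeta>) powr p) \<partial>mT)
    \<le> (\<integral>\<^sup>+\<zeta>. ennreal (3 powr p) * (\<integral>\<^sup>+\<alpha>. ennreal (hk_dist s t \<alpha> \<zeta>) * ennreal (norm (f \<alpha>) powr p) \<partial>mT) \<partial>mT)"
  proof (rule nn_integral_mono_AE)
    show "AE \<zeta> in mT. ennreal (norm ((compL (phi s) f - compL (phi t) f) \<zeta>) powr p)
       \<le> ennreal (3 powr p) * (\<integral>\<^sup>+\<alpha>. ennreal (hk_dist s t \<alpha> \<zeta>) * ennreal (norm (f \<alpha>) powr p) \<partial>mT)"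
      using compL_phi(2)[OF fi(1) st(1)] compL_phi(2)[OF fi(1) st(2)] AE_not_ssupp AE_space[of mT]
    proof eventually_elim
      case (elim \<zeta>)
      then show ?case using poisson_fun_phi_diff_powr_le[OF f(1) p, of \<zeta> s t] by simp
    qed
  qed
  also have "\<dots> = ennreal (3 powr p) * (\<integral>\<^sup>+\<zeta>. (\<integral>\<^sup>+\<alpha>. ennreal (hk_dist s t \<alpha> \<zeta>) * ennreal (norm (f \<alpha>) powr p) \<partial>mT) \<partial>mT)"
  proof (rule nn_integral_cmult)
    have "(\<lambda>q. ennreal (hk_dist s t (snd q) (fst q))) \<in> borel_measurable (mT \<Otimes>\<^sub>M mT)"
      using measurable_compose[OF measurable_pair_swap' hk_dist_measurable[OF sets_mT, of s t], unfolded case_prod_unfold] by simp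
    moreover have "(\<lambda>\<alpha>. ennreal (norm (f \<alpha>) powr p)) \<in> borel_measurable mT" using borel_measurable_integrable[OF fi(2)] by simp
    from measurable_compose[OF measurable_snd this, of mT]
    have "(\<lambda>q. ennreal (norm (f (snd q)) powr p)) \<in> borel_measurable (mT \<Otimes>\<^sub>M mT)" .
    ultimately have "(\<lambda>q. ennreal (hk_dist s t (snd q) (fst q)) * ennreal (norm (f (snd q)) powr p)) \<in> borel_measurable (mT \<Otimes>\<^sub>M mT)"
      by (rule borel_measurable_times_ennreal)
    then show "(\<lambda>\<zeta>. \<integral>\<^sup>+\<alpha>. ennreal (hk_dist s t \<alpha> \<zeta>) * ennreal (norm (f \<alpha>) powr p) \<partial>mT) \<in> borel_measurable mT"
      by (intro mT.borel_measurable_nn_integral) (simp add: case_prod_unfold)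
  qed
  also have "\<dots> \<le> ennreal (3 powr p) * (ennreal (D powr p) * (\<integral>\<^sup>+\<alpha>. ennreal (norm (f \<alpha>) powr p) \<partial>mT))"
    using borel_measurable_integrable[OF fi(2)] D(2)
    by (intro mult_left_mono hk_dist_Tonelli mT.finite_measure_axioms) auto
  also have "(\<integral>\<^sup>+\<alpha>. ennreal (norm (f \<alpha>) powr p) \<partial>mT) = ennreal (\<integral>\<alpha>. norm (f \<alpha>) powr p \<partial>mT)"
    using fi(2) by (intro nn_integral_eq_integral) auto
  also have "ennreal (3 powr p) * (ennreal (D powr p) * ennreal (\<integral>\<alpha>. norm (f \<alpha>) powr p \<partial>mT))
     \<le> ennreal (3 powr p) * (ennreal (D powr p) * ennreal 1)"
    by (intro mult_left_mono ennreal_leI Lp_norm_le_1 p f) auto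
  also have "\<dots> = ennreal ((3 * D) powr p)" using D(1) by (simp add: powr_mult flip: ennreal_mult)
  finally show "(\<integral>\<zeta>. norm ((compL (phi s) f - compL (phi t) f) \<zeta>) powr p \<partial>mT) \<le> (3 * D) powr p"
    by (intro integral_real_bounded) auto
qed (use D in simp)

lemma zero_in_Hp: "1 \<le> p \<Longrightarrow> (\<lambda>_. 0) \<in> Hp p" "Lp_norm p (\<lambda>_. 0) = 0" "Hp p \<subseteq> Lp p"
  by (auto simp: Hp_def Lp_def Lp_norm_def)

text \<open>Any class X of L^p functions containing 0 is allowed, since the estimate concerns single
  functions; L^p and H^p are served at once.\<close>

theorem norm_continuous_Lp:
  assumes p: "1 \<le> p" and X: "X \<subseteq> Lp p" "(\<lambda>_. 0) \<in> X"
  shows "norm_continuous_family X (Lp_norm p) (\<lambda>t. compL (phi t))"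
proof (rule norm_continuous_familyI)
  show "(\<lambda>_. 0) \<in> X" "Lp_norm p (\<lambda>_. 0) \<le> 1" using X zero_in_Hp by auto
  fix t e :: real assume t: "0 \<le> t" "t \<le> 1" and e: "0 < e"
  obtain \<delta> where d: "0 < \<delta>" "\<And>s \<alpha>. s \<in> {0..1} \<Longrightarrow> \<bar>s - t\<bar> < \<delta> \<Longrightarrow> norm \<alpha> = 1 \<Longrightarrow> (\<integral>\<zeta>. hk_dist s t \<alpha> \<zeta> \<partial>mT) < (e/3) powr p"
    using hk_norm_continuous[OF t, of "(e/3) powr p"] e unfolding hk_dist_def by auto
  show "\<exists>\<delta>>0. \<forall>s\<in>{0..1}. \<bar>s - t\<bar> < \<delta> \<longrightarrow> (\<forall>x\<in>X. Lp_norm p x \<le> 1 \<longrightarrow> Lp_norm p (compL (phi s) x - compL (phi t) x) \<le> e)"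
  proof (intro exI[of _ \<delta>] conjI ballI impI d(1))
    fix s x assume s: "s \<in> {0..1}" "\<bar>s - t\<bar> < \<delta>" and x: "x \<in> X" "Lp_norm p x \<le> 1"
    have "Lp_norm p (compL (phi s) x - compL (phi t) x) \<le> 3 * (e/3)"
      using s x t e X p d(2)[OF s] by (intro Lp_norm_compL_diff) (auto simp: less_imp_le)
    then show "Lp_norm p (compL (phi s) x - compL (phi t) x) \<le> e" by simp
  qed
qed

section \<open>Compactness at the start of the path\<close>

lemma bounded_complex_subseq:
  fixes k :: "nat \<Rightarrow> complex"
  assumes "\<And>n. norm (k n) \<le> B"
  obtains l r where "strict_mono r" "(\<lambda>n. k (r n)) \<longlonglongrightarrow> l"
proof -
  have "\<forall>n. k n \<in> cball 0 B" using assms by simp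
  with compact_cball[of "0::complex" B] obtain l r where "strict_mono r" "(k \<circ> r) \<longlonglongrightarrow> l"
    unfolding compact_def by blast
  then show ?thesis by (intro that[of r l]) (simp_all add: o_def)
qed

lemma DD_0 [simp]: "0 \<in> DD"
  by (simp add: DD_def)

lemma tv_norm_const_mT_le:
  "tv_norm (wlist_meas [(a, mT)] - wlist_meas [(b, mT)]) \<le> norm (a - b)"
proof -
  have "wlist_meas [(a, mT)] - wlist_meas [(b, mT)] = wlist_meas [(a - b, mT)]"
    by (rule ext) (simp add: wlist_meas_Cons algebra_simps)
  then show ?thesis using tv_norm_wlist_meas_le[of "[(a - b, mT)]"] by (simp add: mT.finite_measure_axioms)
qed

theorem compact_M: "compact_op Mspace tv_norm (compM (phi 0))"
  unfolding compact_op_def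
proof (intro allI impI)
  fix x :: "nat \<Rightarrow> complex set \<Rightarrow> complex" assume x: "\<forall>n. x n \<in> Mspace \<and> tv_norm (x n) \<le> 1"
  define k where "k n = poisson_meas (x n) 0" for n
  have w: "wlist [(c, mT)]" for c by (simp add: mT.finite_measure_axioms)
  \<comment> \<open>phi 0 vanishes identically, so only the value of the Poisson integral at the
    origin survives, as a multiple of m.\<close>
  have C: "compM (phi 0) (x n) = wlist_meas [(k n, mT)]" for n
  proof (rule compM_eq[OF cmeasure_wlist_meas[OF w]])
    fix z assume z: "z \<in> DD"
    show "poisson_meas (wlist_meas [(k n, mT)]) z = poisson_meas (x n) (phi 0 z)"
      using integral_poisson_kernel[OF z] by (simp add: poisson_meas_wlist_meas[OF w z] phi_0 k_def)
  qed
  have "norm (k n) \<le> 8" for n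
  proof -
    have "norm (k n) \<le> 8 / (1 - norm (0::complex))\<^sup>2 * tv_norm (x n)"
      unfolding k_def using x by (intro norm_poisson_meas_le) (auto simp: Mspace_def)
    then show ?thesis using x[rule_format, of n] by simp
  qed
  then obtain l r where r: "strict_mono r" "(\<lambda>n. k (r n)) \<longlonglongrightarrow> l" by (rule bounded_complex_subseq)
  show "\<exists>r y. strict_mono r \<and> y \<in> Mspace \<and> (\<lambda>n. tv_norm (compM (phi 0) (x (r n)) - y)) \<longlonglongrightarrow> 0"
  proof (intro exI conjI)
    show "wlist_meas [(l, mT)] \<in> Mspace" using cmeasure_wlist_meas[OF w] by (simp add: Mspace_def)
    show "(\<lambda>n. tv_norm (compM (phi 0) (x (r n)) - wlist_meas [(l, mT)])) \<longlonglongrightarrow> 0"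
    proof (rule Lim_null_comparison)
      have "0 \<le> tv_norm (compM (phi 0) (x (r n)) - wlist_meas [(l, mT)])" for n
        using norm_le_tv_norm[OF cmeasure_diff[OF cmeasure_wlist_meas[OF w] cmeasure_wlist_meas[OF w]] sets.empty_sets, of "k (r n)" l]
        unfolding C by (rule order_trans[OF norm_ge_zero])
      then show "\<forall>\<^sub>F n in sequentially. norm (tv_norm (compM (phi 0) (x (r n)) - wlist_meas [(l, mT)])) \<le> norm (k (r n) - l)"
        unfolding C using tv_norm_const_mT_le by (intro always_eventually) simp
      show "(\<lambda>n. norm (k (r n) - l)) \<longlonglongrightarrow> 0" using r(2) by (simp add: LIM_zero tendsto_norm_zero)
    qed
  qed (rule r)
qed

lemma Lp_const: "1 \<le> p \<Longrightarrow> (\<lambda>_. c) \<in> Lp p"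
  by (simp add: Lp_def)

lemma integral_power_circle: "n > 0 \<Longrightarrow> (\<integral>\<zeta>. \<zeta> ^ n \<partial>mT) = 0"
proof -
  assume n: "n > 0"
  have "(\<integral>\<zeta>. of_real (poisson_kernel 0 \<zeta>) * \<zeta> ^ n \<partial>mT) = 0 ^ n"
    by (intro poisson_formula_cball continuous_intros holomorphic_intros) simp
  moreover have "(\<integral>\<zeta>. of_real (poisson_kernel 0 \<zeta>) * \<zeta> ^ n \<partial>mT) = (\<integral>\<zeta>. \<zeta> ^ n \<partial>mT)"
    by (intro Bochner_Integration.integral_cong) auto
  ultimately show ?thesis using n by simp
qed

lemma Hp_const: "1 \<le> p \<Longrightarrow> (\<lambda>_. c) \<in> Hp p"
  using Lp_const integral_power_circle by (simp add: Hp_def)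

text \<open>The images are almost everywhere constant with bounded values, so Bolzano--Weierstrass
  suffices; X must contain the constants for the limit to stay in X.\<close>

theorem compact_Lp:
  assumes p: "1 \<le> p" and X: "X \<subseteq> Lp p" "\<And>c. (\<lambda>_. c) \<in> X"
  shows "compact_op X (Lp_norm p) (compL (phi 0))"
  unfolding compact_op_def
proof (intro allI impI)
  fix x :: "nat \<Rightarrow> complex \<Rightarrow> complex" assume x: "\<forall>n. x n \<in> X \<and> Lp_norm p (x n) \<le> 1"
  then have xL: "x n \<in> Lp p" "Lp_norm p (x n) \<le> 1" for n using X by auto
  define k where "k n = poisson_fun (x n) 0" for n
  have AE: "AE \<zeta> in mT. compL (phi 0) (x n) \<zeta> = k n" and Lm: "compL (phi 0) (x n) \<in> borel_measurable borelT" for n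
    using compL_phi(2,3)[OF Lp_integrable(1)[OF xL(1) p, of n], of 0] by (auto simp: phi_0 k_def borel_measurable_mT[symmetric] simp del: borel_measurable_mT)
  have "norm (k n) \<le> 4" for n
  proof -
    note xi = Lp_integrable[OF xL(1) p, of n]
    have "norm (k n) \<le> 2 / (1 - norm (0::complex))\<^sup>2 * (\<integral>\<zeta>. norm (x n \<zeta>) \<partial>mT)"
      unfolding k_def using xi by (intro norm_poisson_fun_le) auto
    moreover have "(\<integral>\<zeta>. norm (x n \<zeta>) \<partial>mT) \<le> (\<integral>\<zeta>. norm (x n \<zeta>) powr p + 1 \<partial>mT)"
      using xi p by (intro integral_mono le_one_plus_powr) auto
    moreover have "(\<integral>\<zeta>. norm (x n \<zeta>) powr p + 1 \<partial>mT) \<le> 2"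
      using xi Lp_norm_le_1[OF p xL(2), of n] by simp
    ultimately show ?thesis by simp
  qed
  then obtain l r where r: "strict_mono r" "(\<lambda>n. k (r n)) \<longlonglongrightarrow> l" by (rule bounded_complex_subseq)
  have N: "Lp_norm p (compL (phi 0) (x n) - (\<lambda>_. l)) = norm (k n - l)" for n
  proof -
    have "(\<integral>\<zeta>. norm ((compL (phi 0) (x n) - (\<lambda>_. l)) \<zeta>) powr p \<partial>mT) = (\<integral>\<zeta>. norm (k n - l) powr p \<partial>mT)"
    proof (rule integral_cong_AE)
      show "(\<lambda>\<zeta>. norm ((compL (phi 0) (x n) - (\<lambda>_. l)) \<zeta>) powr p) \<in> borel_measurable mT"
        using Lm[of n] by simp
      show "AE \<zeta> in mT. norm ((compL (phi 0) (x n) - (\<lambda>_. l)) \<zeta>) powr p = norm (k n - l) powr p"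
        using AE[of n] by eventually_elim simp
    qed simp
    then show ?thesis using p by (simp add: Lp_norm_def powr_powr)
  qed
  show "\<exists>r y. strict_mono r \<and> y \<in> X \<and> (\<lambda>n. Lp_norm p (compL (phi 0) (x (r n)) - y)) \<longlonglongrightarrow> 0"
  proof (intro exI conjI)
    show "(\<lambda>n. Lp_norm p (compL (phi 0) (x (r n)) - (\<lambda>_. l))) \<longlonglongrightarrow> 0"
      unfolding N using r(2) by (simp add: LIM_zero tendsto_norm_zero)
  qed (use r X in auto)
qed

section \<open>Non-compactness at the end of the path\<close>

lemma tendsto_poisson_meas:
  assumes c: "\<And>n. cmeasure (x n)" "cmeasure y" and l: "(\<lambda>n. tv_norm (x n - y)) \<longlonglongrightarrow> 0" and z: "z \<in> DD"
  shows "(\<lambda>n. poisson_meas (x n) z) \<longlonglongrightarrow> poisson_meas y z"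
proof (rule LIM_zero_cancel, rule Lim_null_comparison)
  show "\<forall>\<^sub>F n in sequentially. norm (poisson_meas (x n) z - poisson_meas y z) \<le> 8 / (1 - norm z)\<^sup>2 * tv_norm (x n - y)"
    using norm_poisson_meas_le[OF cmeasure_diff[OF c(1) c(2)] z] poisson_meas_diff[OF c(1) c(2) z]
    by (intro always_eventually) simp
  show "(\<lambda>n. 8 / (1 - norm z)\<^sup>2 * tv_norm (x n - y)) \<longlonglongrightarrow> 0" using tendsto_mult_right_zero[OF l] .
qed

text \<open>The identity is a self-map, so \<open>poisson_kernel_selfmap\<close> together with the
  symmetry gives the semigroup property of Poisson kernels.\<close>

lemma poisson_fun_poisson_kernel:
  assumes r: "0 \<le> r" "r < 1" and z: "z \<in> DD"
  shows "poisson_fun (\<lambda>\<zeta>. of_real (poisson_kernel (of_real r) \<zeta>)) z = of_real (poisson_kernel (of_real r * z) 1)"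
proof -
  have "analytic_selfmap (\<lambda>z. z)" by (auto simp: analytic_selfmap_def)
  from poisson_kernel_selfmap[OF this, of 1 r z] r z
  have "(\<integral>\<zeta>. poisson_kernel z \<zeta> * poisson_kernel (of_real r * \<zeta>) 1 \<partial>mT) = poisson_kernel (of_real r * z) 1" by simp
  moreover have "(\<integral>\<zeta>. poisson_kernel z \<zeta> * poisson_kernel (of_real r * \<zeta>) 1 \<partial>mT)
     = (\<integral>\<zeta>. poisson_kernel z \<zeta> * poisson_kernel (of_real r) \<zeta> \<partial>mT)"
    using poisson_kernel_swap[of _ 1 r] by (intro Bochner_Integration.integral_cong) auto
  ultimately show ?thesis by (simp add: poisson_fun_def flip: of_real_mult)
qed

lemma poisson_kernel_rad_tendsto:
  assumes "z \<in> DD"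
  shows "(\<lambda>n. poisson_kernel (of_real (rad n) * z) 1) \<longlonglongrightarrow> poisson_kernel z 1"
proof -
  have "(\<lambda>n. poisson_kernel (of_real (rad n) * z) 1) \<longlonglongrightarrow> poisson_kernel (of_real 1 * z) 1"
    using assms by (intro tendsto_intros tendsto_rad) (auto simp: DD_def)
  then show ?thesis by simp
qed

theorem not_compact_M: "\<not> compact_op Mspace tv_norm (compM (phi 1))"
proof
  assume C: "compact_op Mspace tv_norm (compM (phi 1))"
  define f where "f n \<zeta> = complex_of_real (poisson_kernel (of_real (rad n)) \<zeta>)" for n \<zeta>
  have rD: "of_real (rad n) \<in> DD" for n using rad[of n] by (simp add: DD_def)
  have fi: "integrable mT (f n)" for n unfolding f_def[abs_def] using integrable_poisson_kernel[OF rD] by (rule integrable_of_real)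
  define x where "x n = wlist_meas (dlist (f n))" for n
  have xc: "cmeasure (x n)" for n unfolding x_def using fi by (intro cmeasure_wlist_meas wlist_dlist)
  have xz: "poisson_meas (x n) z = of_real (poisson_kernel (of_real (rad n) * z) 1)" if "z \<in> DD" for n z
    unfolding x_def poisson_meas_dlist[OF fi that] unfolding f_def using that by (intro poisson_fun_poisson_kernel rad)
  have "tv_norm (x n) \<le> 1" for n
  proof (rule tv_norm_le)
    fix I :: "nat set" and E assume I: "finite I" "\<And>i. i \<in> I \<Longrightarrow> E i \<in> sets borelT" "disjoint_family_on E I"
    have "(\<Sum>i\<in>I. norm (x n (E i))) = (\<Sum>i\<in>I. norm (\<integral>\<zeta>. indicator (E i) \<zeta> * f n \<zeta> \<partial>mT))"
      unfolding x_def using I(2) by (intro sum.cong refl) (simp add: wlist_meas_dlist[OF fi])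
    also have "\<dots> \<le> (\<integral>\<zeta>. norm (f n \<zeta>) \<partial>mT)" by (rule sum_norm_dlist_le[OF fi I])
    also have "\<dots> = (\<integral>\<zeta>. poisson_kernel (of_real (rad n)) \<zeta> \<partial>mT)"
      using rad[of n] by (intro Bochner_Integration.integral_cong refl) (simp add: f_def)
    also have "\<dots> = 1" by (rule integral_poisson_kernel[OF rD])
    finally show "(\<Sum>i\<in>I. norm (x n (E i))) \<le> 1" .
  qed
  then have "\<forall>n. x n \<in> Mspace \<and> tv_norm (x n) \<le> 1" using xc by (simp add: Mspace_def)
  with C obtain r y where r: "strict_mono r" and y: "cmeasure y"
    and l: "(\<lambda>n. tv_norm (compM (phi 1) (x (r n)) - y)) \<longlonglongrightarrow> 0"
    unfolding compact_op_def Mspace_def by blast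
  have Cx: "compM (phi 1) (x n) = wlist_meas (comp_list 1 (x n))" for n using xc by (intro compM_phi) auto
  have Cc: "cmeasure (compM (phi 1) (x n))" for n unfolding Cx using xc by (intro cmeasure_wlist_meas wlist_comp_list) auto
  \<comment> \<open>A norm limit of the images would have Poisson integral P_{phi(z)}(1), which is
    that of m + sigma_1; by uniqueness it would be this measure.\<close>
  let ?L = "[(1, mT), (1, smu 1)]"
  have wL: "wlist ?L" by (simp add: mT.finite_measure_axioms smu.finite_measure_axioms)
  have pC: "poisson_meas (compM (phi 1) (x n)) z = poisson_meas (x n) (phi 1 z)" if z: "z \<in> DD" for n z
  proof -
    have one: "{1} \<in> sets borelT" by (simp add: sets_borelT_iff)
    have ex: "poisson_meas (wlist_meas (comp_list 1 (x n))) z = poisson_meas (x n) (phi 1 z)"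
      using poisson_meas_compM_phi[OF xc _ z, of 1 n] by simp
    then show ?thesis by (simp add: Cx)
  qed
  have "poisson_meas y z = poisson_meas (wlist_meas ?L) z" if z: "z \<in> DD" for z
  proof -
    have D: "phi 1 z \<in> DD" using z DD_not_ssupp by (intro phi_DD) (auto simp: DD_def)
    have "(\<lambda>n. poisson_meas (compM (phi 1) (x (r n))) z) \<longlonglongrightarrow> poisson_meas y z"
      using Cc y l z by (intro tendsto_poisson_meas)
    moreover have "(\<lambda>n. poisson_meas (compM (phi 1) (x (r n))) z) \<longlonglongrightarrow> of_real (poisson_kernel (phi 1 z) 1)"
      unfolding pC[OF z] xz[OF D]
      using LIMSEQ_subseq_LIMSEQ[OF poisson_kernel_rad_tendsto[OF D] r] by (intro tendsto_of_real) (simp add: o_def)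
    ultimately have "poisson_meas y z = of_real (poisson_kernel (phi 1 z) 1)" using LIMSEQ_unique by blast
    then show ?thesis
      by (simp add: poisson_meas_wlist_meas[OF wL z] poisson_phi_kernel_1(2)[OF z] integral_poisson_kernel[OF z])
  qed
  then have "y - wlist_meas ?L = (\<lambda>_. 0)"
    using y cmeasure_wlist_meas[OF wL] by (intro poisson_meas_unique cmeasure_diff) (auto simp: poisson_meas_diff)
  then have "y ssupp = wlist_meas ?L ssupp" by (metis eq_iff_diff_eq_0 minus_apply)
  also have "\<dots> = 1" using null_ssupp by (simp add: wlist_meas_Cons sets_ssupp measure_smu_ssupp measure_eq_0_null_sets)
  finally have ys: "y ssupp = 1" .
  have x1: "x n {1} = 0" for n
  proof -
    have one: "{1} \<in> sets borelT" by (simp add: sets_borelT_iff)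
    have "(\<integral>\<zeta>. indicator {1} \<zeta> * f n \<zeta> \<partial>mT) = (\<integral>\<zeta>. 0 \<partial>mT)"
    proof (rule integral_cong_AE)
      show "AE \<zeta> in mT. indicator {1} \<zeta> * f n \<zeta> = 0"
        using AE_not_in[OF null_mT_one] by eventually_elim simp
      show "(\<lambda>\<zeta>. indicator {1} \<zeta> * f n \<zeta>) \<in> borel_measurable mT"
        using fi[of n] one by (intro borel_measurable_times borel_measurable_indicator) auto
    qed simp
    then show ?thesis using wlist_meas_dlist[OF fi one, of n] by (simp add: x_def)
  qed
  have Cs: "compM (phi 1) (x n) ssupp = 0" for n
  proof -
    let ?g = "\<lambda>\<zeta>. poisson_meas (x n) (phi 1 \<zeta>)"
    have gi: "integrable mT ?g" using xc by (intro poisson_meas_phi_integrable) auto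
    have "(\<integral>\<zeta>. indicator ssupp \<zeta> * ?g \<zeta> \<partial>mT) = (\<integral>\<zeta>. 0 \<partial>mT)"
    proof (rule integral_cong_AE)
      show "AE \<zeta> in mT. indicator ssupp \<zeta> * ?g \<zeta> = 0" using AE_not_ssupp by eventually_elim simp
      show "(\<lambda>\<zeta>. indicator ssupp \<zeta> * ?g \<zeta>) \<in> borel_measurable mT"
        using gi sets_ssupp by (intro borel_measurable_times borel_measurable_indicator) auto
    qed simp
    then show ?thesis unfolding Cx comp_list_def wlist_meas_Cons wlist_meas_dlist[OF gi sets_ssupp] x1 by simp
  qed
  \<comment> \<open>\<open>ssupp\<close> is null for the absolutely continuous images but has mass 1
    for the only possible limit.\<close>
  have "1 \<le> tv_norm (compM (phi 1) (x (r n)) - y)" for n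
    using norm_le_tv_norm[OF cmeasure_diff[OF Cc[of "r n"] y] sets_ssupp] by (simp add: Cs ys)
  with l have "(1::real) \<le> 0" by (intro LIMSEQ_le_const) auto
  then show False by simp
qed

section \<open>Non-compactness on L^p and H^p\<close>

lemma Lp_AE_cong:
  assumes "f \<in> borel_measurable borelT" "g \<in> borel_measurable borelT" "AE x in mT. f x = g x"
  shows "f \<in> Lp p \<longleftrightarrow> g \<in> Lp p" "Lp_norm p f = Lp_norm p g"
proof -
  have ae: "AE x in mT. norm (f x) powr p = norm (g x) powr p" using assms(3) by eventually_elim simp
  have m: "(\<lambda>x. norm (f x) powr p) \<in> borel_measurable mT" "(\<lambda>x. norm (g x) powr p) \<in> borel_measurable mT"
    using assms by simp_all
  show "f \<in> Lp p \<longleftrightarrow> g \<in> Lp p" using integrable_cong_AE[OF m ae] assms by (simp add: Lp_def)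
  show "Lp_norm p f = Lp_norm p g" using integral_cong_AE[OF m ae] by (simp add: Lp_norm_def)
qed

lemma norm_diff_powr_le:
  fixes a b :: complex
  assumes "1 \<le> p"
  shows "norm (a - b) powr p \<le> 2 powr p * (norm a powr p + norm b powr p)"
proof -
  have "norm (a - b) \<le> 2 * max (norm a) (norm b)" using norm_triangle_ineq4[of a b] by simp
  then have "norm (a - b) powr p \<le> (2 * max (norm a) (norm b)) powr p" using assms by (intro powr_mono2) auto
  also have "\<dots> = 2 powr p * max (norm a) (norm b) powr p" by (simp add: powr_mult)
  also have "\<dots> \<le> 2 powr p * (norm a powr p + norm b powr p)"
    by (intro mult_left_mono) (auto simp: max_def)
  finally show ?thesis .
qed

lemma Lp_diff:
  assumes "f \<in> Lp p" "g \<in> Lp p" "1 \<le> p"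
  shows "f - g \<in> Lp p"
proof -
  note fi = Lp_integrable[OF assms(1,3)] and gi = Lp_integrable[OF assms(2,3)]
  have m: "f - g \<in> borel_measurable borelT" unfolding fun_diff_def using fi gi by (intro borel_measurable_diff)
  have "integrable mT (\<lambda>x. norm ((f - g) x) powr p)"
  proof (rule Bochner_Integration.integrable_bound)
    show "integrable mT (\<lambda>x. 2 powr p * (norm (f x) powr p + norm (g x) powr p))" using fi gi by simp
    show "AE x in mT. norm (norm ((f - g) x) powr p) \<le> norm (2 powr p * (norm (f x) powr p + norm (g x) powr p))"
      using norm_diff_powr_le[OF assms(3)] by (intro AE_I2) (auto simp: abs_of_nonneg)
    show "(\<lambda>x. norm ((f - g) x) powr p) \<in> borel_measurable mT"
      using borel_measurable_diff[OF fi(3) gi(3)] by simp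
  qed
  then show ?thesis using m by (simp add: Lp_def)
qed

lemma integral_norm_le_Lp_norm:
  assumes "f \<in> Lp p" "1 \<le> p"
  shows "(\<integral>x. norm (f x) \<partial>mT) \<le> 3 * Lp_norm p f"
  using jensen_weak[of mT "\<lambda>_. 1" "\<lambda>x. norm (f x)" p] Lp_integrable[OF assms] assms(2)
  by (simp add: Lp_norm_def)

lemma tendsto_poisson_fun_Lp:
  assumes p: "1 \<le> p" and f: "\<And>n. f n \<in> Lp p" "g \<in> Lp p" and l: "(\<lambda>n. Lp_norm p (f n - g)) \<longlonglongrightarrow> 0" and z: "z \<in> DD"
  shows "(\<lambda>n. poisson_fun (f n) z) \<longlonglongrightarrow> poisson_fun g z"
proof (rule LIM_zero_cancel, rule Lim_null_comparison)
  have "norm (poisson_fun (f n) z - poisson_fun g z) \<le> 2 / (1 - norm z)\<^sup>2 * (3 * Lp_norm p (f n - g))" for n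
  proof -
    have d: "f n - g \<in> Lp p" using f p by (intro Lp_diff)
    have "poisson_fun (f n) z - poisson_fun g z = poisson_fun (f n - g) z"
      using poisson_fun_diff[OF Lp_integrable(1)[OF f(1) p] Lp_integrable(1)[OF f(2) p] z, of n] by (simp add: fun_diff_def)
    also have "norm \<dots> \<le> 2 / (1 - norm z)\<^sup>2 * (\<integral>x. norm ((f n - g) x) \<partial>mT)"
      by (rule norm_poisson_fun_le[OF Lp_integrable(1)[OF d p] z])
    also have "\<dots> \<le> 2 / (1 - norm z)\<^sup>2 * (3 * Lp_norm p (f n - g))"
      by (intro mult_left_mono integral_norm_le_Lp_norm d p) auto
    finally show ?thesis .
  qed
  then show "\<forall>\<^sub>F n in sequentially. norm (poisson_fun (f n) z - poisson_fun g z) \<le> 2 / (1 - norm z)\<^sup>2 * (3 * Lp_norm p (f n - g))"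
    by (intro always_eventually allI)
  show "(\<lambda>n. 2 / (1 - norm z)\<^sup>2 * (3 * Lp_norm p (f n - g))) \<longlonglongrightarrow> 0"
    by (intro tendsto_mult_right_zero l)
qed

text \<open>The normalised reproducing kernels, \<open>((1 - r\<^sup>2) / (1 - r \<zeta>)\<^sup>2) powr (1/p)\<close>.\<close>

definition peak :: "real \<Rightarrow> real \<Rightarrow> complex \<Rightarrow> complex" where
  "peak p r \<zeta> = exp (of_real (1/p) * (of_real (ln (1 - r\<^sup>2)) - 2 * Ln (1 - of_real r * \<zeta>)))"

context
  fixes p r :: real assumes p: "1 \<le> p" and r: "0 \<le> r" "r < 1"
begin

lemma peak_Re: "norm \<zeta> \<le> 1 \<Longrightarrow> 0 < Re (1 - of_real r * \<zeta>)"
  using of_real_mult_DD[OF r] complex_Re_le_cmod[of "of_real r * \<zeta>"] by (force simp: DD_def)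

lemma norm_peak_powr:
  assumes z: "norm \<zeta> \<le> 1"
  shows "norm (peak p r \<zeta>) powr p = (1 - r\<^sup>2) / (norm (1 - of_real r * \<zeta>))\<^sup>2"
proof -
  let ?w = "1 - of_real r * \<zeta>"
  have w: "?w \<noteq> 0" using peak_Re[OF z] by (metis less_irrefl zero_complex.sel(1))
  have r2: "0 < 1 - r\<^sup>2" using r by (simp add: power_less_one_iff abs_square_less_1)
  have "Re (of_real (1/p) * (of_real (ln (1 - r\<^sup>2)) - 2 * Ln ?w)) = (1/p) * (ln (1 - r\<^sup>2) - 2 * ln (norm ?w))"
    using w by (simp only: Re_complex_of_real Re_Ln scaleR_conv_of_real[symmetric] scaleR_complex.sel minus_complex.sel) simp
  then have "norm (peak p r \<zeta>) = exp ((1/p) * (ln (1 - r\<^sup>2) - 2 * ln (norm ?w)))"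
    unfolding peak_def norm_exp_eq_Re by simp
  then have "norm (peak p r \<zeta>) powr p = exp (ln (1 - r\<^sup>2) - 2 * ln (norm ?w))"
    using p by (simp add: powr_def)
  also have "\<dots> = (1 - r\<^sup>2) / exp (2 * ln (norm ?w))" using r2 by (simp add: exp_diff)
  also have "exp (2 * ln (norm ?w)) = (norm ?w)\<^sup>2"
  proof -
    have "exp (2 * ln (norm ?w)) = exp (ln (norm ?w)) ^ 2" by (simp add: exp_double)
    then show ?thesis using w by simp
  qed
  finally show ?thesis .
qed

lemma norm_peak_powr_circle:
  assumes z: "norm \<zeta> = 1"
  shows "norm (peak p r \<zeta>) powr p = poisson_kernel (of_real r) \<zeta>"
proof -
  have "poisson_kernel (of_real r) \<zeta> = poisson_kernel (of_real r * \<zeta>) 1"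
    using poisson_kernel_swap[of \<zeta> 1 r] z by simp
  moreover have "norm (peak p r \<zeta>) powr p = poisson_kernel (of_real r * \<zeta>) 1"
    using z r by (simp add: norm_peak_powr poisson_kernel_def norm_mult)
  ultimately show ?thesis by simp
qed

lemma peak_nonpos_Reals: "norm \<zeta> \<le> 1 \<Longrightarrow> 1 - of_real r * \<zeta> \<notin> \<real>\<^sub>\<le>\<^sub>0" for \<zeta> :: complex
  using peak_Re[of \<zeta>] by (auto simp: complex_nonpos_Reals_iff)

lemma peak_continuous: "continuous_on (cball 0 1) (peak p r)"
  unfolding peak_def[abs_def] by (intro continuous_intros) (simp_all add: peak_nonpos_Reals)

lemma peak_holomorphic: "peak p r holomorphic_on ball 0 1"
  unfolding peak_def[abs_def] by (intro holomorphic_intros) (simp_all add: peak_nonpos_Reals)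

lemma peak_measurable: "peak p r \<in> borel_measurable borelT"
  by (rule continuous_imp_measurable_borelT, rule continuous_on_subset[OF peak_continuous]) auto

lemma peak_integral: "integrable mT (\<lambda>\<zeta>. norm (peak p r \<zeta>) powr p)" "(\<integral>\<zeta>. norm (peak p r \<zeta>) powr p \<partial>mT) = 1"
proof -
  have D: "of_real r \<in> DD" using r by (simp add: DD_def)
  show "integrable mT (\<lambda>\<zeta>. norm (peak p r \<zeta>) powr p)"
    using integrable_poisson_kernel[OF D]
    by (subst Bochner_Integration.integrable_cong[OF refl, where g="poisson_kernel (of_real r)"])
       (simp_all add: norm_peak_powr_circle)
  have "(\<integral>\<zeta>. norm (peak p r \<zeta>) powr p \<partial>mT) = (\<integral>\<zeta>. poisson_kernel (of_real r) \<zeta> \<partial>mT)"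
    by (intro Bochner_Integration.integral_cong refl) (simp add: norm_peak_powr_circle)
  then show "(\<integral>\<zeta>. norm (peak p r \<zeta>) powr p \<partial>mT) = 1" by (simp add: integral_poisson_kernel[OF D])
qed

lemma peak_Hp: "peak p r \<in> Hp p"
proof -
  have "(\<integral>\<zeta>. peak p r \<zeta> * \<zeta> ^ n \<partial>mT) = 0" if n: "n > 0" for n
  proof -
    have "(\<integral>\<zeta>. of_real (poisson_kernel 0 \<zeta>) * (peak p r \<zeta> * \<zeta> ^ n) \<partial>mT) = peak p r 0 * 0 ^ n"
      by (intro poisson_formula_cball continuous_intros holomorphic_intros peak_continuous peak_holomorphic) simp
    moreover have "(\<integral>\<zeta>. of_real (poisson_kernel 0 \<zeta>) * (peak p r \<zeta> * \<zeta> ^ n) \<partial>mT) = (\<integral>\<zeta>. peak p r \<zeta> * \<zeta> ^ n \<partial>mT)"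
      by (intro Bochner_Integration.integral_cong) auto
    ultimately show ?thesis using n by simp
  qed
  then show ?thesis using peak_measurable peak_integral(1) by (simp add: Hp_def Lp_def)
qed

lemma poisson_fun_peak: "z \<in> DD \<Longrightarrow> poisson_fun (peak p r) z = peak p r z"
  unfolding poisson_fun_def by (rule poisson_formula_cball[OF peak_continuous peak_holomorphic]) (simp add: DD_def)

lemma peak_Lp_norm: "Lp_norm p (peak p r) = 1"
  by (simp add: Lp_norm_def peak_integral)

end

lemma peak_rad_tendsto_0:
  assumes p: "1 \<le> p" and z: "z \<in> DD"
  shows "(\<lambda>n. peak p (rad n) z) \<longlonglongrightarrow> 0"
proof -
  have z1: "norm z < 1" using z by (simp add: DD_def)
  have "(\<lambda>n. (1 - (rad n)\<^sup>2) / (norm (1 - of_real (rad n) * z))\<^sup>2) \<longlonglongrightarrow> (1 - 1\<^sup>2) / (norm (1 - of_real 1 * z))\<^sup>2"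
    using z1 by (intro tendsto_intros tendsto_rad) auto
  then have l: "(\<lambda>n. norm (peak p (rad n) z) powr p) \<longlonglongrightarrow> 0" using norm_peak_powr[OF p rad] z1 by simp
  have "(\<lambda>n. (norm (peak p (rad n) z) powr p) powr (1/p)) \<longlonglongrightarrow> 0 powr (1/p)"
    using p by (intro tendsto_powr' l tendsto_const) auto
  then have "(\<lambda>n. norm (peak p (rad n) z)) \<longlonglongrightarrow> 0" using p by (simp add: powr_powr)
  then show ?thesis by (rule tendsto_norm_zero_cancel)
qed

text \<open>The integrand is the boundary function of C_phi applied to the kernel at r, and its mean
  is the value of the composed Poisson integral at 0.\<close>

lemma integral_poisson_kernel_phi_1:
  assumes r: "0 \<le> r" "r < 1"
  shows "integrable mT (\<lambda>\<zeta>. poisson_kernel (of_real r * phi 1 \<zeta>) 1)"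
    and "(\<integral>\<zeta>. poisson_kernel (of_real r * phi 1 \<zeta>) 1 \<partial>mT) = poisson_kernel (of_real r * phi 1 0) 1"
proof -
  define f where "f \<zeta> = complex_of_real (poisson_kernel (of_real r) \<zeta>)" for \<zeta>
  have rD: "of_real r \<in> DD" using r by (simp add: DD_def)
  have fi: "integrable mT f" unfolding f_def[abs_def] using integrable_poisson_kernel[OF rD] by (rule integrable_of_real)
  have pf: "poisson_fun f z = of_real (poisson_kernel (of_real r * z) 1)" if "z \<in> DD" for z
    unfolding f_def using poisson_fun_poisson_kernel[OF r that] .
  have m: "(\<lambda>\<zeta>. poisson_kernel (of_real r * phi 1 \<zeta>) 1) \<in> borel_measurable borelT"
    by (rule borel_measurable_borelT) measurable
  have ae: "AE \<zeta> in mT. compL (phi 1) f \<zeta> = of_real (poisson_kernel (of_real r * phi 1 \<zeta>) 1)"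
    using compL_phi(2)[OF fi zero_le_one] AE_not_ssupp AE_space[of mT]
    by eventually_elim (simp add: pf phi_DD)
  note ci = compL_phi(3)[OF fi zero_le_one]
  have i: "integrable mT (\<lambda>\<zeta>. complex_of_real (poisson_kernel (of_real r * phi 1 \<zeta>) 1))"
    by (rule integrable_cong_AE_imp[OF ci]) (use m ae in auto)
  then show "integrable mT (\<lambda>\<zeta>. poisson_kernel (of_real r * phi 1 \<zeta>) 1)" by (simp add: complex_of_real_integrable_eq)
  have "of_real (\<integral>\<zeta>. poisson_kernel (of_real r * phi 1 \<zeta>) 1 \<partial>mT) = (\<integral>\<zeta>. compL (phi 1) f \<zeta> \<partial>mT)"
    unfolding integral_complex_of_real[symmetric] by (rule integral_cong_AE) (use i ci ae in auto)
  also have "\<dots> = poisson_fun (compL (phi 1) f) 0" unfolding poisson_fun_def by (intro Bochner_Integration.integral_cong) auto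
  also have "\<dots> = of_real (poisson_kernel (of_real r * phi 1 0) 1)"
    using compL_phi(4)[OF fi zero_le_one DD_0] pf[of "phi 1 0"] phi_DD[of 0 1] DD_not_ssupp[OF DD_0] by simp
  finally show "(\<integral>\<zeta>. poisson_kernel (of_real r * phi 1 \<zeta>) 1 \<partial>mT) = poisson_kernel (of_real r * phi 1 0) 1"
    using of_real_eq_iff by blast
qed

text \<open>With r = rad n the integrand is P_{r phi}(1) minus Q, where Q = r^2 (1 - |phi|^2) / |1 -
  r phi|^2. The first mean tends to P_{phi(0)}(1) = 2, the mass of m + sigma_1; the second tends by
  dominated convergence to 1, the mass of m. The difference is the mass of sigma_1.\<close>

lemma peak_phi_integral_tendsto:
  "(\<lambda>n. \<integral>\<zeta>. (1 - (rad n)\<^sup>2) / (norm (1 - of_real (rad n) * phi 1 \<zeta>))\<^sup>2 \<partial>mT) \<longlonglongrightarrow> 1"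
proof -
  define Q where "Q n \<zeta> = (rad n)\<^sup>2 * (1 - (norm (phi 1 \<zeta>))\<^sup>2) / (norm (1 - of_real (rad n) * phi 1 \<zeta>))\<^sup>2" for n \<zeta>
  have Qm: "Q n \<in> borel_measurable mT" for n
    unfolding Q_def[abs_def] borel_measurable_mT by (rule borel_measurable_borelT) measurable
  have P1: "(1 - (norm (phi 1 \<zeta>))\<^sup>2) / (norm (1 - phi 1 \<zeta>))\<^sup>2 = 1" if "\<zeta> \<notin> ssupp" "norm \<zeta> = 1" for \<zeta>
  proof -
    have "(1 - (norm (phi 1 \<zeta>))\<^sup>2) / (norm (1 - phi 1 \<zeta>))\<^sup>2 = poisson_kernel (phi 1 \<zeta>) 1" by (simp add: poisson_kernel_def)
    also have "\<dots> = 1" using poisson_kernel_phi_1[of \<zeta> 1] that by (simp add: Re_herg_sphere)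
    finally show ?thesis .
  qed
  \<comment> \<open>|1 - phi| <= 2 |1 - r phi|, and on the horocycle P_w(1) = 1 the numerator 1 -
    |phi|^2 equals |1 - phi|^2.\<close>
  have bnd: "norm (Q n \<zeta>) \<le> 4" if z: "\<zeta> \<notin> ssupp" "norm \<zeta> = 1" for n \<zeta>
  proof -
    let ?w = "phi 1 \<zeta>"
    have w: "norm ?w < 1" using norm_phi[of \<zeta> 1] z by simp
    have "norm (of_real (rad n) * ?w) \<le> rad n" using w rad[of n] mult_left_mono[of "norm ?w" 1 "rad n"] by (simp add: norm_mult)
    then have 1: "1 - rad n \<le> norm (1 - of_real (rad n) * ?w)" using norm_triangle_ineq2[of 1 "of_real (rad n) * ?w"] by simp
    have e: "of_real (rad n) * ?w - ?w = of_real (rad n - 1) * ?w" by (simp add: algebra_simps)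
    have "norm (of_real (rad n) * ?w - ?w) \<le> 1 - rad n"
      unfolding e norm_mult norm_of_real using w rad[of n] mult_left_mono[of "norm ?w" 1 "1 - rad n"] by simp
    then have "norm (1 - ?w) \<le> 2 * norm (1 - of_real (rad n) * ?w)"
      using norm_triangle_ineq[of "1 - of_real (rad n) * ?w" "of_real (rad n) * ?w - ?w"] 1 by simp
    then have "(norm (1 - ?w))\<^sup>2 \<le> (2 * norm (1 - of_real (rad n) * ?w))\<^sup>2" by (intro power_mono) auto
    then have 2: "(norm (1 - ?w))\<^sup>2 \<le> 4 * (norm (1 - of_real (rad n) * ?w))\<^sup>2" by (simp add: power_mult_distrib)
    have nz: "0 < norm (1 - of_real (rad n) * ?w)" using 1 rad[of n] by linarith
    have w2: "0 \<le> 1 - (norm ?w)\<^sup>2" using w by (simp add: power_le_one)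
    have "1 - (norm ?w)\<^sup>2 = (norm (1 - ?w))\<^sup>2" using P1[OF z] by (metis div_by_0 divide_eq_1_iff zero_neq_one)
    then have 3: "1 - (norm ?w)\<^sup>2 \<le> 4 * (norm (1 - of_real (rad n) * ?w))\<^sup>2" using 2 by simp
    have "(rad n)\<^sup>2 * (1 - (norm ?w)\<^sup>2) \<le> 1 * (1 - (norm ?w)\<^sup>2)" using rad[of n] w2 by (intro mult_right_mono) (auto simp: power_le_one)
    from order_trans[OF this[unfolded mult_1] 3]
    have "(rad n)\<^sup>2 * (1 - (norm ?w)\<^sup>2) \<le> 4 * (norm (1 - of_real (rad n) * ?w))\<^sup>2" .
    moreover have "0 \<le> Q n \<zeta>" using w2 by (simp add: Q_def)
    moreover have "0 < (norm (1 - of_real (rad n) * ?w))\<^sup>2" using nz by simp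
    ultimately have "Q n \<zeta> \<le> 4" unfolding Q_def by (subst pos_divide_le_eq)
    with \<open>0 \<le> Q n \<zeta>\<close> show ?thesis by simp
  qed
  have Qae: "AE \<zeta> in mT. norm (Q n \<zeta>) \<le> 4" for n using AE_not_ssupp AE_space[of mT] by eventually_elim (rule bnd, auto)
  have Qi: "integrable mT (Q n)" for n by (rule mT.integrable_const_bound[OF Qae Qm])
  have "(\<lambda>n. \<integral>\<zeta>. Q n \<zeta> \<partial>mT) \<longlonglongrightarrow> (\<integral>\<zeta>. 1 \<partial>mT)"
  proof (rule integral_dominated_convergence[where w="\<lambda>_. 4"])
    show "AE \<zeta> in mT. (\<lambda>n. Q n \<zeta>) \<longlonglongrightarrow> 1" using AE_not_ssupp AE_space[of mT]
    proof eventually_elim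
      case (elim \<zeta>)
      then have "norm (phi 1 \<zeta>) < 1" by (intro norm_phi) auto
      then have "1 - complex_of_real 1 * phi 1 \<zeta> \<noteq> 0" by auto
      then have "(\<lambda>n. Q n \<zeta>) \<longlonglongrightarrow> 1\<^sup>2 * (1 - (norm (phi 1 \<zeta>))\<^sup>2) / (norm (1 - of_real 1 * phi 1 \<zeta>))\<^sup>2"
        unfolding Q_def by (intro tendsto_intros tendsto_rad) auto
      moreover have "1\<^sup>2 * (1 - (norm (phi 1 \<zeta>))\<^sup>2) / (norm (1 - of_real 1 * phi 1 \<zeta>))\<^sup>2 = 1"
        unfolding of_real_1 mult_1_left power_one by (rule P1) (use elim in simp_all)
      ultimately show ?case by (simp only:)
    qed
    show "AE \<zeta> in mT. norm (Q n \<zeta>) \<le> 4" for n by (rule Qae)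
  qed (use Qm in auto)
  then have lQ: "(\<lambda>n. \<integral>\<zeta>. Q n \<zeta> \<partial>mT) \<longlonglongrightarrow> 1" by simp
  have "(\<lambda>n. poisson_kernel (of_real (rad n) * phi 1 0) 1) \<longlonglongrightarrow> poisson_kernel (phi 1 0) 1"
    using phi_DD[of 0 1] DD_not_ssupp[OF DD_0] by (intro poisson_kernel_rad_tendsto) auto
  also have "poisson_kernel (phi 1 0) 1 = 2"
    using poisson_kernel_phi_1[OF DD_not_ssupp[OF DD_0], of 1] herg_0[of 1] by simp
  finally have "(\<lambda>n. poisson_kernel (of_real (rad n) * phi 1 0) 1 - (\<integral>\<zeta>. Q n \<zeta> \<partial>mT)) \<longlonglongrightarrow> 2 - 1"
    using lQ by (intro tendsto_diff)
  moreover have "(\<integral>\<zeta>. (1 - (rad n)\<^sup>2) / (norm (1 - of_real (rad n) * phi 1 \<zeta>))\<^sup>2 \<partial>mT)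
     = poisson_kernel (of_real (rad n) * phi 1 0) 1 - (\<integral>\<zeta>. Q n \<zeta> \<partial>mT)" for n
  proof -
    have "(1 - (rad n)\<^sup>2) / (norm (1 - of_real (rad n) * phi 1 \<zeta>))\<^sup>2 = poisson_kernel (of_real (rad n) * phi 1 \<zeta>) 1 - Q n \<zeta>" for \<zeta>
      unfolding poisson_kernel_def Q_def diff_divide_distrib[symmetric]
      using rad[of n] by (simp add: norm_mult power_mult_distrib algebra_simps)
    then show ?thesis
      using integral_poisson_kernel_phi_1[OF rad, of n] Qi[of n] by simp
  qed
  ultimately show ?thesis by simp
qed

text \<open>The images of the unit vectors \<open>peak p (rad n)\<close> have Poisson integrals
  tending to 0 at every point, so a norm limit must be 0, while the p-th powers of their norms tend
  to 1. The peaks lie in H^p, hence one argument covers every X between H^p and L^p.\<close>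

theorem not_compact_Lp:
  assumes p: "1 \<le> p" and X: "X \<subseteq> Lp p" "Hp p \<subseteq> X"
  shows "\<not> compact_op X (Lp_norm p) (compL (phi 1))"
proof
  assume C: "compact_op X (Lp_norm p) (compL (phi 1))"
  define x where "x n = peak p (rad n)" for n
  have xX: "x n \<in> X" "x n \<in> Lp p" for n using peak_Hp[OF p rad] X by (auto simp: x_def)
  have "\<forall>n. x n \<in> X \<and> Lp_norm p (x n) \<le> 1" using xX peak_Lp_norm[OF p rad] by (simp add: x_def)
  with C obtain r y where r: "strict_mono r" and y: "y \<in> X" and l: "(\<lambda>n. Lp_norm p (compL (phi 1) (x (r n)) - y)) \<longlonglongrightarrow> 0"
    unfolding compact_op_def by blast
  note xi = Lp_integrable(1)[OF xX(2) p]
  have yL: "y \<in> Lp p" using y X by auto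
  note cp = compL_phi[OF xi zero_le_one]
  define g where "g n = compL (phi 1) (x n)" for n
  have gm: "g n \<in> borel_measurable borelT" for n using cp(3)[of n] by (auto simp: g_def borel_measurable_mT[symmetric] simp del: borel_measurable_mT)
  have gae: "AE \<zeta> in mT. norm (g n \<zeta>) powr p = (1 - (rad n)\<^sup>2) / (norm (1 - of_real (rad n) * phi 1 \<zeta>))\<^sup>2" for n
    using cp(2)[of n] AE_not_ssupp AE_space[of mT]
  proof eventually_elim
    case (elim \<zeta>)
    then have D: "phi 1 \<zeta> \<in> DD" by (intro phi_DD) auto
    then show ?case using elim norm_peak_powr[OF p rad, of "phi 1 \<zeta>" n]
      by (simp add: g_def x_def poisson_fun_peak[OF p rad D] DD_def)
  qed
  have gp: "(\<lambda>\<zeta>. norm (g n \<zeta>) powr p) \<in> borel_measurable mT" for n using gm by simp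
  have hm: "(\<lambda>\<zeta>. (1 - (rad n)\<^sup>2) / (norm (1 - of_real (rad n) * phi 1 \<zeta>))\<^sup>2) \<in> borel_measurable mT" for n
    unfolding borel_measurable_mT by (rule borel_measurable_borelT) measurable
  have gL: "g n \<in> Lp p" for n
  proof -
    have "integrable mT (\<lambda>\<zeta>. norm (g n \<zeta>) powr p)"
    proof (rule mT.integrable_const_bound[where B="1 / (1 - rad n)\<^sup>2"])
      show "AE \<zeta> in mT. norm (norm (g n \<zeta>) powr p) \<le> 1 / (1 - rad n)\<^sup>2"
        using gae[of n] AE_not_ssupp AE_space[of mT]
      proof eventually_elim
        case (elim \<zeta>)
        then have w: "norm (phi 1 \<zeta>) < 1" by (intro norm_phi) auto
        have "norm (of_real (rad n) * phi 1 \<zeta>) \<le> rad n"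
          using w rad[of n] mult_left_mono[of "norm (phi 1 \<zeta>)" 1 "rad n"] by (simp add: norm_mult)
        then have 1: "1 - rad n \<le> norm (1 - of_real (rad n) * phi 1 \<zeta>)" using norm_triangle_ineq2[of 1 "of_real (rad n) * phi 1 \<zeta>"] by simp
        have "(1 - (rad n)\<^sup>2) / (norm (1 - of_real (rad n) * phi 1 \<zeta>))\<^sup>2 \<le> 1 / (1 - rad n)\<^sup>2"
          using 1 rad[of n] by (intro frac_le power_mono) auto
        then have "norm (g n \<zeta>) powr p \<le> 1 / (1 - rad n)\<^sup>2" unfolding elim(1) .
        then show ?case by simp
      qed
    qed (use gp in auto)
    then show ?thesis using gm by (simp add: Lp_def)
  qed
  have "poisson_fun y z = 0" if z: "z \<in> DD" for z
  proof -
    have D: "phi 1 z \<in> DD" using z DD_not_ssupp by (intro phi_DD) (auto simp: DD_def)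
    have "(\<lambda>n. poisson_fun (g (r n)) z) \<longlonglongrightarrow> poisson_fun y z"
      using l by (intro tendsto_poisson_fun_Lp[OF p gL yL _ z]) (simp add: g_def)
    moreover have "poisson_fun (g n) z = peak p (rad n) (phi 1 z)" for n
      unfolding g_def cp(4)[OF z] unfolding x_def by (rule poisson_fun_peak[OF p rad D])
    moreover have "(\<lambda>n. peak p (rad (r n)) (phi 1 z)) \<longlonglongrightarrow> 0"
      using LIMSEQ_subseq_LIMSEQ[OF peak_rad_tendsto_0[OF p D] r] by (simp add: o_def)
    ultimately show ?thesis using LIMSEQ_unique by simp
  qed
  then have y0: "AE \<zeta> in mT. y \<zeta> = 0"
    using Lp_integrable(1)[OF yL p] by (intro poisson_fun_unique) (auto simp: poisson_fun_def)
  have N: "Lp_norm p (g n - y) powr p = (\<integral>\<zeta>. (1 - (rad n)\<^sup>2) / (norm (1 - of_real (rad n) * phi 1 \<zeta>))\<^sup>2 \<partial>mT)" for n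
  proof -
    have "Lp_norm p (g n - y) = Lp_norm p (g n)"
      by (rule Lp_AE_cong(2)) (use gm Lp_integrable(3)[OF yL p] y0 in \<open>auto simp: fun_diff_def\<close>)
    then have "Lp_norm p (g n - y) powr p = (\<integral>\<zeta>. norm (g n \<zeta>) powr p \<partial>mT)" using Lp_norm_powr[OF p] by simp
    also have "\<dots> = (\<integral>\<zeta>. (1 - (rad n)\<^sup>2) / (norm (1 - of_real (rad n) * phi 1 \<zeta>))\<^sup>2 \<partial>mT)"
      by (rule integral_cong_AE[OF gp hm gae])
    finally show ?thesis .
  qed
  have "(\<lambda>n. Lp_norm p (g (r n) - y) powr p) \<longlonglongrightarrow> 1"
    unfolding N using LIMSEQ_subseq_LIMSEQ[OF peak_phi_integral_tendsto r] by (simp add: o_def)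
  moreover have "(\<lambda>n. Lp_norm p (g (r n) - y) powr p) \<longlonglongrightarrow> 0 powr p"
    using l p Lp_norm_nonneg by (intro tendsto_powr') (auto simp: g_def)
  ultimately have "(1::real) = 0 powr p" using LIMSEQ_unique by blast
  then show False by simp
qed

section \<open>Composition operators on the Hardy space\<close>

text \<open>1/(1 - a) + b/(1 - b) = (1 - a b) / ((1 - a)(1 - b)) with a = z cnj zeta and b = cnj
  a.\<close>

lemma poisson_kernel_geometric:
  assumes z: "norm z < 1" "norm \<zeta> = 1"
  shows "(\<lambda>n. (z * cnj \<zeta>) ^ n + (cnj z * \<zeta>) ^ Suc n) sums of_real (poisson_kernel z \<zeta>)"
proof -
  let ?a = "z * cnj \<zeta>" and ?b = "cnj z * \<zeta>"
  have n: "norm ?a < 1" "norm ?b < 1" using z by (simp_all add: norm_mult)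
  have "(\<lambda>n. ?a ^ n + ?b * ?b ^ n) sums (1 / (1 - ?a) + ?b * (1 / (1 - ?b)))"
    using n by (intro sums_add sums_mult geometric_sums)
  moreover have "1 / (1 - ?a) + ?b * (1 / (1 - ?b)) = of_real (poisson_kernel z \<zeta>)"
  proof -
    have ne: "1 - ?a \<noteq> 0" "1 - ?b \<noteq> 0" using n by auto
    have ab: "?a * ?b = of_real ((norm z)\<^sup>2)"
      using complex_norm_square[of z] complex_norm_square[of \<zeta>] z(2) by (simp add: mult_ac)
    have u: "\<zeta> * cnj \<zeta> = 1" using complex_norm_square[of \<zeta>] z(2) by simp
    have "of_real ((norm (\<zeta> - z))\<^sup>2) = (\<zeta> - z) * (cnj \<zeta> - cnj z)" by (metis complex_norm_square complex_cnj_diff of_real_power)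
    also have "\<dots> = (1 - ?a) * (1 - ?b)" using u by algebra
    finally have d: "complex_of_real ((norm (\<zeta> - z))\<^sup>2) = (1 - ?a) * (1 - ?b)" .
    have "1 / (1 - ?a) + ?b * (1 / (1 - ?b)) = (1 - ?a * ?b) / ((1 - ?a) * (1 - ?b))"
      using ne by (simp add: divide_simps) (simp add: algebra_simps)
    also have "\<dots> = of_real (1 - (norm z)\<^sup>2) / of_real ((norm (\<zeta> - z))\<^sup>2)" unfolding ab d by simp
    finally show ?thesis by (simp add: poisson_kernel_def)
  qed
  ultimately show ?thesis by simp
qed

text \<open>Vanishing of the negative coefficients kills the antiholomorphic half of the kernel
  expansion, so the Poisson integral is a power series. Partial sums of the kernel are bounded by 2
  / (1 - |z|), which dominates.\<close>

lemma poisson_fun_Hp_sums: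
  assumes f: "integrable mT f" "\<And>n::nat. n > 0 \<Longrightarrow> (\<integral>\<zeta>. f \<zeta> * \<zeta> ^ n \<partial>mT) = 0" and z: "z \<in> DD"
  shows "(\<lambda>n. (\<integral>\<zeta>. f \<zeta> * cnj \<zeta> ^ n \<partial>mT) * z ^ n) sums poisson_fun f z"
proof -
  have z1: "norm z < 1" using z by (simp add: DD_def)
  define S where "S N \<zeta> = (\<Sum>n<N. (z * cnj \<zeta>) ^ n + (cnj z * \<zeta>) ^ Suc n)" for N \<zeta>
  have Sm: "S N \<in> borel_measurable borelT" for N
    unfolding S_def[abs_def] by (intro continuous_imp_measurable_borelT continuous_intros)
  have geo: "(\<Sum>n<N. norm z ^ n) \<le> 1 / (1 - norm z)" for N
    using z1 sum_le_suminf[OF summable_geometric[of "norm z"], of "{..<N}"] suminf_geometric[of "norm z"] by simp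
  have SB: "norm (S N \<zeta>) \<le> 2 / (1 - norm z)" if n: "norm \<zeta> = 1" for N \<zeta>
  proof -
    have "norm (S N \<zeta>) \<le> (\<Sum>n<N. norm z ^ n + norm z ^ Suc n)"
      unfolding S_def by (rule order_trans[OF norm_sum sum_mono], rule order_trans[OF norm_triangle_ineq])
        (use n in \<open>simp add: norm_mult norm_power\<close>)
    also have "\<dots> \<le> (\<Sum>n<N. norm z ^ n + norm z ^ n)" using z1 by (intro sum_mono add_left_mono power_decreasing) auto
    also have "\<dots> = 2 * (\<Sum>n<N. norm z ^ n)" by (simp add: sum_distrib_left)
    also have "\<dots> \<le> 2 * (1 / (1 - norm z))" by (intro mult_left_mono geo) simp
    also have "\<dots> = 2 / (1 - norm z)" by simp
    finally show ?thesis .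
  qed
  have "(\<lambda>N. \<integral>\<zeta>. S N \<zeta> * f \<zeta> \<partial>mT) \<longlonglongrightarrow> (\<integral>\<zeta>. of_real (poisson_kernel z \<zeta>) * f \<zeta> \<partial>mT)"
  proof (rule integral_dominated_convergence[where w="\<lambda>\<zeta>. 2 / (1 - norm z) * norm (f \<zeta>)"])
    show "AE \<zeta> in mT. (\<lambda>N. S N \<zeta> * f \<zeta>) \<longlonglongrightarrow> of_real (poisson_kernel z \<zeta>) * f \<zeta>"
      using poisson_kernel_geometric[OF z1] unfolding S_def by (intro AE_I2 tendsto_mult_right) (simp add: sums_def)
    show "AE \<zeta> in mT. norm (S N \<zeta> * f \<zeta>) \<le> 2 / (1 - norm z) * norm (f \<zeta>)" for N
      unfolding norm_mult using SB by (intro AE_I2 mult_right_mono) auto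
  qed (use f Sm in \<open>auto intro!: borel_measurable_times\<close>)
  moreover have "(\<integral>\<zeta>. S N \<zeta> * f \<zeta> \<partial>mT) = (\<Sum>n<N. (\<integral>\<zeta>. f \<zeta> * cnj \<zeta> ^ n \<partial>mT) * z ^ n)" for N
  proof -
    have i1: "integrable mT (\<lambda>\<zeta>. cnj \<zeta> ^ n * f \<zeta>)" for n
      by (rule integrable_bounded_mult[OF f(1), where B=1])
         (auto simp: norm_power intro!: continuous_imp_measurable_borelT continuous_intros)
    have i2: "integrable mT (\<lambda>\<zeta>. \<zeta> ^ n * f \<zeta>)" for n
      by (rule integrable_bounded_mult[OF f(1), where B=1])
         (auto simp: norm_power intro!: continuous_imp_measurable_borelT continuous_intros)
    have "(\<integral>\<zeta>. S N \<zeta> * f \<zeta> \<partial>mT) = (\<integral>\<zeta>. (\<Sum>n<N. z ^ n * (cnj \<zeta> ^ n * f \<zeta>) + cnj z ^ Suc n * (\<zeta> ^ Suc n * f \<zeta>)) \<partial>mT)"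
      unfolding S_def sum_distrib_right by (intro Bochner_Integration.integral_cong refl sum.cong)
        (simp add: power_mult_distrib algebra_simps)
    also have "\<dots> = (\<Sum>n<N. z ^ n * (\<integral>\<zeta>. cnj \<zeta> ^ n * f \<zeta> \<partial>mT) + cnj z ^ Suc n * (\<integral>\<zeta>. \<zeta> ^ Suc n * f \<zeta> \<partial>mT))"
      using i1 i2[of "Suc _"] by (subst Bochner_Integration.integral_sum) simp_all
    also have "\<dots> = (\<Sum>n<N. (\<integral>\<zeta>. f \<zeta> * cnj \<zeta> ^ n \<partial>mT) * z ^ n)"
    proof (intro sum.cong refl)
      fix n
      have "(\<integral>\<zeta>. \<zeta> ^ Suc n * f \<zeta> \<partial>mT) = 0" using f(2)[of "Suc n"] by (simp add: mult_ac)
      then show "z ^ n * (\<integral>\<zeta>. cnj \<zeta> ^ n * f \<zeta> \<partial>mT) + cnj z ^ Suc n * (\<integral>\<zeta>. \<zeta> ^ Suc n * f \<zeta> \<partial>mT)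
         = (\<integral>\<zeta>. f \<zeta> * cnj \<zeta> ^ n \<partial>mT) * z ^ n" by (simp add: mult.commute)
    qed
    finally show ?thesis .
  qed
  ultimately show ?thesis by (simp add: sums_def poisson_fun_def)
qed

lemma poisson_fun_Hp_holomorphic:
  assumes f: "f \<in> Hp p" "1 \<le> p"
  shows "poisson_fun f holomorphic_on DD"
proof -
  have fL: "f \<in> Lp p" using f by (simp add: Hp_def)
  have "(\<lambda>n. (\<integral>\<zeta>. f \<zeta> * cnj \<zeta> ^ n \<partial>mT) * (w - 0) ^ n) sums poisson_fun f w" if "w \<in> ball 0 1" for w
    using poisson_fun_Hp_sums[OF Lp_integrable(1)[OF fL f(2)]] f that by (simp add: Hp_def DD_def)
  then show ?thesis unfolding DD_def by (rule power_series_holomorphic)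
qed

section \<open>Composition with an arbitrary self-map on H^2\<close>

lemma norm_poisson_fun_square_le:
  assumes f: "f \<in> Lp 2" and z: "z \<in> DD"
  shows "(norm (poisson_fun f z))\<^sup>2 \<le> 9 * (\<integral>\<alpha>. poisson_kernel z \<alpha> * (norm (f \<alpha>))\<^sup>2 \<partial>mT)"
    and "integrable mT (\<lambda>\<alpha>. poisson_kernel z \<alpha> * (norm (f \<alpha>))\<^sup>2)"
proof -
  note fi = Lp_integrable[OF f, simplified]
  have z1: "norm z < 1" using z by (simp add: DD_def)
  have pw: "norm (f x) powr 2 = (norm (f x))\<^sup>2" for x by simp
  have pk: "0 \<le> poisson_kernel z \<alpha>" for \<alpha> using z1 by simp
  have i: "integrable mT (\<lambda>\<alpha>. poisson_kernel z \<alpha> * F \<alpha>)" if "integrable mT F" for F :: "complex \<Rightarrow> real"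
  proof (rule Bochner_Integration.integrable_bound)
    show "integrable mT (\<lambda>\<alpha>. 2 / (1 - norm z)\<^sup>2 * F \<alpha>)" using that by simp
    show "AE \<alpha> in mT. norm (poisson_kernel z \<alpha> * F \<alpha>) \<le> norm (2 / (1 - norm z)\<^sup>2 * F \<alpha>)"
    proof (intro AE_I2)
      fix \<alpha> assume "\<alpha> \<in> space mT"
      then have "poisson_kernel z \<alpha> \<le> 2 / (1 - norm z)\<^sup>2" using z1 by (intro poisson_kernel_le) auto
      then show "norm (poisson_kernel z \<alpha> * F \<alpha>) \<le> norm (2 / (1 - norm z)\<^sup>2 * F \<alpha>)"
        unfolding norm_mult using pk[of \<alpha>] by (intro mult_right_mono) auto
    qed
    show "(\<lambda>\<alpha>. poisson_kernel z \<alpha> * F \<alpha>) \<in> borel_measurable mT"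
      using borel_measurable_integrable[OF that] by (intro borel_measurable_times) auto
  qed
  have i2: "integrable mT (\<lambda>\<alpha>. (norm (f \<alpha>))\<^sup>2)" using fi(2) by (simp only: pw)
  show ii: "integrable mT (\<lambda>\<alpha>. poisson_kernel z \<alpha> * (norm (f \<alpha>))\<^sup>2)" by (rule i[OF i2])
  have "norm (poisson_fun f z) \<le> (\<integral>\<alpha>. poisson_kernel z \<alpha> * norm (f \<alpha>) \<partial>mT)"
    unfolding poisson_fun_def
    by (rule norm_integral_le_integral) (use fi z pk i in \<open>auto simp: norm_mult intro: integrable_poisson_mult\<close>)
  also have "\<dots> \<le> 3 * (\<integral>\<alpha>. poisson_kernel z \<alpha> * norm (f \<alpha>) powr 2 \<partial>mT) powr (1/2)"
    using fi i2 pk by (intro jensen_weak i integrable_poisson_kernel z) (auto simp: integral_poisson_kernel[OF z])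
  also have "\<dots> = 3 * sqrt (\<integral>\<alpha>. poisson_kernel z \<alpha> * (norm (f \<alpha>))\<^sup>2 \<partial>mT)"
    using pk by (simp add: powr_half_sqrt Bochner_Integration.integral_nonneg)
  finally have "(norm (poisson_fun f z))\<^sup>2 \<le> (3 * sqrt (\<integral>\<alpha>. poisson_kernel z \<alpha> * (norm (f \<alpha>))\<^sup>2 \<partial>mT))\<^sup>2"
    by (intro power_mono) auto
  also have "\<dots> = 9 * (\<integral>\<alpha>. poisson_kernel z \<alpha> * (norm (f \<alpha>))\<^sup>2 \<partial>mT)"
    using pk by (simp add: power_mult_distrib Bochner_Integration.integral_nonneg)
  finally show "(norm (poisson_fun f z))\<^sup>2 \<le> 9 * (\<integral>\<alpha>. poisson_kernel z \<alpha> * (norm (f \<alpha>))\<^sup>2 \<partial>mT)" .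
qed

text \<open>|u(phi)|^2 is at most 9 times the Poisson integral of |f|^2 at phi. After exchanging
  integrals, the mean of P_{phi(r zeta)}(alpha) over zeta is P_{phi(0)}(alpha) <= 2 / (1 -
  |phi(0)|)^2; hence 18 = 9 * 2.\<close>

lemma littlewood_subordination:
  assumes f: "f \<in> Lp 2" and \<phi>: "analytic_selfmap \<phi>" and r: "0 \<le> r" "r < 1"
  shows "(\<integral>\<^sup>+\<zeta>. ennreal ((norm (poisson_fun f (\<phi> (of_real r * \<zeta>))))\<^sup>2) \<partial>mT)
    \<le> ennreal (18 / (1 - norm (\<phi> 0))\<^sup>2 * (\<integral>\<alpha>. (norm (f \<alpha>))\<^sup>2 \<partial>mT))"
proof -
  note fi = Lp_integrable[OF f, simplified]
  have i2: "integrable mT (\<lambda>\<alpha>. (norm (f \<alpha>))\<^sup>2)" using fi(2) by simp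
  have P0: "norm (\<phi> 0) < 1" using \<phi> by (auto simp: analytic_selfmap_def DD_def image_subset_iff)
  have pD: "\<phi> (of_real r * \<zeta>) \<in> DD" if "norm \<zeta> = 1" for \<zeta>
    using of_real_mult_DD[OF r, of \<zeta>] that \<phi> by (auto simp: analytic_selfmap_def)
  have pm: "(\<lambda>\<zeta>. \<phi> (of_real r * \<zeta>)) \<in> borel_measurable borelT"
    by (rule continuous_imp_measurable_borelT,
        rule continuous_on_compose2[OF holomorphic_on_imp_continuous_on, of \<phi> DD])
       (use \<phi> r in \<open>auto simp: analytic_selfmap_def intro!: continuous_intros of_real_mult_DD\<close>)
  have km: "(\<lambda>q. poisson_kernel (\<phi> (of_real r * fst q)) (snd q)) \<in> borel_measurable (borelT \<Otimes>\<^sub>M borelT)"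
    by (intro measurable_poisson_kernel snd_borelT measurable_compose[OF measurable_fst pm])
  have fm: "(\<lambda>\<alpha>. (norm (f \<alpha>))\<^sup>2) \<in> borel_measurable borelT" using borel_measurable_integrable[OF i2] by simp
  have "(\<lambda>q. poisson_kernel (\<phi> (of_real r * fst q)) (snd q) * (norm (f (snd q)))\<^sup>2) \<in> borel_measurable (borelT \<Otimes>\<^sub>M borelT)"
    by (intro borel_measurable_times km measurable_compose[OF measurable_snd fm])
  then have m: "(\<lambda>q. ennreal (poisson_kernel (\<phi> (of_real r * fst q)) (snd q) * (norm (f (snd q)))\<^sup>2)) \<in> borel_measurable (mT \<Otimes>\<^sub>M mT)"
    using measurable_cong_sets[OF sets_pair_measure_cong[OF sets_mT sets_mT] refl, of "borel :: ennreal measure"] by simp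
  interpret P: pair_sigma_finite mT mT ..
  let ?K = "\<lambda>\<zeta> \<alpha>. ennreal (poisson_kernel (\<phi> (of_real r * \<zeta>)) \<alpha> * (norm (f \<alpha>))\<^sup>2)"
  have "(\<integral>\<^sup>+\<zeta>. ennreal ((norm (poisson_fun f (\<phi> (of_real r * \<zeta>))))\<^sup>2) \<partial>mT) \<le> (\<integral>\<^sup>+\<zeta>. ennreal 9 * (\<integral>\<^sup>+\<alpha>. ?K \<zeta> \<alpha> \<partial>mT) \<partial>mT)"
  proof (rule nn_integral_mono)
    fix \<zeta> assume "\<zeta> \<in> space mT"
    then have D: "\<phi> (of_real r * \<zeta>) \<in> DD" using pD by simp
    have pk: "0 \<le> poisson_kernel (\<phi> (of_real r * \<zeta>)) \<alpha>" for \<alpha> using D by (simp add: DD_def)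
    note sq = norm_poisson_fun_square_le[OF f D]
    have "ennreal ((norm (poisson_fun f (\<phi> (of_real r * \<zeta>))))\<^sup>2) \<le> ennreal (9 * (\<integral>\<alpha>. poisson_kernel (\<phi> (of_real r * \<zeta>)) \<alpha> * (norm (f \<alpha>))\<^sup>2 \<partial>mT))"
      using sq(1) by (rule ennreal_leI)
    also have "\<dots> = ennreal 9 * ennreal (\<integral>\<alpha>. poisson_kernel (\<phi> (of_real r * \<zeta>)) \<alpha> * (norm (f \<alpha>))\<^sup>2 \<partial>mT)"
      using pk by (intro ennreal_mult) (auto intro!: Bochner_Integration.integral_nonneg)
    also have "ennreal (\<integral>\<alpha>. poisson_kernel (\<phi> (of_real r * \<zeta>)) \<alpha> * (norm (f \<alpha>))\<^sup>2 \<partial>mT) = (\<integral>\<^sup>+\<alpha>. ?K \<zeta> \<alpha> \<partial>mT)"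
      using sq(2) pk by (intro nn_integral_eq_integral[symmetric]) auto
    finally show "ennreal ((norm (poisson_fun f (\<phi> (of_real r * \<zeta>))))\<^sup>2) \<le> ennreal 9 * (\<integral>\<^sup>+\<alpha>. ?K \<zeta> \<alpha> \<partial>mT)" .
  qed
  also have "\<dots> = ennreal 9 * (\<integral>\<^sup>+\<zeta>. (\<integral>\<^sup>+\<alpha>. ?K \<zeta> \<alpha> \<partial>mT) \<partial>mT)"
    using m by (intro nn_integral_cmult mT.borel_measurable_nn_integral) (simp add: case_prod_unfold)
  finally have outer: "(\<integral>\<^sup>+\<zeta>. ennreal ((norm (poisson_fun f (\<phi> (of_real r * \<zeta>))))\<^sup>2) \<partial>mT)
     \<le> ennreal 9 * (\<integral>\<^sup>+\<zeta>. (\<integral>\<^sup>+\<alpha>. ?K \<zeta> \<alpha> \<partial>mT) \<partial>mT)" .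
  have "(\<integral>\<^sup>+\<zeta>. (\<integral>\<^sup>+\<alpha>. ?K \<zeta> \<alpha> \<partial>mT) \<partial>mT) = (\<integral>\<^sup>+\<alpha>. (\<integral>\<^sup>+\<zeta>. ?K \<zeta> \<alpha> \<partial>mT) \<partial>mT)"
    using P.Fubini[OF m] by simp
  also have "\<dots> \<le> (\<integral>\<^sup>+\<alpha>. ennreal (2 / (1 - norm (\<phi> 0))\<^sup>2 * (norm (f \<alpha>))\<^sup>2) \<partial>mT)"
  proof (rule nn_integral_mono)
    fix \<alpha> assume "\<alpha> \<in> space mT"
    then have a: "norm \<alpha> = 1" by simp
    have pos: "0 \<le> poisson_kernel (\<phi> (of_real r * \<zeta>)) \<alpha>" if "\<zeta> \<in> space mT" for \<zeta> using pD[of \<zeta>] that by (simp add: DD_def)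
    have eq: "(\<integral>\<zeta>. poisson_kernel (\<phi> (of_real r * \<zeta>)) \<alpha> \<partial>mT) = poisson_kernel (\<phi> 0) \<alpha>"
    proof -
      have "(\<integral>\<zeta>. poisson_kernel (\<phi> (of_real r * \<zeta>)) \<alpha> \<partial>mT)
        = (\<integral>\<zeta>. poisson_kernel 0 \<zeta> * poisson_kernel (\<phi> (of_real r * \<zeta>)) \<alpha> \<partial>mT)"
        by (intro Bochner_Integration.integral_cong) auto
      also have "\<dots> = poisson_kernel (\<phi> 0) \<alpha>" using poisson_kernel_selfmap[OF \<phi> a r DD_0] by simp
      finally show ?thesis .
    qed
    have cont: "continuous_on (sphere 0 1) (\<lambda>\<zeta>. \<phi> (of_real r * \<zeta>))"
      by (rule continuous_on_compose2[OF holomorphic_on_imp_continuous_on, of \<phi> DD])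
       (use \<phi> r in \<open>auto simp: analytic_selfmap_def intro!: continuous_intros of_real_mult_DD\<close>)
    have c2: "continuous_on (sphere 0 1) (\<lambda>\<zeta>. poisson_kernel (\<phi> (of_real r * \<zeta>)) \<alpha>)"
      using pD a by (intro continuous_poisson_kernel cont continuous_on_const) (force simp: DD_def)
    obtain B where B: "\<And>\<zeta>. norm \<zeta> = 1 \<Longrightarrow> norm (poisson_kernel (\<phi> (of_real r * \<zeta>)) \<alpha>) \<le> B"
      using continuous_bounded_sphere[OF c2] by blast
    have int: "integrable mT (\<lambda>\<zeta>. poisson_kernel (\<phi> (of_real r * \<zeta>)) \<alpha>)"
      by (rule integrable_mT_bounded[OF continuous_imp_measurable_borelT[OF c2] B])
    have "(\<integral>\<^sup>+\<zeta>. ?K \<zeta> \<alpha> \<partial>mT) = ennreal (\<integral>\<zeta>. poisson_kernel (\<phi> (of_real r * \<zeta>)) \<alpha> * (norm (f \<alpha>))\<^sup>2 \<partial>mT)"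
      using int pos by (intro nn_integral_eq_integral) auto
    also have "\<dots> = ennreal (poisson_kernel (\<phi> 0) \<alpha> * (norm (f \<alpha>))\<^sup>2)" using eq by simp
    also have "\<dots> \<le> ennreal (2 / (1 - norm (\<phi> 0))\<^sup>2 * (norm (f \<alpha>))\<^sup>2)"
      using P0 a by (intro ennreal_leI mult_right_mono poisson_kernel_le) auto
    finally show "(\<integral>\<^sup>+\<zeta>. ?K \<zeta> \<alpha> \<partial>mT) \<le> ennreal (2 / (1 - norm (\<phi> 0))\<^sup>2 * (norm (f \<alpha>))\<^sup>2)" .
  qed
  also have "\<dots> = ennreal (\<integral>\<alpha>. 2 / (1 - norm (\<phi> 0))\<^sup>2 * (norm (f \<alpha>))\<^sup>2 \<partial>mT)"
    using i2 by (intro nn_integral_eq_integral) auto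
  finally have "ennreal 9 * (\<integral>\<^sup>+\<zeta>. (\<integral>\<^sup>+\<alpha>. ?K \<zeta> \<alpha> \<partial>mT) \<partial>mT)
    \<le> ennreal 9 * ennreal (\<integral>\<alpha>. 2 / (1 - norm (\<phi> 0))\<^sup>2 * (norm (f \<alpha>))\<^sup>2 \<partial>mT)" by (rule mult_left_mono) simp
  also have "\<dots> = ennreal (9 * (\<integral>\<alpha>. 2 / (1 - norm (\<phi> 0))\<^sup>2 * (norm (f \<alpha>))\<^sup>2 \<partial>mT))"
    by (rule ennreal_mult[symmetric]) (auto intro!: Bochner_Integration.integral_nonneg)
  also have "9 * (\<integral>\<alpha>. 2 / (1 - norm (\<phi> 0))\<^sup>2 * (norm (f \<alpha>))\<^sup>2 \<partial>mT) = 18 / (1 - norm (\<phi> 0))\<^sup>2 * (\<integral>\<alpha>. (norm (f \<alpha>))\<^sup>2 \<partial>mT)"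
    by simp
  finally show ?thesis using outer by (rule order_trans[rotated])
qed

lemma integral_powers:
  "(\<integral>\<zeta>. \<zeta> ^ m * cnj \<zeta> ^ n \<partial>mT) = (if m = n then 1 else 0)"
proof -
  have u: "\<zeta> * cnj \<zeta> = 1" if "\<zeta> \<in> space mT" for \<zeta> using complex_norm_square[of \<zeta>] that by simp
  have "m = n + (m - n) \<or> (n = m + (n - m) \<and> n - m > 0)" by arith
  then consider k where "m = n + k" | k where "n = m + k" "k > 0" by blast
  then show ?thesis
  proof cases
    case 1
    have "(\<integral>\<zeta>. \<zeta> ^ m * cnj \<zeta> ^ n \<partial>mT) = (\<integral>\<zeta>. \<zeta> ^ k \<partial>mT)"
    proof (intro Bochner_Integration.integral_cong refl)
      fix \<zeta> assume "\<zeta> \<in> space mT"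
      have "\<zeta> ^ m * cnj \<zeta> ^ n = (\<zeta> * cnj \<zeta>) ^ n * \<zeta> ^ k" by (simp add: 1 power_add power_mult_distrib)
      then show "\<zeta> ^ m * cnj \<zeta> ^ n = \<zeta> ^ k" using u[OF \<open>\<zeta> \<in> space mT\<close>] by simp
    qed
    then show ?thesis using 1 integral_power_circle[of k] by (cases "k = 0") auto
  next
    case 2
    have "(\<integral>\<zeta>. \<zeta> ^ m * cnj \<zeta> ^ n \<partial>mT) = (\<integral>\<zeta>. cnj (\<zeta> ^ k) \<partial>mT)"
    proof (intro Bochner_Integration.integral_cong refl)
      fix \<zeta> assume "\<zeta> \<in> space mT"
      have "\<zeta> ^ m * cnj \<zeta> ^ n = (\<zeta> * cnj \<zeta>) ^ m * cnj \<zeta> ^ k" by (simp add: 2 power_add power_mult_distrib)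
      then show "\<zeta> ^ m * cnj \<zeta> ^ n = cnj (\<zeta> ^ k)" using u[OF \<open>\<zeta> \<in> space mT\<close>] by simp
    qed
    also have "\<dots> = cnj (\<integral>\<zeta>. \<zeta> ^ k \<partial>mT)" by (rule Bochner_Integration.integral_cnj)
    finally show ?thesis using 2 integral_power_circle[of k] by simp
  qed
qed

lemma integral_norm_square_trig:
  "(\<integral>\<zeta>. (norm (\<Sum>n\<in>A. b n * \<zeta> ^ n))\<^sup>2 \<partial>mT) = (\<Sum>n\<in>A. (norm (b n))\<^sup>2)" if A: "finite A"
proof -
  have i: "integrable mT (\<lambda>\<zeta>. c * (\<zeta> ^ m * cnj \<zeta> ^ n))" for c m n
    by (rule integrable_mT_bounded[where B="norm c"]) (auto simp: norm_mult norm_power intro!: continuous_imp_measurable_borelT continuous_intros)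
  have "complex_of_real (\<integral>\<zeta>. (norm (\<Sum>n\<in>A. b n * \<zeta> ^ n))\<^sup>2 \<partial>mT) = (\<integral>\<zeta>. of_real ((norm (\<Sum>n\<in>A. b n * \<zeta> ^ n))\<^sup>2) \<partial>mT)"
    by (rule integral_complex_of_real[symmetric])
  also have "\<dots> = (\<integral>\<zeta>. (\<Sum>m\<in>A. \<Sum>n\<in>A. (b m * cnj (b n)) * (\<zeta> ^ m * cnj \<zeta> ^ n)) \<partial>mT)"
  proof (intro Bochner_Integration.integral_cong refl)
    fix \<zeta>
    have "of_real ((norm (\<Sum>n\<in>A. b n * \<zeta> ^ n))\<^sup>2) = (\<Sum>n\<in>A. b n * \<zeta> ^ n) * cnj (\<Sum>n\<in>A. b n * \<zeta> ^ n)" 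
      by (metis complex_norm_square of_real_power)
    also have "\<dots> = (\<Sum>m\<in>A. \<Sum>n\<in>A. (b m * cnj (b n)) * (\<zeta> ^ m * cnj \<zeta> ^ n))"
      unfolding cnj_sum sum_product by (intro sum.cong refl) simp
    finally show "of_real ((norm (\<Sum>n\<in>A. b n * \<zeta> ^ n))\<^sup>2) = (\<Sum>m\<in>A. \<Sum>n\<in>A. (b m * cnj (b n)) * (\<zeta> ^ m * cnj \<zeta> ^ n))" .
  qed
  also have "\<dots> = (\<Sum>m\<in>A. \<Sum>n\<in>A. (b m * cnj (b n)) * (if m = n then 1 else 0))"
    using i by (subst Bochner_Integration.integral_sum, simp) (subst Bochner_Integration.integral_sum, simp_all add: integral_powers)
  also have "\<dots> = (\<Sum>m\<in>A. of_real ((norm (b m))\<^sup>2))"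
  proof (intro sum.cong refl)
    fix m assume "m \<in> A"
    have "b m * cnj (b m) = of_real ((norm (b m))\<^sup>2)" by (metis complex_norm_square of_real_power)
    then show "(\<Sum>n\<in>A. (b m * cnj (b n)) * (if m = n then 1 else 0)) = of_real ((norm (b m))\<^sup>2)"
      using A \<open>m \<in> A\<close> by (simp add: if_distrib sum.delta cong: if_cong)
  qed
  also have "\<dots> = complex_of_real (\<Sum>n\<in>A. (norm (b n))\<^sup>2)" by (rule of_real_sum[symmetric])
  finally show ?thesis by (rule of_real_eq_iff[THEN iffD1])
qed

lemma taylor_coeff_integral:
  assumes G: "G holomorphic_on DD" and r: "0 \<le> r" "r < 1"
  shows "(\<integral>\<zeta>. G (of_real r * \<zeta>) * cnj \<zeta> ^ n \<partial>mT) = (deriv ^^ n) G 0 / fact n * of_real r ^ n"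
proof -
  define b where "b k = (deriv ^^ k) G 0 / fact k" for k
  have sm: "(\<lambda>k. b k * w ^ k) sums G w" if "w \<in> DD" for w
    using holomorphic_power_series[of G 0 1 w] G that by (simp add: b_def DD_def)
  \<comment> \<open>The radius (1 + r)/2 lies strictly between r and 1; convergence of the Taylor
    series there gives absolute convergence on the circle of radius r.\<close>
  have nr: "norm (complex_of_real ((1 + r)/2)) = (1 + r)/2" unfolding norm_of_real using r by simp
  then have rr: "of_real ((1 + r)/2) \<in> DD" using r by (simp add: DD_def del: of_real_divide of_real_add)
  have abs: "summable (\<lambda>k. norm (b k * of_real r ^ k))"
    by (rule powser_insidea[OF sums_summable[OF sm[OF rr]]]) (unfold nr, use r in simp)
  have i: "integrable mT (\<lambda>\<zeta>. b k * of_real r ^ k * (\<zeta> ^ k * cnj \<zeta> ^ n))" for k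
    by (rule integrable_mT_bounded[where B="norm (b k * of_real r ^ k)"])
       (auto simp: norm_mult norm_power intro!: continuous_imp_measurable_borelT continuous_intros)
  have s: "(\<lambda>k. \<integral>\<zeta>. b k * of_real r ^ k * (\<zeta> ^ k * cnj \<zeta> ^ n) \<partial>mT) sums (\<integral>\<zeta>. (\<Sum>k. b k * of_real r ^ k * (\<zeta> ^ k * cnj \<zeta> ^ n)) \<partial>mT)"
  proof (rule sums_integral[OF i])
    show "AE \<zeta> in mT. summable (\<lambda>k. norm (b k * of_real r ^ k * (\<zeta> ^ k * cnj \<zeta> ^ n)))"
      using abs by (intro AE_I2) (simp add: norm_mult norm_power)
    have "(\<integral>\<zeta>. norm (b k * of_real r ^ k * (\<zeta> ^ k * cnj \<zeta> ^ n)) \<partial>mT) = norm (b k * of_real r ^ k)" for k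
    proof -
      have "(\<integral>\<zeta>. norm (b k * of_real r ^ k * (\<zeta> ^ k * cnj \<zeta> ^ n)) \<partial>mT) = (\<integral>\<zeta>. norm (b k * of_real r ^ k) \<partial>mT)"
        by (intro Bochner_Integration.integral_cong refl) (simp add: norm_mult norm_power)
      then show ?thesis by simp
    qed
    then show "summable (\<lambda>k. \<integral>\<zeta>. norm (b k * of_real r ^ k * (\<zeta> ^ k * cnj \<zeta> ^ n)) \<partial>mT)" using abs by simp
  qed
  have "(\<integral>\<zeta>. (\<Sum>k. b k * of_real r ^ k * (\<zeta> ^ k * cnj \<zeta> ^ n)) \<partial>mT) = (\<integral>\<zeta>. G (of_real r * \<zeta>) * cnj \<zeta> ^ n \<partial>mT)"
  proof (intro Bochner_Integration.integral_cong refl)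
    fix \<zeta> assume "\<zeta> \<in> space mT"
    then have "of_real r * \<zeta> \<in> DD" using of_real_mult_DD[OF r] by simp
    from sums_mult2[OF sm[OF this], of "cnj \<zeta> ^ n"]
    have "(\<lambda>k. b k * of_real r ^ k * (\<zeta> ^ k * cnj \<zeta> ^ n)) sums (G (of_real r * \<zeta>) * cnj \<zeta> ^ n)"
      by (simp add: power_mult_distrib mult_ac)
    then show "(\<Sum>k. b k * of_real r ^ k * (\<zeta> ^ k * cnj \<zeta> ^ n)) = G (of_real r * \<zeta>) * cnj \<zeta> ^ n" by (simp add: sums_iff)
  qed
  moreover have "(\<lambda>k. \<integral>\<zeta>. b k * of_real r ^ k * (\<zeta> ^ k * cnj \<zeta> ^ n) \<partial>mT) sums (b n * of_real r ^ n)"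
    using sums_single[of n "\<lambda>k. b k * of_real r ^ k"] by (simp add: integral_powers if_distrib eq_commute cong: if_cong)
  ultimately have "(\<integral>\<zeta>. G (of_real r * \<zeta>) * cnj \<zeta> ^ n \<partial>mT) = b n * of_real r ^ n" using sums_unique2[OF s] by simp
  then show ?thesis by (simp add: b_def)
qed

text \<open>With T the Taylor polynomial of g(zeta) = G(r zeta), orthogonality turns the mean of |g
  - T|^2 into the mean of |g|^2 minus the sum in question.\<close>

lemma bessel:
  assumes G: "G holomorphic_on DD" and r: "0 \<le> r" "r < 1"
    and C: "(\<integral>\<^sup>+\<zeta>. ennreal ((norm (G (of_real r * \<zeta>)))\<^sup>2) \<partial>mT) \<le> ennreal C" "0 \<le> C"
  shows "(\<Sum>n<N. (norm ((deriv ^^ n) G 0 / fact n * of_real r ^ n))\<^sup>2) \<le> C"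
proof -
  define c where "c n = (deriv ^^ n) G 0 / fact n * of_real r ^ n" for n
  define T where "T \<zeta> = (\<Sum>n<N. c n * \<zeta> ^ n)" for \<zeta>
  define g where "g \<zeta> = G (of_real r * \<zeta>)" for \<zeta>
  have gc: "continuous_on (sphere 0 1) g" unfolding g_def
    by (rule continuous_on_compose2[OF holomorphic_on_imp_continuous_on[OF G]])
       (use r in \<open>auto intro!: continuous_intros of_real_mult_DD\<close>)
  have Tc: "continuous_on (sphere 0 1) T" unfolding T_def by (intro continuous_intros)
  have ci: "integrable mT h" if h: "continuous_on (sphere 0 1) h" for h :: "complex \<Rightarrow> complex"
  proof -
    obtain B where "\<And>\<zeta>. norm \<zeta> = 1 \<Longrightarrow> norm (h \<zeta>) \<le> B" using continuous_bounded_sphere[OF h] by blast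
    then show ?thesis by (intro integrable_mT_bounded[OF continuous_imp_measurable_borelT[OF h]])
  qed
  have ints: "integrable mT (\<lambda>\<zeta>. g \<zeta> * cnj (g \<zeta>))" "integrable mT (\<lambda>\<zeta>. g \<zeta> * cnj (T \<zeta>))"
    "integrable mT (\<lambda>\<zeta>. T \<zeta> * cnj (g \<zeta>))" "integrable mT (\<lambda>\<zeta>. T \<zeta> * cnj (T \<zeta>))"
    by (intro ci continuous_intros gc Tc)+
  have sq: "w * cnj w = of_real ((norm w)\<^sup>2)" for w by (metis complex_norm_square of_real_power)
  define s where "s = (\<Sum>n<N. (norm (c n))\<^sup>2)"
  have TT: "(\<integral>\<zeta>. T \<zeta> * cnj (T \<zeta>) \<partial>mT) = of_real s"
    unfolding sq using integral_norm_square_trig[of "{..<N}" c] by (simp add: T_def s_def del: of_real_power)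
  have gT: "(\<integral>\<zeta>. g \<zeta> * cnj (T \<zeta>) \<partial>mT) = of_real s"
  proof -
    have "(\<integral>\<zeta>. g \<zeta> * cnj (T \<zeta>) \<partial>mT) = (\<integral>\<zeta>. (\<Sum>n<N. cnj (c n) * (g \<zeta> * cnj \<zeta> ^ n)) \<partial>mT)"
      unfolding T_def cnj_sum sum_distrib_left by (intro Bochner_Integration.integral_cong refl sum.cong) (simp add: mult_ac)
    also have "\<dots> = (\<Sum>n<N. cnj (c n) * (\<integral>\<zeta>. g \<zeta> * cnj \<zeta> ^ n \<partial>mT))"
    proof -
      have "integrable mT (\<lambda>\<zeta>. g \<zeta> * cnj \<zeta> ^ n)" for n by (intro ci continuous_intros gc)
      then show ?thesis by (subst Bochner_Integration.integral_sum) auto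
    qed
    also have "\<dots> = (\<Sum>n<N. cnj (c n) * c n)"
      unfolding g_def taylor_coeff_integral[OF G r] c_def ..
    also have "\<dots> = of_real s" unfolding s_def of_real_sum by (intro sum.cong refl) (metis sq mult.commute)
    finally show ?thesis .
  qed
  have Tg: "(\<integral>\<zeta>. T \<zeta> * cnj (g \<zeta>) \<partial>mT) = of_real s"
  proof -
    have "(\<integral>\<zeta>. T \<zeta> * cnj (g \<zeta>) \<partial>mT) = (\<integral>\<zeta>. cnj (g \<zeta> * cnj (T \<zeta>)) \<partial>mT)" by (simp add: mult.commute)
    also have "\<dots> = cnj (\<integral>\<zeta>. g \<zeta> * cnj (T \<zeta>) \<partial>mT)" by (rule Bochner_Integration.integral_cnj)
    finally show ?thesis by (simp add: gT)
  qed
  have "complex_of_real (\<integral>\<zeta>. (norm (g \<zeta> - T \<zeta>))\<^sup>2 \<partial>mT) = (\<integral>\<zeta>. (g \<zeta> - T \<zeta>) * cnj (g \<zeta> - T \<zeta>) \<partial>mT)"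
    unfolding sq by (rule integral_complex_of_real[symmetric])
  also have "\<dots> = (\<integral>\<zeta>. g \<zeta> * cnj (g \<zeta>) - g \<zeta> * cnj (T \<zeta>) - T \<zeta> * cnj (g \<zeta>) + T \<zeta> * cnj (T \<zeta>) \<partial>mT)"
    by (intro Bochner_Integration.integral_cong refl) (simp add: algebra_simps)
  also have "\<dots> = (\<integral>\<zeta>. g \<zeta> * cnj (g \<zeta>) \<partial>mT) - of_real s - of_real s + of_real s"
    using ints by (simp add: TT gT Tg)
  also have "(\<integral>\<zeta>. g \<zeta> * cnj (g \<zeta>) \<partial>mT) = of_real (\<integral>\<zeta>. (norm (g \<zeta>))\<^sup>2 \<partial>mT)" unfolding sq by (rule integral_complex_of_real)
  finally have "complex_of_real (\<integral>\<zeta>. (norm (g \<zeta> - T \<zeta>))\<^sup>2 \<partial>mT) = of_real ((\<integral>\<zeta>. (norm (g \<zeta>))\<^sup>2 \<partial>mT) - s)" by simp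
  then have "(\<integral>\<zeta>. (norm (g \<zeta> - T \<zeta>))\<^sup>2 \<partial>mT) = (\<integral>\<zeta>. (norm (g \<zeta>))\<^sup>2 \<partial>mT) - s" using of_real_eq_iff by blast
  moreover have "0 \<le> (\<integral>\<zeta>. (norm (g \<zeta> - T \<zeta>))\<^sup>2 \<partial>mT)" by (intro Bochner_Integration.integral_nonneg) simp
  moreover have "(\<integral>\<zeta>. (norm (g \<zeta>))\<^sup>2 \<partial>mT) \<le> C" using C by (intro integral_real_bounded) (simp_all add: g_def)
  ultimately show ?thesis by (simp add: s_def c_def)
qed

text \<open>Completeness of L^2 made explicit: a fast subsequence of partial sums converges almost
  everywhere, Fatou puts the limit g in L^2, and dominated convergence identifies its Poisson
  integral wherever the power series sums to w z.\<close>

lemma riesz_fischer: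
  fixes b :: "nat \<Rightarrow> complex"
  assumes b: "\<And>N. (\<Sum>n<N. (norm (b n))\<^sup>2) \<le> C"
  obtains g where "g \<in> Lp 2" "\<And>z. z \<in> DD \<Longrightarrow> (\<lambda>n. b n * z ^ n) sums w z \<Longrightarrow> poisson_fun g z = w z"
proof -
  have sb: "summable (\<lambda>n. (norm (b n))\<^sup>2)" by (rule summableI_nonneg_bounded[OF _ b]) simp
  define S where "S N \<zeta> = (\<Sum>n<N. b n * \<zeta> ^ n)" for N \<zeta>
  have Sm: "S N \<in> borel_measurable borelT" for N
    unfolding S_def[abs_def] by (intro continuous_imp_measurable_borelT continuous_intros)
  have Sc: "continuous_on (sphere 0 1) (S N)" for N unfolding S_def[abs_def] by (intro continuous_intros)
  have diff: "S n \<zeta> - S m \<zeta> = (\<Sum>k\<in>{m..<n}. b k * \<zeta> ^ k)" if "m \<le> n" for m n \<zeta>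
    using that unfolding S_def by (simp add: lessThan_atLeast0 sum_diff_nat_ivl)
  have "\<exists>N. \<forall>m\<ge>N. \<forall>n\<ge>m. (\<Sum>k\<in>{m..<n}. (norm (b k))\<^sup>2) \<le> (1/4) ^ j" for j
  proof -
    have "(0::real) < (1/4) ^ j" by simp
    with sb[unfolded summable_Cauchy] obtain N where "\<forall>m\<ge>N. \<forall>n. norm (\<Sum>k\<in>{m..<n}. (norm (b k))\<^sup>2) < (1/4) ^ j" by blast
    then show ?thesis by (intro exI[of _ N]) (auto intro: less_imp_le order_trans[OF abs_ge_self])
  qed
  then obtain N0 where N0: "\<And>j m n. N0 j \<le> m \<Longrightarrow> m \<le> n \<Longrightarrow> (\<Sum>k\<in>{m..<n}. (norm (b k))\<^sup>2) \<le> (1/4) ^ j" by metis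
  \<comment> \<open>The sum over i <= j makes M monotone and at least N0 j; the extra j forces M to
    infinity.\<close>
  define M where "M j = (\<Sum>i\<le>j. N0 i) + j" for j
  have MN: "N0 j \<le> M j" for j unfolding M_def by (intro trans_le_add1 member_le_sum) auto
  have Msuc: "M j \<le> M (Suc j)" for j by (simp add: M_def)
  have Mge: "j \<le> M j" for j by (simp add: M_def)
  define B where "B j \<zeta> = S (M (Suc j)) \<zeta> - S (M j) \<zeta>" for j \<zeta>
  have Bi: "integrable mT (B j)" and B1: "(\<integral>\<zeta>. norm (B j \<zeta>) \<partial>mT) \<le> 3 * (1/2) ^ j" for j
  proof -
    have Bc: "continuous_on (sphere 0 1) (B j)" unfolding B_def[abs_def] by (intro continuous_intros Sc)
    obtain D where D: "\<And>\<zeta>. norm \<zeta> = 1 \<Longrightarrow> norm (B j \<zeta>) \<le> D" using continuous_bounded_sphere[OF Bc] by blast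
    show "integrable mT (B j)" by (rule integrable_mT_bounded[OF continuous_imp_measurable_borelT[OF Bc] D])
    have "continuous_on (sphere 0 1) (\<lambda>\<zeta>. (norm (B j \<zeta>))\<^sup>2)" by (intro continuous_intros Bc)
    then obtain D2 where D2: "\<And>\<zeta>. norm \<zeta> = 1 \<Longrightarrow> norm ((norm (B j \<zeta>))\<^sup>2) \<le> D2"
      and m2: "(\<lambda>\<zeta>. (norm (B j \<zeta>))\<^sup>2) \<in> borel_measurable borelT"
      using continuous_bounded_sphere continuous_imp_measurable_borelT by metis
    have "integrable mT (\<lambda>\<zeta>. (norm (B j \<zeta>))\<^sup>2)" by (rule integrable_mT_bounded[OF m2 D2])
    then have BL: "B j \<in> Lp 2" using continuous_imp_measurable_borelT[OF Bc] by (simp add: Lp_def)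
    have "(\<integral>\<zeta>. (norm (B j \<zeta>))\<^sup>2 \<partial>mT) = (\<Sum>k\<in>{M j..<M (Suc j)}. (norm (b k))\<^sup>2)"
      unfolding B_def diff[OF Msuc] by (rule integral_norm_square_trig) simp
    also have "\<dots> \<le> (1/4) ^ j" by (rule N0[OF MN Msuc])
    also have "\<dots> = ((1/2) ^ j) powr 2" by (simp add: power2_eq_square flip: power_mult_distrib)
    finally have "Lp_norm 2 (B j) \<le> (1/2) ^ j" by (intro Lp_norm_le_iff) auto
    then show "(\<integral>\<zeta>. norm (B j \<zeta>) \<partial>mT) \<le> 3 * (1/2) ^ j" using integral_norm_le_Lp_norm[OF BL] by simp
  qed
  have gsum: "summable (\<lambda>j. 3 * (1/2::real) ^ j)" by (intro summable_mult summable_geometric) simp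
  have sB: "summable (\<lambda>j. \<integral>\<zeta>. norm (B j \<zeta>) \<partial>mT)"
    by (rule summable_comparison_test[OF _ gsum]) (use B1 in \<open>auto intro!: exI[of _ 0] simp: abs_of_nonneg Bochner_Integration.integral_nonneg\<close>)
  have aeB: "AE \<zeta> in mT. summable (\<lambda>j. norm (B j \<zeta>))"
  proof -
    have mB: "(\<lambda>\<zeta>. ennreal (norm (B j \<zeta>))) \<in> borel_measurable mT" for j
      using borel_measurable_integrable[OF Bi[of j]] by simp
    have "(\<integral>\<^sup>+\<zeta>. (\<Sum>j. ennreal (norm (B j \<zeta>))) \<partial>mT) = (\<Sum>j. \<integral>\<^sup>+\<zeta>. ennreal (norm (B j \<zeta>)) \<partial>mT)"
      using mB by (rule nn_integral_suminf)
    also have "\<dots> = (\<Sum>j. ennreal (\<integral>\<zeta>. norm (B j \<zeta>) \<partial>mT))"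
      using Bi by (intro suminf_cong nn_integral_eq_integral) auto
    also have "\<dots> = ennreal (\<Sum>j. \<integral>\<zeta>. norm (B j \<zeta>) \<partial>mT)"
      using sB by (intro suminf_ennreal2) (auto intro: Bochner_Integration.integral_nonneg)
    finally have "(\<integral>\<^sup>+\<zeta>. (\<Sum>j. ennreal (norm (B j \<zeta>))) \<partial>mT) \<noteq> \<infinity>" by simp
    then have "AE \<zeta> in mT. (\<Sum>j. ennreal (norm (B j \<zeta>))) \<noteq> \<infinity>"
      using mB by (intro nn_integral_PInf_AE) auto
    then show ?thesis by eventually_elim (simp add: summable_suminf_not_top)
  qed
  \<comment> \<open>The sum of the moduli of the increments dominates every S (M k). It is
    integrable because the L^1 norm of the j-th increment is at most 3 times its L^2 norm, which is
    at most (1/2)^j.\<close>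
  define w0 where "w0 \<zeta> = norm (S (M 0) \<zeta>) + (\<Sum>j. norm (B j \<zeta>))" for \<zeta>
  define g where "g \<zeta> = S (M 0) \<zeta> + (\<Sum>j. B j \<zeta>)" for \<zeta>
  have S0i: "integrable mT (S (M 0))"
  proof -
    obtain D where "\<And>\<zeta>. norm \<zeta> = 1 \<Longrightarrow> norm (S (M 0) \<zeta>) \<le> D" using continuous_bounded_sphere[OF Sc] by blast
    then show ?thesis by (intro integrable_mT_bounded[OF Sm])
  qed
  have w0i: "integrable mT w0" unfolding w0_def[abs_def]
    using Bi aeB sB S0i by (intro Bochner_Integration.integrable_add integrable_norm integrable_suminf) auto
  have tele: "S (M 0) \<zeta> + (\<Sum>j<k. B j \<zeta>) = S (M k) \<zeta>" for k \<zeta>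
  proof (induction k)
    case (Suc k)
    have "S (M 0) \<zeta> + (\<Sum>j<Suc k. B j \<zeta>) = (S (M 0) \<zeta> + (\<Sum>j<k. B j \<zeta>)) + B k \<zeta>" by (simp only: sum.lessThan_Suc add.assoc)
    then show ?case unfolding Suc by (simp add: B_def)
  qed simp
  have conv: "AE \<zeta> in mT. (\<lambda>k. S (M k) \<zeta>) \<longlonglongrightarrow> g \<zeta>" using aeB
  proof eventually_elim
    case (elim \<zeta>)
    then have "(\<lambda>k. S (M 0) \<zeta> + (\<Sum>j<k. B j \<zeta>)) \<longlonglongrightarrow> g \<zeta>"
      unfolding g_def by (intro tendsto_add tendsto_const summable_LIMSEQ) (rule summable_norm_cancel)
    then show ?case by (simp add: tele)
  qed
  have dom: "AE \<zeta> in mT. norm (S (M k) \<zeta>) \<le> w0 \<zeta>" for k using aeB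
  proof eventually_elim
    case (elim \<zeta>)
    have "norm (S (M k) \<zeta>) \<le> norm (S (M 0) \<zeta>) + norm (\<Sum>j<k. B j \<zeta>)" by (subst tele[where k=k, symmetric]) (rule norm_triangle_ineq)
    also have "norm (\<Sum>j<k. B j \<zeta>) \<le> (\<Sum>j<k. norm (B j \<zeta>))" by (rule norm_sum)
    also have "\<dots> \<le> (\<Sum>j. norm (B j \<zeta>))" using elim by (intro sum_le_suminf) auto
    finally show ?case by (simp add: w0_def)
  qed
  have Bm: "B j \<in> borel_measurable mT" for j using Bi by auto
  have gi: "integrable mT g" unfolding g_def[abs_def]
    using Bi aeB sB S0i by (intro Bochner_Integration.integrable_add integrable_suminf) auto
  have gm: "g \<in> borel_measurable borelT" using gi borel_measurable_integrable by fastforce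
  have "(\<integral>\<^sup>+\<zeta>. ennreal ((norm (g \<zeta>))\<^sup>2) \<partial>mT) \<le> ennreal C"
  proof -
    have "(\<integral>\<^sup>+\<zeta>. ennreal ((norm (g \<zeta>))\<^sup>2) \<partial>mT) = (\<integral>\<^sup>+\<zeta>. liminf (\<lambda>k. ennreal ((norm (S (M k) \<zeta>))\<^sup>2)) \<partial>mT)"
    proof (rule nn_integral_cong_AE)
      show "AE \<zeta> in mT. ennreal ((norm (g \<zeta>))\<^sup>2) = liminf (\<lambda>k. ennreal ((norm (S (M k) \<zeta>))\<^sup>2))"
        using conv
      proof eventually_elim
        case (elim \<zeta>)
        then have "(\<lambda>k. ennreal ((norm (S (M k) \<zeta>))\<^sup>2)) \<longlonglongrightarrow> ennreal ((norm (g \<zeta>))\<^sup>2)"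
          by (intro tendsto_ennrealI tendsto_intros)
        from lim_imp_Liminf[OF _ this] show ?case by simp
      qed
    qed
    also have "\<dots> \<le> liminf (\<lambda>k. \<integral>\<^sup>+\<zeta>. ennreal ((norm (S (M k) \<zeta>))\<^sup>2) \<partial>mT)"
      using Sm by (intro nn_integral_liminf) simp
    also have "\<dots> \<le> ennreal C"
    proof -
      have "(\<integral>\<^sup>+\<zeta>. ennreal ((norm (S (M k) \<zeta>))\<^sup>2) \<partial>mT) \<le> ennreal C" for k
      proof -
        have "continuous_on (sphere 0 1) (\<lambda>\<zeta>. (norm (S (M k) \<zeta>))\<^sup>2)" by (intro continuous_intros Sc)
        then obtain D2 where D2: "\<And>\<zeta>. norm \<zeta> = 1 \<Longrightarrow> norm ((norm (S (M k) \<zeta>))\<^sup>2) \<le> D2"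
          and m2: "(\<lambda>\<zeta>. (norm (S (M k) \<zeta>))\<^sup>2) \<in> borel_measurable borelT"
          using continuous_bounded_sphere continuous_imp_measurable_borelT by metis
        have "integrable mT (\<lambda>\<zeta>. (norm (S (M k) \<zeta>))\<^sup>2)" by (rule integrable_mT_bounded[OF m2 D2])
        then have "(\<integral>\<^sup>+\<zeta>. ennreal ((norm (S (M k) \<zeta>))\<^sup>2) \<partial>mT) = ennreal (\<integral>\<zeta>. (norm (S (M k) \<zeta>))\<^sup>2 \<partial>mT)"
          by (intro nn_integral_eq_integral) auto
        also have "\<dots> \<le> ennreal C" unfolding S_def integral_norm_square_trig[OF finite_lessThan] using b by (rule ennreal_leI)
        finally show ?thesis .
      qed
      then have "liminf (\<lambda>k. \<integral>\<^sup>+\<zeta>. ennreal ((norm (S (M k) \<zeta>))\<^sup>2) \<partial>mT) \<le> limsup (\<lambda>k. ennreal C)"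
        by (intro order_trans[OF Liminf_le_Limsup Limsup_mono]) auto
      then show ?thesis by (simp add: Limsup_const)
    qed
    finally show ?thesis .
  qed
  then have "integrable mT (\<lambda>\<zeta>. (norm (g \<zeta>))\<^sup>2)"
    using gm by (intro integrableI_bounded) (auto simp: less_top intro: le_less_trans)
  then have gL: "g \<in> Lp 2" using gm by (simp add: Lp_def)
  have "poisson_fun g z = w z" if z: "z \<in> DD" and s: "(\<lambda>n. b n * z ^ n) sums w z" for z
  proof -
    have "(\<lambda>k. poisson_fun (S (M k)) z) \<longlonglongrightarrow> poisson_fun g z"
      unfolding poisson_fun_def
    proof (rule integral_dominated_convergence[where w="\<lambda>\<zeta>. 2 / (1 - norm z)\<^sup>2 * w0 \<zeta>"])
      show "AE \<zeta> in mT. (\<lambda>k. of_real (poisson_kernel z \<zeta>) * S (M k) \<zeta>) \<longlonglongrightarrow> of_real (poisson_kernel z \<zeta>) * g \<zeta>"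
        using conv by eventually_elim (intro tendsto_intros)
      show "AE \<zeta> in mT. norm (of_real (poisson_kernel z \<zeta>) * S (M k) \<zeta>) \<le> 2 / (1 - norm z)\<^sup>2 * w0 \<zeta>" for k
        using dom[of k] AE_space[of mT]
      proof eventually_elim
        case (elim \<zeta>)
        then have "0 \<le> poisson_kernel z \<zeta>" "poisson_kernel z \<zeta> \<le> 2 / (1 - norm z)\<^sup>2"
          using z by (auto simp: DD_def intro!: poisson_kernel_le)
        then show ?case unfolding norm_mult norm_of_real using elim(1) by (intro mult_mono) auto
      qed
    qed (use w0i gm Sm in \<open>auto intro!: borel_measurable_times\<close>)
    moreover have "poisson_fun (S N) z = (\<Sum>n<N. b n * z ^ n)" for N
      unfolding poisson_fun_def S_def
      using poisson_formula_cball[of "\<lambda>\<zeta>. \<Sum>n<N. b n * \<zeta> ^ n" z] z by (simp add: DD_def continuous_intros holomorphic_intros)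
    moreover have "filterlim M at_top sequentially"
      by (rule filterlim_at_top_mono[OF filterlim_ident]) (use Mge in auto)
    then have "(\<lambda>k. \<Sum>n<M k. b n * z ^ n) \<longlonglongrightarrow> w z"
      using filterlim_compose[OF s[unfolded sums_def]] by blast
    ultimately show ?thesis using LIMSEQ_unique by simp
  qed
  with gL show ?thesis by (rule that)
qed

text \<open>Subordination and Bessel bound the Taylor coefficients of the composed function on each
  circle of radius \<open>rad k\<close>, uniformly in k; the radius tends to 1 in the finite sums.
  Riesz--Fischer then supplies a candidate for \<open>compL_AE\<close>.\<close>

theorem compL_H2:
  assumes f: "f \<in> Hp 2" and \<phi>: "analytic_selfmap \<phi>"
  shows "compL \<phi> f \<in> Lp 2" "\<And>z. z \<in> DD \<Longrightarrow> poisson_fun (compL \<phi> f) z = poisson_fun f (\<phi> z)"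
proof -
  have fL: "f \<in> Lp 2" using f by (simp add: Hp_def)
  define G where "G z = poisson_fun f (\<phi> z)" for z
  have G: "G holomorphic_on DD"
    using holomorphic_on_compose_gen[OF _ poisson_fun_Hp_holomorphic[OF f], of \<phi> DD] \<phi>
    by (simp add: G_def[abs_def] o_def analytic_selfmap_def)
  define C where "C = 18 / (1 - norm (\<phi> 0))\<^sup>2 * (\<integral>\<alpha>. (norm (f \<alpha>))\<^sup>2 \<partial>mT)"
  have C0: "0 \<le> C" unfolding C_def by (intro mult_nonneg_nonneg Bochner_Integration.integral_nonneg) auto
  define b where "b n = (deriv ^^ n) G 0 / fact n" for n
  have "(\<Sum>n<N. (norm (b n))\<^sup>2) \<le> C" for N
  proof -
    have "(\<Sum>n<N. (norm (b n * of_real (rad k) ^ n))\<^sup>2) \<le> C" for k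
      unfolding b_def using littlewood_subordination[OF fL \<phi> rad, of k] by (intro bessel[OF G rad _ C0]) (simp add: G_def C_def)
    moreover have "(\<lambda>k. \<Sum>n<N. (norm (b n * of_real (rad k) ^ n))\<^sup>2) \<longlonglongrightarrow> (\<Sum>n<N. (norm (b n * of_real 1 ^ n))\<^sup>2)"
      by (intro tendsto_intros tendsto_rad)
    ultimately have "(\<Sum>n<N. (norm (b n * of_real 1 ^ n))\<^sup>2) \<le> C" by (intro LIMSEQ_le_const2) auto
    then show ?thesis by simp
  qed
  from riesz_fischer[OF this, of G] obtain g where g: "g \<in> Lp 2"
    "\<And>z. z \<in> DD \<Longrightarrow> (\<lambda>n. b n * z ^ n) sums G z \<Longrightarrow> poisson_fun g z = G z" by blast
  have "poisson_fun g z = poisson_fun f (\<phi> z)" if z: "z \<in> DD" for z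
    using g(2)[OF z] holomorphic_power_series[of G 0 1 z] G z by (simp add: b_def DD_def G_def)
  note cA = compL_AE[OF Lp_integrable(1)[OF g(1)] this, simplified]
  have "compL \<phi> f \<in> borel_measurable borelT" using cA(1) borel_measurable_integrable by fastforce
  then show "compL \<phi> f \<in> Lp 2" using Lp_AE_cong(1)[OF _ Lp_integrable(3)[OF g(1)] cA(2)] g(1) by simp
  show "\<And>z. z \<in> DD \<Longrightarrow> poisson_fun (compL \<phi> f) z = poisson_fun f (\<phi> z)" by (rule cA(3))
qed

section \<open>The component of the compact composition operators\<close>

lemma Lp_norm_minus_commute: "Lp_norm p (f - g) = Lp_norm p (g - f)"
  by (simp add: Lp_norm_def norm_minus_commute)

text \<open>Setting the value at r = 1 to f itself makes the endpoint of the path r -> C_{r phi}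
  available without boundary limits.\<close>

definition dil :: "real \<Rightarrow> (complex \<Rightarrow> complex) \<Rightarrow> complex \<Rightarrow> complex" where
  "dil r f \<zeta> = (if r < 1 then poisson_fun f (of_real r * \<zeta>) else f \<zeta>)"

lemma dil_H2:
  assumes f: "f \<in> Hp 2" and r: "0 \<le> r" "r \<le> 1"
  shows "dil r f \<in> Hp 2" "(\<integral>\<zeta>. (norm (dil r f \<zeta>))\<^sup>2 \<partial>mT) \<le> 18 * (\<integral>\<zeta>. (norm (f \<zeta>))\<^sup>2 \<partial>mT)"
    "\<And>z. z \<in> DD \<Longrightarrow> poisson_fun (dil r f) z = poisson_fun f (of_real r * z)"
proof -
  have fL: "f \<in> Lp 2" using f by (simp add: Hp_def)
  have I0: "0 \<le> (\<integral>\<zeta>. (norm (f \<zeta>))\<^sup>2 \<partial>mT)" by (intro Bochner_Integration.integral_nonneg) simp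
  have "dil r f \<in> Hp 2 \<and> (\<integral>\<zeta>. (norm (dil r f \<zeta>))\<^sup>2 \<partial>mT) \<le> 18 * (\<integral>\<zeta>. (norm (f \<zeta>))\<^sup>2 \<partial>mT)
     \<and> (\<forall>z\<in>DD. poisson_fun (dil r f) z = poisson_fun f (of_real r * z))"
  proof (cases "r < 1")
    case True
    note r1 = r(1) True
    have d: "dil r f = (\<lambda>\<zeta>. poisson_fun f (of_real r * \<zeta>))" using True by (auto simp: dil_def)
    have hol: "poisson_fun f holomorphic_on DD" using f by (rule poisson_fun_Hp_holomorphic) simp
    have c: "continuous_on (sphere 0 1) (dil r f)" unfolding d
      by (rule continuous_on_compose2[OF holomorphic_on_imp_continuous_on[OF hol]])
         (use r1 in \<open>auto intro!: continuous_intros of_real_mult_DD\<close>)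
    have m: "dil r f \<in> borel_measurable borelT" by (rule continuous_imp_measurable_borelT[OF c])
    have c2: "continuous_on (sphere 0 1) (\<lambda>\<zeta>. (norm (dil r f \<zeta>))\<^sup>2)" by (intro continuous_intros c)
    obtain B where "\<And>\<zeta>. norm \<zeta> = 1 \<Longrightarrow> norm ((norm (dil r f \<zeta>))\<^sup>2) \<le> B" using continuous_bounded_sphere[OF c2] by blast
    then have i: "integrable mT (\<lambda>\<zeta>. (norm (dil r f \<zeta>))\<^sup>2)" by (intro integrable_mT_bounded[OF continuous_imp_measurable_borelT[OF c2]])
    have "(\<integral>\<zeta>. dil r f \<zeta> * \<zeta> ^ n \<partial>mT) = 0" if n: "n > 0" for n
    proof (cases "r = 0")
      case True
      then have "dil r f = (\<lambda>_. poisson_fun f 0)" using d by simp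
      then show ?thesis using integral_power_circle[OF n] by simp
    next
      case False
      have "(\<integral>\<zeta>. of_real (poisson_kernel 0 \<zeta>) * (poisson_fun f (of_real r * \<zeta>) * (of_real r * \<zeta>) ^ n) \<partial>mT)
        = poisson_fun f (of_real r * 0) * (of_real r * 0) ^ n"
        by (rule poisson_formula[OF _ r1 DD_0]) (intro holomorphic_intros hol)
      moreover have "(\<integral>\<zeta>. of_real (poisson_kernel 0 \<zeta>) * (poisson_fun f (of_real r * \<zeta>) * (of_real r * \<zeta>) ^ n) \<partial>mT)
        = (\<integral>\<zeta>. of_real r ^ n * (dil r f \<zeta> * \<zeta> ^ n) \<partial>mT)"
        by (intro Bochner_Integration.integral_cong) (auto simp: d power_mult_distrib)
      ultimately show ?thesis using n False by (simp add: zero_power)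
    qed
    then have H: "dil r f \<in> Hp 2" using m i by (simp add: Hp_def Lp_def)
    have "analytic_selfmap (\<lambda>z. z)" by (auto simp: analytic_selfmap_def)
    from littlewood_subordination[OF fL this r1] have "(\<integral>\<zeta>. (norm (dil r f \<zeta>))\<^sup>2 \<partial>mT) \<le> 18 * (\<integral>\<zeta>. (norm (f \<zeta>))\<^sup>2 \<partial>mT)"
      using I0 by (intro integral_real_bounded) (simp_all add: d)
    moreover have "poisson_fun (dil r f) z = poisson_fun f (of_real r * z)" if "z \<in> DD" for z
      using poisson_formula[OF hol r1 that] unfolding d poisson_fun_def[of "\<lambda>\<zeta>. poisson_fun f (of_real r * \<zeta>)"] .
    ultimately show ?thesis using H by blast
  next
    case False
    then have "r = 1" using r by simp
    moreover have "dil 1 f = f" by (auto simp: dil_def)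
    ultimately show ?thesis using f I0 by simp
  qed
  then show "dil r f \<in> Hp 2" "(\<integral>\<zeta>. (norm (dil r f \<zeta>))\<^sup>2 \<partial>mT) \<le> 18 * (\<integral>\<zeta>. (norm (f \<zeta>))\<^sup>2 \<partial>mT)"
    "\<And>z. z \<in> DD \<Longrightarrow> poisson_fun (dil r f) z = poisson_fun f (of_real r * z)" by auto
qed

lemma selfmap_scaled:
  assumes "analytic_selfmap \<phi>" "0 \<le> r" "r \<le> 1"
  shows "analytic_selfmap (\<lambda>z. of_real r * \<phi> z)"
  unfolding analytic_selfmap_def
proof
  show "(\<lambda>z. of_real r * \<phi> z) holomorphic_on DD" using assms by (intro holomorphic_intros) (simp add: analytic_selfmap_def)
  show "(\<lambda>z. of_real r * \<phi> z) ` DD \<subseteq> DD"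
  proof safe
    fix z assume "z \<in> DD"
    then have "\<phi> z \<in> DD" using assms(1) by (auto simp: analytic_selfmap_def)
    then have "norm (\<phi> z) < 1" by (simp add: DD_def)
    moreover have "r * norm (\<phi> z) \<le> 1 * norm (\<phi> z)" using assms by (intro mult_right_mono) auto
    ultimately show "of_real r * \<phi> z \<in> DD" using assms by (simp add: DD_def norm_mult)
  qed
qed

text \<open>Scaling phi is composing with phi after a dilation, so a difference of scaled operators
  is C_phi applied to a difference of dilates. Division by 12 puts it in the unit ball: 4 (18 + 18)
  = 12^2.\<close>

lemma dil_difference_H2:
  assumes f: "f \<in> Hp 2" "Lp_norm 2 f \<le> 1" and \<phi>: "analytic_selfmap \<phi>" and ab: "0 \<le> a" "a \<le> 1" "0 \<le> b" "b \<le> 1"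
  defines "h \<equiv> (\<lambda>\<zeta>. (dil a f \<zeta> - dil b f \<zeta>) / 12)"
  shows "h \<in> Hp 2" "Lp_norm 2 h \<le> 1"
    "\<And>z. z \<in> DD \<Longrightarrow> poisson_fun h z = (poisson_fun f (of_real a * z) - poisson_fun f (of_real b * z)) / 12"
    "Lp_norm 2 (compL (\<lambda>z. of_real a * \<phi> z) f - compL (\<lambda>z. of_real b * \<phi> z) f) = 12 * Lp_norm 2 (compL \<phi> h)"
proof -
  note da = dil_H2[OF f(1) ab(1,2)] and db = dil_H2[OF f(1) ab(3,4)]
  have L: "f \<in> Lp 2" "dil a f \<in> Lp 2" "dil b f \<in> Lp 2" using f da(1) db(1) by (simp_all add: Hp_def)
  note ia = Lp_integrable[OF L(2), simplified] and ib = Lp_integrable[OF L(3), simplified]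
  have f1: "(\<integral>\<zeta>. (norm (f \<zeta>))\<^sup>2 \<partial>mT) \<le> 1" using Lp_norm_le_1[of 2 f] f(2) by simp
  have hm: "h \<in> borel_measurable borelT" unfolding h_def using ia(3) ib(3) by (intro borel_measurable_divide borel_measurable_diff) auto
  have hb: "(norm (h \<zeta>))\<^sup>2 \<le> ((norm (dil a f \<zeta>))\<^sup>2 + (norm (dil b f \<zeta>))\<^sup>2) / 36" for \<zeta>
  proof -
    have "(norm (h \<zeta>))\<^sup>2 = (norm (dil a f \<zeta> - dil b f \<zeta>))\<^sup>2 / 144" by (simp add: h_def norm_divide power_divide)
    moreover have "(norm (dil a f \<zeta> - dil b f \<zeta>))\<^sup>2 \<le> 4 * ((norm (dil a f \<zeta>))\<^sup>2 + (norm (dil b f \<zeta>))\<^sup>2)"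
      using norm_diff_powr_le[of 2 "dil a f \<zeta>" "dil b f \<zeta>"] by simp
    ultimately show ?thesis by simp
  qed
  have hi: "integrable mT (\<lambda>\<zeta>. (norm (h \<zeta>))\<^sup>2)"
  proof (rule Bochner_Integration.integrable_bound)
    show "integrable mT (\<lambda>\<zeta>. ((norm (dil a f \<zeta>))\<^sup>2 + (norm (dil b f \<zeta>))\<^sup>2) / 36)" using ia(2) ib(2) by simp
    show "AE \<zeta> in mT. norm ((norm (h \<zeta>))\<^sup>2) \<le> norm (((norm (dil a f \<zeta>))\<^sup>2 + (norm (dil b f \<zeta>))\<^sup>2) / 36)"
      using hb by (intro AE_I2) (simp add: abs_of_nonneg)
  qed (use hm in simp)
  have hL: "h \<in> Lp 2" using hm hi by (simp add: Lp_def)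
  have "(\<integral>\<zeta>. h \<zeta> * \<zeta> ^ n \<partial>mT) = 0" if n: "n > 0" for n
  proof -
    have i: "integrable mT (\<lambda>\<zeta>. g \<zeta> * \<zeta> ^ n)" if "integrable mT g" for g :: "complex \<Rightarrow> complex"
      using integrable_bounded_mult[OF that, of "\<lambda>\<zeta>. \<zeta> ^ n" 1]
      by (simp add: norm_power mult.commute continuous_imp_measurable_borelT continuous_intros)
    have "(\<integral>\<zeta>. h \<zeta> * \<zeta> ^ n \<partial>mT) = (\<integral>\<zeta>. (dil a f \<zeta> * \<zeta> ^ n - dil b f \<zeta> * \<zeta> ^ n) / 12 \<partial>mT)"
      by (intro Bochner_Integration.integral_cong refl) (simp add: h_def algebra_simps)
    also have "\<dots> = ((\<integral>\<zeta>. dil a f \<zeta> * \<zeta> ^ n \<partial>mT) - (\<integral>\<zeta>. dil b f \<zeta> * \<zeta> ^ n \<partial>mT)) / 12"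
      using i[OF ia(1)] i[OF ib(1)] by simp
    finally show ?thesis using da(1) db(1) n by (simp add: Hp_def)
  qed
  then show hH: "h \<in> Hp 2" using hL by (simp add: Hp_def)
  have "(\<integral>\<zeta>. (norm (h \<zeta>))\<^sup>2 \<partial>mT) \<le> (\<integral>\<zeta>. ((norm (dil a f \<zeta>))\<^sup>2 + (norm (dil b f \<zeta>))\<^sup>2) / 36 \<partial>mT)"
    using hi ia(2) ib(2) hb by (intro integral_mono) simp_all
  also have "\<dots> = ((\<integral>\<zeta>. (norm (dil a f \<zeta>))\<^sup>2 \<partial>mT) + (\<integral>\<zeta>. (norm (dil b f \<zeta>))\<^sup>2 \<partial>mT)) / 36" using ia(2) ib(2) by simp
  also have "\<dots> \<le> 1" using da(2) db(2) f1 by simp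
  finally show "Lp_norm 2 h \<le> 1" by (intro Lp_norm_le_iff) simp_all
  show pz: "poisson_fun h z = (poisson_fun f (of_real a * z) - poisson_fun f (of_real b * z)) / 12" if z: "z \<in> DD" for z
  proof -
    have "poisson_fun h z = (\<integral>\<zeta>. (of_real (poisson_kernel z \<zeta>) * dil a f \<zeta> - of_real (poisson_kernel z \<zeta>) * dil b f \<zeta>) / 12 \<partial>mT)"
      unfolding poisson_fun_def h_def by (intro Bochner_Integration.integral_cong refl) (simp add: algebra_simps)
    also have "\<dots> = (poisson_fun (dil a f) z - poisson_fun (dil b f) z) / 12"
      using integrable_poisson_mult[OF ia(1) z] integrable_poisson_mult[OF ib(1) z] by (simp add: poisson_fun_def)
    finally show ?thesis by (simp add: da(3)[OF z] db(3)[OF z])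
  qed
  note ca = compL_H2[OF f(1) selfmap_scaled[OF \<phi> ab(1,2)]] and cb = compL_H2[OF f(1) selfmap_scaled[OF \<phi> ab(3,4)]]
  note ch = compL_H2[OF hH \<phi>]
  note ica = Lp_integrable[OF ca(1), simplified] and icb = Lp_integrable[OF cb(1), simplified] and ich = Lp_integrable[OF ch(1), simplified]
  have "AE \<zeta> in mT. (compL (\<lambda>z. of_real a * \<phi> z) f \<zeta> - compL (\<lambda>z. of_real b * \<phi> z) f \<zeta>) = 12 * compL \<phi> h \<zeta>"
  proof (rule poisson_fun_unique)
    fix z assume z: "z \<in> DD"
    then have pD: "\<phi> z \<in> DD" using \<phi> by (auto simp: analytic_selfmap_def)
    have "(\<lambda>\<zeta>. complex_of_real (poisson_kernel z \<zeta>) * (12 * compL \<phi> h \<zeta>)) = (\<lambda>\<zeta>. 12 * (of_real (poisson_kernel z \<zeta>) * compL \<phi> h \<zeta>))"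
      by (simp add: fun_eq_iff)
    then have "poisson_fun (\<lambda>\<zeta>. 12 * compL \<phi> h \<zeta>) z = 12 * poisson_fun (compL \<phi> h) z"
      unfolding poisson_fun_def by (simp only: integral_mult_right_zero)
    also have "\<dots> = poisson_fun f (of_real a * \<phi> z) - poisson_fun f (of_real b * \<phi> z)"
      unfolding ch(2)[OF z] pz[OF pD] by simp
    finally show "poisson_fun (\<lambda>\<zeta>. compL (\<lambda>z. of_real a * \<phi> z) f \<zeta> - compL (\<lambda>z. of_real b * \<phi> z) f \<zeta>) z
      = poisson_fun (\<lambda>\<zeta>. 12 * compL \<phi> h \<zeta>) z"
      by (simp add: poisson_fun_diff[OF ica(1) icb(1) z] ca(2)[OF z] cb(2)[OF z])
  qed (use ica icb ich in auto)
  then have "Lp_norm 2 (compL (\<lambda>z. of_real a * \<phi> z) f - compL (\<lambda>z. of_real b * \<phi> z) f) = Lp_norm 2 (\<lambda>\<zeta>. 12 * compL \<phi> h \<zeta>)"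
    using ica(3) icb(3) ich(3) by (intro Lp_AE_cong(2)) (auto simp: fun_diff_def intro!: borel_measurable_diff borel_measurable_times)
  also have "\<dots> = 12 * Lp_norm 2 (compL \<phi> h)"
    by (simp add: Lp_norm_def norm_mult power_mult_distrib powr_mult Bochner_Integration.integral_nonneg powr_half_sqrt real_sqrt_mult)
  finally show "Lp_norm 2 (compL (\<lambda>z. of_real a * \<phi> z) f - compL (\<lambda>z. of_real b * \<phi> z) f) = 12 * Lp_norm 2 (compL \<phi> h)" .
qed

text \<open>The difference of two Herglotz kernels is 2 zeta (a - b) / ((zeta - a)(zeta - b)); real
  parts give a Lipschitz bound on discs of radius rho.\<close>

lemma poisson_fun_difference_le:
  assumes f: "integrable mT f" and a: "norm a \<le> \<rho>" "norm b \<le> \<rho>" "\<rho> < 1"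
  shows "norm (poisson_fun f a - poisson_fun f b) \<le> 2 * norm (a - b) / (1 - \<rho>)\<^sup>2 * (\<integral>\<zeta>. norm (f \<zeta>) \<partial>mT)"
proof -
  have D: "a \<in> DD" "b \<in> DD" using a by (auto simp: DD_def)
  have "poisson_fun f a - poisson_fun f b = (\<integral>\<zeta>. of_real (poisson_kernel a \<zeta>) * f \<zeta> - of_real (poisson_kernel b \<zeta>) * f \<zeta> \<partial>mT)"
    unfolding poisson_fun_def using integrable_poisson_mult[OF f] D by simp
  also have "norm \<dots> \<le> (\<integral>\<zeta>. 2 * norm (a - b) / (1 - \<rho>)\<^sup>2 * norm (f \<zeta>) \<partial>mT)"
  proof (rule norm_integral_le_integral)
    fix \<zeta> assume "\<zeta> \<in> space mT"
    then have z: "norm \<zeta> = 1" by simp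
    have d: "1 - \<rho> \<le> norm (\<zeta> - a)" "1 - \<rho> \<le> norm (\<zeta> - b)"
      using norm_triangle_ineq2[of \<zeta> a] norm_triangle_ineq2[of \<zeta> b] a z by auto
    then have ne: "\<zeta> - a \<noteq> 0" "\<zeta> - b \<noteq> 0" using a by auto
    have "(\<zeta> + a) / (\<zeta> - a) - (\<zeta> + b) / (\<zeta> - b) = 2 * \<zeta> * (a - b) / ((\<zeta> - a) * (\<zeta> - b))"
      using ne by (simp add: divide_simps) (simp add: algebra_simps)
    then have "norm ((\<zeta> + a) / (\<zeta> - a) - (\<zeta> + b) / (\<zeta> - b)) = 2 * norm (a - b) / (norm (\<zeta> - a) * norm (\<zeta> - b))"
      using z by (simp add: norm_divide norm_mult)
    also have "\<dots> \<le> 2 * norm (a - b) / ((1 - \<rho>) * (1 - \<rho>))"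
      using d a(3) by (intro divide_left_mono mult_mono mult_pos_pos) auto
    finally have "norm ((\<zeta> + a) / (\<zeta> - a) - (\<zeta> + b) / (\<zeta> - b)) \<le> 2 * norm (a - b) / (1 - \<rho>)\<^sup>2"
      by (simp add: power2_eq_square)
    then have "\<bar>poisson_kernel a \<zeta> - poisson_kernel b \<zeta>\<bar> \<le> 2 * norm (a - b) / (1 - \<rho>)\<^sup>2"
      unfolding poisson_kernel_Re[OF z] minus_complex.sel[symmetric] using abs_Re_le_cmod order_trans by blast
    then have "\<bar>poisson_kernel a \<zeta> - poisson_kernel b \<zeta>\<bar> * norm (f \<zeta>) \<le> 2 * norm (a - b) / (1 - \<rho>)\<^sup>2 * norm (f \<zeta>)"
      by (rule mult_right_mono) simp
    moreover have "of_real (poisson_kernel a \<zeta>) * f \<zeta> - of_real (poisson_kernel b \<zeta>) * f \<zeta>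
        = of_real (poisson_kernel a \<zeta> - poisson_kernel b \<zeta>) * f \<zeta>" by (simp add: algebra_simps)
    ultimately show "norm (of_real (poisson_kernel a \<zeta>) * f \<zeta> - of_real (poisson_kernel b \<zeta>) * f \<zeta>)
        \<le> 2 * norm (a - b) / (1 - \<rho>)\<^sup>2 * norm (f \<zeta>)" by (simp add: norm_mult del: of_real_diff)
  qed (use integrable_poisson_mult[OF f] D f in auto)
  finally show ?thesis by simp
qed

text \<open>If \<open>C_\<phi>\<close> is compact, the operators \<open>C_{r\<phi>} = C_\<phi> D_r\<close> depend continuously on \<open>r\<close>, because
  the dilations \<open>D_r\<close> do so in the weak sense which a compact operator turns into norm convergence.\<close>

lemma compact_scaling_continuous:
  assumes \<phi>: "analytic_selfmap \<phi>" and C: "compact_op (Hp 2) (Lp_norm 2) (compL \<phi>)"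
    and r: "0 \<le> r0" "r0 \<le> 1" and e: "0 < e"
  shows "\<exists>\<delta>>0. \<forall>r\<in>{0..1}. \<bar>r - r0\<bar> < \<delta> \<longrightarrow> dist_H2 (compL (\<lambda>z. of_real r0 * \<phi> z)) (compL (\<lambda>z. of_real r * \<phi> z)) < e"
proof (rule ccontr)
  let ?T = "\<lambda>r f. compL (\<lambda>z. of_real r0 * \<phi> z) f - compL (\<lambda>z. of_real r * \<phi> z) f"
  assume c: "\<not> ?thesis"
  \<comment> \<open>The operator norm is a supremum; asking for e/2 rather than e at a single f
    leaves room for the strict inequality.\<close>
  have "\<exists>r f. r \<in> {0..1} \<and> \<bar>r - r0\<bar> < 1 / real (Suc n) \<and> f \<in> Hp 2 \<and> Lp_norm 2 f \<le> 1 \<and> e / 2 < Lp_norm 2 (?T r f)" for n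
  proof (rule ccontr)
    assume a: "\<not> ?thesis"
    have "dist_H2 (compL (\<lambda>z. of_real r0 * \<phi> z)) (compL (\<lambda>z. of_real r * \<phi> z)) < e"
      if "r \<in> {0..1}" "\<bar>r - r0\<bar> < 1 / real (Suc n)" for r
    proof -
      have "op_norm (Hp 2) (Lp_norm 2) (?T r) \<le> e / 2"
        by (rule op_norm_le[where ?x0.0="\<lambda>_. 0"]) (use a that zero_in_Hp[of 2] in \<open>auto simp: not_less\<close>)
      then show ?thesis using e by (simp add: dist_H2_def)
    qed
    moreover have "0 < 1 / real (Suc n)" by simp
    ultimately show False using c by blast
  qed
  then have "\<forall>n. \<exists>r f. r \<in> {0..1} \<and> \<bar>r - r0\<bar> < 1 / real (Suc n) \<and> f \<in> Hp 2 \<and> Lp_norm 2 f \<le> 1 \<and> e / 2 < Lp_norm 2 (?T r f)" by (rule allI)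
  from choice[OF this] obtain r where
    "\<forall>n. \<exists>f. r n \<in> {0..1} \<and> \<bar>r n - r0\<bar> < 1 / real (Suc n) \<and> f \<in> Hp 2 \<and> Lp_norm 2 f \<le> 1 \<and> e / 2 < Lp_norm 2 (?T (r n) f)" by (elim exE)
  from choice[OF this] obtain f where
    rf: "\<forall>n. r n \<in> {0..1} \<and> \<bar>r n - r0\<bar> < 1 / real (Suc n) \<and> f n \<in> Hp 2 \<and> Lp_norm 2 (f n) \<le> 1 \<and> e / 2 < Lp_norm 2 (?T (r n) (f n))" by (elim exE)
  have r01: "0 \<le> r n" "r n \<le> 1" and rl: "\<bar>r n - r0\<bar> < 1 / real (Suc n)" and f: "f n \<in> Hp 2" "Lp_norm 2 (f n) \<le> 1"
    and big: "e / 2 < Lp_norm 2 (?T (r n) (f n))" for n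
    using rf[rule_format, of n] by auto
  have fL: "f n \<in> Lp 2" for n using f by (simp add: Hp_def)
  have lim: "r \<longlonglongrightarrow> r0"
  proof (rule LIM_zero_cancel, rule Lim_null_comparison)
    show "\<forall>\<^sub>F n in sequentially. norm (r n - r0) \<le> 1 / real (Suc n)"
      unfolding real_norm_def using rl by (intro always_eventually allI less_imp_le)
    show "(\<lambda>n. 1 / real (Suc n)) \<longlonglongrightarrow> 0" by (rule LIMSEQ_Suc[OF lim_1_over_n])
  qed
  define h where "h n \<zeta> = (dil r0 (f n) \<zeta> - dil (r n) (f n) \<zeta>) / 12" for n \<zeta>
  have hh: "h n \<in> Hp 2" "Lp_norm 2 (h n) \<le> 1"
    "\<And>z. z \<in> DD \<Longrightarrow> poisson_fun (h n) z = (poisson_fun (f n) (of_real r0 * z) - poisson_fun (f n) (of_real (r n) * z)) / 12"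
    "Lp_norm 2 (?T (r n) (f n)) = 12 * Lp_norm 2 (compL \<phi> (h n))" for n
    unfolding h_def[abs_def] by (rule dil_difference_H2[OF f[of n] \<phi> r r01[of n]] | assumption)+
  from C obtain s y where s: "strict_mono s" and y: "y \<in> Hp 2" and l: "(\<lambda>n. Lp_norm 2 (compL \<phi> (h (s n)) - y)) \<longlonglongrightarrow> 0"
    unfolding compact_op_def using hh(1,2) by blast
  have yL: "y \<in> Lp 2" using y by (simp add: Hp_def)
  note ch = compL_H2[OF hh(1) \<phi>]
  \<comment> \<open>The limit y is identified by point evaluations: at phi(z) the two dilates differ
    by a constant times |r n - r0|, uniformly over the unit ball.\<close>
  have "poisson_fun y z = 0" if z: "z \<in> DD" for z
  proof -
    have pD: "\<phi> z \<in> DD" using z \<phi> by (auto simp: analytic_selfmap_def)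
    then have p1: "norm (\<phi> z) < 1" by (simp add: DD_def)
    have le: "norm (complex_of_real x * \<phi> z) \<le> norm (\<phi> z)" if "0 \<le> x" "x \<le> 1" for x
      using that mult_right_mono[of x 1 "norm (\<phi> z)"] by (simp add: norm_mult)
    have "norm (poisson_fun (compL \<phi> (h n)) z) \<le> \<bar>r n - r0\<bar> * (2 / (1 - norm (\<phi> z))\<^sup>2 * 3)" for n
    proof -
      have "norm (poisson_fun (compL \<phi> (h n)) z) = norm (poisson_fun (f n) (of_real r0 * \<phi> z) - poisson_fun (f n) (of_real (r n) * \<phi> z)) / 12"
        by (simp add: ch(2)[OF z] hh(3)[OF pD] norm_divide)
      also have "\<dots> \<le> norm (poisson_fun (f n) (of_real r0 * \<phi> z) - poisson_fun (f n) (of_real (r n) * \<phi> z))" by simp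
      also have "\<dots> \<le> 2 * norm (of_real r0 * \<phi> z - of_real (r n) * \<phi> z) / (1 - norm (\<phi> z))\<^sup>2 * (\<integral>\<zeta>. norm (f n \<zeta>) \<partial>mT)"
        using Lp_integrable(1)[OF fL] le r r01 p1 by (intro poisson_fun_difference_le) auto
      also have "\<dots> \<le> 2 * \<bar>r n - r0\<bar> / (1 - norm (\<phi> z))\<^sup>2 * 3"
      proof (intro mult_mono divide_right_mono)
        have "of_real r0 * \<phi> z - of_real (r n) * \<phi> z = of_real (r0 - r n) * \<phi> z" by (simp add: algebra_simps)
        then have "norm (of_real r0 * \<phi> z - of_real (r n) * \<phi> z) = \<bar>r n - r0\<bar> * norm (\<phi> z)"
          by (simp add: norm_mult abs_minus_commute del: of_real_diff)
        then show "norm (of_real r0 * \<phi> z - of_real (r n) * \<phi> z) \<le> \<bar>r n - r0\<bar>" using p1 by (simp add: mult_left_le)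
        show "(\<integral>\<zeta>. norm (f n \<zeta>) \<partial>mT) \<le> 3" using integral_norm_le_Lp_norm[OF fL, of n] f(2)[of n] by simp
      qed auto
      finally show ?thesis by (simp add: mult_ac)
    qed
    moreover have "(\<lambda>n. \<bar>r n - r0\<bar> * (2 / (1 - norm (\<phi> z))\<^sup>2 * 3)) \<longlonglongrightarrow> 0"
      using tendsto_rabs[OF LIM_zero[OF lim]] by (intro tendsto_mult_left_zero) simp
    ultimately have "(\<lambda>n. poisson_fun (compL \<phi> (h n)) z) \<longlonglongrightarrow> 0"
      by (rule Lim_null_comparison[OF always_eventually, OF allI])
    from LIMSEQ_subseq_LIMSEQ[OF this s] have "(\<lambda>n. poisson_fun (compL \<phi> (h (s n))) z) \<longlonglongrightarrow> 0" by (simp add: o_def)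
    moreover have "(\<lambda>n. poisson_fun (compL \<phi> (h (s n))) z) \<longlonglongrightarrow> poisson_fun y z"
      by (rule tendsto_poisson_fun_Lp[OF _ ch(1) yL l z]) simp
    ultimately show ?thesis using LIMSEQ_unique by blast
  qed
  then have y0: "AE \<zeta> in mT. y \<zeta> = 0"
    using Lp_integrable(1)[OF yL] by (intro poisson_fun_unique) (auto simp: poisson_fun_def)
  have "Lp_norm 2 (compL \<phi> (h n) - y) = Lp_norm 2 (compL \<phi> (h n))" for n
  proof (rule Lp_AE_cong(2))
    show m: "compL \<phi> (h n) \<in> borel_measurable borelT" using Lp_integrable(3)[OF ch(1)] by simp
    show "compL \<phi> (h n) - y \<in> borel_measurable borelT"
      using borel_measurable_diff[OF m Lp_integrable(3)[OF yL]] by (simp add: fun_diff_def)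
    show "AE \<zeta> in mT. (compL \<phi> (h n) - y) \<zeta> = compL \<phi> (h n) \<zeta>" using y0 by eventually_elim simp
  qed
  with l have "(\<lambda>n. Lp_norm 2 (compL \<phi> (h (s n)))) \<longlonglongrightarrow> 0" by simp
  \<comment> \<open>12 * (e/24) = e/2 contradicts the choice of the functions f n.\<close>
  from order_tendstoD(2)[OF this, of "e/24"] e obtain n where "Lp_norm 2 (compL \<phi> (h (s n))) < e / 24"
    by (auto simp: eventually_sequentially)
  then have "Lp_norm 2 (?T (r (s n)) (f (s n))) < e / 2" using hh(4)[of "s n"] by simp
  then show False using big[of "s n"] by simp
qed

section \<open>The topology and paths of composition operators\<close>

text \<open>\<open>topology\<close> reveals its open sets only after the argument is shown to be an
  \<open>istopology\<close>; intersections are met by taking the smaller radius.\<close>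

lemma openin_compops_H2_top:
  "openin compops_H2_top U \<longleftrightarrow> U \<subseteq> compops_H2 \<and> (\<forall>A\<in>U. \<exists>\<epsilon>>0. \<forall>B\<in>compops_H2. dist_H2 A B < \<epsilon> \<longrightarrow> B \<in> U)"
proof -
  have "istopology (\<lambda>U. U \<subseteq> compops_H2 \<and> (\<forall>A\<in>U. \<exists>\<epsilon>>0. \<forall>B\<in>compops_H2. dist_H2 A B < \<epsilon> \<longrightarrow> B \<in> U))"
    unfolding istopology_def
  proof (intro conjI allI impI ballI)
    fix S T A
    assume S: "S \<subseteq> compops_H2 \<and> (\<forall>A\<in>S. \<exists>\<epsilon>>0. \<forall>B\<in>compops_H2. dist_H2 A B < \<epsilon> \<longrightarrow> B \<in> S)"
      and T: "T \<subseteq> compops_H2 \<and> (\<forall>A\<in>T. \<exists>\<epsilon>>0. \<forall>B\<in>compops_H2. dist_H2 A B < \<epsilon> \<longrightarrow> B \<in> T)"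
    show "S \<inter> T \<subseteq> compops_H2" using S by auto
    assume A: "A \<in> S \<inter> T"
    obtain e1 where "e1 > 0" "\<forall>B\<in>compops_H2. dist_H2 A B < e1 \<longrightarrow> B \<in> S" using S A by blast
    moreover obtain e2 where "e2 > 0" "\<forall>B\<in>compops_H2. dist_H2 A B < e2 \<longrightarrow> B \<in> T" using T A by blast
    ultimately show "\<exists>\<epsilon>>0. \<forall>B\<in>compops_H2. dist_H2 A B < \<epsilon> \<longrightarrow> B \<in> S \<inter> T"
      by (intro exI[of _ "min e1 e2"]) auto
  next
    fix K A assume K: "\<forall>S\<in>K. S \<subseteq> compops_H2 \<and> (\<forall>A\<in>S. \<exists>\<epsilon>>0. \<forall>B\<in>compops_H2. dist_H2 A B < \<epsilon> \<longrightarrow> B \<in> S)"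
    show "\<Union>K \<subseteq> compops_H2" using K by auto
    assume "A \<in> \<Union>K"
    then obtain S where S: "S \<in> K" "A \<in> S" by auto
    with K obtain e where "e > 0" "\<forall>B\<in>compops_H2. dist_H2 A B < e \<longrightarrow> B \<in> S" by blast
    then show "\<exists>\<epsilon>>0. \<forall>B\<in>compops_H2. dist_H2 A B < \<epsilon> \<longrightarrow> B \<in> \<Union>K" using S by blast
  qed
  then show ?thesis unfolding compops_H2_top_def by (simp add: topology_inverse')
qed

lemma topspace_compops_H2_top: "topspace compops_H2_top = compops_H2"
proof (rule antisym)
  show "topspace compops_H2_top \<subseteq> compops_H2" using openin_topspace[of compops_H2_top] unfolding openin_compops_H2_top by blast
  have "openin compops_H2_top compops_H2" unfolding openin_compops_H2_top by (auto intro!: exI[of _ 1])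
  then show "compops_H2 \<subseteq> topspace compops_H2_top" by (rule openin_subset)
qed

text \<open>The epsilon-delta hypothesis makes g continuous into \<open>compops_H2_top\<close>, and
  the image of the unit interval is a connected set containing both ends.\<close>

lemma connected_component_of_path:
  assumes g: "\<And>t. t \<in> {0..1} \<Longrightarrow> g t \<in> compops_H2"
    and c: "\<And>t e. \<lbrakk>t \<in> {0..1}; 0 < e\<rbrakk> \<Longrightarrow> \<exists>\<delta>>0. \<forall>s\<in>{0..1}. \<bar>s - t\<bar> < \<delta> \<longrightarrow> dist_H2 (g t) (g s) < e"
  shows "connected_component_of compops_H2_top (g (0::real)) (g 1)"
proof -
  have "continuous_map (top_of_set {0..1}) compops_H2_top g"
    unfolding continuous_map_def
  proof (intro conjI allI impI)
    show "g \<in> topspace (top_of_set {0..1}) \<rightarrow> topspace compops_H2_top"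
      using g by (auto simp: topspace_compops_H2_top)
    fix U assume U: "openin compops_H2_top U"
    show "openin (top_of_set {0..1}) {x \<in> topspace (top_of_set {0..1}). g x \<in> U}"
      unfolding openin_euclidean_subtopology_iff
    proof (intro conjI ballI)
      fix t assume "t \<in> {x \<in> topspace (top_of_set {0..1}). g x \<in> U}"
      then have t: "t \<in> {0..1}" "g t \<in> U" by auto
      then obtain e where e: "e > 0" "\<forall>B\<in>compops_H2. dist_H2 (g t) B < e \<longrightarrow> B \<in> U"
        using U unfolding openin_compops_H2_top by blast
      obtain \<delta> where "\<delta> > 0" "\<forall>s\<in>{0..1}. \<bar>s - t\<bar> < \<delta> \<longrightarrow> dist_H2 (g t) (g s) < e" using c[OF t(1) e(1)] by blast
      then show "\<exists>\<delta>>0. \<forall>s\<in>{0..1}. dist s t < \<delta> \<longrightarrow> s \<in> {x \<in> topspace (top_of_set {0..1}). g x \<in> U}"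
        using e(2) g by (intro exI[of _ \<delta>]) (auto simp: dist_real_def)
    qed auto
  qed
  then have "connectedin compops_H2_top (g ` {0..1})"
    by (rule connectedin_continuous_map_image) (simp add: connectedin_subtopology)
  then show ?thesis unfolding connected_component_of_def by (intro exI[of _ "g ` {0..1}"]) auto
qed

theorem compact_component_noncompact:
  assumes A: "A \<in> compops_H2" "compact_op (Hp 2) (Lp_norm 2) A"
  shows "connected_component_of compops_H2_top A (compL (phi 1))"
proof -
  obtain \<phi> where \<phi>: "A = compL \<phi>" "analytic_selfmap \<phi>" using A by (auto simp: compops_H2_def)
  have p0: "phi 0 = (\<lambda>_. 0)" by (rule ext) (rule phi_0)
  have "connected_component_of compops_H2_top (compL (\<lambda>z. of_real 0 * \<phi> z)) (compL (\<lambda>z. of_real 1 * \<phi> z))"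
  proof (rule connected_component_of_path)
    show "compL (\<lambda>z. of_real t * \<phi> z) \<in> compops_H2" if "t \<in> {0..1}" for t
      using selfmap_scaled[OF \<phi>(2), of t] that by (auto simp: compops_H2_def)
    show "\<exists>\<delta>>0. \<forall>s\<in>{0..1}. \<bar>s - t\<bar> < \<delta> \<longrightarrow> dist_H2 (compL (\<lambda>z. of_real t * \<phi> z)) (compL (\<lambda>z. of_real s * \<phi> z)) < e"
      if "t \<in> {0..1}" "0 < e" for t e
      using that A(2) \<phi> by (intro compact_scaling_continuous) auto
  qed
  \<comment> \<open>At r = 0 the scaled map is the zero map, which is \<open>phi 0\<close>: the two
    paths share this endpoint.\<close>
  then have 1: "connected_component_of compops_H2_top (compL (phi 0)) A" by (simp add: p0 \<phi>(1))
  have 2: "connected_component_of compops_H2_top (compL (phi 0)) (compL (phi 1))"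
  proof (rule connected_component_of_path)
    show "compL (phi t) \<in> compops_H2" if "t \<in> {0..1}" for t using phi_selfmap[of t] that by (auto simp: compops_H2_def)
    fix t e :: real assume t: "t \<in> {0..1}" and e: "0 < e"
    have "norm_continuous_family (Hp 2) (Lp_norm 2) (\<lambda>t. compL (phi t))"
      using zero_in_Hp[of 2] by (intro norm_continuous_Lp) auto
    moreover have "dist_H2 (compL (phi t)) (compL (phi s)) = op_norm (Hp 2) (Lp_norm 2) (\<lambda>x. compL (phi s) x - compL (phi t) x)" for s
      unfolding dist_H2_def op_norm_def by (simp add: Lp_norm_minus_commute)
    ultimately show "\<exists>\<delta>>0. \<forall>s\<in>{0..1}. \<bar>s - t\<bar> < \<delta> \<longrightarrow> dist_H2 (compL (phi t)) (compL (phi s)) < e"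
      unfolding norm_continuous_family_def using t e by auto
  qed
  show ?thesis using connected_component_of_trans[OF _ 2] 1 connected_component_of_sym by metis
qed

theorem mainTheorem1:
  shows "\<exists>\<phi> :: real \<Rightarrow> complex \<Rightarrow> complex.
     (\<forall>t\<in>{0..1}. analytic_selfmap (\<phi> t)) \<and>
     \<comment> \<open>X = M\<close>
     (compact_op Mspace tv_norm (compM (\<phi> 0)) \<and>
      \<not> compact_op Mspace tv_norm (compM (\<phi> 1)) \<and>
      norm_continuous_family Mspace tv_norm (\<lambda>t. compM (\<phi> t))) \<and>
     \<comment> \<open>X = L^p, 1 \<le> p < \<infinity>\<close>
     (\<forall>p::real. 1 \<le> p \<longrightarrow>
        compact_op (Lp p) (Lp_norm p) (compL (\<phi> 0)) \<and>
        \<not> compact_op (Lp p) (Lp_norm p) (compL (\<phi> 1)) \<and>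
        norm_continuous_family (Lp p) (Lp_norm p) (\<lambda>t. compL (\<phi> t))) \<and>
     \<comment> \<open>X = H^p, 1 \<le> p < \<infinity>\<close>
     (\<forall>p::real. 1 \<le> p \<longrightarrow>
        compact_op (Hp p) (Lp_norm p) (compL (\<phi> 0)) \<and>
        \<not> compact_op (Hp p) (Lp_norm p) (compL (\<phi> 1)) \<and>
        norm_continuous_family (Hp p) (Lp_norm p) (\<lambda>t. compL (\<phi> t))) \<and>
     \<comment> \<open>the consequence for H^2\<close>
     (\<forall>A\<in>compops_H2. compact_op (Hp 2) (Lp_norm 2) A \<longrightarrow>
        (\<exists>B\<in>compops_H2. \<not> compact_op (Hp 2) (Lp_norm 2) B \<and>
           connected_component_of compops_H2_top A B))"
proof (intro exI[of _ phi] conjI ballI allI impI)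
  fix p :: real assume p: "1 \<le> p"
  show "compact_op (Lp p) (Lp_norm p) (compL (phi 0))" "compact_op (Hp p) (Lp_norm p) (compL (phi 0))"
    using zero_in_Hp(3)[of p] Lp_const[OF p] Hp_const[OF p] by (auto intro!: compact_Lp[OF p])
  show "\<not> compact_op (Lp p) (Lp_norm p) (compL (phi 1))" "\<not> compact_op (Hp p) (Lp_norm p) (compL (phi 1))"
    using zero_in_Hp(3)[of p] not_compact_Lp[OF p] by blast+
  show "norm_continuous_family (Lp p) (Lp_norm p) (\<lambda>t. compL (phi t))"
    "norm_continuous_family (Hp p) (Lp_norm p) (\<lambda>t. compL (phi t))"
    using zero_in_Hp(1)[OF p] zero_in_Hp(3)[of p] by (auto intro!: norm_continuous_Lp[OF p])
next
  fix A assume A: "A \<in> compops_H2" "compact_op (Hp 2) (Lp_norm 2) A"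
  have "\<not> compact_op (Hp 2) (Lp_norm 2) (compL (phi 1))"
    using zero_in_Hp(3)[of 2] by (intro not_compact_Lp) auto
  moreover have "compL (phi 1) \<in> compops_H2" using phi_selfmap[of 1] by (auto simp: compops_H2_def)
  ultimately show "\<exists>B\<in>compops_H2. \<not> compact_op (Hp 2) (Lp_norm 2) B \<and> connected_component_of compops_H2_top A B"
    using compact_component_noncompact[OF A] by blast
qed (use phi_selfmap compact_M not_compact_M norm_continuous_M in auto)

end
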